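(* Let $\Omega'$ be the monoid of monic polynomials in $\mathbb{C}[z]$ all of whose roots lie in $\mathbb{Z}+\frac12$, and $\mathcal{O}=\{(z-\lambda)\mid\lambda\in\mathbb{Z}\}$. There is an isomorphism of $\Omega'$-graded algebras $$\mathscr{A}(\Omega',\mathcal{O})\simeq\mathbb{C}[x_s^{+},x_s^{-}\mid s\in\mathbb{Z}+\tfrac12]\big/\big(x_s^-x_w^+\mid s,w\in\mathbb{Z}+\tfrac12,\ s\le w\big)$$ (with $x_s^{\pm}$ of degree $z-s$), given by $x_s^-\mapsto[M^{z-s}_{-\infty,s}]$ and $x_s^+\mapsto[M^{z-s}_{s,\infty}]$.
   Context: Let $R=\mathbb{C}[z]$, $\sigma^{1/2}(z)=z-\frac12$, $\sigma(z)=z-1$. For nonzero $t\in\mathbb{C}[z]$, $A(t)$ is the $\mathbb{C}$-algebra generated by $\mathbb{C}[z]$ and $X^+,X^-$ with relations $X^{\pm}r=\sigma^{\pm1}(r)X^{\pm}$ ($r\in\mathbb{C}[z]$) and $X^{\pm}X^{\mp}=\sigma^{\pm1/2}(t)$ (a rank one generalized Weyl algebra). A weight module is an $A(t)$-module $M=\bigoplus_{\mathfrak{m}}M_{\mathfrak{m}}$, $M_{\mathfrak{m}}=\{v\mid\mathfrak{m}v=0\}$, over maximal ideals $\mathfrak{m}$ of $\mathbb{C}[z]$; $\mathrm{Supp}(M)=\{\mathfrak{m}\mid M_{\mathfrak{m}}\ne0\}$. $A(t)\text{-wmod}_{\mathcal{O}}$ is the category of weight modules with finite-dimensional weight spaces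 and support contained in $\mathcal{O}$; $K_0$ denotes its Grothendieck group (generated by classes $[M]$, with $[M'']=[M]+[M']$ for short exact sequences $0\to M\to M''\to M'\to0$). If $M$ is a weight $A(t)$-module and $M'$ a weight $A(t')$-module, then $M\otimes_{\mathbb{C}[z]}M'$ is an $A(tt')$-module via $r(v\otimes v')=rv\otimes v'$ and $X^{\pm}(v\otimes v')=X^{\pm}v\otimes X^{\pm}v'$. This makes $$\mathscr{A}(\Omega',\mathcal{O})=\bigoplus_{t\in\Omega'}\mathbb{C}\otimes_{\mathbb{Z}}K_0(A(t)\text{-wmod}_{\mathcal{O}})$$ into a commutative associative $\Omega'$-graded $\mathbb{C}$-algebra with $[M][M']=[M\otimes_{\mathbb{C}[z]}M']$; its identity is $[M^1]$, the class of the unique simple object of $A(1)\text{-wmod}_{\mathcal{O}}$. For $s\in\mathbb{Z}+\frac12$, $M^{z-s}_{-\infty,s}$ (resp. $M^{z-s}_{s,\infty}$) is the simple object of $A(z-s)\text{-wmod}_{\mathcal{O}}$, unique up to isomorphism, with support $\{(z-k)\mid k\in\mathbb{Z},\ k<s\}$ (resp. $\{(z-k)\mid k\in\mathbb{Z},\ k>s\}$); its weight spaces are one-dimensional. *)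

theory Defs
  imports
    Complex_Main
    "HOL-Library.Poly_Mapping"
    "HOL-Computational_Algebra.Polynomial"
    "HOL-Algebra.Algebra"
    "HOL-Algebra.Algebraic_Closure_Type"
begin

section \<open>Algebraic preliminaries\<close>

abbreviation C_ring :: "complex ring"
  where "C_ring \<equiv> ring_of_type_algebra"

abbreviation Cz_ring :: "complex poly ring"
  where "Cz_ring \<equiv> ring_of_type_algebra"

text \<open>\<open>HOL-Algebra.Module\<close> only treats modules over commutative rings. The record type
  \<^typ>\<open>('a, 'b) module\<close> is reused here for left modules over an arbitrary ring, its fields
  \<open>mult\<close> and \<open>one\<close> being ignored; \<^locale>\<open>submodule\<close> does not need commutativity.\<close>

locale left_module = R?: ring R + M?: abelian_group M
  for R :: "('r, 'm) ring_scheme" (structure) and M :: "('r, 'a, 'n) module_scheme" (structure) +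
  assumes smult_closed:
      "\<lbrakk>a \<in> carrier R; x \<in> carrier M\<rbrakk> \<Longrightarrow> a \<odot>\<^bsub>M\<^esub> x \<in> carrier M"
    and smult_l_distr:
      "\<lbrakk>a \<in> carrier R; b \<in> carrier R; x \<in> carrier M\<rbrakk> \<Longrightarrow>
        (a \<oplus> b) \<odot>\<^bsub>M\<^esub> x = a \<odot>\<^bsub>M\<^esub> x \<oplus>\<^bsub>M\<^esub> b \<odot>\<^bsub>M\<^esub> x"
    and smult_r_distr:
      "\<lbrakk>a \<in> carrier R; x \<in> carrier M; y \<in> carrier M\<rbrakk> \<Longrightarrow>
        a \<odot>\<^bsub>M\<^esub> (x \<oplus>\<^bsub>M\<^esub> y) = a \<odot>\<^bsub>M\<^esub> x \<oplus>\<^bsub>M\<^esub> a \<odot>\<^bsub>M\<^esub> y"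
    and smult_assoc:
      "\<lbrakk>a \<in> carrier R; b \<in> carrier R; x \<in> carrier M\<rbrakk> \<Longrightarrow>
        (a \<otimes> b) \<odot>\<^bsub>M\<^esub> x = a \<odot>\<^bsub>M\<^esub> (b \<odot>\<^bsub>M\<^esub> x)"
    and smult_one:
      "x \<in> carrier M \<Longrightarrow> \<one> \<odot>\<^bsub>M\<^esub> x = x"

definition module_hom ::
  "('r, 'm) ring_scheme \<Rightarrow> ('r, 'a) module \<Rightarrow> ('r, 'b) module \<Rightarrow> ('a \<Rightarrow> 'b) set"
  where "module_hom R M N =
    {f \<in> carrier M \<rightarrow> carrier N.
       (\<forall>x\<in>carrier M. \<forall>y\<in>carrier M. f (x \<oplus>\<^bsub>M\<^esub> y) = f x \<oplus>\<^bsub>N\<^esub> f y) \<and>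
       (\<forall>a\<in>carrier R. \<forall>x\<in>carrier M. f (a \<odot>\<^bsub>M\<^esub> x) = a \<odot>\<^bsub>N\<^esub> f x)}"

definition short_exact ::
  "('r, 'm) ring_scheme \<Rightarrow> ('r, 'a) module \<Rightarrow> ('r, 'b) module \<Rightarrow> ('r, 'c) module \<Rightarrow> bool"
  where "short_exact R M M'' M' \<longleftrightarrow>
    (\<exists>f\<in>module_hom R M M''. \<exists>g\<in>module_hom R M'' M'.
       inj_on f (carrier M) \<and> g ` carrier M'' = carrier M' \<and>
       f ` carrier M = {x \<in> carrier M''. g x = \<zero>\<^bsub>M'\<^esub>})"

definition simple_module :: "('r, 'm) ring_scheme \<Rightarrow> ('r, 'a) module \<Rightarrow> bool"
  where "simple_module R M \<longleftrightarrow>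
    left_module R M \<and> carrier M \<noteq> {\<zero>\<^bsub>M\<^esub>} \<and>
    (\<forall>N. submodule N R M \<longrightarrow> N = {\<zero>\<^bsub>M\<^esub>} \<or> N = carrier M)"

definition is_direct_sum ::
  "('a, 'm) ring_scheme \<Rightarrow> 'i set \<Rightarrow> ('i \<Rightarrow> 'a set) \<Rightarrow> bool"
  where "is_direct_sum M I N \<longleftrightarrow>
    (\<forall>i\<in>I. N i \<subseteq> carrier M) \<and>
    (\<forall>x\<in>carrier M. \<exists>!f. f \<in> (\<Pi>\<^sub>E i\<in>I. N i) \<and> finite {i \<in> I. f i \<noteq> \<zero>\<^bsub>M\<^esub>} \<and>
       x = (\<Oplus>\<^bsub>M\<^esub>i\<in>{i \<in> I. f i \<noteq> \<zero>\<^bsub>M\<^esub>}. f i))"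

text \<open>The tensor product \<open>M \<otimes>\<^sub>R N\<close> over a commutative ring, as an abelian group (in the
  multiplicative notation of \<^const>\<open>free_Abelian_group\<close> and \<^const>\<open>FactGroup\<close>).\<close>

definition tensor_rels ::
  "('r, 'm) ring_scheme \<Rightarrow> ('r, 'a) module \<Rightarrow> ('r, 'b) module \<Rightarrow> ('a \<times> 'b \<Rightarrow>\<^sub>0 int) set"
  where "tensor_rels R M N =
    {frag_of (x \<oplus>\<^bsub>M\<^esub> x', y) - frag_of (x, y) - frag_of (x', y) | x x' y.
       x \<in> carrier M \<and> x' \<in> carrier M \<and> y \<in> carrier N} \<union>
    {frag_of (x, y \<oplus>\<^bsub>N\<^esub> y') - frag_of (x, y) - frag_of (x, y') | x y y'.
       x \<in> carrier M \<and> y \<in> carrier N \<and> y' \<in> carrier N} \<union>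
    {frag_of (r \<odot>\<^bsub>M\<^esub> x, y) - frag_of (x, r \<odot>\<^bsub>N\<^esub> y) | r x y.
       r \<in> carrier R \<and> x \<in> carrier M \<and> y \<in> carrier N}"

definition tensor_sub ::
  "('r, 'm) ring_scheme \<Rightarrow> ('r, 'a) module \<Rightarrow> ('r, 'b) module \<Rightarrow> ('a \<times> 'b \<Rightarrow>\<^sub>0 int) set"
  where "tensor_sub R M N =
    generate (free_Abelian_group (carrier M \<times> carrier N)) (tensor_rels R M N)"

definition tensor_group ::
  "('r, 'm) ring_scheme \<Rightarrow> ('r, 'a) module \<Rightarrow> ('r, 'b) module \<Rightarrow> ('a \<times> 'b \<Rightarrow>\<^sub>0 int) set monoid"
  where "tensor_group R M N =
    free_Abelian_group (carrier M \<times> carrier N) Mod tensor_sub R M N"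

definition pure_tensor ::
  "('r, 'm) ring_scheme \<Rightarrow> ('r, 'a) module \<Rightarrow> ('r, 'b) module \<Rightarrow> 'a \<Rightarrow> 'b \<Rightarrow> ('a \<times> 'b \<Rightarrow>\<^sub>0 int) set"
  where "pure_tensor R M N x y =
    tensor_sub R M N #>\<^bsub>free_Abelian_group (carrier M \<times> carrier N)\<^esub> frag_of (x, y)"

definition C_as_Z_module :: "(int, complex) module"
  where "C_as_Z_module = ring.extend C_ring (module.fields (\<lambda>k c. of_int k * c))"

definition Z_module_of :: "('a, 'm) monoid_scheme \<Rightarrow> (int, 'a) module"
  where "Z_module_of G =
    \<lparr>carrier = carrier G, monoid.mult = undefined, one = undefined,
     ring.zero = \<one>\<^bsub>G\<^esub>, add = (\<otimes>\<^bsub>G\<^esub>), module.smult = (\<lambda>k x. x [^]\<^bsub>G\<^esub> (k::int))\<rparr>"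

text \<open>Graded commutative algebras over the complex numbers, graded by a submonoid \<open>G\<close> of the
  multiplicative monoid of a type.\<close>

definition graded_algebra ::
  "'g::monoid_mult set \<Rightarrow> (complex, 'a) module \<Rightarrow> ('g \<Rightarrow> 'a set) \<Rightarrow> bool"
  where "graded_algebra G A A_comp \<longleftrightarrow>
    algebra C_ring A \<and>
    (\<forall>g\<in>G. submodule (A_comp g) C_ring A) \<and>
    is_direct_sum A G A_comp \<and>
    \<one>\<^bsub>A\<^esub> \<in> A_comp 1 \<and>
    (\<forall>g\<in>G. \<forall>h\<in>G. \<forall>x\<in>A_comp g. \<forall>y\<in>A_comp h. x \<otimes>\<^bsub>A\<^esub> y \<in> A_comp (g * h))"

definition graded_algebra_iso ::
  "'g::monoid_mult set \<Rightarrow> (complex, 'a) module \<Rightarrow> ('g \<Rightarrow> 'a set) \<Rightarrow>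
     (complex, 'b) module \<Rightarrow> ('g \<Rightarrow> 'b set) \<Rightarrow> ('a \<Rightarrow> 'b) \<Rightarrow> bool"
  where "graded_algebra_iso G A A_comp B B_comp \<phi> \<longleftrightarrow>
    graded_algebra G A A_comp \<and> graded_algebra G B B_comp \<and>
    \<phi> \<in> ring_iso A B \<and>
    (\<forall>c. \<forall>x\<in>carrier A. \<phi> (c \<odot>\<^bsub>A\<^esub> x) = c \<odot>\<^bsub>B\<^esub> \<phi> x) \<and>
    (\<forall>g\<in>G. \<phi> ` A_comp g = B_comp g)"


section \<open>The generalized Weyl algebra \<open>A(t)\<close>\<close>

text \<open>Words are the free monoid, written additively so that \<open>'g word \<Rightarrow>\<^sub>0 complex\<close> carries the
  convolution product of \<open>HOL-Library.Poly_Mapping\<close> and is the free associative algebra.\<close>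

datatype 'g word = Word (letters: "'g list")

instantiation word :: (type) monoid_add
begin
definition zero_word :: "'a word" where "zero_word = Word []"
definition plus_word :: "'a word \<Rightarrow> 'a word \<Rightarrow> 'a word"
  where "plus_word u v = Word (letters u @ letters v)"
instance
  by standard (simp_all add: zero_word_def plus_word_def)
end

datatype gen = Gen_z | Gen_Xp | Gen_Xm

type_synonym free_alg = "gen word \<Rightarrow>\<^sub>0 complex"

abbreviation free_alg_ring :: "free_alg ring"
  where "free_alg_ring \<equiv> ring_of_type_algebra"

definition fgen :: "gen \<Rightarrow> free_alg"
  where "fgen g = Poly_Mapping.single (Word [g]) 1"

definition poly_in_free :: "complex poly \<Rightarrow> free_alg"
  where "poly_in_free r =
    (\<Sum>i\<le>Polynomial.degree r. Poly_Mapping.single 0 (Polynomial.coeff r i) * fgen Gen_z ^ i)"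

text \<open>\<open>\<sigma>\<^sup>a(r)(z) = r(z - a)\<close>\<close>

definition \<sigma>pow :: "complex \<Rightarrow> complex poly \<Rightarrow> complex poly"
  where "\<sigma>pow a r = pcompose r [:- a, 1:]"

definition gwa_rels :: "complex poly \<Rightarrow> free_alg set"
  where "gwa_rels t =
    {fgen Gen_Xp * poly_in_free r - poly_in_free (\<sigma>pow 1 r) * fgen Gen_Xp | r. True} \<union>
    {fgen Gen_Xm * poly_in_free r - poly_in_free (\<sigma>pow (- 1) r) * fgen Gen_Xm | r. True} \<union>
    {fgen Gen_Xp * fgen Gen_Xm - poly_in_free (\<sigma>pow (1/2) t),
     fgen Gen_Xm * fgen Gen_Xp - poly_in_free (\<sigma>pow (- (1/2)) t)}"

definition gwa_ideal :: "complex poly \<Rightarrow> free_alg set"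
  where "gwa_ideal t = Idl\<^bsub>free_alg_ring\<^esub> (gwa_rels t)"

definition gwa :: "complex poly \<Rightarrow> free_alg set ring"
  where "gwa t = free_alg_ring Quot gwa_ideal t"

definition gwa_poly :: "complex poly \<Rightarrow> complex poly \<Rightarrow> free_alg set"
  where "gwa_poly t r = gwa_ideal t +>\<^bsub>free_alg_ring\<^esub> poly_in_free r"

definition gwa_Xp :: "complex poly \<Rightarrow> free_alg set"
  where "gwa_Xp t = gwa_ideal t +>\<^bsub>free_alg_ring\<^esub> fgen Gen_Xp"

definition gwa_Xm :: "complex poly \<Rightarrow> free_alg set"
  where "gwa_Xm t = gwa_ideal t +>\<^bsub>free_alg_ring\<^esub> fgen Gen_Xm"


section \<open>Weight modules\<close>

text \<open>Modules whose underlying set is a set of elements of the type \<open>'u\<close>, which plays the role of a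
  universe. A weight module with finite-dimensional weight spaces supported on a countable orbit has
  countable complex dimension, so as soon as \<open>'u\<close> has at least the cardinality of the continuum every
  object of the category has an isomorphic copy here.\<close>

type_synonym 'u gwa_module = "(free_alg set, 'u) module"

definition max_ideals :: "complex poly set set"
  where "max_ideals = {\<mm>. maximalideal \<mm> Cz_ring}"

definition weight_space ::
  "complex poly \<Rightarrow> 'u gwa_module \<Rightarrow> complex poly set \<Rightarrow> 'u set"
  where "weight_space t M \<mm> =
    {v \<in> carrier M. \<forall>r\<in>\<mm>. gwa_poly t r \<odot>\<^bsub>M\<^esub> v = \<zero>\<^bsub>M\<^esub>}"

definition weight_module :: "complex poly \<Rightarrow> 'u gwa_module \<Rightarrow> bool"
  where "weight_module t M \<longleftrightarrow>
    left_module (gwa t) M \<and> is_direct_sum M max_ideals (weight_space t M)"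

definition Supp :: "complex poly \<Rightarrow> 'u gwa_module \<Rightarrow> complex poly set set"
  where "Supp t M = {\<mm> \<in> max_ideals. weight_space t M \<mm> \<noteq> {\<zero>\<^bsub>M\<^esub>}}"

definition fin_dim_weight_space ::
  "complex poly \<Rightarrow> 'u gwa_module \<Rightarrow> complex poly set \<Rightarrow> bool"
  where "fin_dim_weight_space t M \<mm> \<longleftrightarrow>
    (\<exists>B. finite B \<and> B \<subseteq> weight_space t M \<mm> \<and>
      (\<forall>v\<in>weight_space t M \<mm>. \<exists>c. v = (\<Oplus>\<^bsub>M\<^esub>b\<in>B. gwa_poly t [:c b:] \<odot>\<^bsub>M\<^esub> b)))"

definition wmod :: "complex poly set set \<Rightarrow> complex poly \<Rightarrow> 'u gwa_module set"
  where "wmod Orb t =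
    {M. weight_module t M \<and> (\<forall>\<mm>\<in>max_ideals. fin_dim_weight_space t M \<mm>) \<and> Supp t M \<subseteq> Orb}"

text \<open>Submodules of objects of the category are again objects (a submodule of a weight module is a
  weight module), so simple objects are the simple modules in the category.\<close>

definition simple_objects :: "complex poly set set \<Rightarrow> complex poly \<Rightarrow> 'u gwa_module set"
  where "simple_objects Orb t = {M \<in> wmod Orb t. simple_module (gwa t) M}"

definition Cz_module :: "complex poly \<Rightarrow> 'u gwa_module \<Rightarrow> (complex poly, 'u) module"
  where "Cz_module t M =
    ring.extend (ring.truncate M) (module.fields (\<lambda>r v. gwa_poly t r \<odot>\<^bsub>M\<^esub> v))"

text \<open>\<open>N\<close> is (a copy, with underlying set in \<open>'u\<close>, of) the \<open>A(tt')\<close>-module \<open>M \<otimes>\<^bsub>\<complex>[z]\<^esub> M'\<close>, where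
  \<open>M\<close> is an \<open>A(t)\<close>-module and \<open>M'\<close> an \<open>A(t')\<close>-module.\<close>

definition is_tensor ::
  "complex poly \<Rightarrow> complex poly \<Rightarrow> 'u gwa_module \<Rightarrow> 'u gwa_module \<Rightarrow> 'u gwa_module \<Rightarrow> bool"
  where "is_tensor t t' M M' N \<longleftrightarrow>
    left_module (gwa (t * t')) N \<and>
    (let T = tensor_group Cz_ring (Cz_module t M) (Cz_module t' M');
         tens = pure_tensor Cz_ring (Cz_module t M) (Cz_module t' M')
     in \<exists>\<phi>\<in>iso T (add_monoid N). \<forall>v\<in>carrier M. \<forall>v'\<in>carrier M'.
       (\<forall>r. gwa_poly (t * t') r \<odot>\<^bsub>N\<^esub> \<phi> (tens v v') = \<phi> (tens (gwa_poly t r \<odot>\<^bsub>M\<^esub> v) v')) \<and>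
       gwa_Xp (t * t') \<odot>\<^bsub>N\<^esub> \<phi> (tens v v') =
         \<phi> (tens (gwa_Xp t \<odot>\<^bsub>M\<^esub> v) (gwa_Xp t' \<odot>\<^bsub>M'\<^esub> v')) \<and>
       gwa_Xm (t * t') \<odot>\<^bsub>N\<^esub> \<phi> (tens v v') =
         \<phi> (tens (gwa_Xm t \<odot>\<^bsub>M\<^esub> v) (gwa_Xm t' \<odot>\<^bsub>M'\<^esub> v')))"


section \<open>The Grothendieck group and the algebra built from it\<close>

type_synonym 'u K0_elem = "('u gwa_module \<Rightarrow>\<^sub>0 int) set"
type_synonym 'u CK0_elem = "(complex \<times> 'u K0_elem \<Rightarrow>\<^sub>0 int) set"
type_synonym 'u groth_elem = "complex poly \<Rightarrow> 'u CK0_elem"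

definition K0_sub :: "complex poly set set \<Rightarrow> complex poly \<Rightarrow> ('u gwa_module \<Rightarrow>\<^sub>0 int) set"
  where "K0_sub Orb t =
    generate (free_Abelian_group (wmod Orb t))
      {frag_of M'' - (frag_of M + frag_of M') | M M'' M'.
         M \<in> wmod Orb t \<and> M'' \<in> wmod Orb t \<and> M' \<in> wmod Orb t \<and> short_exact (gwa t) M M'' M'}"

definition K0 :: "complex poly set set \<Rightarrow> complex poly \<Rightarrow> 'u K0_elem monoid"
  where "K0 Orb t = free_Abelian_group (wmod Orb t) Mod K0_sub Orb t"

definition K0_class :: "complex poly set set \<Rightarrow> complex poly \<Rightarrow> 'u gwa_module \<Rightarrow> 'u K0_elem"
  where "K0_class Orb t M = K0_sub Orb t #>\<^bsub>free_Abelian_group (wmod Orb t)\<^esub> frag_of M"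

text \<open>\<open>\<complex> \<otimes>\<^sub>\<int> K\<^sub>0\<close> with its scalar multiplication \<open>c(d \<otimes> x) = cd \<otimes> x\<close>.\<close>

definition CK0 :: "complex poly set set \<Rightarrow> complex poly \<Rightarrow> 'u CK0_elem monoid"
  where "CK0 Orb t = tensor_group \<Z> C_as_Z_module (Z_module_of (K0 Orb t))"

definition CK0_tensor ::
  "complex poly set set \<Rightarrow> complex poly \<Rightarrow> complex \<Rightarrow> 'u K0_elem \<Rightarrow> 'u CK0_elem"
  where "CK0_tensor Orb t = pure_tensor \<Z> C_as_Z_module (Z_module_of (K0 Orb t))"

definition CK0_scale ::
  "complex poly set set \<Rightarrow> complex poly \<Rightarrow> complex \<Rightarrow> 'u CK0_elem \<Rightarrow> 'u CK0_elem"
  where "CK0_scale Orb t c U =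
    (let Z = Z_module_of (K0 Orb t)
     in \<Union>u\<in>U. tensor_sub \<Z> C_as_Z_module Z
          #>\<^bsub>free_Abelian_group (carrier C_as_Z_module \<times> carrier Z)\<^esub>
          frag_extend (\<lambda>(d, x). frag_of (c * d, x)) u)"

text \<open>The graded vector space; its \<open>mult\<close> and \<open>one\<close> are supplied in \<open>groth_alg\<close> below.\<close>

definition groth_space ::
  "complex poly set \<Rightarrow> complex poly set set \<Rightarrow> (complex, 'u groth_elem) module"
  where "groth_space \<Omega> Orb =
    (let S = sum_group \<Omega> (CK0 Orb)
     in \<lparr>carrier = carrier S, monoid.mult = undefined, one = undefined,
         ring.zero = \<one>\<^bsub>S\<^esub>, add = (\<otimes>\<^bsub>S\<^esub>),
         module.smult = (\<lambda>c f. \<lambda>t\<in>\<Omega>. CK0_scale Orb t c (f t))\<rparr>)"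

definition groth_comp ::
  "complex poly set \<Rightarrow> complex poly set set \<Rightarrow> complex poly \<Rightarrow> 'u groth_elem set"
  where "groth_comp \<Omega> Orb t =
    {f \<in> carrier (groth_space \<Omega> Orb). \<forall>u\<in>\<Omega>. u \<noteq> t \<longrightarrow> f u = \<one>\<^bsub>CK0 Orb u\<^esub>}"

text \<open>The class \<open>1 \<otimes> [M]\<close> of an object of \<open>A(t)-wmod\<close>, placed in degree \<open>t\<close>.\<close>

definition groth_class ::
  "complex poly set \<Rightarrow> complex poly set set \<Rightarrow> complex poly \<Rightarrow> 'u gwa_module \<Rightarrow> 'u groth_elem"
  where "groth_class \<Omega> Orb t M =
    (\<lambda>u\<in>\<Omega>. if u = t then CK0_tensor Orb t 1 (K0_class Orb t M) else \<one>\<^bsub>CK0 Orb u\<^esub>)"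

text \<open>The product of the algebra is the complex bilinear product determined by
  \<open>[M][M'] = [M \<otimes>\<^bsub>\<complex>[z]\<^esub> M']\<close>; pinning it to \<^const>\<open>undefined\<close> off the carrier
  makes it unique as a function.\<close>

definition is_groth_mult ::
  "complex poly set \<Rightarrow> complex poly set set \<Rightarrow>
     ('u groth_elem \<Rightarrow> 'u groth_elem \<Rightarrow> 'u groth_elem) \<Rightarrow> bool"
  where "is_groth_mult \<Omega> Orb m \<longleftrightarrow>
    (let V = groth_space \<Omega> Orb
     in (\<forall>x y. \<not> (x \<in> carrier V \<and> y \<in> carrier V) \<longrightarrow> m x y = undefined) \<and>
        (\<forall>x\<in>carrier V. m x \<in> module_hom C_ring V V) \<and>
        (\<forall>y\<in>carrier V. (\<lambda>x. m x y) \<in> module_hom C_ring V V) \<and>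
        (\<forall>t\<in>\<Omega>. \<forall>t'\<in>\<Omega>. \<forall>M\<in>wmod Orb t. \<forall>M'\<in>wmod Orb t'. \<forall>N\<in>wmod Orb (t * t').
           is_tensor t t' M M' N \<longrightarrow>
           m (groth_class \<Omega> Orb t M) (groth_class \<Omega> Orb t' M') = groth_class \<Omega> Orb (t * t') N))"

text \<open>The identity is the class of the simple object of \<open>A(1)-wmod\<close>, unique up to isomorphism.\<close>

definition groth_alg ::
  "complex poly set \<Rightarrow> complex poly set set \<Rightarrow> (complex, 'u groth_elem) module"
  where "groth_alg \<Omega> Orb =
    (groth_space \<Omega> Orb)
      \<lparr>monoid.mult := (THE m. is_groth_mult \<Omega> Orb m),
       one := groth_class \<Omega> Orb 1 (SOME M. M \<in> simple_objects Orb 1)\<rparr>"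


section \<open>Half-integers, the grading monoid and the orbit\<close>

typedef half_int = "{s::real. \<exists>k::int. s = of_int k + 1/2}"
  morphisms half_val Half
  by blast

definition z_minus :: "half_int \<Rightarrow> complex poly"
  where "z_minus s = [:- complex_of_real (half_val s), 1:]"

definition \<Omega>_half :: "complex poly set"
  where "\<Omega>_half = {t. Polynomial.lead_coeff t = 1 \<and>
    (\<forall>a. poly t a = 0 \<longrightarrow> (\<exists>s. a = complex_of_real (half_val s)))}"

definition int_ideal :: "int \<Rightarrow> complex poly set"
  where "int_ideal k = PIdl\<^bsub>Cz_ring\<^esub> [:- of_int k, 1:]"

definition \<O>_int :: "complex poly set set"
  where "\<O>_int = range int_ideal"

text \<open>\<open>M\<^bsub>-\<infinity>,s\<^esub>\<close> and \<open>M\<^bsub>s,\<infinity>\<^esub>\<close> over \<open>A(z - s)\<close>, which are determined up to isomorphism.\<close>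

definition M_lower :: "half_int \<Rightarrow> 'u gwa_module"
  where "M_lower s = (SOME M. M \<in> simple_objects \<O>_int (z_minus s) \<and>
    Supp (z_minus s) M = {int_ideal k | k. real_of_int k < half_val s})"

definition M_upper :: "half_int \<Rightarrow> 'u gwa_module"
  where "M_upper s = (SOME M. M \<in> simple_objects \<O>_int (z_minus s) \<and>
    Supp (z_minus s) M = {int_ideal k | k. real_of_int k > half_val s})"


section \<open>The presented algebra\<close>

datatype var = X_plus half_int | X_minus half_int

type_synonym x_poly = "(var \<Rightarrow>\<^sub>0 nat) \<Rightarrow>\<^sub>0 complex"

abbreviation x_poly_ring :: "x_poly ring"
  where "x_poly_ring \<equiv> ring_of_type_algebra"

definition x_var :: "var \<Rightarrow> x_poly"
  where "x_var v = Poly_Mapping.single (Poly_Mapping.single v 1) 1"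

definition x_ideal :: "x_poly set"
  where "x_ideal = Idl\<^bsub>x_poly_ring\<^esub>
    {x_var (X_minus s) * x_var (X_plus w) | s w. half_val s \<le> half_val w}"

definition x_alg :: "(complex, x_poly set) module"
  where "x_alg = ring.extend (x_poly_ring Quot x_ideal)
    (module.fields (\<lambda>c U.
       (x_ideal +>\<^bsub>x_poly_ring\<^esub> Poly_Mapping.single 0 c) \<otimes>\<^bsub>x_poly_ring Quot x_ideal\<^esub> U))"

definition x_class :: "var \<Rightarrow> x_poly set"
  where "x_class v = x_ideal +>\<^bsub>x_poly_ring\<^esub> x_var v"

fun var_degree :: "var \<Rightarrow> complex poly" where
  "var_degree (X_plus s) = z_minus s"
| "var_degree (X_minus s) = z_minus s"

definition monom_degree :: "(var \<Rightarrow>\<^sub>0 nat) \<Rightarrow> complex poly"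
  where "monom_degree m =
    (\<Prod>v\<in>Poly_Mapping.keys m. var_degree v ^ Poly_Mapping.lookup m v)"

definition x_comp :: "complex poly \<Rightarrow> x_poly set set"
  where "x_comp t = {x_ideal +>\<^bsub>x_poly_ring\<^esub> p | p.
    \<forall>m\<in>Poly_Mapping.keys p. monom_degree m = t}"

end

theory Submission
  imports Defs "HOL-Analysis.Abstract_Topology_2"
begin

text \<open>A weight module \<open>M\<close> over \<open>A(t)\<close> has the dimension function \<open>k \<mapsto> dim M\<^sub>k\<close> on the integers. It is
  additive on short exact sequences, multiplicative for tensor products over the polynomials, and
  constant between consecutive roots of \<open>t\<close>, where \<open>X\<^sup>+\<close> and \<open>X\<^sup>-\<close> are bijective. Since \<open>M\<close> has a
  composition series whose factors have one-dimensional weight spaces and are determined by their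
  supports, the dimension function determines the class of \<open>M\<close>. Hence degree \<open>t\<close> of the algebra
  consists of the complex functions on the integers that are constant between the roots of \<open>t\<close>,
  multiplied pointwise. On the other side, a monomial goes to a product of indicator functions of
  half-lines. It lies in the ideal of relations exactly if this product is zero, and for every
  integer \<open>k\<close> exactly one monomial of degree \<open>t\<close> does not vanish at \<open>k\<close>; two such monomials are
  equal exactly if no root of \<open>t\<close> separates the two integers.\<close>

section \<open>Modules over generalized Weyl algebras\<close>

text \<open>The product of the Grothendieck algebra is specified by \<open>THE\<close>, as the
  bilinear map with [M][M'] = [N] for every copy N of the tensor product inside \<open>'u\<close>,
  so existence and uniqueness both have to be proved. For existence, the product of the presented
  algebra is carried over along the bijection with the graded space. It meets the specification
  because a class is determined by its dimension function and dimensions multiply; the ring axioms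
  come over in the same way. Uniqueness calls for actual modules: the classes of the cell modules
  span, and for two of them a tensor product is exhibited, made of functions on the intersection of
  the two cells.

  All modules must have their underlying sets in the type \<open>'u\<close>. The concrete ones
  consist of functions from the integers to the complex numbers and are moved there by an injection
  \<open>j\<close>. Quotients are built on chosen representatives, so that they stay inside
  \<open>'u\<close>. Such an injection exists as soon as the complex numbers embed in
  \<open>'u\<close>, because there are only continuum many complex functions on the
  integers.\<close>

lemma ring_of_type_algebra_simps [simp]:
  "carrier (ring_of_type_algebra :: 'a::ring_1 ring) = UNIV"
  "x \<otimes>\<^bsub>ring_of_type_algebra\<^esub> y = x * (y :: 'a)"
  "x \<oplus>\<^bsub>ring_of_type_algebra\<^esub> y = x + (y :: 'a)"
  "\<zero>\<^bsub>ring_of_type_algebra\<^esub> = (0 :: 'a)"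
  "\<one>\<^bsub>ring_of_type_algebra\<^esub> = (1 :: 'a)"
  by (simp_all add: ring_of_type_algebra_def)

lemma ring_ring_of_type_algebra: "ring (ring_of_type_algebra :: 'a::ring_1 ring)"
proof -
  have "\<exists>y. x + y = 0" for x :: 'a
    by (rule exI[of _ "- x"]) simp
  then show ?thesis
    unfolding ring_of_type_algebra_def
    by unfold_locales (auto simp: algebra_simps Units_def)
qed

lemma a_minus_ring_of_type_algebra [simp]:
  "\<ominus>\<^bsub>ring_of_type_algebra\<^esub> x = - (x :: 'a::ring_1)"
  "x \<ominus>\<^bsub>ring_of_type_algebra\<^esub> y = x - (y :: 'a)"
proof -
  interpret ring "ring_of_type_algebra :: 'a ring" by (rule ring_ring_of_type_algebra)
  show *: "\<ominus>\<^bsub>ring_of_type_algebra\<^esub> x = - x" for x :: 'a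
    by (rule minus_equality) auto
  show "x \<ominus>\<^bsub>ring_of_type_algebra\<^esub> y = x - y"
    by (simp add: a_minus_def *)
qed

lemma ideal_gwa_ideal: "ideal (gwa_ideal t) free_alg_ring"
  unfolding gwa_ideal_def
  by (rule ring.genideal_ideal[OF ring_ring_of_type_algebra]) simp

text \<open>One name for the quotient map on the whole free algebra. The maps
  \<open>gwa_poly\<close>, \<open>gwa_Xp\<close> and \<open>gwa_Xm\<close> of the definition are
  values of it, so its homomorphism laws serve all of them.\<close>

definition gwa_class :: "complex poly \<Rightarrow> free_alg \<Rightarrow> free_alg set"
  where "gwa_class t p = gwa_ideal t +>\<^bsub>free_alg_ring\<^esub> p"

lemma ring_gwa: "ring (gwa t)"
  unfolding gwa_def by (rule ideal.quotient_is_ring[OF ideal_gwa_ideal])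

lemma gwa_class_hom: "gwa_class t \<in> ring_hom free_alg_ring (gwa t)"
  using ideal.rcos_ring_hom[OF ideal_gwa_ideal, of t] unfolding gwa_class_def gwa_def .

lemma gwa_class_closed [simp]: "gwa_class t p \<in> carrier (gwa t)"
  using ring_hom_closed[OF gwa_class_hom] by simp

lemma gwa_class_add: "gwa_class t (p + q) = gwa_class t p \<oplus>\<^bsub>gwa t\<^esub> gwa_class t q"
  using ring_hom_add[OF gwa_class_hom, of p q] by simp

lemma gwa_class_mult: "gwa_class t (p * q) = gwa_class t p \<otimes>\<^bsub>gwa t\<^esub> gwa_class t q"
  using ring_hom_mult[OF gwa_class_hom, of p q] by simp

lemma gwa_class_one: "gwa_class t 1 = \<one>\<^bsub>gwa t\<^esub>"
  using ring_hom_one[OF gwa_class_hom] by simp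

lemma carrier_gwa: "carrier (gwa t) = range (gwa_class t)"
  unfolding gwa_def FactRing_def A_RCOSETS_def RCOSETS_def gwa_class_def a_r_coset_def
  by auto

lemma gwa_class_eq_iff: "gwa_class t p = gwa_class t q \<longleftrightarrow> p - q \<in> gwa_ideal t"
proof -
  interpret ideal "gwa_ideal t" free_alg_ring by (rule ideal_gwa_ideal)
  show ?thesis
    using quotient_eq_iff_same_a_r_cos[OF ideal_gwa_ideal, of p q]
    by (simp add: gwa_class_def)
qed

lemma gwa_relD:
  assumes "p - q \<in> gwa_rels t"
  shows "gwa_class t p = gwa_class t q"
  unfolding gwa_class_eq_iff gwa_ideal_def
  using ring.genideal_self[OF ring_ring_of_type_algebra, of "gwa_rels t"] assms by auto

lemma gwa_poly_class: "gwa_poly t r = gwa_class t (poly_in_free r)"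
  and gwa_Xp_class: "gwa_Xp t = gwa_class t (fgen Gen_Xp)"
  and gwa_Xm_class: "gwa_Xm t = gwa_class t (fgen Gen_Xm)"
  by (simp_all add: gwa_poly_def gwa_Xp_def gwa_Xm_def gwa_class_def)

lemma gwa_poly_closed [simp]: "gwa_poly t r \<in> carrier (gwa t)"
  and gwa_Xp_closed [simp]: "gwa_Xp t \<in> carrier (gwa t)"
  and gwa_Xm_closed [simp]: "gwa_Xm t \<in> carrier (gwa t)"
  by (simp_all add: gwa_poly_class gwa_Xp_class gwa_Xm_class)

section \<open>Polynomials in z inside the free algebra\<close>

abbreviation fconst :: "complex \<Rightarrow> free_alg"
  where "fconst c \<equiv> Poly_Mapping.single 0 c"

text \<open>At a key that is not yet present, \<open>update\<close> is the addition of a monomial.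
  Additive statements thus need to be checked on monomials only; this serves the free algebra and
  the polynomial ring in the x variables alike.\<close>

lemma poly_mapping_single_induct [case_names zero single]:
  fixes p :: "'a \<Rightarrow>\<^sub>0 'b::monoid_add"
  assumes zero: "P 0"
    and single: "\<And>f a b. a \<notin> Poly_Mapping.keys f \<Longrightarrow> b \<noteq> 0 \<Longrightarrow> P f \<Longrightarrow> P (Poly_Mapping.single a b + f)"
  shows "P p"
proof (induction p rule: update_induct)
  case (update f a b)
  have "Poly_Mapping.update a b f = Poly_Mapping.single a b + f"
    using update by (intro poly_mapping_eqI)
      (auto simp: lookup_update lookup_add lookup_single when_def in_keys_iff)
  then show ?case using update single by simp
qed (rule zero)

text \<open>Scalars sit on the empty word, which is neutral for concatenation.\<close>

lemma fconst_commute: "fconst c * p = p * (fconst c :: free_alg)"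
  by (induction p rule: poly_mapping_single_induct)
     (simp_all add: distrib_left distrib_right mult_single mult.commute)

lemma poly_in_free_sum:
  assumes "Polynomial.degree r \<le> n"
  shows "poly_in_free r = (\<Sum>i\<le>n. fconst (Polynomial.coeff r i) * fgen Gen_z ^ i)"
  unfolding poly_in_free_def
  by (rule sum.mono_neutral_left) (use assms in \<open>auto simp: coeff_eq_0\<close>)

lemma poly_in_free_add: "poly_in_free (r + s) = poly_in_free r + poly_in_free s"
proof -
  define n where "n = max (Polynomial.degree r) (Polynomial.degree s)"
  have "Polynomial.degree (r + s) \<le> n" unfolding n_def by (rule degree_add_le_max)
  then show ?thesis
    by (simp add: poly_in_free_sum[of _ n] n_def single_add distrib_right sum.distrib)
qed

lemma poly_in_free_smult: "poly_in_free (smult c r) = fconst c * poly_in_free r"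
  by (simp add: poly_in_free_sum[of _ "Polynomial.degree r"] degree_smult_le sum_distrib_left
      mult_single mult.assoc[symmetric])

lemma poly_in_free_const [simp]: "poly_in_free [:c:] = fconst c"
  by (simp add: poly_in_free_def)

lemma poly_in_free_0 [simp]: "poly_in_free 0 = 0"
  by (simp add: poly_in_free_def)

lemma poly_in_free_1 [simp]: "poly_in_free 1 = 1"
  using poly_in_free_const[of 1] by (simp only: one_pCons single_one)

lemma poly_in_free_shift: "poly_in_free (pCons 0 r) = fgen Gen_z * poly_in_free r"
proof -
  have "poly_in_free (pCons 0 r)
      = (\<Sum>i\<le>Suc (Polynomial.degree r). fconst (Polynomial.coeff (pCons 0 r) i) * fgen Gen_z ^ i)"
    by (rule poly_in_free_sum) (rule degree_pCons_le)
  also have "\<dots> = (\<Sum>i\<le>Polynomial.degree r. fgen Gen_z * (fconst (Polynomial.coeff r i) * fgen Gen_z ^ i))"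
    by (subst sum.atMost_Suc_shift) (simp add: fconst_commute[of _ "fgen Gen_z"] mult.assoc[symmetric])
  finally show ?thesis by (simp add: poly_in_free_def sum_distrib_left)
qed

lemma poly_in_free_pCons: "poly_in_free (pCons a r) = fconst a + fgen Gen_z * poly_in_free r"
proof -
  have "pCons a r = [:a:] + pCons 0 r" by simp
  then show ?thesis by (simp only: poly_in_free_add poly_in_free_shift poly_in_free_const)
qed

lemma poly_in_free_mult: "poly_in_free (r * s) = poly_in_free r * poly_in_free s"
proof (induction r)
  case (pCons a r)
  then show ?case
    by (simp add: poly_in_free_pCons mult_pCons_left poly_in_free_add poly_in_free_smult
        distrib_right mult.assoc poly_in_free_shift)
qed simp

text \<open>A monomial with coefficient c is the product of its letters and the constant c.\<close>

lemma free_alg_induct [case_names const gen add mult]: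
  fixes p :: free_alg
  assumes const: "\<And>c. P (fconst c)" and gen: "\<And>g. P (fgen g)"
    and add: "\<And>p q. P p \<Longrightarrow> P q \<Longrightarrow> P (p + q)"
    and mult: "\<And>p q. P p \<Longrightarrow> P q \<Longrightarrow> P (p * q)"
  shows "P p"
proof -
  have w: "P (Poly_Mapping.single (Word gs) c)" for gs c
  proof (induction gs)
    case Nil
    then show ?case using const[of c] by (simp add: zero_word_def)
  next
    case (Cons g gs)
    have "Poly_Mapping.single (Word (g # gs)) c = fgen g * Poly_Mapping.single (Word gs) c"
      by (simp add: fgen_def mult_single plus_word_def)
    then show ?case using mult gen Cons by simp
  qed
  have w: "P (Poly_Mapping.single w c)" for w c
    using w[of "letters w" c] by simp
  show ?thesis
  proof (induction p rule: poly_mapping_single_induct)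
    case zero
    then show ?case using const[of 0] by simp
  next
    case (single f a b)
    then show ?case by (intro add w)
  qed
qed

lemma gwa_poly_add: "gwa_poly t (r + s) = gwa_poly t r \<oplus>\<^bsub>gwa t\<^esub> gwa_poly t s"
  and gwa_poly_mult: "gwa_poly t (r * s) = gwa_poly t r \<otimes>\<^bsub>gwa t\<^esub> gwa_poly t s"
  and gwa_poly_1: "gwa_poly t 1 = \<one>\<^bsub>gwa t\<^esub>"
  by (simp_all add: gwa_poly_class poly_in_free_add poly_in_free_mult gwa_class_add gwa_class_mult
      gwa_class_one)

lemma gwa_Xp_poly: "gwa_Xp t \<otimes>\<^bsub>gwa t\<^esub> gwa_poly t r = gwa_poly t (\<sigma>pow 1 r) \<otimes>\<^bsub>gwa t\<^esub> gwa_Xp t"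
  and gwa_Xm_poly: "gwa_Xm t \<otimes>\<^bsub>gwa t\<^esub> gwa_poly t r = gwa_poly t (\<sigma>pow (-1) r) \<otimes>\<^bsub>gwa t\<^esub> gwa_Xm t"
  and gwa_Xp_Xm: "gwa_Xp t \<otimes>\<^bsub>gwa t\<^esub> gwa_Xm t = gwa_poly t (\<sigma>pow (1/2) t)"
  and gwa_Xm_Xp: "gwa_Xm t \<otimes>\<^bsub>gwa t\<^esub> gwa_Xp t = gwa_poly t (\<sigma>pow (-(1/2)) t)"
  unfolding gwa_poly_class gwa_Xp_class gwa_Xm_class gwa_class_mult[symmetric]
  by (rule gwa_relD, unfold gwa_rels_def, blast)+

text \<open>The scalars and the generator z have no case of their own since both are values of
  \<open>gwa_poly\<close>, at the constants and at the polynomial z.\<close>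

lemma gwa_induct [consumes 1, case_names poly Xp Xm add mult]:
  assumes "a \<in> carrier (gwa t)"
    and poly: "\<And>r. P (gwa_poly t r)" and Xp: "P (gwa_Xp t)" and Xm: "P (gwa_Xm t)"
    and add: "\<And>a b. a \<in> carrier (gwa t) \<Longrightarrow> b \<in> carrier (gwa t) \<Longrightarrow> P a \<Longrightarrow> P b \<Longrightarrow> P (a \<oplus>\<^bsub>gwa t\<^esub> b)"
    and mult: "\<And>a b. a \<in> carrier (gwa t) \<Longrightarrow> b \<in> carrier (gwa t) \<Longrightarrow> P a \<Longrightarrow> P b \<Longrightarrow> P (a \<otimes>\<^bsub>gwa t\<^esub> b)"
  shows "P a"
proof -
  have "P (gwa_class t p)" for p
  proof (induction p rule: free_alg_induct)
    case (const c)
    then show ?case using poly[of "[:c:]"] by (simp add: gwa_poly_class)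
  next
    case (gen g)
    have "poly_in_free [:0, 1:] = fgen Gen_z" by (simp add: poly_in_free_pCons)
    then show ?case using poly[of "[:0,1:]"] Xp Xm
      by (cases g) (auto simp: gwa_poly_class gwa_Xp_class gwa_Xm_class)
  qed (simp_all add: gwa_class_add gwa_class_mult add mult)
  then show ?thesis using assms(1) by (auto simp: carrier_gwa)
qed

section \<open>The action of A(t) on a module\<close>

locale gwa_module = left_module "gwa t" M for t and M :: "'u gwa_module"
begin

abbreviation pa :: "complex poly \<Rightarrow> 'u \<Rightarrow> 'u" where "pa r v \<equiv> gwa_poly t r \<odot>\<^bsub>M\<^esub> v"
abbreviation sc :: "complex \<Rightarrow> 'u \<Rightarrow> 'u" where "sc c v \<equiv> gwa_poly t [:c:] \<odot>\<^bsub>M\<^esub> v"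
abbreviation xp :: "'u \<Rightarrow> 'u" where "xp v \<equiv> gwa_Xp t \<odot>\<^bsub>M\<^esub> v"
abbreviation xm :: "'u \<Rightarrow> 'u" where "xm v \<equiv> gwa_Xm t \<odot>\<^bsub>M\<^esub> v"

lemmas smult_closed' [simp] = smult_closed
lemmas smult_add = smult_r_distr

lemma smult_zero [simp]: "a \<in> carrier (gwa t) \<Longrightarrow> a \<odot>\<^bsub>M\<^esub> \<zero>\<^bsub>M\<^esub> = \<zero>\<^bsub>M\<^esub>"
  using smult_r_distr[of a "\<zero>\<^bsub>M\<^esub>" "\<zero>\<^bsub>M\<^esub>"] smult_closed[of a "\<zero>\<^bsub>M\<^esub>"]
  by (metis M.add.l_cancel_one' M.add.r_one M.zero_closed)

lemma smult_minus: "a \<in> carrier (gwa t) \<Longrightarrow> v \<in> carrier M \<Longrightarrow> a \<odot>\<^bsub>M\<^esub> (\<ominus>\<^bsub>M\<^esub> v) = \<ominus>\<^bsub>M\<^esub> (a \<odot>\<^bsub>M\<^esub> v)"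
  by (rule M.minus_equality[symmetric])
     (simp_all flip: smult_r_distr add: M.l_neg)

lemma smult_diff:
  "a \<in> carrier (gwa t) \<Longrightarrow> v \<in> carrier M \<Longrightarrow> w \<in> carrier M \<Longrightarrow>
    a \<odot>\<^bsub>M\<^esub> (v \<ominus>\<^bsub>M\<^esub> w) = a \<odot>\<^bsub>M\<^esub> v \<ominus>\<^bsub>M\<^esub> a \<odot>\<^bsub>M\<^esub> w"
  by (simp add: a_minus_def smult_r_distr smult_minus)

lemma pa_add: "v \<in> carrier M \<Longrightarrow> pa (r + s) v = pa r v \<oplus>\<^bsub>M\<^esub> pa s v"
  by (simp add: gwa_poly_add smult_l_distr)

lemma pa_mult: "v \<in> carrier M \<Longrightarrow> pa (r * s) v = pa r (pa s v)"
  by (simp add: gwa_poly_mult smult_assoc)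

lemma pa_1 [simp]: "v \<in> carrier M \<Longrightarrow> pa 1 v = v"
  by (simp add: gwa_poly_1 smult_one)

lemma pa_0 [simp]: "v \<in> carrier M \<Longrightarrow> pa 0 v = \<zero>\<^bsub>M\<^esub>"
  using pa_add[of v 0 0] by (metis M.add.l_cancel_one' add.right_neutral gwa_poly_closed smult_closed)

lemma pa_minus: "v \<in> carrier M \<Longrightarrow> pa (- r) v = \<ominus>\<^bsub>M\<^esub> pa r v"
  by (rule M.minus_equality[symmetric]) (simp_all flip: pa_add)

lemma pa_commute: "v \<in> carrier M \<Longrightarrow> pa r (pa s v) = pa s (pa r v)"
  by (simp flip: pa_mult add: mult.commute)

lemma sc_1 [simp]: "v \<in> carrier M \<Longrightarrow> sc 1 v = v"
  using pa_1 by (simp add: one_pCons)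

lemma sc_sc: "v \<in> carrier M \<Longrightarrow> sc c (sc d v) = sc (c * d) v"
  by (simp flip: pa_mult add: mult.commute)

lemma sc_add: "v \<in> carrier M \<Longrightarrow> sc (c + d) v = sc c v \<oplus>\<^bsub>M\<^esub> sc d v"
  by (simp flip: pa_add)

lemma xp_pa: "v \<in> carrier M \<Longrightarrow> xp (pa r v) = pa (\<sigma>pow 1 r) (xp v)"
  and xm_pa: "v \<in> carrier M \<Longrightarrow> xm (pa r v) = pa (\<sigma>pow (-1) r) (xm v)"
  and xp_xm: "v \<in> carrier M \<Longrightarrow> xp (xm v) = pa (\<sigma>pow (1/2) t) v"
  and xm_xp: "v \<in> carrier M \<Longrightarrow> xm (xp v) = pa (\<sigma>pow (-(1/2)) t) v"
  by (simp_all flip: smult_assoc add: gwa_Xp_poly gwa_Xm_poly gwa_Xp_Xm gwa_Xm_Xp)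

end

text \<open>The elements of A(t) that commute with an additive map are closed under sums and
  products, so the generators suffice.\<close>

lemma gwa_module_homI:
  assumes "gwa_module t M" "gwa_module t N"
    and cl: "\<And>x. x \<in> carrier M \<Longrightarrow> f x \<in> carrier N"
    and add: "\<And>x y. x \<in> carrier M \<Longrightarrow> y \<in> carrier M \<Longrightarrow> f (x \<oplus>\<^bsub>M\<^esub> y) = f x \<oplus>\<^bsub>N\<^esub> f y"
    and pa: "\<And>r x. x \<in> carrier M \<Longrightarrow> f (gwa_poly t r \<odot>\<^bsub>M\<^esub> x) = gwa_poly t r \<odot>\<^bsub>N\<^esub> f x"
    and xp: "\<And>x. x \<in> carrier M \<Longrightarrow> f (gwa_Xp t \<odot>\<^bsub>M\<^esub> x) = gwa_Xp t \<odot>\<^bsub>N\<^esub> f x"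
    and xm: "\<And>x. x \<in> carrier M \<Longrightarrow> f (gwa_Xm t \<odot>\<^bsub>M\<^esub> x) = gwa_Xm t \<odot>\<^bsub>N\<^esub> f x"
  shows "f \<in> module_hom (gwa t) M N"
proof -
  interpret M: gwa_module t M by fact
  interpret N: gwa_module t N by fact
  have "\<forall>x\<in>carrier M. f (a \<odot>\<^bsub>M\<^esub> x) = a \<odot>\<^bsub>N\<^esub> f x" if "a \<in> carrier (gwa t)" for a
    using that
  proof (induction rule: gwa_induct)
    case (add a b)
    then show ?case by (simp add: M.smult_l_distr N.smult_l_distr assms(4) cl)
  next
    case (mult a b)
    then show ?case by (simp add: M.smult_assoc N.smult_assoc cl)
  qed (simp_all add: pa xp xm)
  then show ?thesis using cl add by (simp add: module_hom_def)
qed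

section \<open>Weight spaces\<close>

lemma cring_Cz: "cring Cz_ring"
  by (rule cring_from_type_algebra)

text \<open>The factor theorem, which from here on turns membership in the ideal into evaluation at
  \<open>k\<close>.\<close>

lemma int_ideal_eq: "int_ideal k = {r. poly r (of_int k) = 0}"
  unfolding int_ideal_def cgenideal_def
  by (auto simp: poly_eq_0_iff_dvd dvd_def mult.commute)

text \<open>A strictly larger ideal contains some r with r(k) nonzero. As r - r(k) lies in the
  smaller ideal, the larger one contains the nonzero constant r(k), which is a unit.\<close>

lemma int_ideal_max: "int_ideal k \<in> max_ideals"
proof -
  interpret cring Cz_ring by (rule cring_Cz)
  have id: "ideal (int_ideal k) Cz_ring"
    unfolding int_ideal_def by (rule cgenideal_ideal) simp
  have "maximalideal (int_ideal k) Cz_ring"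
  proof (rule maximalidealI[OF id])
    have "(1::complex poly) \<notin> int_ideal k" by (simp add: int_ideal_eq)
    then show "carrier Cz_ring \<noteq> int_ideal k" by auto
    fix J :: "complex poly set"
    assume J: "ideal J Cz_ring" "int_ideal k \<subseteq> J" "J \<subseteq> carrier Cz_ring"
    interpret J: ideal J Cz_ring by fact
    show "J = int_ideal k \<or> J = carrier Cz_ring"
    proof (cases "J \<subseteq> int_ideal k")
      case True
      then show ?thesis using J by auto
    next
      case False
      then obtain r where r: "r \<in> J" "poly r (of_int k) \<noteq> 0" by (auto simp: int_ideal_eq)
      define c where "c = poly r (of_int k)"
      have "r - [:c:] \<in> J" using J(2) by (auto simp: int_ideal_eq c_def)
      with r have "r - (r - [:c:]) \<in> J"
        using J.a_closed[of r "- (r - [:c:])"] J.a_inv_closed[of "r - [:c:]"] by simp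
      then have "[:1/c:] * [:c:] \<in> J" using J.I_l_closed[of "[:c:]" "[:1/c:]"] by simp
      then have "1 \<in> J" using r by (simp add: c_def one_pCons)
      then have "x \<in> J" for x using J.I_l_closed[of 1 x] by simp
      then show ?thesis by auto
    qed
  qed
  then show ?thesis by (simp add: max_ideals_def)
qed

lemma int_ideal_inj: "int_ideal k = int_ideal l \<longleftrightarrow> k = l"
proof
  assume "int_ideal k = int_ideal l"
  moreover have "[:- of_int k, 1:] \<in> int_ideal k" by (simp add: int_ideal_eq)
  ultimately have "[:- of_int k, 1:] \<in> int_ideal l" by simp
  then show "k = l" by (simp add: int_ideal_eq)
qed simp

text \<open>Of two distinct maximal ideals neither contains the other. The polynomial obtained here
  kills the vectors of weight \<open>m\<close> and acts on those of weight k by a nonzero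
  scalar.\<close>

lemma max_ideal_separate:
  assumes "m \<in> max_ideals" "m \<noteq> int_ideal k"
  obtains r where "r \<in> m" "poly r (of_int k) \<noteq> 0"
proof -
  interpret m: maximalideal m Cz_ring using assms by (simp add: max_ideals_def)
  interpret k: maximalideal "int_ideal k" Cz_ring using int_ideal_max by (simp add: max_ideals_def)
  have "\<not> m \<subseteq> int_ideal k"
    using m.I_maximal[OF k.is_ideal] assms(2) k.I_notcarr k.a_subset by auto
  then show thesis using that by (auto simp: int_ideal_eq)
qed

section \<open>Integral weights\<close>

context gwa_module
begin

text \<open>The condition is imposed for the generator z - k of the ideal only;
  \<open>wsp_weight_space\<close> identifies the result with the weight space of the ideal.\<close>

definition wsp :: "int \<Rightarrow> 'u set"
  where "wsp k = {v \<in> carrier M. pa [:- of_int k, 1:] v = \<zero>\<^bsub>M\<^esub>}"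

lemma wsp_carrier: "v \<in> wsp k \<Longrightarrow> v \<in> carrier M"
  by (simp add: wsp_def)

text \<open>Division of r by z - k leaves the remainder r(k), and z - k kills the vector.\<close>

lemma wsp_pa:
  assumes "v \<in> wsp k"
  shows "pa r v = sc (poly r (of_int k)) v"
proof -
  have v: "v \<in> carrier M" "pa [:- of_int k, 1:] v = \<zero>\<^bsub>M\<^esub>" using assms by (auto simp: wsp_def)
  have "[:- of_int k, 1:] dvd (r - [:poly r (of_int k):])"
    by (simp add: poly_eq_0_iff_dvd[symmetric])
  then obtain q where "r - [:poly r (of_int k):] = [:- of_int k, 1:] * q" by (auto simp: dvd_def)
  then have "r = [:poly r (of_int k):] + q * [:- of_int k, 1:]" by (simp add: algebra_simps)
  then have "pa r v = sc (poly r (of_int k)) v \<oplus>\<^bsub>M\<^esub> pa q (pa [:- of_int k, 1:] v)"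
    using v pa_add pa_mult by metis
  then show ?thesis using v by simp
qed

lemma wsp_weight_space: "weight_space t M (int_ideal k) = wsp k"
proof
  show "weight_space t M (int_ideal k) \<subseteq> wsp k"
    by (auto simp: weight_space_def wsp_def int_ideal_eq)
  show "wsp k \<subseteq> weight_space t M (int_ideal k)"
  proof
    fix v assume v: "v \<in> wsp k"
    have "pa r v = \<zero>\<^bsub>M\<^esub>" if "poly r (of_int k) = 0" for r
      using wsp_pa[OF v, of r] that wsp_carrier[OF v] by simp
    then show "v \<in> weight_space t M (int_ideal k)"
      using wsp_carrier[OF v] by (auto simp: weight_space_def int_ideal_eq)
  qed
qed

lemma wsp_zero [simp]: "\<zero>\<^bsub>M\<^esub> \<in> wsp k"
  by (simp add: wsp_def)

lemma wsp_add: "v \<in> wsp k \<Longrightarrow> w \<in> wsp k \<Longrightarrow> v \<oplus>\<^bsub>M\<^esub> w \<in> wsp k"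
  by (simp add: wsp_def smult_add)

lemma wsp_minus: "v \<in> wsp k \<Longrightarrow> \<ominus>\<^bsub>M\<^esub> v \<in> wsp k"
  by (simp add: wsp_def smult_minus)

lemma wsp_diff: "v \<in> wsp k \<Longrightarrow> w \<in> wsp k \<Longrightarrow> v \<ominus>\<^bsub>M\<^esub> w \<in> wsp k"
  by (simp add: a_minus_def wsp_add wsp_minus)

lemma wsp_pa_closed: "v \<in> wsp k \<Longrightarrow> pa r v \<in> wsp k"
  using pa_commute[of v "[:- of_int k, 1:]" r] by (simp add: wsp_def)

lemma wsp_sc: "v \<in> wsp k \<Longrightarrow> sc c v \<in> wsp k"
  by (rule wsp_pa_closed)

text \<open>The relation that moves X+ past r = z - k replaces it by sigma(r) = z - (k + 1), whence
  the shift by one.\<close>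

lemma wsp_xp: "v \<in> wsp k \<Longrightarrow> xp v \<in> wsp (k + 1)"
  using xp_pa[of v "[:- of_int k, 1:]"]
  by (simp add: wsp_def \<sigma>pow_def pcompose_pCons)

lemma wsp_xm: "v \<in> wsp k \<Longrightarrow> xm v \<in> wsp (k - 1)"
  using xm_pa[of v "[:- of_int k, 1:]"]
  by (simp add: wsp_def \<sigma>pow_def pcompose_pCons)

text \<open>The half shift of t evaluated at k is t(k + 1/2), a number attached to the edge between
  k and k + 1; \<open>wsp_xp_xm\<close> gives the same number at the upper end of the edge. The
  half-integral roots of t are thus the only places where X+ and X- can fail to be
  bijective.\<close>

lemma wsp_xm_xp: "v \<in> wsp k \<Longrightarrow> xm (xp v) = sc (poly t (of_int k + 1/2)) v"
  using wsp_pa[of v k "\<sigma>pow (-(1/2)) t"] xm_xp[of v]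
  by (simp add: wsp_carrier \<sigma>pow_def poly_pcompose add.commute)

lemma wsp_xp_xm: "v \<in> wsp k \<Longrightarrow> xp (xm v) = sc (poly t (of_int k - 1/2)) v"
  using wsp_pa[of v k "\<sigma>pow (1/2) t"] xp_xm[of v]
  by (simp add: wsp_carrier \<sigma>pow_def poly_pcompose)

lemma sc_eq_zero: "v \<in> carrier M \<Longrightarrow> sc c v = \<zero>\<^bsub>M\<^esub> \<Longrightarrow> c \<noteq> 0 \<Longrightarrow> v = \<zero>\<^bsub>M\<^esub>"
  using sc_sc[of v "1/c" c] by simp

lemma diff_eq_zero: "v \<in> carrier M \<Longrightarrow> w \<in> carrier M \<Longrightarrow> v \<ominus>\<^bsub>M\<^esub> w = \<zero>\<^bsub>M\<^esub> \<longleftrightarrow> v = w"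
  using M.minus_equality[of v] by (metis M.minus_equality M.minus_minus M.r_neg M.a_inv_closed a_minus_def)

lemma minus_zero [simp]: "\<ominus>\<^bsub>M\<^esub> \<zero>\<^bsub>M\<^esub> = \<zero>\<^bsub>M\<^esub>"
  by (rule M.minus_equality) auto

text \<open>The component of weight \<^term>\<open>k\<close> is singled out by being the only weight vector from which
  \<^term>\<open>x\<close> differs by something annihilated by a polynomial not vanishing at \<^term>\<open>k\<close>.\<close>

definition is_prj :: "int \<Rightarrow> 'u \<Rightarrow> 'u \<Rightarrow> bool"
  where "is_prj k x v \<longleftrightarrow> v \<in> wsp k \<and> (\<exists>q. poly q (of_int k) \<noteq> 0 \<and> pa q (x \<ominus>\<^bsub>M\<^esub> v) = \<zero>\<^bsub>M\<^esub>)"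

text \<open>If p and q are the two witnesses, then p q has the same effect on x, on v and on w. On
  the weight vector v - w it acts by the nonzero scalar p(k) q(k).\<close>

lemma is_prj_unique:
  assumes "x \<in> carrier M" "is_prj k x v" "is_prj k x w"
  shows "v = w"
proof -
  obtain p q where pq: "poly p (of_int k) \<noteq> 0" "pa p (x \<ominus>\<^bsub>M\<^esub> v) = \<zero>\<^bsub>M\<^esub>"
      "poly q (of_int k) \<noteq> 0" "pa q (x \<ominus>\<^bsub>M\<^esub> w) = \<zero>\<^bsub>M\<^esub>" and vw: "v \<in> wsp k" "w \<in> wsp k"
    using assms by (auto simp: is_prj_def)
  note c = vw[THEN wsp_carrier] assms(1)
  have "pa (p * q) (x \<ominus>\<^bsub>M\<^esub> w) = \<zero>\<^bsub>M\<^esub>" "pa (p * q) (x \<ominus>\<^bsub>M\<^esub> v) = \<zero>\<^bsub>M\<^esub>"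
    using c pq by (simp_all add: pa_mult pa_commute[of _ p q])
  then have "pa (p * q) x = pa (p * q) v" "pa (p * q) x = pa (p * q) w"
    using c by (simp_all add: smult_diff diff_eq_zero)
  then have "pa (p * q) (v \<ominus>\<^bsub>M\<^esub> w) = \<zero>\<^bsub>M\<^esub>"
    using c by (simp add: smult_diff diff_eq_zero)
  then have "sc (poly (p * q) (of_int k)) (v \<ominus>\<^bsub>M\<^esub> w) = \<zero>\<^bsub>M\<^esub>"
    by (rule trans[OF wsp_pa[OF wsp_diff[OF vw], symmetric]])
  then have "v \<ominus>\<^bsub>M\<^esub> w = \<zero>\<^bsub>M\<^esub>"
    using pq c by (auto intro: sc_eq_zero[of _ "poly (p * q) (of_int k)"])
  then show ?thesis using c diff_eq_zero by auto
qed

lemma is_prj_add: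
  assumes "x \<in> carrier M" "y \<in> carrier M" "is_prj k x v" "is_prj k y w"
  shows "is_prj k (x \<oplus>\<^bsub>M\<^esub> y) (v \<oplus>\<^bsub>M\<^esub> w)"
proof -
  obtain p q where pq: "poly p (of_int k) \<noteq> 0" "pa p (x \<ominus>\<^bsub>M\<^esub> v) = \<zero>\<^bsub>M\<^esub>"
      "poly q (of_int k) \<noteq> 0" "pa q (y \<ominus>\<^bsub>M\<^esub> w) = \<zero>\<^bsub>M\<^esub>" and vw: "v \<in> wsp k" "w \<in> wsp k"
    using assms by (auto simp: is_prj_def)
  note c = vw[THEN wsp_carrier] assms(1,2)
  have "(x \<oplus>\<^bsub>M\<^esub> y) \<ominus>\<^bsub>M\<^esub> (v \<oplus>\<^bsub>M\<^esub> w) = (x \<ominus>\<^bsub>M\<^esub> v) \<oplus>\<^bsub>M\<^esub> (y \<ominus>\<^bsub>M\<^esub> w)"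
    using c by (simp add: a_minus_def M.minus_add M.a_ac)
  moreover have "pa (p * q) (x \<ominus>\<^bsub>M\<^esub> v) = \<zero>\<^bsub>M\<^esub>" "pa (p * q) (y \<ominus>\<^bsub>M\<^esub> w) = \<zero>\<^bsub>M\<^esub>"
    using c pq by (simp_all add: pa_mult pa_commute[of _ p q])
  ultimately have "pa (p * q) ((x \<oplus>\<^bsub>M\<^esub> y) \<ominus>\<^bsub>M\<^esub> (v \<oplus>\<^bsub>M\<^esub> w)) = \<zero>\<^bsub>M\<^esub>"
    using c by (simp add: smult_add)
  then show ?thesis
    unfolding is_prj_def using pq vw wsp_add
    by (intro conjI exI[of _ "p * q"]) auto
qed

lemma is_prj_pa:
  assumes "x \<in> carrier M" "is_prj k x v"
  shows "is_prj k (pa r x) (pa r v)"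
proof -
  obtain p where p: "poly p (of_int k) \<noteq> 0" "pa p (x \<ominus>\<^bsub>M\<^esub> v) = \<zero>\<^bsub>M\<^esub>" and v: "v \<in> wsp k"
    using assms by (auto simp: is_prj_def)
  note c = v[THEN wsp_carrier] assms(1)
  have "pa p (pa r x \<ominus>\<^bsub>M\<^esub> pa r v) = pa p (pa r (x \<ominus>\<^bsub>M\<^esub> v))"
    using c by (simp add: smult_diff)
  also have "\<dots> = pa r (pa p (x \<ominus>\<^bsub>M\<^esub> v))"
    using c by (intro pa_commute) simp
  finally have "pa p (pa r x \<ominus>\<^bsub>M\<^esub> pa r v) = pa r (pa p (x \<ominus>\<^bsub>M\<^esub> v))" .
  then show ?thesis unfolding is_prj_def using p v by (auto simp: wsp_pa_closed)
qed

lemma is_prj_self: "v \<in> wsp k \<Longrightarrow> is_prj k v v"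
  unfolding is_prj_def by (intro conjI exI[of _ 1]) (auto simp: wsp_carrier diff_eq_zero)

lemma is_prj_zeroI: "v \<in> carrier M \<Longrightarrow> pa r v = \<zero>\<^bsub>M\<^esub> \<Longrightarrow> poly r (of_int k) \<noteq> 0 \<Longrightarrow> is_prj k v \<zero>\<^bsub>M\<^esub>"
  unfolding is_prj_def by (auto simp: a_minus_def)

lemma is_prj_other: "v \<in> wsp l \<Longrightarrow> l \<noteq> k \<Longrightarrow> is_prj k v \<zero>\<^bsub>M\<^esub>"
  by (rule is_prj_zeroI[of _ "[:- of_int l, 1:]"]) (auto simp: wsp_def)

end

text \<open>Only the existence of a finite decomposition into vectors of integral weight is
  demanded. Uniqueness of the components comes from \<open>is_prj_unique\<close>, and the direct sum
  over all maximal ideals is recovered in \<open>direct_sum_weight_spaces\<close>.\<close>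

locale weight_mod = gwa_module t M for t and M :: "'u gwa_module" +
  assumes decomp: "x \<in> carrier M \<Longrightarrow>
    \<exists>K f. finite K \<and> (\<forall>k\<in>K. f k \<in> wsp k) \<and> x = (\<Oplus>\<^bsub>M\<^esub>k\<in>K. f k)"
begin

lemma ex_is_prj: "x \<in> carrier M \<Longrightarrow> \<exists>v. is_prj k x v"
proof -
  have *: "(\<forall>k\<in>K. f k \<in> wsp k) \<Longrightarrow> \<exists>v. is_prj k (\<Oplus>\<^bsub>M\<^esub>k\<in>K. f k) v" if "finite K" for K f
    using that
  proof (induction K)
    case empty
    then show ?case using is_prj_self[of "\<zero>\<^bsub>M\<^esub>" k] by auto
  next
    case (insert l K)
    then obtain v where v: "is_prj k (\<Oplus>\<^bsub>M\<^esub>k\<in>K. f k) v" by auto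
    obtain w where w: "is_prj k (f l) w"
      using is_prj_self[of "f l" k] is_prj_other[of "f l" l k] insert by (cases "l = k") auto
    have "f \<in> K \<rightarrow> carrier M" "f l \<in> carrier M" using insert wsp_carrier by auto
    then show ?case using is_prj_add[OF _ _ w v] insert by auto
  qed
  assume "x \<in> carrier M"
  then show ?thesis using decomp[of x] * by blast
qed

definition prj :: "int \<Rightarrow> 'u \<Rightarrow> 'u"
  where "prj k x = (THE v. is_prj k x v)"

lemma prj_eqI: "x \<in> carrier M \<Longrightarrow> is_prj k x v \<Longrightarrow> prj k x = v"
  unfolding prj_def using is_prj_unique by blast

lemma is_prj_prj: "x \<in> carrier M \<Longrightarrow> is_prj k x (prj k x)"
  using ex_is_prj[of x k] prj_eqI by blast

lemma prj_wsp: "x \<in> carrier M \<Longrightarrow> prj k x \<in> wsp k"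
  using is_prj_prj by (auto simp: is_prj_def)

lemma prj_closed [simp]: "x \<in> carrier M \<Longrightarrow> prj k x \<in> carrier M"
  using prj_wsp wsp_carrier by blast

lemma prj_add: "x \<in> carrier M \<Longrightarrow> y \<in> carrier M \<Longrightarrow> prj k (x \<oplus>\<^bsub>M\<^esub> y) = prj k x \<oplus>\<^bsub>M\<^esub> prj k y"
  by (intro prj_eqI is_prj_add is_prj_prj) auto

lemma prj_pa: "x \<in> carrier M \<Longrightarrow> prj k (pa r x) = pa r (prj k x)"
  by (intro prj_eqI is_prj_pa is_prj_prj) auto

lemma prj_self: "v \<in> wsp k \<Longrightarrow> prj k v = v"
  by (intro prj_eqI is_prj_self wsp_carrier)

lemma prj_other: "v \<in> wsp l \<Longrightarrow> l \<noteq> k \<Longrightarrow> prj k v = \<zero>\<^bsub>M\<^esub>"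
  by (intro prj_eqI is_prj_other wsp_carrier)

lemma prj_zero [simp]: "prj k \<zero>\<^bsub>M\<^esub> = \<zero>\<^bsub>M\<^esub>"
  by (rule prj_self) simp

lemma prj_finsum:
  "finite S \<Longrightarrow> f \<in> S \<rightarrow> carrier M \<Longrightarrow> prj k (\<Oplus>\<^bsub>M\<^esub>s\<in>S. f s) = (\<Oplus>\<^bsub>M\<^esub>s\<in>S. prj k (f s))"
proof (induction S rule: finite_induct)
  case (insert s S)
  have "f \<in> S \<rightarrow> carrier M" "f s \<in> carrier M" "\<forall>s\<in>S. f s \<in> carrier M"
    using insert by auto
  moreover from this have "(\<lambda>s. prj k (f s)) \<in> S \<rightarrow> carrier M" by auto
  ultimately show ?case using insert by (simp add: prj_add)
qed simp

lemma prj_weight_sum: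
  assumes "finite K" "\<forall>k\<in>K. f k \<in> wsp k"
  shows "prj l (\<Oplus>\<^bsub>M\<^esub>k\<in>K. f k) = (if l \<in> K then f l else \<zero>\<^bsub>M\<^esub>)"
  using assms
proof (induction K rule: finite_induct)
  case (insert k K)
  have f: "f \<in> K \<rightarrow> carrier M" "f k \<in> carrier M" "\<forall>k\<in>K. f k \<in> carrier M"
    using insert wsp_carrier by auto
  then show ?case using insert
    by (cases "l = k") (auto simp: prj_add prj_self prj_other)
qed simp

definition wt_supp :: "'u \<Rightarrow> int set"
  where "wt_supp x = {k. prj k x \<noteq> \<zero>\<^bsub>M\<^esub>}"

lemma prj_sum_superset:
  assumes "x \<in> carrier M"
  shows "finite (wt_supp x)"
    and "\<lbrakk>finite L; wt_supp x \<subseteq> L\<rbrakk> \<Longrightarrow> x = (\<Oplus>\<^bsub>M\<^esub>k\<in>L. prj k x)"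
proof -
  obtain K f where Kf: "finite K" "\<forall>k\<in>K. f k \<in> wsp k" "x = (\<Oplus>\<^bsub>M\<^esub>k\<in>K. f k)"
    using decomp[OF assms] by blast
  have p: "prj l x = (if l \<in> K then f l else \<zero>\<^bsub>M\<^esub>)" for l
    using prj_weight_sum[OF Kf(1,2)] Kf(3) by simp
  have sub: "wt_supp x \<subseteq> K" using p by (auto simp: wt_supp_def)
  show "finite (wt_supp x)" using sub Kf(1) finite_subset by blast
  have "x = (\<Oplus>\<^bsub>M\<^esub>k\<in>K. prj k x)"
    using Kf(2) wsp_carrier by (subst Kf(3)) (intro M.finsum_cong', auto simp: p)
  also have "\<dots> = (\<Oplus>\<^bsub>M\<^esub>k\<in>wt_supp x. prj k x)"
    by (rule M.add.finprod_mono_neutral_cong_right) (use sub Kf assms in \<open>auto simp: wt_supp_def\<close>)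
  finally have 1: "x = (\<Oplus>\<^bsub>M\<^esub>k\<in>wt_supp x. prj k x)" .
  show "x = (\<Oplus>\<^bsub>M\<^esub>k\<in>L. prj k x)" if "finite L" "wt_supp x \<subseteq> L"
    by (subst 1, rule M.add.finprod_mono_neutral_cong_left) (use that assms in \<open>auto simp: wt_supp_def\<close>)
qed

text \<open>A vector is the sum of its components. This is the test by which vectors of a weight
  module are compared below.\<close>

lemma prj_ext:
  assumes "x \<in> carrier M" "y \<in> carrier M" "\<And>k. prj k x = prj k y"
  shows "x = y"
proof -
  have "wt_supp x = wt_supp y" using assms by (simp add: wt_supp_def)
  then show ?thesis
    using prj_sum_superset(1)[OF assms(1)] prj_sum_superset(2)[OF assms(1), of "wt_supp x"]
      prj_sum_superset(2)[OF assms(2), of "wt_supp x"] assms(3) by simp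
qed

text \<open>Here \<open>m\<close> is any maximal ideal. If it differs from that of k, some
  polynomial in it does not vanish at k; this polynomial kills the vector and so certifies that the
  component is zero.\<close>

lemma prj_weight_space:
  assumes "m \<in> max_ideals" "v \<in> weight_space t M m"
  shows "prj k v = (if m = int_ideal k then v else \<zero>\<^bsub>M\<^esub>)"
proof (cases "m = int_ideal k")
  case True
  then show ?thesis using assms prj_self wsp_weight_space by simp
next
  case False
  then obtain r where "r \<in> m" "poly r (of_int k) \<noteq> 0" using max_ideal_separate assms by blast
  with False assms show ?thesis
    by (auto simp: weight_space_def intro!: prj_eqI is_prj_zeroI[of _ r])
qed

lemma nonint_weight_space:
  assumes "m \<in> max_ideals" "m \<notin> \<O>_int"
  shows "weight_space t M m = {\<zero>\<^bsub>M\<^esub>}"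
proof -
  have "v = \<zero>\<^bsub>M\<^esub>" if "v \<in> weight_space t M m" for v
  proof (rule prj_ext)
    show "v \<in> carrier M" using that by (simp add: weight_space_def)
    show "\<zero>\<^bsub>M\<^esub> \<in> carrier M" by simp
    show "prj k v = prj k \<zero>\<^bsub>M\<^esub>" for k
      using prj_weight_space[OF assms(1) that, of k] assms(2) by (auto simp: \<O>_int_def)
  qed
  moreover have "\<zero>\<^bsub>M\<^esub> \<in> weight_space t M m"
    unfolding weight_space_def by (intro CollectI conjI ballI M.zero_closed smult_zero gwa_poly_closed)
  ultimately show ?thesis by blast
qed

text \<open>The definition of a weight module sums over all maximal ideals. Those outside the
  integral orbit contribute only zero, by \<open>nonint_weight_space\<close>, and the other summands
  are recovered by the projections.\<close>

lemma direct_sum_weight_spaces: "is_direct_sum M max_ideals (weight_space t M)"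
  unfolding is_direct_sum_def
proof (intro conjI ballI)
  fix m show "weight_space t M m \<subseteq> carrier M" by (auto simp: weight_space_def)
next
  fix x assume x: "x \<in> carrier M"
  define f where "f = (\<lambda>m\<in>max_ideals. if m \<in> \<O>_int then prj (inv_into UNIV int_ideal m) x else \<zero>\<^bsub>M\<^esub>)"
  have inj: "inj int_ideal" by (auto intro: injI simp: int_ideal_inj)
  have fk: "f (int_ideal k) = prj k x" for k
    using int_ideal_max inj by (simp add: f_def \<O>_int_def)
  have fn: "f m = \<zero>\<^bsub>M\<^esub>" if "m \<notin> \<O>_int" "m \<in> max_ideals" for m using that by (simp add: f_def)
  have "f m \<in> weight_space t M m" if "m \<in> max_ideals" for m
  proof (cases "m \<in> \<O>_int")
    case True
    then obtain k where "m = int_ideal k" by (auto simp: \<O>_int_def)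
    then show ?thesis using fk prj_wsp[OF x] wsp_weight_space by simp
  qed (use that fn nonint_weight_space in auto)
  then have fE: "f \<in> (\<Pi>\<^sub>E i\<in>max_ideals. weight_space t M i)"
    by (auto simp: f_def)
  have S: "{i \<in> max_ideals. f i \<noteq> \<zero>\<^bsub>M\<^esub>} = int_ideal ` wt_supp x"
  proof (intro equalityI subsetI)
    fix m assume m: "m \<in> {i \<in> max_ideals. f i \<noteq> \<zero>\<^bsub>M\<^esub>}"
    then obtain k where "m = int_ideal k" using fn by (auto simp: \<O>_int_def)
    then show "m \<in> int_ideal ` wt_supp x" using m fk by (simp add: wt_supp_def)
  next
    fix m assume "m \<in> int_ideal ` wt_supp x"
    then obtain k where "m = int_ideal k" "prj k x \<noteq> \<zero>\<^bsub>M\<^esub>" by (auto simp: wt_supp_def)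
    then show "m \<in> {i \<in> max_ideals. f i \<noteq> \<zero>\<^bsub>M\<^esub>}" using int_ideal_max fk by simp
  qed
  have "(\<Oplus>\<^bsub>M\<^esub>i\<in>int_ideal ` wt_supp x. f i) = (\<Oplus>\<^bsub>M\<^esub>k\<in>wt_supp x. f (int_ideal k))"
  proof (rule M.finsum_reindex)
    show "f \<in> int_ideal ` wt_supp x \<rightarrow> carrier M" using fk x by (auto simp: Pi_def)
    show "inj_on int_ideal (wt_supp x)" using inj by (rule inj_on_subset) simp
  qed
  then have fx: "x = (\<Oplus>\<^bsub>M\<^esub>i\<in>{i \<in> max_ideals. f i \<noteq> \<zero>\<^bsub>M\<^esub>}. f i)"
    using prj_sum_superset[OF x] by (simp add: S fk)
  have fin: "finite {i \<in> max_ideals. f i \<noteq> \<zero>\<^bsub>M\<^esub>}" using prj_sum_superset(1)[OF x] by (simp add: S)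
  show "\<exists>!f. f \<in> (\<Pi>\<^sub>E i\<in>max_ideals. weight_space t M i) \<and> finite {i \<in> max_ideals. f i \<noteq> \<zero>\<^bsub>M\<^esub>} \<and>
       x = (\<Oplus>\<^bsub>M\<^esub>i\<in>{i \<in> max_ideals. f i \<noteq> \<zero>\<^bsub>M\<^esub>}. f i)"
  proof (rule ex1I[of _ f], use fE fin fx in blast)
    fix g assume g: "g \<in> (\<Pi>\<^sub>E i\<in>max_ideals. weight_space t M i) \<and> finite {i \<in> max_ideals. g i \<noteq> \<zero>\<^bsub>M\<^esub>} \<and>
       x = (\<Oplus>\<^bsub>M\<^esub>i\<in>{i \<in> max_ideals. g i \<noteq> \<zero>\<^bsub>M\<^esub>}. g i)"
    define S where "S = {i \<in> max_ideals. g i \<noteq> \<zero>\<^bsub>M\<^esub>}"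
    have gc: "g i \<in> weight_space t M i" "g i \<in> carrier M" if "i \<in> max_ideals" for i
      using g that by (auto simp: weight_space_def)
    \<comment> \<open>Applying the projection to the assumed decomposition leaves a single summand,
      so the values of any decomposition are the components of x.\<close>
    have gk: "g (int_ideal k) = prj k x" for k
    proof -
      have "prj k x = (\<Oplus>\<^bsub>M\<^esub>i\<in>S. prj k (g i))"
        using g gc prj_finsum[of S g k] by (auto simp: S_def)
      also have "\<dots> = (\<Oplus>\<^bsub>M\<^esub>i\<in>S. if int_ideal k = i then g i else \<zero>\<^bsub>M\<^esub>)"
      proof (intro M.finsum_cong' refl)
        show "prj k (g i) = (if int_ideal k = i then g i else \<zero>\<^bsub>M\<^esub>)" if "i \<in> S" for i
          using prj_weight_space[OF _ gc(1), of i k] that by (simp add: S_def eq_commute[of i])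
      qed (use gc in \<open>simp add: S_def Pi_def\<close>)
      also have "\<dots> = g (int_ideal k)"
      proof (cases "int_ideal k \<in> S")
        case True
        have "finite S" "g \<in> S \<rightarrow> carrier M" using g gc by (auto simp: S_def)
        then show ?thesis using M.add.finprod_singleton[OF True, of g] by simp
      next
        case False
        then have "(\<Oplus>\<^bsub>M\<^esub>i\<in>S. if int_ideal k = i then g i else \<zero>\<^bsub>M\<^esub>) = (\<Oplus>\<^bsub>M\<^esub>i\<in>S. \<zero>\<^bsub>M\<^esub>)"
          by (intro M.finsum_cong') auto
        then show ?thesis using False int_ideal_max by (simp add: S_def M.finsum_zero)
      qed
      finally show ?thesis by simp
    qed
    have "g m = f m" for m
    proof (cases "m \<in> max_ideals")
      case True
      show ?thesis
      proof (cases "m \<in> \<O>_int")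
        case False
        then show ?thesis using gc[OF True] True nonint_weight_space fn by auto
      qed (auto simp: \<O>_int_def gk fk)
    next
      case False
      then show ?thesis using g fE by (auto simp: PiE_def extensional_def)
    qed
    then show "g = f" by auto
  qed
qed

definition fin_dim :: bool
  where "fin_dim \<longleftrightarrow> (\<forall>k. \<exists>B. finite B \<and> B \<subseteq> wsp k \<and> (\<forall>v\<in>wsp k. \<exists>c. v = (\<Oplus>\<^bsub>M\<^esub>b\<in>B. sc (c b) b)))"

lemma wmodI:
  assumes fin_dim
  shows "M \<in> wmod \<O>_int t"
proof -
  have "fin_dim_weight_space t M m" if "m \<in> max_ideals" for m
  proof (cases "m \<in> \<O>_int")
    case True
    then obtain k where "m = int_ideal k" by (auto simp: \<O>_int_def)
    then show ?thesis using assms unfolding fin_dim_def fin_dim_weight_space_def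
      by (simp add: wsp_weight_space)
  next
    case False
    then show ?thesis unfolding fin_dim_weight_space_def
      by (intro exI[of _ "{}"]) (simp add: nonint_weight_space that)
  qed
  moreover have "Supp t M \<subseteq> \<O>_int" using nonint_weight_space by (auto simp: Supp_def)
  ultimately show ?thesis
    using direct_sum_weight_spaces left_module_axioms by (auto simp: wmod_def weight_module_def)
qed

end

text \<open>Together with \<open>wmodI\<close> this exchanges membership in the category for the
  locale assumptions under which modules are studied.\<close>

lemma wmodD:
  assumes "M \<in> wmod \<O>_int t"
  shows "weight_mod t M" and "weight_mod.fin_dim t M"
proof -
  have lm: "left_module (gwa t) M" and ds: "is_direct_sum M max_ideals (weight_space t M)"
    and fd: "\<forall>m\<in>max_ideals. fin_dim_weight_space t M m" and su: "Supp t M \<subseteq> \<O>_int"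
    using assms by (auto simp: wmod_def weight_module_def)
  interpret gwa_module t M using lm by (simp add: gwa_module_def)
  show wm: "weight_mod t M"
  proof
    fix x assume "x \<in> carrier M"
    then obtain f where f: "f \<in> (\<Pi>\<^sub>E i\<in>max_ideals. weight_space t M i)"
      "finite {i \<in> max_ideals. f i \<noteq> \<zero>\<^bsub>M\<^esub>}" "x = (\<Oplus>\<^bsub>M\<^esub>i\<in>{i \<in> max_ideals. f i \<noteq> \<zero>\<^bsub>M\<^esub>}. f i)"
      using ds unfolding is_direct_sum_def by blast
    define K where "K = {k. f (int_ideal k) \<noteq> \<zero>\<^bsub>M\<^esub>}"
    have inj: "inj int_ideal" by (auto intro: injI simp: int_ideal_inj)
    \<comment> \<open>A nonzero summand puts its ideal into the support, hence into the
      orbit.\<close>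
    have sub: "{i \<in> max_ideals. f i \<noteq> \<zero>\<^bsub>M\<^esub>} \<subseteq> \<O>_int"
      using su f(1) by (fastforce simp: Supp_def PiE_iff)
    have S: "{i \<in> max_ideals. f i \<noteq> \<zero>\<^bsub>M\<^esub>} = int_ideal ` K"
      using sub int_ideal_max by (auto simp: K_def \<O>_int_def)
    have w: "f (int_ideal k) \<in> wsp k" for k
      using f(1) int_ideal_max[of k] wsp_weight_space[of k] by auto
    have "(\<Oplus>\<^bsub>M\<^esub>i\<in>int_ideal ` K. f i) = (\<Oplus>\<^bsub>M\<^esub>k\<in>K. f (int_ideal k))"
    proof (rule M.finsum_reindex)
      show "f \<in> int_ideal ` K \<rightarrow> carrier M" using w wsp_carrier by (auto simp: Pi_def)
      show "inj_on int_ideal K" using inj by (rule inj_on_subset) simp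
    qed
    moreover have "finite K" using f(2) inj by (simp add: S finite_image_iff inj_on_subset)
    ultimately show "\<exists>K f. finite K \<and> (\<forall>k\<in>K. f k \<in> wsp k) \<and> x = (\<Oplus>\<^bsub>M\<^esub>k\<in>K. f k)"
      using f(3) w by (intro exI[of _ K] exI[of _ "\<lambda>k. f (int_ideal k)"]) (simp add: S)
  qed
  show "weight_mod.fin_dim t M"
    unfolding weight_mod.fin_dim_def[OF wm]
  proof
    fix k
    show "\<exists>B. finite B \<and> B \<subseteq> wsp k \<and> (\<forall>v\<in>wsp k. \<exists>c. v = (\<Oplus>\<^bsub>M\<^esub>b\<in>B. sc (c b) b))"
      using fd int_ideal_max[of k] unfolding fin_dim_weight_space_def wsp_weight_space[symmetric] by blast
  qed
qed

section \<open>Homomorphisms and weights\<close>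

lemma module_homD:
  assumes "f \<in> module_hom R M N"
  shows "x \<in> carrier M \<Longrightarrow> f x \<in> carrier N"
    and "x \<in> carrier M \<Longrightarrow> y \<in> carrier M \<Longrightarrow> f (x \<oplus>\<^bsub>M\<^esub> y) = f x \<oplus>\<^bsub>N\<^esub> f y"
    and "a \<in> carrier R \<Longrightarrow> x \<in> carrier M \<Longrightarrow> f (a \<odot>\<^bsub>M\<^esub> x) = a \<odot>\<^bsub>N\<^esub> f x"
  using assms by (auto simp: module_hom_def)

lemma additive_zero_minus:
  assumes "abelian_group M" "abelian_group N"
    and f: "\<And>x. x \<in> carrier M \<Longrightarrow> f x \<in> carrier N"
      "\<And>x y. x \<in> carrier M \<Longrightarrow> y \<in> carrier M \<Longrightarrow> f (x \<oplus>\<^bsub>M\<^esub> y) = f x \<oplus>\<^bsub>N\<^esub> f y"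
  shows "f \<zero>\<^bsub>M\<^esub> = \<zero>\<^bsub>N\<^esub>"
    and "x \<in> carrier M \<Longrightarrow> f (\<ominus>\<^bsub>M\<^esub> x) = \<ominus>\<^bsub>N\<^esub> f x"
    and "x \<in> carrier M \<Longrightarrow> y \<in> carrier M \<Longrightarrow> f (x \<ominus>\<^bsub>M\<^esub> y) = f x \<ominus>\<^bsub>N\<^esub> f y"
    and "finite S \<Longrightarrow> g \<in> S \<rightarrow> carrier M \<Longrightarrow> f (\<Oplus>\<^bsub>M\<^esub>s\<in>S. g s) = (\<Oplus>\<^bsub>N\<^esub>s\<in>S. f (g s))"
proof -
  interpret M: abelian_group M by fact
  interpret N: abelian_group N by fact
  show z: "f \<zero>\<^bsub>M\<^esub> = \<zero>\<^bsub>N\<^esub>"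
    using f(2)[of "\<zero>\<^bsub>M\<^esub>" "\<zero>\<^bsub>M\<^esub>"] f(1)[of "\<zero>\<^bsub>M\<^esub>"] by (metis M.zero_closed M.l_zero N.add.l_cancel_one')
  show m: "f (\<ominus>\<^bsub>M\<^esub> x) = \<ominus>\<^bsub>N\<^esub> f x" if "x \<in> carrier M" for x
    by (rule N.minus_equality[symmetric]) (use that f z in \<open>simp_all flip: f(2) add: M.l_neg\<close>)
  show "f (x \<ominus>\<^bsub>M\<^esub> y) = f x \<ominus>\<^bsub>N\<^esub> f y" if "x \<in> carrier M" "y \<in> carrier M"
    using that f m by (simp add: a_minus_def)
  show "f (\<Oplus>\<^bsub>M\<^esub>s\<in>S. g s) = (\<Oplus>\<^bsub>N\<^esub>s\<in>S. f (g s))" if "finite S" "g \<in> S \<rightarrow> carrier M"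
    using that
  proof (induction S rule: finite_induct)
    case (insert s S)
    have "g \<in> S \<rightarrow> carrier M" "g s \<in> carrier M" "(\<lambda>s. f (g s)) \<in> S \<rightarrow> carrier N" using insert f by auto
    then show ?case using insert f by simp
  qed (simp add: z)
qed

lemma hom_wsp:
  assumes "gwa_module t M" "gwa_module t N" "h \<in> module_hom (gwa t) M N" "v \<in> gwa_module.wsp t M k"
  shows "h v \<in> gwa_module.wsp t N k"
proof -
  interpret M: gwa_module t M by fact
  interpret N: gwa_module t N by fact
  note h = module_homD[OF assms(3)]
  note z = additive_zero_minus[OF M.M.abelian_group_axioms N.M.abelian_group_axioms h(1,2)]
  show ?thesis using assms(4) h(1) h(3)[of "gwa_poly t [:- of_int k, 1:]" v] z(1)
    by (simp add: M.wsp_def N.wsp_def)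
qed

text \<open>A polynomial that certifies the component of x certifies its image as well, because
  homomorphisms commute with polynomials.\<close>

lemma hom_prj:
  assumes "weight_mod t M" "weight_mod t N" "h \<in> module_hom (gwa t) M N" "x \<in> carrier M"
  shows "h (weight_mod.prj t M k x) = weight_mod.prj t N k (h x)"
proof -
  interpret M: weight_mod t M by fact
  interpret N: weight_mod t N by fact
  note h = module_homD[OF assms(3)]
  note z = additive_zero_minus[OF M.M.abelian_group_axioms N.M.abelian_group_axioms h(1,2)]
  obtain q where q: "poly q (of_int k) \<noteq> 0" "M.pa q (x \<ominus>\<^bsub>M\<^esub> M.prj k x) = \<zero>\<^bsub>M\<^esub>"
    using M.is_prj_prj[OF assms(4)] by (auto simp: M.is_prj_def)
  have "N.is_prj k (h x) (h (M.prj k x))"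
    unfolding N.is_prj_def
  proof (intro conjI exI[of _ q])
    show "h (M.prj k x) \<in> N.wsp k"
      using hom_wsp[OF M.gwa_module_axioms N.gwa_module_axioms assms(3)] M.prj_wsp assms(4) by blast
    show "N.pa q (h x \<ominus>\<^bsub>N\<^esub> h (M.prj k x)) = \<zero>\<^bsub>N\<^esub>"
      using h(3)[of "gwa_poly t q" "x \<ominus>\<^bsub>M\<^esub> M.prj k x"] q z assms(4) by simp
  qed (fact q)
  then show ?thesis using N.prj_eqI h(1) assms(4) by simp
qed

lemma module_hom_zero_minus:
  assumes "abelian_group M" "abelian_group N" "f \<in> module_hom R M N"
  shows "f \<zero>\<^bsub>M\<^esub> = \<zero>\<^bsub>N\<^esub>"
    and "x \<in> carrier M \<Longrightarrow> f (\<ominus>\<^bsub>M\<^esub> x) = \<ominus>\<^bsub>N\<^esub> f x"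
    and "x \<in> carrier M \<Longrightarrow> y \<in> carrier M \<Longrightarrow> f (x \<ominus>\<^bsub>M\<^esub> y) = f x \<ominus>\<^bsub>N\<^esub> f y"
    and "finite S \<Longrightarrow> g \<in> S \<rightarrow> carrier M \<Longrightarrow> f (\<Oplus>\<^bsub>M\<^esub>s\<in>S. g s) = (\<Oplus>\<^bsub>N\<^esub>s\<in>S. f (g s))"
  using additive_zero_minus[OF assms(1,2), of f] module_homD[OF assms(3)] by blast+

section \<open>Dimensions of weight spaces\<close>

context gwa_module
begin

text \<open>Indexed families are used instead of sets of vectors: a basis can then be mapped
  forward, or be indexed by a disjoint sum or a product of other bases, without a check that its
  members are distinct.\<close>

definition lin :: "'i set \<Rightarrow> ('i \<Rightarrow> 'u) \<Rightarrow> ('i \<Rightarrow> complex) \<Rightarrow> 'u"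
  where "lin A \<beta> h = (\<Oplus>\<^bsub>M\<^esub>a\<in>A. sc (h a) (\<beta> a))"

lemma lin_closed [simp]: "(\<And>a. a \<in> A \<Longrightarrow> \<beta> a \<in> carrier M) \<Longrightarrow> lin A \<beta> h \<in> carrier M"
  unfolding lin_def by (rule M.finsum_closed) auto

lemma lin_empty [simp]: "lin {} \<beta> h = \<zero>\<^bsub>M\<^esub>"
  by (simp add: lin_def)

lemma lin_insert:
  assumes "finite A" "a \<notin> A" "\<beta> a \<in> carrier M" "\<And>x. x \<in> A \<Longrightarrow> \<beta> x \<in> carrier M"
  shows "lin (insert a A) \<beta> h = sc (h a) (\<beta> a) \<oplus>\<^bsub>M\<^esub> lin A \<beta> h"
  unfolding lin_def by (rule M.finsum_insert) (use assms in auto)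

lemma lin_wsp: "finite A \<Longrightarrow> (\<And>a. a \<in> A \<Longrightarrow> \<beta> a \<in> wsp k) \<Longrightarrow> lin A \<beta> h \<in> wsp k"
proof (induction A rule: finite_induct)
  case (insert a A)
  then have "lin (insert a A) \<beta> h = sc (h a) (\<beta> a) \<oplus>\<^bsub>M\<^esub> lin A \<beta> h"
    using wsp_carrier by (intro lin_insert) auto
  then show ?case using insert by (simp add: wsp_add wsp_sc)
qed simp

lemma lin_cong:
  assumes "\<And>a. a \<in> A \<Longrightarrow> h a = h' a" "\<And>a. a \<in> A \<Longrightarrow> \<beta> a \<in> carrier M" "\<And>a. a \<in> A \<Longrightarrow> \<beta> a = \<beta>' a"
  shows "lin A \<beta> h = lin A \<beta>' h'"
  unfolding lin_def by (rule M.finsum_cong') (use assms in auto)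

lemma lin_add:
  assumes "\<And>a. a \<in> A \<Longrightarrow> \<beta> a \<in> carrier M"
  shows "lin A \<beta> h \<oplus>\<^bsub>M\<^esub> lin A \<beta> h' = lin A \<beta> (\<lambda>a. h a + h' a)"
proof -
  have "lin A \<beta> h \<oplus>\<^bsub>M\<^esub> lin A \<beta> h' = (\<Oplus>\<^bsub>M\<^esub>a\<in>A. sc (h a) (\<beta> a) \<oplus>\<^bsub>M\<^esub> sc (h' a) (\<beta> a))"
    unfolding lin_def by (rule M.finsum_addf[symmetric]) (use assms in auto)
  also have "\<dots> = lin A \<beta> (\<lambda>a. h a + h' a)"
    unfolding lin_def by (rule M.finsum_cong') (use assms in \<open>auto simp: sc_add\<close>)
  finally show ?thesis .
qed

text \<open>The two modules may belong to different algebras, as only addition and scalars enter.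
  Tensor products rely on this: there the target is a module over A(t t').\<close>

lemma lin_map:
  assumes "finite A" "gwa_module t' N" "\<And>a. a \<in> A \<Longrightarrow> \<beta> a \<in> carrier M"
    and F: "\<And>x. x \<in> carrier M \<Longrightarrow> F x \<in> carrier N" "F \<zero>\<^bsub>M\<^esub> = \<zero>\<^bsub>N\<^esub>"
      "\<And>x y. x \<in> carrier M \<Longrightarrow> y \<in> carrier M \<Longrightarrow> F (x \<oplus>\<^bsub>M\<^esub> y) = F x \<oplus>\<^bsub>N\<^esub> F y"
      "\<And>c x. x \<in> carrier M \<Longrightarrow> F (sc c x) = gwa_poly t' [:c:] \<odot>\<^bsub>N\<^esub> F x"
  shows "F (lin A \<beta> h) = gwa_module.lin t' N A (F \<circ> \<beta>) h"
proof -
  interpret N: gwa_module t' N by fact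
  show ?thesis using assms(1,3)
  proof (induction A rule: finite_induct)
    case (insert a A)
    then show ?case by (simp add: lin_insert N.lin_insert F)
  qed (simp add: F)
qed

lemma lin_zero: "(\<And>a. a \<in> A \<Longrightarrow> \<beta> a \<in> carrier M) \<Longrightarrow> lin A \<beta> (\<lambda>a. 0) = \<zero>\<^bsub>M\<^esub>"
proof -
  assume "\<And>a. a \<in> A \<Longrightarrow> \<beta> a \<in> carrier M"
  then have "lin A \<beta> (\<lambda>a. 0) = (\<Oplus>\<^bsub>M\<^esub>a\<in>A. \<zero>\<^bsub>M\<^esub>)"
    unfolding lin_def by (intro M.finsum_cong') auto
  then show ?thesis by (simp add: M.finsum_zero)
qed

lemma lin_sc:
  assumes "finite A" "\<And>a. a \<in> A \<Longrightarrow> \<beta> a \<in> carrier M"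
  shows "sc c (lin A \<beta> h) = lin A \<beta> (\<lambda>a. c * h a)"
  using assms
proof (induction A rule: finite_induct)
  case (insert a A)
  then have "lin (insert a A) \<beta> f = sc (f a) (\<beta> a) \<oplus>\<^bsub>M\<^esub> lin A \<beta> f" for f
    by (intro lin_insert) auto
  then show ?case using insert by (simp add: smult_add sc_sc)
qed simp

lemma lin_delta:
  assumes "finite A" "a \<in> A" "\<And>a. a \<in> A \<Longrightarrow> \<beta> a \<in> carrier M"
  shows "lin A \<beta> (\<lambda>i. if i = a then c else 0) = sc c (\<beta> a)"
proof -
  have "lin A \<beta> (\<lambda>i. if i = a then c else 0) = lin (insert a (A - {a})) \<beta> (\<lambda>i. if i = a then c else 0)"
    using assms by (simp add: insert_absorb)
  also have "\<dots> = sc c (\<beta> a) \<oplus>\<^bsub>M\<^esub> lin (A - {a}) \<beta> (\<lambda>i. if i = a then c else 0)"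
    by (subst lin_insert) (use assms in auto)
  also have "lin (A - {a}) \<beta> (\<lambda>i. if i = a then c else 0) = lin (A - {a}) \<beta> (\<lambda>i. 0)"
    by (rule lin_cong) (use assms in auto)
  finally show ?thesis using assms lin_zero[of "A - {a}" \<beta>] by simp
qed

text \<open>Substitution of one coordinate expression into another, that is, multiplication of
  matrices.\<close>

lemma lin_lin:
  assumes "finite A" "finite B" "\<And>a. a \<in> A \<Longrightarrow> \<beta> a \<in> carrier M"
  shows "lin B (\<lambda>b. lin A \<beta> (P b)) q = lin A \<beta> (\<lambda>a. \<Sum>b\<in>B. q b * P b a)"
  using assms(2)
proof (induction B rule: finite_induct)
  case empty
  then show ?case using lin_zero[of A \<beta>] assms by simp
next
  case (insert b B)
  have "lin (insert b B) (\<lambda>b. lin A \<beta> (P b)) q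
      = sc (q b) (lin A \<beta> (P b)) \<oplus>\<^bsub>M\<^esub> lin B (\<lambda>b. lin A \<beta> (P b)) q"
    by (rule lin_insert) (use insert assms in auto)
  also have "\<dots> = lin A \<beta> (\<lambda>a. q b * P b a) \<oplus>\<^bsub>M\<^esub> lin A \<beta> (\<lambda>a. \<Sum>b\<in>B. q b * P b a)"
    using insert assms by (simp add: lin_sc)
  also have "\<dots> = lin A \<beta> (\<lambda>a. \<Sum>b\<in>insert b B. q b * P b a)"
    using assms insert by (subst lin_add) auto
  finally show ?case .
qed

lemma lin_Plus:
  assumes "finite A" "finite B" "\<And>a. a \<in> A \<Longrightarrow> \<beta> a \<in> carrier M" "\<And>b. b \<in> B \<Longrightarrow> \<gamma> b \<in> carrier M"
  shows "lin (Sum_Type.Plus A B) (case_sum \<beta> \<gamma>) h = lin A \<beta> (h \<circ> Inl) \<oplus>\<^bsub>M\<^esub> lin B \<gamma> (h \<circ> Inr)"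
proof -
  have "lin (Sum_Type.Plus A B) (case_sum \<beta> \<gamma>) h = lin (Inl ` A) (case_sum \<beta> \<gamma>) h \<oplus>\<^bsub>M\<^esub> lin (Inr ` B) (case_sum \<beta> \<gamma>) h"
    unfolding lin_def Sum_Type.Plus_def by (rule M.finsum_Un_disjoint) (use assms in auto)
  also have "lin (Inl ` A) (case_sum \<beta> \<gamma>) h = lin A \<beta> (h \<circ> Inl)"
    unfolding lin_def by (subst M.finsum_reindex) (use assms in auto)
  also have "lin (Inr ` B) (case_sum \<beta> \<gamma>) h = lin B \<gamma> (h \<circ> Inr)"
    unfolding lin_def by (subst M.finsum_reindex) (use assms in auto)
  finally show ?thesis .
qed

definition basis :: "int \<Rightarrow> 'i set \<Rightarrow> ('i \<Rightarrow> 'u) \<Rightarrow> bool"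
  where "basis k A \<beta> \<longleftrightarrow> finite A \<and> (\<forall>a\<in>A. \<beta> a \<in> wsp k) \<and>
    (\<forall>v\<in>wsp k. \<exists>h. v = lin A \<beta> h) \<and> (\<forall>h. lin A \<beta> h = \<zero>\<^bsub>M\<^esub> \<longrightarrow> (\<forall>a\<in>A. h a = 0))"

lemma basisD:
  assumes "basis k A \<beta>"
  shows "finite A" "\<And>a. a \<in> A \<Longrightarrow> \<beta> a \<in> wsp k" "\<And>a. a \<in> A \<Longrightarrow> \<beta> a \<in> carrier M"
    "\<And>v. v \<in> wsp k \<Longrightarrow> \<exists>h. v = lin A \<beta> h" "\<And>h a. lin A \<beta> h = \<zero>\<^bsub>M\<^esub> \<Longrightarrow> a \<in> A \<Longrightarrow> h a = 0"
  using assms wsp_carrier by (auto simp: basis_def)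

lemma basis_coeff_unique:
  assumes "basis k A \<beta>" "lin A \<beta> h = lin A \<beta> h'" "a \<in> A"
  shows "h a = h' a"
proof -
  note b = basisD[OF assms(1)]
  have "lin A \<beta> (\<lambda>a. h a + (-1) * h' a) = lin A \<beta> h \<oplus>\<^bsub>M\<^esub> sc (-1) (lin A \<beta> h')"
    using b by (simp add: lin_sc lin_add)
  also have "\<dots> = sc (1 + - 1) (lin A \<beta> h)"
    using b assms(2) by (subst sc_add) simp_all
  also have "\<dots> = \<zero>\<^bsub>M\<^esub>" using b by simp
  finally show ?thesis using b(5)[OF _ assms(3)] by fastforce
qed

text \<open>The change of basis matrices \<^term>\<open>P\<close> and \<^term>\<open>Q\<close> satisfy \<open>QP = 1\<close> and \<open>PQ = 1\<close>; comparing
  traces gives equality of the cardinalities, since the characteristic is zero.\<close>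

lemma basis_card_unique:
  fixes \<beta> :: "'i \<Rightarrow> 'u" and \<gamma> :: "'j \<Rightarrow> 'u"
  assumes "basis k A \<beta>" "basis k B \<gamma>"
  shows "card A = card B"
proof -
  note a = basisD[OF assms(1)] and b = basisD[OF assms(2)]
  obtain P where P: "\<And>x. x \<in> B \<Longrightarrow> \<gamma> x = lin A \<beta> (P x)"
    using bchoice[of B "\<lambda>x h. \<gamma> x = lin A \<beta> h"] a(4) b(2) by blast
  obtain Q where Q: "\<And>x. x \<in> A \<Longrightarrow> \<beta> x = lin B \<gamma> (Q x)"
    using bchoice[of A "\<lambda>x h. \<beta> x = lin B \<gamma> h"] b(4) a(2) by blast
  have 1: "(\<Sum>y\<in>B. Q x y * P y x) = 1" if "x \<in> A" for x
  proof -
    have "lin A \<beta> (\<lambda>i. if i = x then 1 else 0) = lin B \<gamma> (Q x)"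
      using lin_delta[OF a(1) that a(3), where c = 1] a(3) that Q by simp
    also have "\<dots> = lin B (\<lambda>y. lin A \<beta> (P y)) (Q x)" by (rule lin_cong) (use P b in auto)
    also have "\<dots> = lin A \<beta> (\<lambda>i. \<Sum>y\<in>B. Q x y * P y i)" by (rule lin_lin) (use a b in auto)
    finally have "(if x = x then 1 else 0) = (\<Sum>y\<in>B. Q x y * P y x)"
      by (rule basis_coeff_unique[OF assms(1) _ that])
    then show ?thesis by simp
  qed
  have 2: "(\<Sum>x\<in>A. P y x * Q x y) = 1" if "y \<in> B" for y
  proof -
    have "lin B \<gamma> (\<lambda>i. if i = y then 1 else 0) = lin A \<beta> (P y)"
      using lin_delta[OF b(1) that b(3), where c = 1] b(3) that P by simp
    also have "\<dots> = lin A (\<lambda>x. lin B \<gamma> (Q x)) (P y)" by (rule lin_cong) (use Q a in auto)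
    also have "\<dots> = lin B \<gamma> (\<lambda>i. \<Sum>x\<in>A. P y x * Q x i)" by (rule lin_lin) (use a b in auto)
    finally have "(if y = y then 1 else 0) = (\<Sum>x\<in>A. P y x * Q x y)"
      by (rule basis_coeff_unique[OF assms(2) _ that])
    then show ?thesis by simp
  qed
  have "of_nat (card A) = (\<Sum>x\<in>A. \<Sum>y\<in>B. Q x y * P y x)" using 1 by simp
  also have "\<dots> = (\<Sum>y\<in>B. \<Sum>x\<in>A. P y x * Q x y)" by (subst sum.swap) (simp add: mult.commute)
  also have "\<dots> = (of_nat (card B) :: complex)" using 2 by simp
  finally show ?thesis using of_nat_eq_iff by blast
qed

text \<open>The chosen basis is a set of vectors indexed by itself, so that the choice ranges over
  one type; \<open>dimw_eq\<close> compares it with bases indexed by any type.\<close>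

definition dimw :: "int \<Rightarrow> nat"
  where "dimw k = card (SOME B. basis k B (\<lambda>b. b))"

lemma dimw_eq:
  assumes "\<exists>B. basis k B (\<lambda>b. b)" "basis k A \<beta>"
  shows "dimw k = card A"
  unfolding dimw_def using someI_ex[OF assms(1)] assms(2) by (rule basis_card_unique)

end

locale findim_mod = weight_mod t M for t and M :: "'u gwa_module" +
  assumes fin_dim: fin_dim
begin

text \<open>A spanning set of least cardinality is independent: a nontrivial relation would express
  one member through the others, which would then span.\<close>

lemma ex_basis: "\<exists>B. basis k B (\<lambda>b. b)"
proof -
  define S where "S B \<longleftrightarrow> finite B \<and> B \<subseteq> wsp k \<and> (\<forall>v\<in>wsp k. \<exists>c. v = lin B (\<lambda>b. b) c)" for B
  have "\<exists>B. S B" using fin_dim by (simp add: fin_dim_def S_def lin_def)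
  then obtain B where B: "S B" and min: "\<And>B'. S B' \<Longrightarrow> card B \<le> card B'"
    using ex_has_least_nat[of S _ card] by metis
  have Bc: "b \<in> carrier M" if "b \<in> B" for b using B that wsp_carrier by (auto simp: S_def)
  have "h b = 0" if h: "lin B (\<lambda>b. b) h = \<zero>\<^bsub>M\<^esub>" and b: "b \<in> B" for h b
  proof (rule ccontr)
    assume nz: "h b \<noteq> 0"
    define B' where "B' = B - {b}"
    have B': "finite B'" "B = insert b B'" "b \<notin> B'" using B b by (auto simp: S_def B'_def)
    have B'c: "\<And>x. x \<in> B' \<Longrightarrow> x \<in> carrier M" using Bc B' by auto
    have "sc (h b) b \<oplus>\<^bsub>M\<^esub> lin B' (\<lambda>b. b) h = \<zero>\<^bsub>M\<^esub>"
      using h lin_insert[of B' b "\<lambda>b. b" h] B' Bc by auto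
    then have "sc (h b) b = \<ominus>\<^bsub>M\<^esub> lin B' (\<lambda>b. b) h"
      using Bc b B'c by (intro M.minus_equality[symmetric]) (auto simp: M.a_comm)
    then have e1: "sc (h b) b = sc (-1) (lin B' (\<lambda>b. b) h)"
      using pa_minus[of "lin B' (\<lambda>b. b) h" 1] B'c by (simp add: one_pCons)
    \<comment> \<open>The relation is solved for b, whose coefficient \<open>h b\<close> is
      nonzero.\<close>
    have e: "b = lin B' (\<lambda>b. b) (\<lambda>x. - h x / h b)"
    proof -
      have "b = sc (1 / h b) (sc (h b) b)" using nz Bc b by (simp add: sc_sc)
      also have "\<dots> = lin B' (\<lambda>b. b) (\<lambda>x. - h x / h b)"
        unfolding e1 using B' B'c by (simp add: lin_sc)
      finally show ?thesis .
    qed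
    have "S B'"
      unfolding S_def
    proof (intro conjI ballI)
      show "finite B'" "B' \<subseteq> wsp k" using B B' by (auto simp: S_def)
      fix v assume "v \<in> wsp k"
      then obtain c where "v = lin B (\<lambda>b. b) c" using B by (auto simp: S_def)
      also have "\<dots> = sc (c b) b \<oplus>\<^bsub>M\<^esub> lin B' (\<lambda>b. b) c"
        using lin_insert[of B' b "\<lambda>b. b" c] B' Bc by auto
      also have "\<dots> = sc (c b) (lin B' (\<lambda>b. b) (\<lambda>x. - h x / h b)) \<oplus>\<^bsub>M\<^esub> lin B' (\<lambda>b. b) c"
        using e by simp
      also have "\<dots> = lin B' (\<lambda>b. b) (\<lambda>x. c b * (- h x / h b) + c x)"
        using B' B'c by (simp only: lin_sc lin_add)
      finally show "\<exists>c. v = lin B' (\<lambda>b. b) c" by blast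
    qed
    then have "card B \<le> card B'" by (rule min)
    then show False using B' by simp
  qed
  then have "basis k B (\<lambda>b. b)" using B by (auto simp: basis_def S_def)
  then show ?thesis by blast
qed

lemma dimw_basis: "basis k A \<beta> \<Longrightarrow> dimw k = card A"
  using dimw_eq ex_basis by blast

lemma dimw_zero_iff: "dimw k = 0 \<longleftrightarrow> wsp k = {\<zero>\<^bsub>M\<^esub>}"
proof -
  obtain B where B: "basis k B (\<lambda>b. b)" using ex_basis by blast
  note b = basisD[OF B]
  have "b \<noteq> \<zero>\<^bsub>M\<^esub>" if "b \<in> B" for b
  proof
    assume "b = \<zero>\<^bsub>M\<^esub>"
    then have "lin B (\<lambda>b. b) (\<lambda>i. if i = b then 1 else 0) = \<zero>\<^bsub>M\<^esub>"
      using lin_delta[OF b(1) that b(3), where c = 1] by simp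
    then show False using b(5) that by fastforce
  qed
  then have "B = {}" if "wsp k = {\<zero>\<^bsub>M\<^esub>}" using b(2) that by auto
  moreover have "wsp k = {\<zero>\<^bsub>M\<^esub>}" if "B = {}" using b(4) that by auto
  ultimately show ?thesis using dimw_basis[OF B] b(1) by auto
qed

lemma xp_sc: "v \<in> carrier M \<Longrightarrow> xp (sc c v) = sc c (xp v)"
  and xm_sc: "v \<in> carrier M \<Longrightarrow> xm (sc c v) = sc c (xm v)"
  by (simp_all add: xp_pa xm_pa \<sigma>pow_def)

text \<open>Between the weights k and k + 1, both X- X+ and X+ X- are the scalar t(k + 1/2). When it
  is nonzero, X+ carries a basis of the one weight space to a basis of the other.\<close>

lemma dimw_step:
  assumes nz: "poly t (of_int k + 1/2) \<noteq> 0"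
  shows "dimw (k + 1) = dimw k"
proof -
  obtain B where B: "basis k B (\<lambda>b. b)" using ex_basis by blast
  note b = basisD[OF B]
  have map: "xp (lin B (\<lambda>b. b) h) = lin B xp h" for h
    using lin_map[OF b(1) gwa_module_axioms, of "\<lambda>b. b" xp h] b(3)
    by (simp add: smult_add xp_sc comp_def)
  have "basis (k + 1) B xp"
    unfolding basis_def
  proof (intro conjI ballI allI impI)
    show "finite B" by (rule b)
    show "xp a \<in> wsp (k + 1)" if "a \<in> B" for a using that b(2) wsp_xp by blast
    show "\<exists>h. v = lin B xp h" if v: "v \<in> wsp (k + 1)" for v
    proof -
      define c where "c = poly t (of_int k + 1/2)"
      have "xm v \<in> wsp k" using wsp_xm[OF v] by simp
      then obtain h where h: "xm v = lin B (\<lambda>b. b) h" using b(4) by blast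
      have "xp (xm v) = sc c v" using wsp_xp_xm[OF v] by (simp add: c_def add.commute)
      then have "lin B xp h = sc c v" using h map by simp
      then have "v = sc (1/c) (lin B xp h)" using nz wsp_carrier[OF v] by (simp add: sc_sc c_def)
      also have "\<dots> = lin B xp (\<lambda>x. (1/c) * h x)" using b by (intro lin_sc) auto
      finally show ?thesis by blast
    qed
    fix h a assume 0: "lin B xp h = \<zero>\<^bsub>M\<^esub>" and a: "a \<in> B"
    have w: "lin B (\<lambda>b. b) h \<in> wsp k" using b(1,2) by (rule lin_wsp)
    have "xm (xp (lin B (\<lambda>b. b) h)) = \<zero>\<^bsub>M\<^esub>" using map 0 by simp
    then have "lin B (\<lambda>b. b) h = \<zero>\<^bsub>M\<^esub>" using wsp_xm_xp[OF w] nz sc_eq_zero wsp_carrier[OF w] by simp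
    then show "h a = 0" using b(5) a by blast
  qed
  then show ?thesis using dimw_basis B by metis
qed

end

lemma wmod_findim: "M \<in> wmod \<O>_int t \<Longrightarrow> findim_mod t M"
  using wmodD[of M t] by (simp add: findim_mod_def findim_mod_axioms_def)

lemma findim_wmod: "findim_mod t M \<Longrightarrow> M \<in> wmod \<O>_int t"
  unfolding findim_mod_def findim_mod_axioms_def using weight_mod.wmodI by blast

text \<open>A basis of the middle space consists of the image of a basis of M and of lifts of a
  basis of M'. What has to be settled is that lifts and preimages can be taken of weight k.\<close>

lemma short_exact_dimw:
  assumes "findim_mod t M" "findim_mod t M''" "findim_mod t M'" "short_exact (gwa t) M M'' M'"
  shows "gwa_module.dimw t M'' k = gwa_module.dimw t M k + gwa_module.dimw t M' k"
proof -
  interpret M: findim_mod t M by fact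
  interpret N: findim_mod t M'' by fact
  interpret L: findim_mod t M' by fact
  obtain f g where fh: "f \<in> module_hom (gwa t) M M''" and gh: "g \<in> module_hom (gwa t) M'' M'"
    and inj: "inj_on f (carrier M)" and surj: "g ` carrier M'' = carrier M'"
    and ex: "f ` carrier M = {x \<in> carrier M''. g x = \<zero>\<^bsub>M'\<^esub>}"
    using assms(4) unfolding short_exact_def by blast
  note f = module_homD[OF fh] and g = module_homD[OF gh]
  note zf = module_hom_zero_minus[OF M.M.abelian_group_axioms N.M.abelian_group_axioms fh]
  note zg = module_hom_zero_minus[OF N.M.abelian_group_axioms L.M.abelian_group_axioms gh]
  obtain A where A: "M.basis k A (\<lambda>b. b)" using M.ex_basis by blast
  obtain B where B: "L.basis k B (\<lambda>b. b)" using L.ex_basis by blast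
  note a = M.basisD[OF A] and b = L.basisD[OF B]
  \<comment> \<open>Projecting an arbitrary preimage to weight k does not change its image, as y
    already has weight k.\<close>
  have "\<exists>x\<in>N.wsp k. g x = y" if y: "y \<in> B" for y
  proof -
    have "y \<in> g ` carrier M''" using b(3)[OF y] surj by simp
    then obtain x where "x \<in> carrier M''" "g x = y" by blast
    then have "g (N.prj k x) = y"
      using hom_prj[OF N.weight_mod_axioms L.weight_mod_axioms gh] L.prj_self b(2)[OF y] by simp
    then show ?thesis using N.prj_wsp \<open>x \<in> carrier M''\<close> by blast
  qed
  then obtain \<gamma> where \<gamma>: "\<And>y. y \<in> B \<Longrightarrow> \<gamma> y \<in> N.wsp k" "\<And>y. y \<in> B \<Longrightarrow> g (\<gamma> y) = y" by metis
  note \<gamma>c = N.wsp_carrier[OF \<gamma>(1)]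
  have fl: "f (M.lin A (\<lambda>b. b) h) = N.lin A f h" for h
    using M.lin_map[OF a(1) N.gwa_module_axioms, of "\<lambda>b. b" f h] a(3) f zf by (simp add: comp_def)
  have gl: "g (N.lin B \<gamma> h) = L.lin B (\<lambda>b. b) h" for h
  proof -
    have "g (N.lin B \<gamma> h) = L.lin B (g \<circ> \<gamma>) h"
      using N.lin_map[OF b(1) L.gwa_module_axioms, of \<gamma> g h] \<gamma>c g zg by simp
    also have "\<dots> = L.lin B (\<lambda>b. b) h" by (rule L.lin_cong) (use \<gamma> b in auto)
    finally show ?thesis .
  qed
  have lp: "N.lin (Sum_Type.Plus A B) (case_sum f \<gamma>) h = N.lin A f (h \<circ> Inl) \<oplus>\<^bsub>M''\<^esub> N.lin B \<gamma> (h \<circ> Inr)" for h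
    using a b f \<gamma>c by (intro N.lin_Plus) auto
  have gf: "g (f x) = \<zero>\<^bsub>M'\<^esub>" if "x \<in> carrier M" for x using ex that by blast
  have "N.basis k (Sum_Type.Plus A B) (case_sum f \<gamma>)"
    unfolding N.basis_def
  proof (intro conjI ballI allI impI)
    show "finite (Sum_Type.Plus A B)" using a b by simp
    show "case_sum f \<gamma> x \<in> N.wsp k" if "x \<in> Sum_Type.Plus A B" for x
      using that \<gamma> hom_wsp[OF M.gwa_module_axioms N.gwa_module_axioms fh] a(2) by auto
    show "\<exists>h. v = N.lin (Sum_Type.Plus A B) (case_sum f \<gamma>) h" if v: "v \<in> N.wsp k" for v
    proof -
      have vc: "v \<in> carrier M''" using v N.wsp_carrier by blast
      have "g v \<in> L.wsp k" using hom_wsp[OF N.gwa_module_axioms L.gwa_module_axioms gh v] .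
      then obtain hb where hb: "g v = L.lin B (\<lambda>b. b) hb" using b(4) by blast
      define u where "u = v \<ominus>\<^bsub>M''\<^esub> N.lin B \<gamma> hb"
      have lc: "N.lin B \<gamma> hb \<in> carrier M''" using \<gamma>c by simp
      have uc: "u \<in> carrier M''" using vc lc by (simp add: u_def)
      have uw: "u \<in> N.wsp k" unfolding u_def
        by (rule N.wsp_diff[OF v N.lin_wsp[OF b(1) \<gamma>(1)]])
      have "g u = g v \<ominus>\<^bsub>M'\<^esub> g (N.lin B \<gamma> hb)" unfolding u_def by (rule zg(3)[OF vc lc])
      also have "g (N.lin B \<gamma> hb) = g v" unfolding hb by (rule gl)
      also have "g v \<ominus>\<^bsub>M'\<^esub> g v = \<zero>\<^bsub>M'\<^esub>" using L.diff_eq_zero g(1)[OF vc] by blast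
      finally have "g u = \<zero>\<^bsub>M'\<^esub>" .
      then have "u \<in> f ` carrier M" unfolding ex using uc by simp
      then obtain x where x: "x \<in> carrier M" "f x = u" by blast
      \<comment> \<open>The preimage has weight k too: x and its projection have the same image u
        under the injective f.\<close>
      have "f (M.prj k x) = f x"
        using hom_prj[OF M.weight_mod_axioms N.weight_mod_axioms fh x(1)] N.prj_self[OF uw] x by simp
      then have "x \<in> M.wsp k" using inj x M.prj_wsp[OF x(1), of k] by (metis M.prj_closed inj_onD)
      then obtain ha where ha: "x = M.lin A (\<lambda>b. b) ha" using a(4) by blast
      have "v = u \<oplus>\<^bsub>M''\<^esub> N.lin B \<gamma> hb"
        unfolding u_def using vc lc by (simp add: a_minus_def N.M.a_assoc N.M.l_neg)
      also have "\<dots> = N.lin A f ha \<oplus>\<^bsub>M''\<^esub> N.lin B \<gamma> hb" using x ha fl by simp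
      also have "\<dots> = N.lin (Sum_Type.Plus A B) (case_sum f \<gamma>) (case_sum ha hb)"
        by (simp add: lp comp_def)
      finally show ?thesis by blast
    qed
    fix h x assume 0: "N.lin (Sum_Type.Plus A B) (case_sum f \<gamma>) h = \<zero>\<^bsub>M''\<^esub>" and x: "x \<in> Sum_Type.Plus A B"
    have c1: "N.lin A f (h \<circ> Inl) \<in> carrier M''" "N.lin B \<gamma> (h \<circ> Inr) \<in> carrier M''"
      using a f \<gamma>c by auto
    have "g (N.lin A f (h \<circ> Inl)) = \<zero>\<^bsub>M'\<^esub>"
      using gf[of "M.lin A (\<lambda>b. b) (h \<circ> Inl)"] fl a by simp
    then have "L.lin B (\<lambda>b. b) (h \<circ> Inr) = \<zero>\<^bsub>M'\<^esub>"
      using g(2)[OF c1] 0 lp gl zg(1) b by simp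
    then have hB: "h (Inr y) = 0" if "y \<in> B" for y using b(5) that by fastforce
    have "N.lin B \<gamma> (h \<circ> Inr) = N.lin B \<gamma> (\<lambda>_. 0)" by (rule N.lin_cong) (use hB \<gamma>c in auto)
    then have "N.lin B \<gamma> (h \<circ> Inr) = \<zero>\<^bsub>M''\<^esub>" using N.lin_zero[OF \<gamma>c] by simp
    then have "N.lin A f (h \<circ> Inl) = \<zero>\<^bsub>M''\<^esub>" using 0 lp c1 by simp
    then have "f (M.lin A (\<lambda>b. b) (h \<circ> Inl)) = f \<zero>\<^bsub>M\<^esub>" using fl zf by simp
    then have "M.lin A (\<lambda>b. b) (h \<circ> Inl) = \<zero>\<^bsub>M\<^esub>" using inj a by (auto dest: inj_onD)
    then have hA: "h (Inl y) = 0" if "y \<in> A" for y using a(5) that by fastforce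
    show "h x = 0" using x hA hB by auto
  qed
  then have "N.dimw k = card (Sum_Type.Plus A B)" by (rule N.dimw_basis)
  then show ?thesis using M.dimw_basis[OF A] L.dimw_basis[OF B] a b by (simp add: card_Plus)
qed

section \<open>Modules with one-dimensional weight spaces\<close>

text \<open>\<open>Q\<close> is a mere record here, and every axiom is inherited from
  \<open>M\<close> along the surjection. Copies of modules, quotients and the graded space of the
  Grothendieck algebra all become modules in this way.\<close>

lemma left_module_image:
  assumes "left_module R M"
    and surj: "h ` carrier M = carrier Q"
    and add: "\<And>x y. x \<in> carrier M \<Longrightarrow> y \<in> carrier M \<Longrightarrow> h (x \<oplus>\<^bsub>M\<^esub> y) = h x \<oplus>\<^bsub>Q\<^esub> h y"
    and zero: "h \<zero>\<^bsub>M\<^esub> = \<zero>\<^bsub>Q\<^esub>"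
    and smult: "\<And>a x. a \<in> carrier R \<Longrightarrow> x \<in> carrier M \<Longrightarrow> h (a \<odot>\<^bsub>M\<^esub> x) = a \<odot>\<^bsub>Q\<^esub> h x"
  shows "left_module R Q" and "h \<in> module_hom R M Q"
proof -
  interpret M: left_module R M by fact
  have c: "h x \<in> carrier Q" if "x \<in> carrier M" for x using surj that by blast
  have e: "\<exists>x\<in>carrier M. y = h x" if "y \<in> carrier Q" for y using surj that by blast
  have gr: "abelian_group Q"
  proof (rule abelian_groupI)
    fix x y assume "x \<in> carrier Q" "y \<in> carrier Q"
    then obtain x' y' where xy: "x' \<in> carrier M" "x = h x'" "y' \<in> carrier M" "y = h y'" using e by metis
    have s: "x \<oplus>\<^bsub>Q\<^esub> y = h (x' \<oplus>\<^bsub>M\<^esub> y')" "y \<oplus>\<^bsub>Q\<^esub> x = h (y' \<oplus>\<^bsub>M\<^esub> x')" using xy add by auto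
    show "x \<oplus>\<^bsub>Q\<^esub> y \<in> carrier Q" unfolding s using xy by (intro c) simp
    show "x \<oplus>\<^bsub>Q\<^esub> y = y \<oplus>\<^bsub>Q\<^esub> x" unfolding s using xy M.M.a_comm by simp
    show "x \<oplus>\<^bsub>Q\<^esub> y \<oplus>\<^bsub>Q\<^esub> z = x \<oplus>\<^bsub>Q\<^esub> (y \<oplus>\<^bsub>Q\<^esub> z)" if zQ: "z \<in> carrier Q" for z
    proof -
      obtain z' where z: "z' \<in> carrier M" "z = h z'" using e zQ by metis
      have "x \<oplus>\<^bsub>Q\<^esub> y \<oplus>\<^bsub>Q\<^esub> z = h (x' \<oplus>\<^bsub>M\<^esub> y' \<oplus>\<^bsub>M\<^esub> z')"
        unfolding s z using xy z by (intro add[symmetric]) auto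
      also have "\<dots> = h (x' \<oplus>\<^bsub>M\<^esub> (y' \<oplus>\<^bsub>M\<^esub> z'))" using xy z M.M.a_assoc by simp
      also have "\<dots> = x \<oplus>\<^bsub>Q\<^esub> (y \<oplus>\<^bsub>Q\<^esub> z)" using xy z add by simp
      finally show ?thesis .
    qed
  next
    show "\<zero>\<^bsub>Q\<^esub> \<in> carrier Q" using zero c by (metis M.M.zero_closed)
  next
    fix x assume "x \<in> carrier Q"
    then obtain x' where x: "x' \<in> carrier M" "x = h x'" using e by metis
    have "h (\<zero>\<^bsub>M\<^esub> \<oplus>\<^bsub>M\<^esub> x') = \<zero>\<^bsub>Q\<^esub> \<oplus>\<^bsub>Q\<^esub> x" unfolding x(2) zero[symmetric] by (rule add) (use x in auto)
    then show "\<zero>\<^bsub>Q\<^esub> \<oplus>\<^bsub>Q\<^esub> x = x" using x by simp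
    have "h (\<ominus>\<^bsub>M\<^esub> x' \<oplus>\<^bsub>M\<^esub> x') = h (\<ominus>\<^bsub>M\<^esub> x') \<oplus>\<^bsub>Q\<^esub> x" unfolding x(2) by (rule add) (use x in auto)
    then have "h (\<ominus>\<^bsub>M\<^esub> x') \<oplus>\<^bsub>Q\<^esub> x = \<zero>\<^bsub>Q\<^esub>" using x zero by (simp add: M.M.l_neg)
    then show "\<exists>y\<in>carrier Q. y \<oplus>\<^bsub>Q\<^esub> x = \<zero>\<^bsub>Q\<^esub>" using c x by (intro bexI[of _ "h (\<ominus>\<^bsub>M\<^esub> x')"]) auto
  qed
  show "left_module R Q"
  proof (intro left_module.intro left_module_axioms.intro gr M.ring_axioms)
    fix a x assume a: "a \<in> carrier R" and "x \<in> carrier Q"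
    then obtain x' where x: "x' \<in> carrier M" "x = h x'" using e by metis
    have ax: "b \<odot>\<^bsub>Q\<^esub> x = h (b \<odot>\<^bsub>M\<^esub> x')" "b \<odot>\<^bsub>M\<^esub> x' \<in> carrier M" if "b \<in> carrier R" for b
      using x that smult M.smult_closed by auto
    show "a \<odot>\<^bsub>Q\<^esub> x \<in> carrier Q" using a ax c by simp
    show "a \<odot>\<^bsub>Q\<^esub> (x \<oplus>\<^bsub>Q\<^esub> y) = a \<odot>\<^bsub>Q\<^esub> x \<oplus>\<^bsub>Q\<^esub> a \<odot>\<^bsub>Q\<^esub> y" if y: "y \<in> carrier Q" for y
    proof -
      obtain y' where y: "y' \<in> carrier M" "y = h y'" using e y by metis
      have ay: "a \<odot>\<^bsub>Q\<^esub> y = h (a \<odot>\<^bsub>M\<^esub> y')" "a \<odot>\<^bsub>M\<^esub> y' \<in> carrier M"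
        using y a smult M.smult_closed by auto
      have "a \<odot>\<^bsub>Q\<^esub> (x \<oplus>\<^bsub>Q\<^esub> y) = h (a \<odot>\<^bsub>M\<^esub> (x' \<oplus>\<^bsub>M\<^esub> y'))"
        using x y a add smult by simp
      then show ?thesis using a x y ay ax add by (simp add: M.smult_r_distr)
    qed
    show "(a \<oplus>\<^bsub>R\<^esub> b) \<odot>\<^bsub>Q\<^esub> x = a \<odot>\<^bsub>Q\<^esub> x \<oplus>\<^bsub>Q\<^esub> b \<odot>\<^bsub>Q\<^esub> x" if b: "b \<in> carrier R" for b
      using a x b ax add by (simp add: M.smult_l_distr)
    show "(a \<otimes>\<^bsub>R\<^esub> b) \<odot>\<^bsub>Q\<^esub> x = a \<odot>\<^bsub>Q\<^esub> (b \<odot>\<^bsub>Q\<^esub> x)" if b: "b \<in> carrier R" for b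
      using a x(1) b ax smult[of a "b \<odot>\<^bsub>M\<^esub> x'"] by (simp add: M.smult_assoc)
  next
    fix x assume "x \<in> carrier Q"
    then obtain x' where x: "x' \<in> carrier M" "x = h x'" using e by metis
    then show "\<one>\<^bsub>R\<^esub> \<odot>\<^bsub>Q\<^esub> x = x" using smult[of "\<one>\<^bsub>R\<^esub>" x'] by (simp add: M.smult_one)
  qed
  show "h \<in> module_hom R M Q"
    using c add smult by (auto simp: module_hom_def)
qed

definition transport :: "('a \<Rightarrow> 'b) \<Rightarrow> ('r, 'a) module \<Rightarrow> ('r, 'b) module"
  where "transport j M = \<lparr>carrier = j ` carrier M, monoid.mult = undefined, one = undefined,
    ring.zero = j \<zero>\<^bsub>M\<^esub>,
    add = (\<lambda>x y. j (inv_into (carrier M) j x \<oplus>\<^bsub>M\<^esub> inv_into (carrier M) j y)),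
    module.smult = (\<lambda>a x. j (a \<odot>\<^bsub>M\<^esub> inv_into (carrier M) j x))\<rparr>"

lemma transport:
  assumes "left_module R M" "inj_on j (carrier M)"
  shows "left_module R (transport j M)" "j \<in> module_hom R M (transport j M)"
    "bij_betw j (carrier M) (carrier (transport j M))"
proof -
  have *: "j ` carrier M = carrier (transport j M)" by (simp add: transport_def)
  show "left_module R (transport j M)" "j \<in> module_hom R M (transport j M)"
    by (rule left_module_image[OF assms(1) *]; use assms(2) in \<open>simp add: transport_def\<close>)+
  show "bij_betw j (carrier M) (carrier (transport j M))" using * assms(2) by (simp add: bij_betw_def)
qed

text \<open>X+ is the plain shift, and X- is the backward shift times t(k + 1/2). With the whole
  factor placed on X-, both compositions come out as the required values of t. Arrows that enter or
  leave I are cut.\<close>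

fun gen_act :: "complex poly \<Rightarrow> int set \<Rightarrow> gen \<Rightarrow> (int \<Rightarrow> complex) \<Rightarrow> int \<Rightarrow> complex" where
  "gen_act t I Gen_z f = (\<lambda>k. of_int k * f k)"
| "gen_act t I Gen_Xp f = (\<lambda>k. if k \<in> I \<and> k - 1 \<in> I then f (k - 1) else 0)"
| "gen_act t I Gen_Xm f = (\<lambda>k. if k \<in> I \<and> k + 1 \<in> I then poly t (of_int k + 1/2) * f (k + 1) else 0)"

definition word_act :: "complex poly \<Rightarrow> int set \<Rightarrow> gen word \<Rightarrow> (int \<Rightarrow> complex) \<Rightarrow> int \<Rightarrow> complex"
  where "word_act t I w f = foldr (gen_act t I) (letters w) f"

definition free_act :: "complex poly \<Rightarrow> int set \<Rightarrow> free_alg \<Rightarrow> (int \<Rightarrow> complex) \<Rightarrow> int \<Rightarrow> complex"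
  where "free_act t I p f = (\<lambda>k. \<Sum>w\<in>Poly_Mapping.keys p. Poly_Mapping.lookup p w * word_act t I w f k)"

lemma word_act_plus: "word_act t I (u + v) f = word_act t I u (word_act t I v f)"
  by (simp add: word_act_def plus_word_def)

lemma word_act_linear:
  "word_act t I w (\<lambda>k. f k + g k) = (\<lambda>k. word_act t I w f k + word_act t I w g k)"
  "word_act t I w (\<lambda>k. c * f k) = (\<lambda>k. c * word_act t I w f k)"
proof -
  have g: "gen_act t I x (\<lambda>k. f k + g k) = (\<lambda>k. gen_act t I x f k + gen_act t I x g k)"
    "gen_act t I x (\<lambda>k. c * f k) = (\<lambda>k. c * gen_act t I x f k)" for x f g c
    by (cases x; auto simp: fun_eq_iff algebra_simps)+
  have "foldr (gen_act t I) xs (\<lambda>k. f k + g k)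
      = (\<lambda>k. foldr (gen_act t I) xs f k + foldr (gen_act t I) xs g k)"
    "foldr (gen_act t I) xs (\<lambda>k. c * f k) = (\<lambda>k. c * foldr (gen_act t I) xs f k)" for xs
    by (induction xs) (simp_all add: g)
  then show "word_act t I w (\<lambda>k. f k + g k) = (\<lambda>k. word_act t I w f k + word_act t I w g k)"
    "word_act t I w (\<lambda>k. c * f k) = (\<lambda>k. c * word_act t I w f k)"
    by (simp_all add: word_act_def)
qed

lemma free_act_superset:
  "finite S \<Longrightarrow> Poly_Mapping.keys p \<subseteq> S \<Longrightarrow>
    free_act t I p f = (\<lambda>k. \<Sum>w\<in>S. Poly_Mapping.lookup p w * word_act t I w f k)"
  unfolding free_act_def fun_eq_iff
  by (intro allI sum.mono_neutral_left) (auto simp: in_keys_iff)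

lemma free_act_add: "free_act t I (p + q) f = (\<lambda>k. free_act t I p f k + free_act t I q f k)"
proof -
  define S where "S = Poly_Mapping.keys p \<union> Poly_Mapping.keys q"
  have "Poly_Mapping.keys (p + q) \<subseteq> S" unfolding S_def by (rule keys_add)
  then show ?thesis
    by (simp add: free_act_superset[of S] S_def lookup_add distrib_right sum.distrib)
qed

lemma free_act_zero [simp]: "free_act t I 0 f = (\<lambda>k. 0)"
  by (simp add: free_act_def)

lemma free_act_single: "free_act t I (Poly_Mapping.single w c) f = (\<lambda>k. c * word_act t I w f k)"
  using free_act_superset[of "{w}" "Poly_Mapping.single w c" t I f] by simp

lemma free_act_linear:
  "free_act t I p (\<lambda>k. f k + g k) = (\<lambda>k. free_act t I p f k + free_act t I p g k)"
  "free_act t I p (\<lambda>k. c * f k) = (\<lambda>k. c * free_act t I p f k)"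
  by (simp_all add: free_act_def word_act_linear distrib_left sum.distrib sum_distrib_left mult.left_commute)

text \<open>Both factors are reduced to single words, where concatenation is composition; the
  coefficient of the second word passes through the first by linearity.\<close>

lemma free_act_mult: "free_act t I (p * q) f = free_act t I p (free_act t I q f)"
proof (induction p rule: poly_mapping_single_induct)
  case (single p v b)
  have "free_act t I (Poly_Mapping.single v b * q) f = free_act t I (Poly_Mapping.single v b) (free_act t I q f)"
  proof (induction q rule: poly_mapping_single_induct)
    case zero
    show ?case using free_act_linear(2)[of t I "Poly_Mapping.single v b" 0 "\<lambda>_. 0"] by simp
  next
    case (single q w c)
    then show ?case
      by (simp add: distrib_left mult_single free_act_add free_act_single word_act_plus
          word_act_linear free_act_linear mult.assoc mult.left_commute[of c b])
  qed
  then show ?case using single by (simp add: distrib_right free_act_add)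
qed simp

lemma free_act_minus: "free_act t I (- p) f = (\<lambda>k. - free_act t I p f k)"
proof -
  have "free_act t I (- p + p) f = (\<lambda>k. 0)" by simp
  then show ?thesis unfolding free_act_add by (simp add: fun_eq_iff eq_neg_iff_add_eq_0)
qed

lemma free_act_diff: "free_act t I (p - q) f = (\<lambda>k. free_act t I p f k - free_act t I q f k)"
  using free_act_add[of t I p "- q" f] by (simp add: free_act_minus)

lemma free_act_fgen: "free_act t I (fgen g) f = gen_act t I g f"
  by (simp add: fgen_def free_act_single word_act_def)

lemma free_act_fconst: "free_act t I (fconst c) f = (\<lambda>k. c * f k)"
  by (simp add: free_act_single word_act_def zero_word_def)

lemma free_act_poly: "free_act t I (poly_in_free r) f = (\<lambda>k. poly r (of_int k) * f k)"
proof (induction r)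
  case (pCons a r)
  then show ?case
    by (simp add: poly_in_free_pCons free_act_add free_act_mult free_act_fgen free_act_fconst algebra_simps)
qed simp

definition fin_fun :: "int set \<Rightarrow> (int \<Rightarrow> complex) set"
  where "fin_fun I = {f. finite {k. f k \<noteq> 0} \<and> (\<forall>k. k \<notin> I \<longrightarrow> f k = 0)}"

lemma fin_fun_add: "f \<in> fin_fun I \<Longrightarrow> g \<in> fin_fun I \<Longrightarrow> (\<lambda>k. f k + g k) \<in> fin_fun I"
  unfolding fin_fun_def by (auto intro: finite_subset[of _ "{k. f k \<noteq> 0} \<union> {k. g k \<noteq> 0}"])

lemma fin_fun_scale: "f \<in> fin_fun I \<Longrightarrow> (\<lambda>k. c k * f k) \<in> fin_fun I"
  unfolding fin_fun_def by (auto intro: finite_subset[of _ "{k. f k \<noteq> 0}"])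

lemma fin_fun_zero: "(\<lambda>k. 0) \<in> fin_fun I"
  by (simp add: fin_fun_def)

lemma fin_fun_gen_act:
  assumes "f \<in> fin_fun I"
  shows "gen_act t I g f \<in> fin_fun I"
proof (cases g)
  case Gen_z
  then show ?thesis using assms fin_fun_scale by simp
next
  case Gen_Xp
  have "{k. gen_act t I g f k \<noteq> 0} \<subseteq> (\<lambda>k. k + 1) ` {k. f k \<noteq> 0}"
    by (auto simp: Gen_Xp image_iff split: if_splits) (metis diff_add_cancel)
  then have "finite {k. gen_act t I g f k \<noteq> 0}"
    by (rule finite_subset) (use assms in \<open>simp add: fin_fun_def\<close>)
  then show ?thesis using assms unfolding fin_fun_def by (auto simp: Gen_Xp)
next
  case Gen_Xm
  have "{k. gen_act t I g f k \<noteq> 0} \<subseteq> (\<lambda>k. k - 1) ` {k. f k \<noteq> 0}"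
    by (auto simp: Gen_Xm image_iff split: if_splits) (metis add_diff_cancel_right')
  then have "finite {k. gen_act t I g f k \<noteq> 0}"
    by (rule finite_subset) (use assms in \<open>simp add: fin_fun_def\<close>)
  then show ?thesis using assms unfolding fin_fun_def by (auto simp: Gen_Xm)
qed

lemma fin_fun_free_act: "f \<in> fin_fun I \<Longrightarrow> free_act t I p f \<in> fin_fun I"
proof (induction p arbitrary: f rule: free_alg_induct)
  case (const c)
  then show ?case by (simp add: free_act_fconst fin_fun_scale)
next
  case (gen g)
  then show ?case by (simp add: free_act_fgen fin_fun_gen_act)
next
  case (add p q)
  then show ?case by (simp add: free_act_add fin_fun_add)
next
  case (mult p q)
  then show ?case by (simp add: free_act_mult)
qed

text \<open>If exactly one of k and k + 1 lies in I, the arrows between them are cut and the product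
  of X+ and X- at the remaining point is zero. The relations then demand that t vanish at k +
  1/2.\<close>

definition admissible :: "complex poly \<Rightarrow> int set \<Rightarrow> bool"
  where "admissible t I \<longleftrightarrow> (\<forall>k. (k \<in> I) \<noteq> (k + 1 \<in> I) \<longrightarrow> poly t (of_int k + 1/2) = 0)"

lemma free_act_rels:
  assumes "admissible t I" "f \<in> fin_fun I" "p \<in> gwa_rels t"
  shows "free_act t I p f = (\<lambda>k. 0)"
proof -
  have z: "f k = 0" if "k \<notin> I" for k using assms(2) that by (simp add: fin_fun_def)
  \<comment> \<open>The boundary cases of the two quadratic relations: at a point of I whose upper
    or lower neighbour is missing, the left side is zero, and so must be the value of t.\<close>
  have a: "poly t (of_int k + 1/2) = 0" if "k \<in> I" "k + 1 \<notin> I" for k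
    using assms(1) that by (simp add: admissible_def)
  have a': "poly t (of_int k - 1/2) = 0" if "k \<in> I" "k - 1 \<notin> I" for k
    using assms(1)[unfolded admissible_def, rule_format, of "k - 1"] that
    by (simp add: algebra_simps)
  consider (1) r where "p = fgen Gen_Xp * poly_in_free r - poly_in_free (\<sigma>pow 1 r) * fgen Gen_Xp"
    | (2) r where "p = fgen Gen_Xm * poly_in_free r - poly_in_free (\<sigma>pow (- 1) r) * fgen Gen_Xm"
    | (3) "p = fgen Gen_Xp * fgen Gen_Xm - poly_in_free (\<sigma>pow (1/2) t)"
    | (4) "p = fgen Gen_Xm * fgen Gen_Xp - poly_in_free (\<sigma>pow (- (1/2)) t)"
    using assms(3) unfolding gwa_rels_def by blast
  then show ?thesis
  proof cases
    case 1
    then show ?thesis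
      by (auto simp: free_act_diff free_act_mult free_act_poly free_act_fgen \<sigma>pow_def poly_pcompose fun_eq_iff)
  next
    case 2
    then show ?thesis
      by (auto simp: free_act_diff free_act_mult free_act_poly free_act_fgen \<sigma>pow_def poly_pcompose
          fun_eq_iff add.commute)
  next
    case 3
    have e: "complex_of_int k - 1 + 1/2 = of_int k - 1/2" "- (1/2) + complex_of_int k = of_int k - 1/2" for k
      by simp_all
    show ?thesis unfolding 3 using a' z
      by (auto simp: free_act_diff free_act_mult free_act_poly free_act_fgen \<sigma>pow_def poly_pcompose
          fun_eq_iff e)
  next
    case 4
    then show ?thesis using a z
      by (auto simp: free_act_diff free_act_mult free_act_poly free_act_fgen \<sigma>pow_def poly_pcompose
          fun_eq_iff add.commute)
  qed
qed

lemma free_act_ideal: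
  assumes "admissible t I" "f \<in> fin_fun I" "p \<in> gwa_ideal t"
  shows "free_act t I p f = (\<lambda>k. 0)"
proof -
  \<comment> \<open>Quantifying over all these functions makes J closed under multiplication on the
    right, because the free algebra maps them into themselves.\<close>
  define J where "J = {p. \<forall>f\<in>fin_fun I. free_act t I p f = (\<lambda>k. 0)}"
  interpret ring free_alg_ring by (rule ring_ring_of_type_algebra)
  have "ideal J free_alg_ring"
  proof (rule idealI)
    show "subgroup J (add_monoid free_alg_ring)"
    proof (rule add.subgroupI)
      show "J \<noteq> {}" unfolding J_def using free_act_zero by blast
      show "\<ominus>\<^bsub>free_alg_ring\<^esub> a \<in> J" if "a \<in> J" for a
        using that by (auto simp: J_def free_act_minus)
      show "a \<oplus>\<^bsub>free_alg_ring\<^esub> b \<in> J" if "a \<in> J" "b \<in> J" for a b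
        using that by (auto simp: J_def free_act_add)
    qed simp
    fix a x assume a: "a \<in> J"
    show "x \<otimes>\<^bsub>free_alg_ring\<^esub> a \<in> J"
      using a free_act_linear(2)[of t I x 0 "\<lambda>_. 0"] by (auto simp: J_def free_act_mult)
    show "a \<otimes>\<^bsub>free_alg_ring\<^esub> x \<in> J"
      using a fin_fun_free_act by (auto simp: J_def free_act_mult)
  qed (rule ring_axioms)
  moreover have "gwa_rels t \<subseteq> J" using free_act_rels[OF assms(1)] by (auto simp: J_def)
  ultimately have "gwa_ideal t \<subseteq> J" unfolding gwa_ideal_def by (rule genideal_minimal)
  then show ?thesis using assms by (auto simp: J_def)
qed

text \<open>An element of A(t) is a coset and acts through a chosen representative;
  \<open>std_module_act\<close> derives from \<open>free_act_ideal\<close> that the choice does not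
  matter on the carrier.\<close>

definition std_module :: "complex poly \<Rightarrow> int set \<Rightarrow> (free_alg set, int \<Rightarrow> complex) module"
  where "std_module t I = \<lparr>carrier = fin_fun I, monoid.mult = undefined, one = undefined,
    ring.zero = (\<lambda>k. 0), add = (\<lambda>f g k. f k + g k),
    module.smult = (\<lambda>U. free_act t I (SOME p. gwa_class t p = U))\<rparr>"

lemma std_module_simps [simp]:
  "carrier (std_module t I) = fin_fun I" "\<zero>\<^bsub>std_module t I\<^esub> = (\<lambda>k. 0)"
  "f \<oplus>\<^bsub>std_module t I\<^esub> g = (\<lambda>k. f k + g k)"
  by (simp_all add: std_module_def)

lemma std_module_act:
  assumes "admissible t I" "f \<in> fin_fun I"
  shows "gwa_class t p \<odot>\<^bsub>std_module t I\<^esub> f = free_act t I p f"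
proof -
  define q where "q = (SOME q. gwa_class t q = gwa_class t p)"
  have "gwa_class t q = gwa_class t p" unfolding q_def by (rule someI) simp
  then have "free_act t I (q - p) f = (\<lambda>k. 0)"
    using free_act_ideal[OF assms] by (simp add: gwa_class_eq_iff)
  then show ?thesis by (simp add: std_module_def q_def[symmetric] free_act_diff fun_eq_iff)
qed

lemma std_module_gens:
  assumes "admissible t I" "f \<in> fin_fun I"
  shows "gwa_poly t r \<odot>\<^bsub>std_module t I\<^esub> f = (\<lambda>k. poly r (of_int k) * f k)"
    "gwa_Xp t \<odot>\<^bsub>std_module t I\<^esub> f = (\<lambda>k. if k \<in> I \<and> k - 1 \<in> I then f (k - 1) else 0)"
    "gwa_Xm t \<odot>\<^bsub>std_module t I\<^esub> f = (\<lambda>k. if k \<in> I \<and> k + 1 \<in> I then poly t (of_int k + 1/2) * f (k + 1) else 0)"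
  using std_module_act[OF assms]
  by (simp_all add: gwa_poly_class gwa_Xp_class gwa_Xm_class free_act_poly free_act_fgen)

lemma left_module_std_module:
  assumes "admissible t I"
  shows "left_module (gwa t) (std_module t I)"
proof (intro left_module.intro left_module_axioms.intro ring_gwa)
  show "abelian_group (std_module t I)"
  proof (rule abelian_groupI)
    show "\<exists>y\<in>carrier (std_module t I). y \<oplus>\<^bsub>std_module t I\<^esub> x = \<zero>\<^bsub>std_module t I\<^esub>"
      if "x \<in> carrier (std_module t I)" for x
      using that fin_fun_scale[of x I "\<lambda>_. -1"] by (intro bexI[of _ "\<lambda>k. - x k"]) auto
  qed (auto simp: fin_fun_add fin_fun_zero algebra_simps)
qed (auto simp: carrier_gwa std_module_act[OF assms] fin_fun_free_act fin_fun_add free_act_linear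
      free_act_add free_act_mult free_act_fconst
      simp flip: gwa_class_add gwa_class_mult gwa_class_one single_one)

text \<open>Certificates move along with X+: if q certifies the component of weight k - 1 of x, its
  shift certifies the component of weight k of the image.\<close>

lemma (in weight_mod) prj_xp:
  assumes "x \<in> carrier M"
  shows "prj k (xp x) = xp (prj (k - 1) x)"
proof (rule prj_eqI)
  obtain q where q: "poly q (of_int (k - 1)) \<noteq> 0" "pa q (x \<ominus>\<^bsub>M\<^esub> prj (k - 1) x) = \<zero>\<^bsub>M\<^esub>"
    using is_prj_prj[OF assms] unfolding is_prj_def by blast
  show "is_prj k (xp x) (xp (prj (k - 1) x))"
    unfolding is_prj_def
  proof (intro conjI exI[of _ "\<sigma>pow 1 q"])
    show "xp (prj (k - 1) x) \<in> wsp k" using wsp_xp[OF prj_wsp[OF assms], of "k - 1"] by simp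
    show "poly (\<sigma>pow 1 q) (of_int k) \<noteq> 0" using q by (simp add: \<sigma>pow_def poly_pcompose)
    have "pa (\<sigma>pow 1 q) (xp x \<ominus>\<^bsub>M\<^esub> xp (prj (k - 1) x)) = xp (pa q (x \<ominus>\<^bsub>M\<^esub> prj (k - 1) x))"
      using assms by (simp add: smult_diff[symmetric] xp_pa)
    then show "pa (\<sigma>pow 1 q) (xp x \<ominus>\<^bsub>M\<^esub> xp (prj (k - 1) x)) = \<zero>\<^bsub>M\<^esub>" using q by simp
  qed
qed (use assms in simp)

lemma (in weight_mod) prj_xm:
  assumes "x \<in> carrier M"
  shows "prj k (xm x) = xm (prj (k + 1) x)"
proof (rule prj_eqI)
  obtain q where q: "poly q (of_int (k + 1)) \<noteq> 0" "pa q (x \<ominus>\<^bsub>M\<^esub> prj (k + 1) x) = \<zero>\<^bsub>M\<^esub>"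
    using is_prj_prj[OF assms] unfolding is_prj_def by blast
  show "is_prj k (xm x) (xm (prj (k + 1) x))"
    unfolding is_prj_def
  proof (intro conjI exI[of _ "\<sigma>pow (-1) q"])
    show "xm (prj (k + 1) x) \<in> wsp k" using wsp_xm[OF prj_wsp[OF assms], of "k + 1"] by simp
    show "poly (\<sigma>pow (-1) q) (of_int k) \<noteq> 0" using q by (simp add: \<sigma>pow_def poly_pcompose add.commute)
    have "pa (\<sigma>pow (-1) q) (xm x \<ominus>\<^bsub>M\<^esub> xm (prj (k + 1) x)) = xm (pa q (x \<ominus>\<^bsub>M\<^esub> prj (k + 1) x))"
      using assms by (simp add: smult_diff[symmetric] xm_pa)
    then show "pa (\<sigma>pow (-1) q) (xm x \<ominus>\<^bsub>M\<^esub> xm (prj (k + 1) x)) = \<zero>\<^bsub>M\<^esub>" using q by simp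
  qed
qed (use assms in simp)

text \<open>The definition asks for a spanning set, while the spanning families that arise may have
  repetitions; the coefficients over each fibre of the family are added up.\<close>

lemma (in weight_mod) fin_dimI:
  assumes "\<And>k. \<exists>A (\<beta> :: 'i \<Rightarrow> 'u). finite A \<and> (\<forall>a\<in>A. \<beta> a \<in> wsp k) \<and> (\<forall>v\<in>wsp k. \<exists>h. v = lin A \<beta> h)"
  shows fin_dim
  unfolding fin_dim_def
proof
  fix k
  obtain A and \<beta> :: "'i \<Rightarrow> 'u" where A: "finite A" "\<And>a. a \<in> A \<Longrightarrow> \<beta> a \<in> wsp k"
    "\<And>v. v \<in> wsp k \<Longrightarrow> \<exists>h. v = lin A \<beta> h" using assms[of k] by blast
  note Ac = wsp_carrier[OF A(2)]
  have *: "\<exists>c. lin A \<beta> h = lin (\<beta> ` A) (\<lambda>b. b) c" for h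
  proof -
    have "lin A \<beta> h = lin A (\<lambda>a. lin (\<beta> ` A) (\<lambda>b. b) (\<lambda>i. if i = \<beta> a then 1 else 0)) h"
    proof (rule lin_cong)
      fix a assume a: "a \<in> A"
      have "lin (\<beta> ` A) (\<lambda>b. b) (\<lambda>i. if i = \<beta> a then 1 else 0) = sc 1 (\<beta> a)"
        by (rule lin_delta) (use A Ac a in auto)
      then show "\<beta> a = lin (\<beta> ` A) (\<lambda>b. b) (\<lambda>i. if i = \<beta> a then 1 else 0)" using Ac a by simp
    qed (use Ac in auto)
    also have "\<dots> = lin (\<beta> ` A) (\<lambda>b. b) (\<lambda>b. \<Sum>a\<in>A. h a * (if b = \<beta> a then 1 else 0))"
      by (rule lin_lin) (use A Ac in auto)
    finally show ?thesis by blast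
  qed
  show "\<exists>B. finite B \<and> B \<subseteq> wsp k \<and> (\<forall>v\<in>wsp k. \<exists>c. v = (\<Oplus>\<^bsub>M\<^esub>b\<in>B. sc (c b) b))"
  proof (intro exI[of _ "\<beta> ` A"] conjI ballI)
    fix v assume "v \<in> wsp k"
    then obtain h where "v = lin A \<beta> h" using A(3) by blast
    then obtain c where "v = lin (\<beta> ` A) (\<lambda>b. b) c" using *[of h] by auto
    then show "\<exists>c. v = (\<Oplus>\<^bsub>M\<^esub>b\<in>\<beta> ` A. sc (c b) b)" unfolding lin_def by blast
  qed (use A in auto)
qed

text \<open>Components and spanning families of the image are the images of those of M. Both copies
  and quotients enter the category through this lemma.\<close>

lemma findim_image:
  fixes M :: "'u gwa_module"
  assumes "findim_mod t M" "left_module (gwa t) Q" "h \<in> module_hom (gwa t) M Q"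
    "h ` carrier M = carrier Q"
  shows "findim_mod t Q"
proof -
  interpret M: findim_mod t M by fact
  interpret Q: gwa_module t Q using assms(2) by (simp add: gwa_module_def)
  note h = module_homD[OF assms(3)]
  note z = module_hom_zero_minus[OF M.M.abelian_group_axioms Q.M.abelian_group_axioms assms(3)]
  note hw = hom_wsp[OF M.gwa_module_axioms Q.gwa_module_axioms assms(3)]
  interpret Q: weight_mod t Q
  proof
    fix x assume "x \<in> carrier Q"
    then obtain y where y: "y \<in> carrier M" "x = h y" using assms(4) by blast
    have "x = h (\<Oplus>\<^bsub>M\<^esub>k\<in>M.wt_supp y. M.prj k y)"
      using M.prj_sum_superset[OF y(1)] y(2) by simp
    also have "\<dots> = (\<Oplus>\<^bsub>Q\<^esub>k\<in>M.wt_supp y. h (M.prj k y))"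
      using M.prj_sum_superset(1)[OF y(1)] y(1) by (intro z(4)) auto
    finally show "\<exists>K f. finite K \<and> (\<forall>k\<in>K. f k \<in> Q.wsp k) \<and> x = (\<Oplus>\<^bsub>Q\<^esub>k\<in>K. f k)"
      using M.prj_sum_superset(1)[OF y(1)] hw[OF M.prj_wsp[OF y(1)]]
      by (intro exI[of _ "M.wt_supp y"] exI[of _ "\<lambda>k. h (M.prj k y)"]) simp
  qed
  have "Q.fin_dim"
  proof (rule Q.fin_dimI)
    fix k
    obtain B where B: "M.basis k B (\<lambda>b. b)" using M.ex_basis by blast
    note b = M.basisD[OF B]
    have "\<exists>c. v = Q.lin B h c" if v: "v \<in> Q.wsp k" for v
    proof -
      have "v \<in> h ` carrier M" using Q.wsp_carrier[OF v] assms(4) by simp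
      then obtain y where y: "y \<in> carrier M" "v = h y" by blast
      have "v = h (M.prj k y)"
        using hom_prj[OF M.weight_mod_axioms Q.weight_mod_axioms assms(3) y(1)] Q.prj_self[OF v] y(2) by simp
      moreover obtain c where "M.prj k y = M.lin B (\<lambda>b. b) c" using b(4)[OF M.prj_wsp[OF y(1)]] by blast
      moreover have "h (M.lin B (\<lambda>b. b) c) = Q.lin B h c"
        using M.lin_map[OF b(1) Q.gwa_module_axioms, of "\<lambda>b. b" h c] b(3) h z(1) by (simp add: comp_def)
      ultimately show ?thesis by auto
    qed
    then show "\<exists>(A :: 'u set) \<beta>. finite A \<and> (\<forall>a\<in>A. \<beta> a \<in> Q.wsp k) \<and> (\<forall>v\<in>Q.wsp k. \<exists>c. v = Q.lin A \<beta> c)"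
      using b(1) hw[OF b(2)] by (intro exI[of _ B] exI[of _ h]) simp
  qed
  then show ?thesis by unfold_locales
qed

lemma basis_iso:
  assumes "weight_mod t M" "weight_mod t Q" "h \<in> module_hom (gwa t) M Q"
    "bij_betw h (carrier M) (carrier Q)" "gwa_module.basis t M k A \<beta>"
  shows "gwa_module.basis t Q k A (h \<circ> \<beta>)"
proof -
  interpret M: weight_mod t M by fact
  interpret Q: weight_mod t Q by fact
  note h = module_homD[OF assms(3)]
  note z = module_hom_zero_minus[OF M.M.abelian_group_axioms Q.M.abelian_group_axioms assms(3)]
  note hw = hom_wsp[OF M.gwa_module_axioms Q.gwa_module_axioms assms(3)]
  note b = M.basisD[OF assms(5)]
  have inj: "inj_on h (carrier M)" and surj: "h ` carrier M = carrier Q"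
    using assms(4) by (auto simp: bij_betw_def)
  have hl: "h (M.lin A \<beta> c) = Q.lin A (h \<circ> \<beta>) c" for c
    using M.lin_map[where F = h and A = A and \<beta> = \<beta> and N = Q and t' = t and h = c] b h z(1) Q.gwa_module_axioms by simp
  show ?thesis
    unfolding Q.basis_def
  proof (intro conjI ballI allI impI)
    show "(h \<circ> \<beta>) a \<in> Q.wsp k" if "a \<in> A" for a using hw b(2)[OF that] by simp
    show "\<exists>c. v = Q.lin A (h \<circ> \<beta>) c" if v: "v \<in> Q.wsp k" for v
    proof -
      have "v \<in> h ` carrier M" using Q.wsp_carrier[OF v] surj by simp
      then obtain y where y: "y \<in> carrier M" "v = h y" by blast
      have "v = h (M.prj k y)"
        using hom_prj[OF M.weight_mod_axioms Q.weight_mod_axioms assms(3) y(1)] Q.prj_self[OF v] y(2) by simp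
      moreover obtain c where "M.prj k y = M.lin A \<beta> c" using b(4)[OF M.prj_wsp[OF y(1)]] by blast
      ultimately show ?thesis using hl by auto
    qed
    fix c a assume 0: "Q.lin A (h \<circ> \<beta>) c = \<zero>\<^bsub>Q\<^esub>" and a: "a \<in> A"
    have "h (M.lin A \<beta> c) = h \<zero>\<^bsub>M\<^esub>" using 0 hl z(1) by simp
    then have "M.lin A \<beta> c = \<zero>\<^bsub>M\<^esub>" using inj b(3) by (auto dest: inj_onD)
    then show "c a = 0" using b(5) a by blast
  qed (rule b)
qed

lemma dimw_iso:
  assumes "findim_mod t M" "findim_mod t Q" "h \<in> module_hom (gwa t) M Q"
    "bij_betw h (carrier M) (carrier Q)"
  shows "gwa_module.dimw t Q k = gwa_module.dimw t M k"
proof -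
  interpret M: findim_mod t M by fact
  interpret Q: findim_mod t Q by fact
  obtain B where B: "M.basis k B (\<lambda>b. b)" using M.ex_basis by blast
  show ?thesis
    using M.dimw_basis[OF B] Q.dimw_basis[OF basis_iso[OF M.weight_mod_axioms Q.weight_mod_axioms assms(3,4) B]]
    by simp
qed

section \<open>Weight spaces of the standard modules\<close>

definition unit_fun :: "int \<Rightarrow> int \<Rightarrow> complex"
  where "unit_fun k = (\<lambda>l. if l = k then 1 else 0)"

lemma unit_fun_fin_fun: "k \<in> I \<Longrightarrow> (\<lambda>l. c * unit_fun k l) \<in> fin_fun I"
  by (auto simp: fin_fun_def unit_fun_def intro: finite_subset[of _ "{k}"])

lemma fin_fun_induct [consumes 1, case_names zero add]:
  assumes "f \<in> fin_fun I"
    and zero: "P (\<lambda>k. 0)"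
    and add: "\<And>c k g. k \<in> I \<Longrightarrow> g \<in> fin_fun I \<Longrightarrow> P g \<Longrightarrow> P (\<lambda>l. c * unit_fun k l + g l)"
  shows "P f"
proof -
  have "\<forall>f\<in>fin_fun I. {k. f k \<noteq> 0} \<subseteq> S \<longrightarrow> P f" if "finite S" for S
    using that
  proof (induction S rule: finite_induct)
    case empty
    then show ?case using zero by (auto simp: fun_eq_iff)
  next
    case (insert a S)
    show ?case
    proof (intro ballI impI)
      fix f assume f: "f \<in> fin_fun I" "{k. f k \<noteq> 0} \<subseteq> insert a S"
      define g where "g = f(a := 0)"
      have g: "g \<in> fin_fun I" "{k. g k \<noteq> 0} \<subseteq> S"
        using f by (auto simp: g_def fin_fun_def intro: finite_subset[of _ "{k. f k \<noteq> 0}"])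
      then have Pg: "P g" using insert by blast
      show "P f"
      proof (cases "a \<in> I")
        case True
        have "f = (\<lambda>l. f a * unit_fun a l + g l)" by (auto simp: g_def unit_fun_def)
        then show ?thesis using add[OF True g(1) Pg, of "f a"] by simp
      next
        case False
        then have "g = f" using f(1) by (auto simp: g_def fin_fun_def)
        then show ?thesis using Pg by simp
      qed
    qed
  qed
  then show ?thesis using assms(1) by (auto simp: fin_fun_def)
qed

lemma gwa_module_std_module: "admissible t I \<Longrightarrow> gwa_module t (std_module t I)"
  by (simp add: gwa_module_def left_module_std_module)

lemma wsp_std_module:
  assumes "admissible t I"
  shows "gwa_module.wsp t (std_module t I) k = {f \<in> fin_fun I. \<forall>l. l \<noteq> k \<longrightarrow> f l = 0}"
  unfolding gwa_module.wsp_def[OF gwa_module_std_module[OF assms]]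
  by (auto simp: std_module_gens[OF assms] fun_eq_iff)

lemma weight_mod_std_module:
  assumes "admissible t I"
  shows "weight_mod t (std_module t I)"
proof -
  interpret gwa_module t "std_module t I" by (rule gwa_module_std_module[OF assms])
  show ?thesis
  proof
    fix f assume f: "f \<in> carrier (std_module t I)"
    define g where "g k = (\<lambda>l. f k * unit_fun k l)" for k
    have g: "g k \<in> wsp k" for k
    proof (cases "k \<in> I")
      case True
      then show ?thesis using unit_fun_fin_fun by (auto simp: wsp_std_module[OF assms] g_def unit_fun_def)
    next
      case False
      then have "g k = (\<lambda>l. 0)" using f by (auto simp: g_def fin_fun_def)
      then show ?thesis using wsp_zero by simp
    qed
    have "(\<Oplus>\<^bsub>std_module t I\<^esub>k\<in>K. g k) = (\<lambda>l. if l \<in> K then f l else 0)" if "finite K" for K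
      using that
    proof (induction K rule: finite_induct)
      case (insert k K)
      have "g \<in> K \<rightarrow> carrier (std_module t I)" "g k \<in> carrier (std_module t I)" using g wsp_carrier by auto
      then have "(\<Oplus>\<^bsub>std_module t I\<^esub>k\<in>insert k K. g k) = (\<lambda>l. g k l + (\<Oplus>\<^bsub>std_module t I\<^esub>k\<in>K. g k) l)"
        using insert by simp
      then show ?case unfolding insert.IH using insert(2) by (auto simp: g_def unit_fun_def fun_eq_iff)
    qed simp
    moreover have "f = (\<lambda>l. if l \<in> {k. f k \<noteq> 0} then f l else 0)" by auto
    moreover have "finite {k. f k \<noteq> 0}" using f by (simp add: fin_fun_def)
    ultimately show "\<exists>K g. finite K \<and> (\<forall>k\<in>K. g k \<in> wsp k) \<and> f = (\<Oplus>\<^bsub>std_module t I\<^esub>k\<in>K. g k)"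
      using g by (intro exI[of _ "{k. f k \<noteq> 0}"] exI[of _ g]) simp
  qed
qed

text \<open>The index set has one element or none according as k lies in I, so both cases are
  covered at once.\<close>

lemma basis_std_module:
  assumes "admissible t I"
  shows "gwa_module.basis t (std_module t I) k (I \<inter> {k}) unit_fun"
proof -
  interpret gwa_module t "std_module t I" by (rule gwa_module_std_module[OF assms])
  have u: "unit_fun k \<in> wsp k" "unit_fun k \<in> fin_fun I" if "k \<in> I"
    using unit_fun_fin_fun[OF that, of 1] by (auto simp: wsp_std_module[OF assms] unit_fun_def)
  have l: "lin (I \<inter> {k}) unit_fun h = (\<lambda>l. if k \<in> I then h k * unit_fun k l else 0)" for h
  proof (cases "k \<in> I")
    case True
    then have "lin (I \<inter> {k}) unit_fun h = lin (insert k {}) unit_fun h" by (simp add: insert_absorb)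
    also have "\<dots> = (\<lambda>l. h k * unit_fun k l)"
      by (subst lin_insert) (use u True in \<open>auto simp: std_module_gens[OF assms]\<close>)
    finally show ?thesis using True by simp
  qed simp
  show ?thesis
    unfolding basis_def
  proof (intro conjI ballI allI impI)
    show "\<exists>h. v = lin (I \<inter> {k}) unit_fun h" if "v \<in> wsp k" for v
      using that by (intro exI[of _ "\<lambda>_. v k"])
        (auto simp: l wsp_std_module[OF assms] unit_fun_def fin_fun_def fun_eq_iff)
    show "h a = 0" if "lin (I \<inter> {k}) unit_fun h = \<zero>\<^bsub>std_module t I\<^esub>" "a \<in> I \<inter> {k}" for h a
      using that by (auto simp: l unit_fun_def fun_eq_iff split: if_splits)
  qed (use u in auto)
qed

lemma findim_std_module:
  assumes "admissible t I"
  shows "findim_mod t (std_module t I)"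
proof -
  interpret weight_mod t "std_module t I" by (rule weight_mod_std_module[OF assms])
  have fin_dim
  proof (rule fin_dimI)
    fix k
    have "basis k (I \<inter> {k}) unit_fun" by (rule basis_std_module[OF assms])
    then show "\<exists>(A :: int set) \<beta>. finite A \<and> (\<forall>a\<in>A. \<beta> a \<in> wsp k) \<and> (\<forall>v\<in>wsp k. \<exists>h. v = lin A \<beta> h)"
      unfolding basis_def by (elim conjE, intro exI[of _ "I \<inter> {k}"] exI[of _ unit_fun] conjI) assumption
  qed
  then show ?thesis by unfold_locales
qed

lemma dimw_std_module:
  assumes "admissible t I"
  shows "gwa_module.dimw t (std_module t I) k = (if k \<in> I then 1 else 0)"
proof -
  interpret findim_mod t "std_module t I" by (rule findim_std_module[OF assms])
  show ?thesis using dimw_basis[OF basis_std_module[OF assms]] by simp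
qed

text \<open>The Grothendieck group is formed from modules inside \<open>'u\<close>, so the standard
  modules enter it through an injection j into that type.\<close>

definition std_copy :: "((int \<Rightarrow> complex) \<Rightarrow> 'u) \<Rightarrow> complex poly \<Rightarrow> int set \<Rightarrow> 'u gwa_module"
  where "std_copy j t I = transport j (std_module t I)"

lemma std_copy_iso:
  assumes "admissible t I" "inj j"
  shows "left_module (gwa t) (std_copy j t I)" "j \<in> module_hom (gwa t) (std_module t I) (std_copy j t I)"
    "bij_betw j (fin_fun I) (carrier (std_copy j t I))"
  using transport[OF left_module_std_module[OF assms(1)], of j] assms(2)
  by (auto simp: std_copy_def inj_on_subset)

lemma findim_std_copy:
  assumes "admissible t I" "inj j"
  shows "findim_mod t (std_copy j t I)"
  using findim_image[OF findim_std_module[OF assms(1)] std_copy_iso(1,2)[OF assms]]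
    std_copy_iso(3)[OF assms] by (simp add: bij_betw_def)

lemma dimw_std_copy:
  assumes "admissible t I" "inj j"
  shows "gwa_module.dimw t (std_copy j t I) k = (if k \<in> I then 1 else 0)"
  using dimw_iso[OF findim_std_module[OF assms(1)] findim_std_copy[OF assms] std_copy_iso(2)[OF assms]]
    std_copy_iso(3)[OF assms] dimw_std_module[OF assms(1)] by simp

section \<open>Inverses, images and quotients\<close>

lemma module_hom_inv:
  assumes "left_module R M" "h \<in> module_hom R M N" "bij_betw h (carrier M) (carrier N)"
  shows "inv_into (carrier M) h \<in> module_hom R N M"
proof -
  interpret M: left_module R M by fact
  note h = module_homD[OF assms(2)]
  define g where "g = inv_into (carrier M) h"
  have hg: "h (g y) = y" "g y \<in> carrier M" if "y \<in> carrier N" for y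
    using that assms(3) unfolding g_def bij_betw_def by (auto simp: f_inv_into_f inv_into_into)
  have gh: "g (h x) = x" if "x \<in> carrier M" for x
    using that assms(3) unfolding g_def bij_betw_def by simp
  have "g (x \<oplus>\<^bsub>N\<^esub> y) = g x \<oplus>\<^bsub>M\<^esub> g y" if "x \<in> carrier N" "y \<in> carrier N" for x y
    using gh[of "g x \<oplus>\<^bsub>M\<^esub> g y"] hg that h by simp
  moreover have "g (a \<odot>\<^bsub>N\<^esub> x) = a \<odot>\<^bsub>M\<^esub> g x" if "x \<in> carrier N" "a \<in> carrier R" for a x
    using gh[of "a \<odot>\<^bsub>M\<^esub> g x"] hg that h M.smult_closed by simp
  ultimately show ?thesis using hg unfolding module_hom_def g_def[symmetric] by auto
qed

lemma module_hom_comp: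
  "f \<in> module_hom R L M \<Longrightarrow> g \<in> module_hom R M N \<Longrightarrow> g \<circ> f \<in> module_hom R L N"
  unfolding module_hom_def by (auto simp: Pi_def)

lemma hom_image_submodule:
  assumes "left_module R L" "left_module R M" "f \<in> module_hom R L M"
  shows "submodule (f ` carrier L) R M"
proof -
  interpret L: left_module R L by fact
  interpret M: left_module R M by fact
  note f = module_homD[OF assms(3)]
  note z = module_hom_zero_minus[OF L.M.abelian_group_axioms M.M.abelian_group_axioms assms(3)]
  show ?thesis
  proof (intro submodule.intro submodule_axioms.intro M.M.add.subgroupI)
    show "f ` carrier L \<subseteq> carrier M" using f by blast
    show "f ` carrier L \<noteq> {}" using L.M.zero_closed by blast
    show "\<ominus>\<^bsub>M\<^esub> a \<in> f ` carrier L" if a: "a \<in> f ` carrier L" for a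
    proof -
      obtain x where "x \<in> carrier L" "a = f x" using a by blast
      then have "\<ominus>\<^bsub>M\<^esub> a = f (\<ominus>\<^bsub>L\<^esub> x)" "\<ominus>\<^bsub>L\<^esub> x \<in> carrier L" using z(2) by auto
      then show ?thesis by blast
    qed
    show "a \<oplus>\<^bsub>M\<^esub> b \<in> f ` carrier L" if ab: "a \<in> f ` carrier L" "b \<in> f ` carrier L" for a b
    proof -
      obtain x y where "x \<in> carrier L" "y \<in> carrier L" "a = f x" "b = f y" using ab by blast
      then have "a \<oplus>\<^bsub>M\<^esub> b = f (x \<oplus>\<^bsub>L\<^esub> y)" "x \<oplus>\<^bsub>L\<^esub> y \<in> carrier L" using f by auto
      then show ?thesis by blast
    qed
    show "a \<odot>\<^bsub>M\<^esub> x \<in> f ` carrier L" if ax: "a \<in> carrier R" "x \<in> f ` carrier L" for a x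
    proof -
      obtain y where "y \<in> carrier L" "x = f y" using ax by blast
      then have "a \<odot>\<^bsub>M\<^esub> x = f (a \<odot>\<^bsub>L\<^esub> y)" "a \<odot>\<^bsub>L\<^esub> y \<in> carrier L" using f ax L.smult_closed by auto
      then show ?thesis by blast
    qed
  qed
qed

text \<open>The quotient has to live on \<open>'u\<close> again, whereas cosets are sets of elements
  of \<open>'u\<close>. So a representative is chosen in each coset, and the result of every
  operation is replaced by its representative.\<close>

lemma quotient_exists:
  fixes M :: "'u gwa_module"
  assumes M: "findim_mod t M" and L: "left_module (gwa t) L"
    and f: "f \<in> module_hom (gwa t) L M" "inj_on f (carrier L)"
  shows "\<exists>Q :: 'u gwa_module. findim_mod t Q \<and> short_exact (gwa t) L M Q"
proof -
  interpret M: findim_mod t M by fact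
  define N where "N = f ` carrier L"
  interpret N: submodule N "gwa t" M
    unfolding N_def by (rule hom_image_submodule[OF L M.left_module_axioms f(1)])
  have NM: "x \<in> carrier M" if "x \<in> N" for x using that N.subset by auto
  have N0: "\<zero>\<^bsub>M\<^esub> \<in> N" using N.one_closed by simp
  have Nadd: "x \<oplus>\<^bsub>M\<^esub> y \<in> N" if "x \<in> N" "y \<in> N" for x y using N.m_closed that by simp
  have Nneg: "\<ominus>\<^bsub>M\<^esub> x \<in> N" if "x \<in> N" for x using N.m_inv_closed[OF that] by (simp add: a_inv_def)
  define rep where "rep x = (SOME y. y \<in> carrier M \<and> y \<ominus>\<^bsub>M\<^esub> x \<in> N)" for x
  have rep: "rep x \<in> carrier M" "rep x \<ominus>\<^bsub>M\<^esub> x \<in> N" if x: "x \<in> carrier M" for x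
  proof -
    have "x \<in> carrier M \<and> x \<ominus>\<^bsub>M\<^esub> x \<in> N" using x N0 M.diff_eq_zero[of x x] by simp
    then have "rep x \<in> carrier M \<and> rep x \<ominus>\<^bsub>M\<^esub> x \<in> N" unfolding rep_def by (rule someI)
    then show "rep x \<in> carrier M" "rep x \<ominus>\<^bsub>M\<^esub> x \<in> N" by auto
  qed
  have tr: "x \<ominus>\<^bsub>M\<^esub> z = (x \<ominus>\<^bsub>M\<^esub> y) \<oplus>\<^bsub>M\<^esub> (y \<ominus>\<^bsub>M\<^esub> z)"
    if "x \<in> carrier M" "y \<in> carrier M" "z \<in> carrier M" for x y z
    using that by (simp add: a_minus_def M.M.a_assoc) (simp add: M.M.a_assoc[symmetric] M.M.l_neg)
  have sy: "x \<ominus>\<^bsub>M\<^esub> y = \<ominus>\<^bsub>M\<^esub> (y \<ominus>\<^bsub>M\<^esub> x)" if "x \<in> carrier M" "y \<in> carrier M" for x y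
    using that by (simp add: a_minus_def M.M.minus_add M.M.a_comm)
  \<comment> \<open>Congruent vectors define the same predicate, so the choice operator returns the
    same value for both, which gives equality and not merely congruence.\<close>
  have rep_eq: "rep x = rep y" if "x \<in> carrier M" "y \<in> carrier M" "x \<ominus>\<^bsub>M\<^esub> y \<in> N" for x y
  proof -
    have yx: "y \<ominus>\<^bsub>M\<^esub> x \<in> N" using sy[of y x] that Nneg by simp
    have "z \<ominus>\<^bsub>M\<^esub> x \<in> N \<longleftrightarrow> z \<ominus>\<^bsub>M\<^esub> y \<in> N" if z: "z \<in> carrier M" for z
      using tr[OF z, of y x] tr[OF z, of x y] Nadd that yx \<open>x \<in> carrier M\<close> \<open>y \<in> carrier M\<close>
        \<open>x \<ominus>\<^bsub>M\<^esub> y \<in> N\<close> by (metis (no_types, lifting))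
    then have "(\<lambda>z. z \<in> carrier M \<and> z \<ominus>\<^bsub>M\<^esub> x \<in> N) = (\<lambda>z. z \<in> carrier M \<and> z \<ominus>\<^bsub>M\<^esub> y \<in> N)" by auto
    then show ?thesis unfolding rep_def by simp
  qed
  have rep_eq': "x \<ominus>\<^bsub>M\<^esub> y \<in> N" if "x \<in> carrier M" "y \<in> carrier M" "rep x = rep y" for x y
  proof -
    have "x \<ominus>\<^bsub>M\<^esub> rep x \<in> N" using sy[of x "rep x"] rep[OF that(1)] that(1) Nneg by simp
    then show ?thesis using tr[of x "rep x" y] rep that Nadd by simp
  qed
  have rr: "rep (rep x) = rep x" if "x \<in> carrier M" for x
    using rep_eq[of "rep x" x] rep[OF that] that by simp
  define Q :: "'u gwa_module" where "Q = \<lparr>carrier = rep ` carrier M, monoid.mult = undefined,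
    one = undefined, ring.zero = rep \<zero>\<^bsub>M\<^esub>, add = (\<lambda>x y. rep (x \<oplus>\<^bsub>M\<^esub> y)),
    module.smult = (\<lambda>a x. rep (a \<odot>\<^bsub>M\<^esub> x))\<rparr>"
  have Qs: "carrier Q = rep ` carrier M" "\<zero>\<^bsub>Q\<^esub> = rep \<zero>\<^bsub>M\<^esub>" "x \<oplus>\<^bsub>Q\<^esub> y = rep (x \<oplus>\<^bsub>M\<^esub> y)"
    "a \<odot>\<^bsub>Q\<^esub> x = rep (a \<odot>\<^bsub>M\<^esub> x)" for x y a
    by (simp_all add: Q_def)
  have radd: "rep (x \<oplus>\<^bsub>M\<^esub> y) = rep x \<oplus>\<^bsub>Q\<^esub> rep y" if "x \<in> carrier M" "y \<in> carrier M" for x y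
  proof -
    have "(rep x \<oplus>\<^bsub>M\<^esub> rep y) \<ominus>\<^bsub>M\<^esub> (x \<oplus>\<^bsub>M\<^esub> y) = (rep x \<ominus>\<^bsub>M\<^esub> x) \<oplus>\<^bsub>M\<^esub> (rep y \<ominus>\<^bsub>M\<^esub> y)"
      using that rep by (simp add: a_minus_def M.M.minus_add M.M.a_ac)
    then have "(rep x \<oplus>\<^bsub>M\<^esub> rep y) \<ominus>\<^bsub>M\<^esub> (x \<oplus>\<^bsub>M\<^esub> y) \<in> N" using that rep Nadd by simp
    then show ?thesis unfolding Qs using that rep by (intro rep_eq[symmetric]) auto
  qed
  have rsm: "rep (a \<odot>\<^bsub>M\<^esub> x) = a \<odot>\<^bsub>Q\<^esub> rep x" if "a \<in> carrier (gwa t)" "x \<in> carrier M" for a x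
  proof -
    have "a \<odot>\<^bsub>M\<^esub> rep x \<ominus>\<^bsub>M\<^esub> a \<odot>\<^bsub>M\<^esub> x \<in> N"
      using that rep N.smult_closed[of a "rep x \<ominus>\<^bsub>M\<^esub> x"] by (simp add: M.smult_diff)
    then show ?thesis unfolding Qs using that rep by (intro rep_eq[symmetric]) auto
  qed
  have lm: "left_module (gwa t) Q" and hom: "rep \<in> module_hom (gwa t) M Q"
    by (rule left_module_image[OF M.left_module_axioms, of rep Q]; use radd rsm Qs in simp)+
  have "findim_mod t Q" by (rule findim_image[OF M lm hom]) (simp add: Qs)
  moreover have "short_exact (gwa t) L M Q"
    unfolding short_exact_def
  proof (intro bexI[OF _ f(1)] bexI[OF _ hom] conjI f(2))
    show "rep ` carrier M = carrier Q" by (simp add: Qs)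
    have "x \<in> N \<longleftrightarrow> x \<in> carrier M \<and> rep x = rep \<zero>\<^bsub>M\<^esub>" for x
      using rep_eq[of x "\<zero>\<^bsub>M\<^esub>"] rep_eq'[of x "\<zero>\<^bsub>M\<^esub>"] NM[of x] by (auto simp: a_minus_def)
    then show "f ` carrier L = {x \<in> carrier M. rep x = \<zero>\<^bsub>Q\<^esub>}" unfolding Qs N_def[symmetric] by auto
  qed
  ultimately show ?thesis by blast
qed

section \<open>Cells\<close>

lemma half_valE: obtains k :: int where "half_val s = of_int k + 1/2"
  using half_val[of s] by auto

lemma Omega_nonzero: "t \<in> \<Omega>_half \<Longrightarrow> t \<noteq> 0"
  by (auto simp: \<Omega>_half_def)

lemma Omega_root: "t \<in> \<Omega>_half \<Longrightarrow> poly t a = 0 \<Longrightarrow> \<exists>k::int. a = of_int k + 1/2"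
proof -
  assume "t \<in> \<Omega>_half" "poly t a = 0"
  then obtain s where s: "a = complex_of_real (half_val s)" by (auto simp: \<Omega>_half_def)
  obtain k :: int where "half_val s = of_int k + 1/2" by (rule half_valE)
  then show ?thesis using s by (intro exI[of _ k]) simp
qed

text \<open>The level sets are the maximal intervals of integers not separated by a root of \<^term>\<open>t\<close>.\<close>

definition cidx :: "complex poly \<Rightarrow> int \<Rightarrow> nat"
  where "cidx t k = card {a. poly t a = 0 \<and> Re a < of_int k}"

definition cell :: "complex poly \<Rightarrow> nat \<Rightarrow> int set"
  where "cell t i = {k. cidx t k = i}"

context
  fixes t :: "complex poly"
  assumes t: "t \<in> \<Omega>_half"
begin

lemma finite_roots: "finite {a. poly t a = 0 \<and> P a}"
  by (rule finite_subset[OF _ poly_roots_finite[OF Omega_nonzero[OF t]]]) auto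

text \<open>The roots are half-integers, so k + 1/2 is the only possible one between k and k + 1. It
  counts once, whatever its multiplicity.\<close>

lemma cidx_step: "cidx t (k + 1) = cidx t k + (if poly t (of_int k + 1/2) = 0 then 1 else 0)"
proof -
  have e: "{a. poly t a = 0 \<and> Re a < of_int (k + 1)} = {a. poly t a = 0 \<and> Re a < of_int k} \<union>
     (if poly t (of_int k + 1/2) = 0 then {of_int k + 1/2} else {})" (is "?A = ?B \<union> ?C")
  proof (intro equalityI subsetI)
    fix a assume a: "a \<in> ?A"
    show "a \<in> ?B \<union> ?C"
    proof (cases "Re a < of_int k")
      case False
      obtain l :: int where l: "a = of_int l + 1/2" using Omega_root[OF t] a by blast
      then have "real_of_int l + 1/2 < of_int k + 1" "real_of_int k \<le> of_int l + 1/2" using a False by auto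
      then have "l = k" by linarith
      then show ?thesis using l a by auto
    qed (use a in auto)
  qed (auto split: if_splits)
  have "?B \<inter> ?C = {}" by auto
  then show ?thesis
    unfolding cidx_def e by (subst card_Un_disjoint) (use finite_roots in \<open>auto split: if_splits\<close>)
qed

lemma cidx_mono: "k \<le> l \<Longrightarrow> cidx t k \<le> cidx t l"
  unfolding cidx_def by (rule card_mono) (use finite_roots in auto)

lemma finite_range_cidx: "finite (range (cidx t))"
proof -
  have "cidx t k \<le> card {a. poly t a = 0}" for k
    unfolding cidx_def by (rule card_mono) (use finite_roots[of "\<lambda>_. True"] in auto)
  then have "range (cidx t) \<subseteq> {..card {a. poly t a = 0}}" by auto
  then show ?thesis using finite_subset by blast
qed

lemma admissible_cell: "admissible t (cell t i)"
  unfolding admissible_def cell_def using cidx_step by auto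

lemma cell_nonzero: "k \<in> cell t i \<Longrightarrow> k + 1 \<in> cell t i \<Longrightarrow> poly t (of_int k + 1/2) \<noteq> 0"
  using cidx_step[of k] by (auto simp: cell_def split: if_splits)

lemma cell_convex: "k \<in> cell t i \<Longrightarrow> m \<in> cell t i \<Longrightarrow> k \<le> l \<Longrightarrow> l \<le> m \<Longrightarrow> l \<in> cell t i"
  using cidx_mono[of k l] cidx_mono[of l m] by (auto simp: cell_def)

end

section \<open>Cell modules inside a given module\<close>

context findim_mod
begin

text \<open>The prospective images of the unit functions on I. Extension by zero outside I lets
  formulas range over all integers.\<close>

definition family :: "int set \<Rightarrow> (int \<Rightarrow> 'u) \<Rightarrow> bool"
  where "family I w \<longleftrightarrow> (\<forall>k. w k \<in> wsp k) \<and> (\<forall>k\<in>I. w k \<noteq> \<zero>\<^bsub>M\<^esub>) \<and> (\<forall>k. k \<notin> I \<longrightarrow> w k = \<zero>\<^bsub>M\<^esub>) \<and>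
    (\<forall>k\<in>I. k + 1 \<in> I \<longrightarrow> xp (w k) = w (k + 1))"

text \<open>The unit function at k goes to \<open>w k\<close>. Along I the action of X- is dictated
  by X- X+, and at the ends of I, where the standard module has its arrows cut, R and L supply the
  matching zeros. All identities are compared weight by weight.\<close>

lemma embed_std_module:
  assumes adm: "admissible t I" and w: "family I w"
    and R: "\<And>k. k \<in> I \<Longrightarrow> k + 1 \<notin> I \<Longrightarrow> xp (w k) = \<zero>\<^bsub>M\<^esub>"
    and L: "\<And>k. k \<in> I \<Longrightarrow> k - 1 \<notin> I \<Longrightarrow> xm (w k) = \<zero>\<^bsub>M\<^esub>"
  obtains f where "f \<in> module_hom (gwa t) (std_module t I) M" "inj_on f (fin_fun I)"
    "\<And>h k. h \<in> fin_fun I \<Longrightarrow> prj k (f h) = sc (h k) (w k)"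
proof -
  have ww: "w k \<in> wsp k" and wnz: "k \<in> I \<Longrightarrow> w k \<noteq> \<zero>\<^bsub>M\<^esub>" and wz: "k \<notin> I \<Longrightarrow> w k = \<zero>\<^bsub>M\<^esub>"
    and wx: "k \<in> I \<Longrightarrow> k + 1 \<in> I \<Longrightarrow> xp (w k) = w (k + 1)" for k
    using w by (auto simp: family_def)
  note wc = wsp_carrier[OF ww]
  define f where "f h = lin {k. h k \<noteq> 0} w h" for h
  have fc: "f h \<in> carrier M" for h unfolding f_def using wc by simp
  have fp: "prj k (f h) = sc (h k) (w k)" if "h \<in> fin_fun I" for h k
  proof -
    have "prj k (\<Oplus>\<^bsub>M\<^esub>l\<in>{k. h k \<noteq> 0}. sc (h l) (w l)) = (if k \<in> {k. h k \<noteq> 0} then sc (h k) (w k) else \<zero>\<^bsub>M\<^esub>)"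
      by (rule prj_weight_sum) (use that ww wsp_sc in \<open>auto simp: fin_fun_def\<close>)
    then show ?thesis using wc by (simp add: f_def lin_def)
  qed
  have s: "sc (if b then c else 0) (w k) = (if b then sc c (w k) else \<zero>\<^bsub>M\<^esub>)" for b c k using wc by simp
  have "f \<in> module_hom (gwa t) (std_module t I) M"
  proof (rule gwa_module_homI[OF gwa_module_std_module[OF adm] gwa_module_axioms])
    fix x y assume "x \<in> carrier (std_module t I)" "y \<in> carrier (std_module t I)"
    then have x: "x \<in> fin_fun I" and y: "y \<in> fin_fun I" by auto
    show "f (x \<oplus>\<^bsub>std_module t I\<^esub> y) = f x \<oplus>\<^bsub>M\<^esub> f y"
    proof (rule prj_ext)
      fix k
      show "prj k (f (x \<oplus>\<^bsub>std_module t I\<^esub> y)) = prj k (f x \<oplus>\<^bsub>M\<^esub> f y)"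
        using fin_fun_add[OF x y] x y wc fc by (simp add: fp prj_add sc_add)
    qed (use fc in auto)
  next
    fix r x assume "x \<in> carrier (std_module t I)"
    then have x: "x \<in> fin_fun I" by simp
    show "f (gwa_poly t r \<odot>\<^bsub>std_module t I\<^esub> x) = pa r (f x)"
    proof (rule prj_ext)
      fix k
      have "prj k (pa r (f x)) = pa r (sc (x k) (w k))" using fc x by (simp add: prj_pa fp)
      also have "\<dots> = sc (poly r (of_int k)) (sc (x k) (w k))" by (rule wsp_pa[OF wsp_sc[OF ww]])
      also have "\<dots> = sc (poly r (of_int k) * x k) (w k)" using wc by (simp add: sc_sc)
      finally show "prj k (f (gwa_poly t r \<odot>\<^bsub>std_module t I\<^esub> x)) = prj k (pa r (f x))"
        using fin_fun_scale[OF x] by (simp add: std_module_gens[OF adm x] fp)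
    qed (use fc in auto)
    have g: "gwa_Xp t \<odot>\<^bsub>std_module t I\<^esub> x \<in> fin_fun I" "gwa_Xm t \<odot>\<^bsub>std_module t I\<^esub> x \<in> fin_fun I"
      using std_module_act[OF adm x] fin_fun_free_act[OF x] by (simp_all add: gwa_Xp_class gwa_Xm_class)
    show "f (gwa_Xp t \<odot>\<^bsub>std_module t I\<^esub> x) = xp (f x)"
    proof (rule prj_ext)
      fix k
      have "prj k (xp (f x)) = sc (x (k - 1)) (xp (w (k - 1)))"
        using fc x wc by (simp add: prj_xp fp xp_sc)
      also have "\<dots> = sc (if k \<in> I \<and> k - 1 \<in> I then x (k - 1) else 0) (w k)"
        using wx[of "k - 1"] R[of "k - 1"] wz[of "k - 1"] wc by (cases "k - 1 \<in> I"; cases "k \<in> I") (auto simp: s)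
      finally show "prj k (f (gwa_Xp t \<odot>\<^bsub>std_module t I\<^esub> x)) = prj k (xp (f x))"
        using g by (simp add: fp std_module_gens[OF adm x])
    qed (use fc in auto)
    show "f (gwa_Xm t \<odot>\<^bsub>std_module t I\<^esub> x) = xm (f x)"
    proof (rule prj_ext)
      fix k
      \<comment> \<open>Since w(k + 1) is X+ w(k), this is X- X+ applied to a vector of weight
        k.\<close>
      have m: "xm (w (k + 1)) = sc (poly t (of_int k + 1/2)) (w k)" if "k \<in> I" "k + 1 \<in> I"
        using wx[OF that] wsp_xm_xp[OF ww[of k]] by simp
      have "prj k (xm (f x)) = sc (x (k + 1)) (xm (w (k + 1)))"
        using fc x wc by (simp add: prj_xm fp xm_sc)
      also have "\<dots> = sc (if k \<in> I \<and> k + 1 \<in> I then poly t (of_int k + 1/2) * x (k + 1) else 0) (w k)"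
        using m L[of "k + 1"] wz[of "k + 1"] wc
        by (cases "k + 1 \<in> I"; cases "k \<in> I") (auto simp: s sc_sc mult.commute)
      finally show "prj k (f (gwa_Xm t \<odot>\<^bsub>std_module t I\<^esub> x)) = prj k (xm (f x))"
        using g by (simp add: fp std_module_gens[OF adm x])
    qed (use fc in auto)
  qed (rule fc)
  moreover have "inj_on f (fin_fun I)"
  proof (rule inj_onI)
    fix x y assume xy: "x \<in> fin_fun I" "y \<in> fin_fun I" "f x = f y"
    show "x = y"
    proof
      fix k
      show "x k = y k"
      proof (cases "k \<in> I")
        case True
        have "sc (x k) (w k) = sc (y k) (w k)" using fp[OF xy(1), of k] fp[OF xy(2), of k] xy(3) by simp
        then have "sc (x k - y k) (w k) = \<zero>\<^bsub>M\<^esub>"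
          using sc_add[OF wc, of "x k - y k" "y k" k] wc by (metis M.add.r_cancel_one' add.commute diff_add_cancel gwa_poly_closed smult_closed')
        then show ?thesis using sc_eq_zero[OF wc] wnz[OF True] by fastforce
      qed (use xy in \<open>auto simp: fin_fun_def\<close>)
    qed
  qed
  ultimately show thesis using that fp by blast
qed

context
  assumes t: "t \<in> \<Omega>_half"
begin

text \<open>Upwards the vectors are the iterates of X+ on v. Downwards X- is rescaled at each step
  so that X+ leads back; inside a cell the divisors, values of t at half-integers, are
  nonzero.\<close>

lemma family_exists:
  assumes v: "v \<in> wsp k" "v \<noteq> \<zero>\<^bsub>M\<^esub>"
  obtains w where "family (cell t (cidx t k)) w" "w k = v"
proof -
  define I where "I = cell t (cidx t k)"
  have kI: "k \<in> I" by (simp add: I_def cell_def)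
  define up where "up n = (xp ^^ n) v" for n
  \<comment> \<open>At weight k - n the product X+ X- is the scalar t(k - n - 1/2), so dividing by
    it makes X+ undo the downward step. Where this scalar vanishes the quotient is zero by
    convention, but then weight k - n - 1 is already outside the cell.\<close>
  define dn where "dn = rec_nat v (\<lambda>n u. sc (1 / poly t (of_int (k - int n) - 1/2)) (xm u))"
  have up0: "up 0 = v" "up (Suc n) = xp (up n)" for n by (simp_all add: up_def)
  have dn0: "dn 0 = v" "dn (Suc n) = sc (1 / poly t (of_int (k - int n) - 1/2)) (xm (dn n))" for n
    by (simp_all add: dn_def)
  have upw: "up n \<in> wsp (k + int n)" for n
  proof (induction n)
    case (Suc n)
    then show ?case using wsp_xp[of "up n" "k + int n"] by (simp add: up0 add.assoc add.commute[of 1])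
  qed (use v up0 in simp)
  have dnw: "dn n \<in> wsp (k - int n)" for n
  proof (induction n)
    case (Suc n)
    then show ?case using wsp_xm[of "dn n" "k - int n"] wsp_sc by (simp add: dn0 algebra_simps)
  qed (use v dn0 in simp)
  have xpdn: "xp (dn (Suc n)) = dn n" if "poly t (of_int (k - int n) - 1/2) \<noteq> 0" for n
    using that wsp_xp_xm[OF dnw[of n]] wsp_carrier[OF dnw[of n]] by (simp add: dn0 xp_sc sc_sc)
  have nzI: "poly t (of_int l + 1/2) \<noteq> 0" if "l \<in> I" "l + 1 \<in> I" for l
    using cell_nonzero[OF t] that by (simp add: I_def)
  have between: "l \<in> I" if "k \<le> l" "l \<le> m" "m \<in> I" for l m
    using cell_convex[OF t, of k "cidx t k" m l] that kI by (simp add: I_def)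
  have between': "l \<in> I" if "m \<le> l" "l \<le> k" "m \<in> I" for l m
    using cell_convex[OF t, of m "cidx t k" k l] that kI by (simp add: I_def)
  have dnnz0: "poly t (of_int (k - int n) - 1/2) \<noteq> 0" if "k - int (Suc n) \<in> I" for n
  proof -
    have "k - int (Suc n) + 1 \<in> I" by (rule between'[OF _ _ that]) auto
    then have "poly t (of_int (k - int (Suc n)) + 1/2) \<noteq> 0" using nzI that by blast
    moreover have "complex_of_int (k - int (Suc n)) + 1/2 = of_int (k - int n) - 1/2" by simp
    ultimately show ?thesis by metis
  qed
  have upnz: "up n \<noteq> \<zero>\<^bsub>M\<^esub>" if "k + int n \<in> I" for n
    using that
  proof (induction n)
    case (Suc n)
    have i: "k + int n \<in> I" by (rule between[OF _ _ Suc.prems]) auto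
    have "poly t (of_int (k + int n) + 1/2) \<noteq> 0"
      using nzI[OF i] Suc.prems by (simp add: add.assoc add.commute[of 1])
    moreover have "xm (xp (up n)) = sc (poly t (of_int (k + int n) + 1/2)) (up n)"
      by (rule wsp_xm_xp[OF upw])
    ultimately have "xm (xp (up n)) \<noteq> \<zero>\<^bsub>M\<^esub>"
      using sc_eq_zero[OF wsp_carrier[OF upw[of n]]] Suc.IH[OF i] by metis
    then show ?case unfolding up0 by auto
  qed (use v up0 in simp)
  have dnnz: "dn n \<noteq> \<zero>\<^bsub>M\<^esub>" if "k - int n \<in> I" for n
    using that
  proof (induction n)
    case (Suc n)
    have i: "k - int n \<in> I" by (rule between'[OF _ _ Suc.prems]) auto
    have "xp (dn (Suc n)) \<noteq> \<zero>\<^bsub>M\<^esub>" using xpdn[OF dnnz0[OF Suc.prems]] Suc.IH[OF i] by simp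
    then show ?case by auto
  qed (use v dn0 in simp)
  define w where "w l = (if l \<notin> I then \<zero>\<^bsub>M\<^esub> else if k \<le> l then up (nat (l - k)) else dn (nat (k - l)))" for l
  have "family I w"
    unfolding family_def
  proof (intro conjI allI ballI impI)
    show "w l \<in> wsp l" for l using upw[of "nat (l - k)"] dnw[of "nat (k - l)"]
      by (cases "k \<le> l") (auto simp: w_def)
    show "w l \<noteq> \<zero>\<^bsub>M\<^esub>" if "l \<in> I" for l
      using upnz[of "nat (l - k)"] dnnz[of "nat (k - l)"] that by (simp add: w_def)
    show "w l = \<zero>\<^bsub>M\<^esub>" if "l \<notin> I" for l using that by (simp add: w_def)
    show "xp (w l) = w (l + 1)" if l: "l \<in> I" "l + 1 \<in> I" for l
    proof (cases "k \<le> l")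
      case True
      then have "nat (l + 1 - k) = Suc (nat (l - k))" by simp
      then show ?thesis using True l by (simp add: w_def up0)
    next
      case False
      define n where "n = nat (k - (l + 1))"
      have n: "nat (k - l) = Suc n" "l = k - int (Suc n)" "l + 1 = k - int n" using False by (auto simp: n_def)
      have "w l = dn (Suc n)" using l(1) False n(1) by (simp add: w_def)
      then have "xp (w l) = dn n" using xpdn[OF dnnz0[of n]] l(1) n(2) by simp
      moreover have "w (l + 1) = dn n"
        using l False n up0 dn0 by (cases "n = 0") (auto simp: w_def)
      ultimately show ?thesis by simp
    qed
  qed
  moreover have "w k = v" using kI by (simp add: w_def up0)
  ultimately show thesis using that unfolding I_def by blast
qed

text \<open>Among the cells that carry a family whose upper end is killed by X+, the lowest is
  taken. There is such a cell, namely the highest one in which the module is nonzero. If X- did not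
  kill the lower end of the chosen family, its value there would start a family in the next cell
  below, and X+ would kill the upper end of that one, because X+ X- is there the value of t at a
  root.\<close>

lemma closed_family_exists:
  assumes ne: "\<exists>k. wsp k \<noteq> {\<zero>\<^bsub>M\<^esub>}"
  obtains i w where "i \<in> range (cidx t)" "family (cell t i) w"
    "\<And>k. k \<in> cell t i \<Longrightarrow> k + 1 \<notin> cell t i \<Longrightarrow> xp (w k) = \<zero>\<^bsub>M\<^esub>"
    "\<And>k. k \<in> cell t i \<Longrightarrow> k - 1 \<notin> cell t i \<Longrightarrow> xm (w k) = \<zero>\<^bsub>M\<^esub>"
proof -
  define P where "P i \<longleftrightarrow> (i \<in> range (cidx t) \<and> (\<exists>w. family (cell t i) w \<and>
     (\<forall>k. k \<in> cell t i \<longrightarrow> k + 1 \<notin> cell t i \<longrightarrow> xp (w k) = \<zero>\<^bsub>M\<^esub>)))" for i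
  have step: "cidx t (k + 1) = Suc (cidx t k)" "poly t (of_int k + 1/2) = 0"
    if "cidx t (k + 1) \<noteq> cidx t k" for k
    using cidx_step[OF t, of k] that by (auto split: if_splits)
  have "\<exists>i. P i"
  proof -
    define S where "S = {cidx t k | k. wsp k \<noteq> {\<zero>\<^bsub>M\<^esub>}}"
    have S: "finite S" "S \<noteq> {}"
      using ne finite_subset[OF _ finite_range_cidx[OF t], of S] by (auto simp: S_def)
    have "\<exists>k. cidx t k = x \<and> wsp k \<noteq> {\<zero>\<^bsub>M\<^esub>}" if "x \<in> S" for x using that by (auto simp: S_def)
    then obtain k where k: "cidx t k = Max S" "wsp k \<noteq> {\<zero>\<^bsub>M\<^esub>}" using Max_in[OF S] by blast
    obtain v where v: "v \<in> wsp k" "v \<noteq> \<zero>\<^bsub>M\<^esub>" using k(2) wsp_zero by blast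
    obtain w where w: "family (cell t (cidx t k)) w" using family_exists[OF v] by blast
    have "xp (w l) = \<zero>\<^bsub>M\<^esub>" if l: "l \<in> cell t (cidx t k)" "l + 1 \<notin> cell t (cidx t k)" for l
    proof -
      have "cidx t (l + 1) = Suc (Max S)" using step[of l] l k by (auto simp: cell_def)
      then have "cidx t (l + 1) \<notin> S" using Max_ge[OF S(1)] by force
      then have "wsp (l + 1) = {\<zero>\<^bsub>M\<^esub>}" by (auto simp: S_def)
      moreover have "xp (w l) \<in> wsp (l + 1)" using w wsp_xp by (auto simp: family_def)
      ultimately show ?thesis by simp
    qed
    then show ?thesis using w unfolding P_def by blast
  qed
  define i where "i = (LEAST i. P i)"
  have Pi: "P i" unfolding i_def using \<open>\<exists>i. P i\<close> by (rule LeastI_ex)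
  have Pmin: "\<not> P i'" if "i' < i" for i' using that not_less_Least unfolding i_def by blast
  obtain w where w: "family (cell t i) w"
    "\<And>k. k \<in> cell t i \<Longrightarrow> k + 1 \<notin> cell t i \<Longrightarrow> xp (w k) = \<zero>\<^bsub>M\<^esub>" using Pi unfolding P_def by blast
  have "xm (w k) = \<zero>\<^bsub>M\<^esub>" if k: "k \<in> cell t i" "k - 1 \<notin> cell t i" for k
  proof (rule ccontr)
    assume nz: "xm (w k) \<noteq> \<zero>\<^bsub>M\<^esub>"
    have ci: "i = Suc (cidx t (k - 1))" "poly t (of_int (k - 1) + 1/2) = 0"
      using step[of "k - 1"] k by (auto simp: cell_def)
    have wk: "w k \<in> wsp k" using w by (simp add: family_def)
    have u: "xm (w k) \<in> wsp (k - 1)" by (rule wsp_xm[OF wk])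
    obtain w' where w': "family (cell t (cidx t (k - 1))) w'" "w' (k - 1) = xm (w k)"
      using family_exists[OF u nz] by blast
    have "complex_of_int (k - 1) + 1/2 = of_int k - 1/2" by simp
    then have x0: "xp (xm (w k)) = \<zero>\<^bsub>M\<^esub>"
      using wsp_xp_xm[OF wk] ci(2) wsp_carrier[OF wk] by simp
    \<comment> \<open>By monotonicity of the index, k - 1 is the only member of the lower cell whose
      successor lies outside it.\<close>
    have "xp (w' l) = \<zero>\<^bsub>M\<^esub>" if l: "l \<in> cell t (cidx t (k - 1))" "l + 1 \<notin> cell t (cidx t (k - 1))" for l
    proof -
      have c: "cidx t l = cidx t (k - 1)" "cidx t (l + 1) = i" using step[of l] l ci by (auto simp: cell_def)
      have "\<not> l < k - 1" using cidx_mono[OF t, of "l + 1" "k - 1"] c ci by auto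
      moreover have "\<not> l > k - 1" using cidx_mono[OF t, of k l] c ci k by (auto simp: cell_def)
      ultimately have "l = k - 1" by simp
      then show ?thesis using w'(2) x0 by simp
    qed
    then have "P (cidx t (k - 1))" using w'(1) unfolding P_def by blast
    then show False using Pmin[of "cidx t (k - 1)"] ci by simp
  qed
  then show thesis using that w Pi unfolding P_def by blast
qed

text \<open>Every nonzero object contains a cell module. This drives both the decomposition of
  classes and the description of the simple objects.\<close>

lemma embed_cell:
  assumes "\<exists>k. wsp k \<noteq> {\<zero>\<^bsub>M\<^esub>}"
  obtains i f where "i \<in> range (cidx t)" "f \<in> module_hom (gwa t) (std_module t (cell t i)) M"
    "inj_on f (fin_fun (cell t i))"
proof -
  obtain i w where w: "i \<in> range (cidx t)" "family (cell t i) w"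
    "\<And>k. k \<in> cell t i \<Longrightarrow> k + 1 \<notin> cell t i \<Longrightarrow> xp (w k) = \<zero>\<^bsub>M\<^esub>"
    "\<And>k. k \<in> cell t i \<Longrightarrow> k - 1 \<notin> cell t i \<Longrightarrow> xm (w k) = \<zero>\<^bsub>M\<^esub>"
    using closed_family_exists[OF assms] by blast
  obtain f where "f \<in> module_hom (gwa t) (std_module t (cell t i)) M" "inj_on f (fin_fun (cell t i))"
    using embed_std_module[OF admissible_cell[OF t] w(2) w(3,4)] by metis
  then show thesis by (rule that[OF w(1)])
qed

end

end

text \<open>The embedding is precomposed with the inverse of j, because an exact sequence gives a
  relation in K0 only if all three terms have their underlying sets in \<open>'u\<close>.\<close>

lemma peel_cell:
  fixes M :: "'u gwa_module"
  assumes t: "t \<in> \<Omega>_half" and M: "findim_mod t M" and j: "inj (j :: (int \<Rightarrow> complex) \<Rightarrow> 'u)"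
    and ne: "\<exists>k. gwa_module.dimw t M k \<noteq> 0"
  obtains i and Q :: "'u gwa_module" where "i \<in> range (cidx t)" "findim_mod t Q"
    "short_exact (gwa t) (std_copy j t (cell t i)) M Q"
proof -
  interpret M: findim_mod t M by fact
  have "\<exists>k. M.wsp k \<noteq> {\<zero>\<^bsub>M\<^esub>}" using ne M.dimw_zero_iff by auto
  then obtain i f where f: "i \<in> range (cidx t)" "f \<in> module_hom (gwa t) (std_module t (cell t i)) M"
    "inj_on f (fin_fun (cell t i))" using M.embed_cell[OF t] by blast
  let ?L = "std_copy j t (cell t i)"
  note s = std_copy_iso[OF admissible_cell[OF t] j, of i]
  define g where "g = inv_into (fin_fun (cell t i)) j"
  have gb: "bij_betw g (carrier ?L) (fin_fun (cell t i))" unfolding g_def using s(3) by (rule bij_betw_inv_into)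
  have "g \<in> module_hom (gwa t) ?L (std_module t (cell t i))"
    unfolding g_def
    using module_hom_inv[OF left_module_std_module[OF admissible_cell[OF t]] s(2)] s(3) by simp
  then have 1: "f \<circ> g \<in> module_hom (gwa t) ?L M" using f(2) by (rule module_hom_comp)
  have 2: "inj_on (f \<circ> g) (carrier ?L)" using gb f(3) by (auto simp: bij_betw_def intro: comp_inj_on)
  show thesis using quotient_exists[OF M s(1) 1 2] that[OF f(1)] by blast
qed

text \<open>A nonzero module contains a cell module, and a simple one must coincide with it.\<close>

lemma simple_dimw:
  fixes M :: "'u gwa_module"
  assumes t: "t \<in> \<Omega>_half" and M: "M \<in> simple_objects \<O>_int t"
  obtains i where "i \<in> range (cidx t)" "\<And>k. gwa_module.dimw t M k = (if k \<in> cell t i then 1 else 0)"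
proof -
  have fd: "findim_mod t M" and sm: "simple_module (gwa t) M"
    using M by (auto simp: simple_objects_def wmod_findim)
  interpret M: findim_mod t M by fact
  have "\<exists>k. M.wsp k \<noteq> {\<zero>\<^bsub>M\<^esub>}"
  proof (rule ccontr)
    assume "\<not> (\<exists>k. M.wsp k \<noteq> {\<zero>\<^bsub>M\<^esub>})"
    then have w0: "M.wsp k = {\<zero>\<^bsub>M\<^esub>}" for k by simp
    have "x = \<zero>\<^bsub>M\<^esub>" if x: "x \<in> carrier M" for x
    proof (rule M.prj_ext[OF x M.M.zero_closed])
      show "M.prj k x = M.prj k \<zero>\<^bsub>M\<^esub>" for k using M.prj_wsp[OF x, of k] unfolding w0 by simp
    qed
    then have "carrier M = {\<zero>\<^bsub>M\<^esub>}" using M.M.zero_closed by blast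
    then show False using sm by (simp add: simple_module_def)
  qed
  then obtain i f where f: "i \<in> range (cidx t)" "f \<in> module_hom (gwa t) (std_module t (cell t i)) M"
    "inj_on f (fin_fun (cell t i))" using M.embed_cell[OF t] by blast
  let ?S = "std_module t (cell t i)"
  have adm: "admissible t (cell t i)" by (rule admissible_cell[OF t])
  obtain k where k: "k \<in> cell t i" using f(1) by (auto simp: cell_def)
  have u: "unit_fun k \<in> fin_fun (cell t i)" using unit_fun_fin_fun[OF k, of 1] by simp
  have "f ` carrier ?S \<noteq> {\<zero>\<^bsub>M\<^esub>}"
  proof
    assume 0: "f ` carrier ?S = {\<zero>\<^bsub>M\<^esub>}"
    have "f (unit_fun k) \<in> f ` carrier ?S" "f (\<lambda>k. 0) \<in> f ` carrier ?S" using u fin_fun_zero by auto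
    then have "f (unit_fun k) = f (\<lambda>k. 0)" unfolding 0 by simp
    then have "unit_fun k = (\<lambda>k. 0)" using f(3) u fin_fun_zero by (auto dest: inj_onD)
    from fun_cong[OF this, of k] show False by (simp add: unit_fun_def)
  qed
  moreover have "submodule (f ` carrier ?S) (gwa t) M"
    by (rule hom_image_submodule[OF left_module_std_module[OF adm] M.left_module_axioms f(2)])
  ultimately have "f ` carrier ?S = carrier M" using sm by (auto simp: simple_module_def)
  then have "bij_betw f (carrier ?S) (carrier M)" using f(3) by (simp add: bij_betw_def)
  then have "M.dimw k = (if k \<in> cell t i then 1 else 0)" for k
    using dimw_iso[OF findim_std_module[OF adm] fd f(2)] dimw_std_module[OF adm] by simp
  then show thesis using that f(1) by blast
qed

text \<open>A polynomial isolates one point in the support of a nonzero element of a submodule, so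
  some unit function lies in the submodule. From there X+ and X- reach the whole cell, because t has
  no zero between two neighbours in it.\<close>

lemma simple_std_copy:
  fixes j :: "(int \<Rightarrow> complex) \<Rightarrow> 'u"
  assumes t: "t \<in> \<Omega>_half" and i: "i \<in> range (cidx t)" and j: "inj j"
  shows "simple_module (gwa t) (std_copy j t (cell t i))"
proof -
  define I where "I = cell t i"
  let ?W = "std_copy j t I"
  have adm: "admissible t I" unfolding I_def by (rule admissible_cell[OF t])
  note s = std_copy_iso[OF adm j]
  note h = module_homD[OF s(2)]
  interpret W: gwa_module t ?W using s(1) by (simp add: gwa_module_def)
  interpret S: gwa_module t "std_module t I" by (rule gwa_module_std_module[OF adm])
  note z = module_hom_zero_minus[OF S.M.abelian_group_axioms W.M.abelian_group_axioms s(2)]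
  have nz: "j f \<noteq> \<zero>\<^bsub>?W\<^esub>" if "f \<noteq> (\<lambda>k. 0)" for f using z(1) inj_eq[OF j, of f "\<lambda>k. 0"] that by simp
  have car: "carrier ?W = j ` fin_fun I" using s(3) by (simp add: bij_betw_def)
  have "N = carrier ?W" if N: "submodule N (gwa t) ?W" "N \<noteq> {\<zero>\<^bsub>?W\<^esub>}" for N
  proof -
    interpret N: submodule N "gwa t" ?W by fact
    define N' where "N' = {f \<in> fin_fun I. j f \<in> N}"
    have sub: "N \<subseteq> carrier ?W" using N.subset by simp
    have add: "(\<lambda>k. f k + g k) \<in> N'" if "f \<in> N'" "g \<in> N'" for f g
      using that h(2)[of f g] N.m_closed[of "j f" "j g"] fin_fun_add by (auto simp: N'_def)
    have act: "a \<odot>\<^bsub>std_module t I\<^esub> f \<in> N'" if "a \<in> carrier (gwa t)" "f \<in> N'" for a f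
      using that h(3)[of a f] N.smult_closed[of a "j f"] S.smult_closed[of a f] by (auto simp: N'_def)
    have zero: "(\<lambda>k. 0) \<in> N'" using z(1) N.one_closed fin_fun_zero by (simp add: N'_def)
    have pol: "(\<lambda>k. poly r (of_int k) * f k) \<in> N'" if "f \<in> N'" for r f
      using act[of "gwa_poly t r" f] that std_module_gens(1)[OF adm, of f r] by (simp add: N'_def)
    obtain x where x: "x \<in> N" "x \<noteq> \<zero>\<^bsub>?W\<^esub>" using N N.one_closed by auto
    then obtain f where f: "f \<in> N'" "x = j f" using sub car by (auto simp: N'_def)
    then have "f \<noteq> (\<lambda>k. 0)" using x z(1) by auto
    then obtain k where k: "f k \<noteq> 0" by auto
    have kI: "k \<in> I" using k f by (auto simp: N'_def fin_fun_def)
    have unit: "unit_fun k \<in> N'"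
    proof -
      define K where "K = {l. f l \<noteq> 0} - {k}"
      have K: "finite K" using f by (auto simp: N'_def fin_fun_def K_def)
      \<comment> \<open>Vanishes at the other points of the support; the constant c below normalizes
        the remaining value to 1.\<close>
      define p where "p = (\<Prod>l\<in>K. [:- of_int l, 1:] :: complex poly)"
      have pv: "poly p (of_int l) = 0 \<longleftrightarrow> l \<in> K" for l
        using K by (auto simp: p_def poly_prod)
      define c where "c = 1 / (poly p (of_int k) * f k)"
      have "(\<lambda>l. poly (smult c p) (of_int l) * f l) = unit_fun k"
      proof
        fix l
        have "poly p (of_int k) \<noteq> 0" using pv[of k] by (simp add: K_def)
        then show "poly (smult c p) (of_int l) * f l = unit_fun k l"
          using pv[of l] k by (cases "l = k") (auto simp: unit_fun_def c_def K_def)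
      qed
      then show ?thesis using pol[OF f(1), of "smult c p"] by simp
    qed
    have scal: "(\<lambda>l. c * f l) \<in> N'" if "f \<in> N'" for c f using pol[OF that, of "[:c:]"] by simp
    have up: "unit_fun (l + 1) \<in> N'" if l: "unit_fun l \<in> N'" "l \<in> I" "l + 1 \<in> I" for l
    proof -
      have "(\<lambda>k. if k \<in> I \<and> k - 1 \<in> I then unit_fun l (k - 1) else 0) = unit_fun (l + 1)"
        using l by (auto simp: unit_fun_def fun_eq_iff)
      then show ?thesis using act[of "gwa_Xp t" "unit_fun l"] l std_module_gens(2)[OF adm, of "unit_fun l"]
        by (simp add: N'_def)
    qed
    have down: "unit_fun (l - 1) \<in> N'" if l: "unit_fun l \<in> N'" "l \<in> I" "l - 1 \<in> I" for l
    proof -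
      define c where "c = poly t (of_int (l - 1) + 1/2)"
      have c: "c \<noteq> 0" using cell_nonzero[OF t, of "l - 1" i] l by (simp add: I_def c_def)
      have "(\<lambda>k. if k \<in> I \<and> k + 1 \<in> I then poly t (of_int k + 1/2) * unit_fun l (k + 1) else 0)
          = (\<lambda>k. c * unit_fun (l - 1) k)"
        using l by (auto simp: unit_fun_def fun_eq_iff c_def)
      then have "(\<lambda>k. c * unit_fun (l - 1) k) \<in> N'"
        using act[of "gwa_Xm t" "unit_fun l"] l std_module_gens(3)[OF adm, of "unit_fun l"]
        by (simp add: N'_def)
      from scal[OF this, of "1 / c"] c show ?thesis by simp
    qed
    have conv: "l \<in> I" if "m \<le> l" "l \<le> n" "m \<in> I" "n \<in> I" for l m n
      using cell_convex[OF t, of m i n l] that by (simp add: I_def)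
    have "l \<in> I \<longrightarrow> unit_fun l \<in> N'" if "k \<le> l" for l
      using that
    proof (induction l rule: int_ge_induct)
      case (step l)
      then show ?case using up[of l] conv[of k l "l + 1"] kI by auto
    qed (use unit in simp)
    moreover have "l \<in> I \<longrightarrow> unit_fun l \<in> N'" if "l \<le> k" for l
      using that
    proof (induction l rule: int_le_induct)
      case (step l)
      then show ?case using down[of l] conv[of "l - 1" l k] kI by auto
    qed (use unit in simp)
    ultimately have units: "unit_fun l \<in> N'" if "l \<in> I" for l using that by (meson linear)
    have "f \<in> N'" if "f \<in> fin_fun I" for f
      using that
    proof (induction f rule: fin_fun_induct)
      case (add c k g)
      then show ?case using units scal \<open>\<And>f g. f \<in> N' \<Longrightarrow> g \<in> N' \<Longrightarrow> (\<lambda>k. f k + g k) \<in> N'\<close> by simp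
    qed (rule zero)
    then show ?thesis using sub car by (auto simp: N'_def)
  qed
  moreover have "carrier ?W \<noteq> {\<zero>\<^bsub>?W\<^esub>}"
  proof -
    obtain k where "k \<in> I" using i by (auto simp: I_def cell_def)
    then have "unit_fun k \<in> fin_fun I" using unit_fun_fin_fun[of k I 1] by simp
    then have "j (unit_fun k) \<in> carrier ?W" using car by simp
    moreover have "unit_fun k k \<noteq> 0" by (simp add: unit_fun_def)
    then have "j (unit_fun k) \<noteq> \<zero>\<^bsub>?W\<^esub>" by (intro nz) auto
    ultimately show ?thesis by auto
  qed
  ultimately show ?thesis using s(1) unfolding simple_module_def I_def by blast
qed

section \<open>Quotients of free abelian groups\<close>

text \<open>The additive extension of F from the generators. With complex values the same map serves
  K0 and its complexification.\<close>

definition frag_eval :: "('a \<Rightarrow> complex) \<Rightarrow> ('a \<Rightarrow>\<^sub>0 int) \<Rightarrow> complex"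
  where "frag_eval F x = (\<Sum>s\<in>Poly_Mapping.keys x. of_int (Poly_Mapping.lookup x s) * F s)"

lemma frag_eval_superset:
  "finite S \<Longrightarrow> Poly_Mapping.keys x \<subseteq> S \<Longrightarrow> frag_eval F x = (\<Sum>s\<in>S. of_int (Poly_Mapping.lookup x s) * F s)"
  unfolding frag_eval_def by (rule sum.mono_neutral_left) (auto simp: in_keys_iff)

lemma frag_eval_add: "frag_eval F (x + y) = frag_eval F x + frag_eval F y"
proof -
  have "Poly_Mapping.keys (x + y) \<subseteq> Poly_Mapping.keys x \<union> Poly_Mapping.keys y" by (rule keys_add)
  then show ?thesis
    by (simp add: frag_eval_superset[of "Poly_Mapping.keys x \<union> Poly_Mapping.keys y"]
        lookup_add distrib_right sum.distrib)
qed

lemma frag_eval_zero [simp]: "frag_eval F 0 = 0"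
  by (simp add: frag_eval_def)

lemma frag_eval_minus: "frag_eval F (- x) = - frag_eval F x"
  using frag_eval_add[of F "- x" x] by (simp add: eq_neg_iff_add_eq_0)

lemma frag_eval_diff: "frag_eval F (x - y) = frag_eval F x - frag_eval F y"
  using frag_eval_add[of F x "- y"] by (simp add: frag_eval_minus)

lemma frag_eval_of [simp]: "frag_eval F (frag_of a) = F a"
  by (simp add: frag_eval_def)

text \<open>The Grothendieck group, the tensor products over the polynomials and the
  complexification of K0 are all of this form, a free abelian group on S modulo the span of
  relations.\<close>

locale frag_quotient =
  fixes S :: "'a set" and rels :: "('a \<Rightarrow>\<^sub>0 int) set"
  assumes rels: "r \<in> rels \<Longrightarrow> Poly_Mapping.keys r \<subseteq> S"
begin

definition K where "K = generate (free_Abelian_group S) rels"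
definition Q where "Q = free_Abelian_group S Mod K"
definition cls where "cls x = K #>\<^bsub>free_Abelian_group S\<^esub> x"

sublocale F: comm_group "free_Abelian_group S" by (rule abelian_free_Abelian_group)

lemma rels_sub: "rels \<subseteq> carrier (free_Abelian_group S)"
  using rels by auto

lemma subgroup_K: "subgroup K (free_Abelian_group S)"
  unfolding K_def by (rule F.generate_is_subgroup[OF rels_sub])

sublocale N: normal K "free_Abelian_group S"
  by (rule F.subgroup_imp_normal[OF subgroup_K])

sublocale Q: comm_group Q
  unfolding Q_def by (rule F.abelian_FactGroup[OF subgroup_K])

lemma K_carrier: "x \<in> K \<Longrightarrow> Poly_Mapping.keys x \<subseteq> S"
  using subsetD[OF N.subset, of x] by (simp only: carrier_free_Abelian_group_iff)

lemma K_zero: "0 \<in> K"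
  using N.one_closed by simp

lemma K_add: "x \<in> K \<Longrightarrow> y \<in> K \<Longrightarrow> x + y \<in> K"
  using N.m_closed by simp

lemma K_neg: "x \<in> K \<Longrightarrow> - x \<in> K"
  using N.m_inv_closed[of x] K_carrier[of x] by simp

lemma K_rels: "r \<in> rels \<Longrightarrow> r \<in> K"
  unfolding K_def by (rule generate.incl)

lemma cls_eq_iff:
  assumes "Poly_Mapping.keys x \<subseteq> S" "Poly_Mapping.keys y \<subseteq> S"
  shows "cls x = cls y \<longleftrightarrow> x - y \<in> K"
proof -
  have "cls x = cls y \<longleftrightarrow> x \<in> cls y"
    unfolding cls_def using F.rcos_self[OF _ subgroup_K, of x] F.repr_independence[OF _ _ subgroup_K, of x y] assms
    by (auto simp: eq_commute)
  also have "\<dots> \<longleftrightarrow> (\<exists>h\<in>K. x = h + y)" by (simp add: cls_def r_coset_def)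
  also have "\<dots> \<longleftrightarrow> x - y \<in> K" by (metis diff_add_cancel add_diff_cancel_right')
  finally show ?thesis .
qed

lemma carrier_Q: "carrier Q = cls ` {x. Poly_Mapping.keys x \<subseteq> S}"
proof -
  have "carrier (free_Abelian_group S) = {x. Poly_Mapping.keys x \<subseteq> S}" by auto
  then show ?thesis by (simp add: Q_def carrier_FactGroup cls_def)
qed

lemma cls_closed [simp]: "Poly_Mapping.keys x \<subseteq> S \<Longrightarrow> cls x \<in> carrier Q"
  by (auto simp: carrier_Q)

lemma one_Q: "\<one>\<^bsub>Q\<^esub> = cls 0"
  using F.coset_mult_one[of K] N.subset by (simp add: Q_def cls_def)

lemma cls_add:
  "Poly_Mapping.keys x \<subseteq> S \<Longrightarrow> Poly_Mapping.keys y \<subseteq> S \<Longrightarrow> cls (x + y) = cls x \<otimes>\<^bsub>Q\<^esub> cls y"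
  using N.rcos_sum[of x y] by (simp add: Q_def cls_def)

lemma cls_neg: "Poly_Mapping.keys x \<subseteq> S \<Longrightarrow> cls (- x) = inv\<^bsub>Q\<^esub> cls x"
  by (rule Q.inv_equality[symmetric]) (simp_all flip: cls_add add: one_Q)

lemma Q_induct [consumes 1, case_names gen one mult inv]:
  assumes U: "U \<in> carrier Q"
    and gen: "\<And>s. s \<in> S \<Longrightarrow> P (cls (frag_of s))" and one: "P \<one>\<^bsub>Q\<^esub>"
    and mult: "\<And>U V. U \<in> carrier Q \<Longrightarrow> V \<in> carrier Q \<Longrightarrow> P U \<Longrightarrow> P V \<Longrightarrow> P (U \<otimes>\<^bsub>Q\<^esub> V)"
    and inv: "\<And>U. U \<in> carrier Q \<Longrightarrow> P U \<Longrightarrow> P (inv\<^bsub>Q\<^esub> U)"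
  shows "P U"
proof -
  have "P (cls x)" if "Poly_Mapping.keys x \<subseteq> S" for x
  proof (rule free_Abelian_group_induct[OF that])
    show "P (cls 0)" using one one_Q by simp
  next
    fix x y assume xy: "Poly_Mapping.keys x \<subseteq> S" "Poly_Mapping.keys y \<subseteq> S" "P (cls x)" "P (cls y)"
    then have "cls (x - y) = cls x \<otimes>\<^bsub>Q\<^esub> inv\<^bsub>Q\<^esub> cls y"
      using cls_add[of x "- y"] cls_neg[of y] by simp
    then show "P (cls (x - y))" using xy mult inv by simp
  qed (rule gen)
  then show ?thesis using U by (auto simp: carrier_Q)
qed

text \<open>Computed at a chosen element of the coset; \<open>eval_cls\<close> removes the choice
  when F vanishes on the relations.\<close>

definition eval :: "('a \<Rightarrow> complex) \<Rightarrow> ('a \<Rightarrow>\<^sub>0 int) set \<Rightarrow> complex"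
  where "eval F U = frag_eval F (SOME u. u \<in> U)"

lemma frag_eval_K:
  assumes "\<And>r. r \<in> rels \<Longrightarrow> frag_eval F r = 0" "x \<in> K"
  shows "frag_eval F x = 0"
  using assms(2) unfolding K_def
proof (induction rule: generate.induct)
  case (inv h)
  then show ?case using rels[OF inv] assms(1) by (simp add: frag_eval_minus)
qed (simp_all add: assms(1) frag_eval_add)

lemma eval_cls:
  assumes "\<And>r. r \<in> rels \<Longrightarrow> frag_eval F r = 0" "Poly_Mapping.keys x \<subseteq> S"
  shows "eval F (cls x) = frag_eval F x"
proof -
  have "x \<in> cls x" unfolding cls_def using F.rcos_self[OF _ subgroup_K] assms(2) by simp
  then have "(SOME u. u \<in> cls x) \<in> cls x" by (rule someI)
  then obtain h where "h \<in> K" "(SOME u. u \<in> cls x) = h + x" by (auto simp: cls_def r_coset_def)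
  then show ?thesis using frag_eval_K[OF assms(1)] by (simp add: eval_def frag_eval_add)
qed

lemma eval_mult:
  assumes "\<And>r. r \<in> rels \<Longrightarrow> frag_eval F r = 0" "U \<in> carrier Q" "V \<in> carrier Q"
  shows "eval F (U \<otimes>\<^bsub>Q\<^esub> V) = eval F U + eval F V"
proof -
  obtain x y where xy: "Poly_Mapping.keys x \<subseteq> S" "U = cls x" "Poly_Mapping.keys y \<subseteq> S" "V = cls y"
    using assms(2,3) by (auto simp: carrier_Q)
  then have "Poly_Mapping.keys (x + y) \<subseteq> S" using keys_add[of x y] by blast
  then show ?thesis using xy eval_cls[OF assms(1)] by (simp flip: cls_add add: frag_eval_add)
qed

lemma eval_one:
  assumes "\<And>r. r \<in> rels \<Longrightarrow> frag_eval F r = 0"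
  shows "eval F \<one>\<^bsub>Q\<^esub> = 0"
  using eval_cls[OF assms, of 0] by (simp add: one_Q)

end

section \<open>Tensor products\<close>

text \<open>Closure places all relations over the product of the two carriers. The locale is
  instantiated both with modules over the polynomials and with the integer module records of the
  complex numbers and of K0.\<close>

locale tensor_setup =
  fixes R :: "('r, 'm) ring_scheme" and M :: "('r, 'a) module" and N :: "('r, 'b) module"
  assumes add_M: "x \<in> carrier M \<Longrightarrow> x' \<in> carrier M \<Longrightarrow> x \<oplus>\<^bsub>M\<^esub> x' \<in> carrier M"
    and add_N: "y \<in> carrier N \<Longrightarrow> y' \<in> carrier N \<Longrightarrow> y \<oplus>\<^bsub>N\<^esub> y' \<in> carrier N"
    and smult_M: "r \<in> carrier R \<Longrightarrow> x \<in> carrier M \<Longrightarrow> r \<odot>\<^bsub>M\<^esub> x \<in> carrier M"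
    and smult_N: "r \<in> carrier R \<Longrightarrow> y \<in> carrier N \<Longrightarrow> r \<odot>\<^bsub>N\<^esub> y \<in> carrier N"
begin

sublocale frag_quotient "carrier M \<times> carrier N" "tensor_rels R M N"
proof
  fix r assume "r \<in> tensor_rels R M N"
  have k: "Poly_Mapping.keys (a - b - c) \<subseteq> S"
    if "Poly_Mapping.keys a \<subseteq> S" "Poly_Mapping.keys b \<subseteq> S" "Poly_Mapping.keys c \<subseteq> S"
    for a b c :: "'a \<times> 'b \<Rightarrow>\<^sub>0 int" and S
    using that keys_diff[of "a - b" c] keys_diff[of a b] by blast
  have k2: "Poly_Mapping.keys (a - b) \<subseteq> S" if "Poly_Mapping.keys a \<subseteq> S" "Poly_Mapping.keys b \<subseteq> S"
    for a b :: "'a \<times> 'b \<Rightarrow>\<^sub>0 int" and S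
    using that keys_diff[of a b] by blast
  from \<open>r \<in> _\<close>
  consider x x' y where "r = frag_of (x \<oplus>\<^bsub>M\<^esub> x', y) - frag_of (x, y) - frag_of (x', y)"
      "x \<in> carrier M" "x' \<in> carrier M" "y \<in> carrier N"
    | x y y' where "r = frag_of (x, y \<oplus>\<^bsub>N\<^esub> y') - frag_of (x, y) - frag_of (x, y')"
      "x \<in> carrier M" "y \<in> carrier N" "y' \<in> carrier N"
    | r' x y where "r = frag_of (r' \<odot>\<^bsub>M\<^esub> x, y) - frag_of (x, r' \<odot>\<^bsub>N\<^esub> y)"
      "r' \<in> carrier R" "x \<in> carrier M" "y \<in> carrier N"
    unfolding tensor_rels_def by blast
  then show "Poly_Mapping.keys r \<subseteq> carrier M \<times> carrier N"
  proof cases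
    case 1
    show ?thesis unfolding 1(1) by (rule k) (use 1 in \<open>simp_all add: add_M\<close>)
  next
    case 2
    show ?thesis unfolding 2(1) by (rule k) (use 2 in \<open>simp_all add: add_N\<close>)
  next
    case 3
    show ?thesis unfolding 3(1) by (rule k2) (use 3 in \<open>simp_all add: smult_M smult_N\<close>)
  qed
qed

abbreviation "T \<equiv> tensor_group R M N"
abbreviation "tens \<equiv> pure_tensor R M N"

lemma T_Q: "T = Q"
  by (simp add: tensor_group_def tensor_sub_def Q_def K_def)

lemma tens_cls: "tens x y = cls (frag_of (x, y))"
  by (simp add: pure_tensor_def tensor_sub_def cls_def K_def)

sublocale T: comm_group T unfolding T_Q by (rule Q.comm_group_axioms)

lemma tens_closed [simp]: "x \<in> carrier M \<Longrightarrow> y \<in> carrier N \<Longrightarrow> tens x y \<in> carrier T"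
  by (simp add: tens_cls T_Q)

lemma tens_add_left:
  assumes "x \<in> carrier M" "x' \<in> carrier M" "y \<in> carrier N"
  shows "tens (x \<oplus>\<^bsub>M\<^esub> x') y = tens x y \<otimes>\<^bsub>T\<^esub> tens x' y"
proof -
  have "frag_of (x \<oplus>\<^bsub>M\<^esub> x', y) - frag_of (x, y) - frag_of (x', y) \<in> tensor_rels R M N"
    unfolding tensor_rels_def using assms by blast
  then have "frag_of (x \<oplus>\<^bsub>M\<^esub> x', y) - (frag_of (x, y) + frag_of (x', y)) \<in> K"
    using K_rels by (simp add: diff_diff_eq)
  moreover have "Poly_Mapping.keys (frag_of (x, y) + frag_of (x', y)) \<subseteq> carrier M \<times> carrier N"
    using assms by (intro order.trans[OF keys_add]) auto
  ultimately show ?thesis using assms add_M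
    by (simp add: tens_cls T_Q cls_eq_iff flip: cls_add)
qed

lemma tens_add_right:
  assumes "x \<in> carrier M" "y \<in> carrier N" "y' \<in> carrier N"
  shows "tens x (y \<oplus>\<^bsub>N\<^esub> y') = tens x y \<otimes>\<^bsub>T\<^esub> tens x y'"
proof -
  have "frag_of (x, y \<oplus>\<^bsub>N\<^esub> y') - frag_of (x, y) - frag_of (x, y') \<in> tensor_rels R M N"
    unfolding tensor_rels_def using assms by blast
  then have "frag_of (x, y \<oplus>\<^bsub>N\<^esub> y') - (frag_of (x, y) + frag_of (x, y')) \<in> K"
    using K_rels by (simp add: diff_diff_eq)
  moreover have "Poly_Mapping.keys (frag_of (x, y) + frag_of (x, y')) \<subseteq> carrier M \<times> carrier N"
    using assms by (intro order.trans[OF keys_add]) auto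
  ultimately show ?thesis using assms add_N
    by (simp add: tens_cls T_Q cls_eq_iff flip: cls_add)
qed

lemma tens_balanced:
  assumes "r \<in> carrier R" "x \<in> carrier M" "y \<in> carrier N"
  shows "tens (r \<odot>\<^bsub>M\<^esub> x) y = tens x (r \<odot>\<^bsub>N\<^esub> y)"
proof -
  have "frag_of (r \<odot>\<^bsub>M\<^esub> x, y) - frag_of (x, r \<odot>\<^bsub>N\<^esub> y) \<in> tensor_rels R M N"
    unfolding tensor_rels_def using assms by blast
  then show ?thesis using K_rels assms smult_M smult_N by (simp add: tens_cls cls_eq_iff)
qed

text \<open>The locale states no law for zero elements, so they enter through x + x = x; the tensor
  is then equal to its own double, hence neutral.\<close>

lemma tens_idem_left:
  "x \<in> carrier M \<Longrightarrow> y \<in> carrier N \<Longrightarrow> x \<oplus>\<^bsub>M\<^esub> x = x \<Longrightarrow> tens x y = \<one>\<^bsub>T\<^esub>"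
  using tens_add_left[of x x y] tens_closed[of x y] T.l_cancel_one[of "tens x y" "tens x y"] by simp

lemma tens_idem_right:
  "x \<in> carrier M \<Longrightarrow> y \<in> carrier N \<Longrightarrow> y \<oplus>\<^bsub>N\<^esub> y = y \<Longrightarrow> tens x y = \<one>\<^bsub>T\<^esub>"
  using tens_add_right[of x y y] tens_closed[of x y] T.l_cancel_one[of "tens x y" "tens x y"] by simp

lemma tens_induct [consumes 1, case_names tens one mult inv]:
  assumes "U \<in> carrier T"
    and "\<And>x y. x \<in> carrier M \<Longrightarrow> y \<in> carrier N \<Longrightarrow> P (tens x y)" and "P \<one>\<^bsub>T\<^esub>"
    and "\<And>U V. U \<in> carrier T \<Longrightarrow> V \<in> carrier T \<Longrightarrow> P U \<Longrightarrow> P V \<Longrightarrow> P (U \<otimes>\<^bsub>T\<^esub> V)"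
    and "\<And>U. U \<in> carrier T \<Longrightarrow> P U \<Longrightarrow> P (inv\<^bsub>T\<^esub> U)"
  shows "P U"
  using assms unfolding T_Q tens_cls by (intro Q_induct[of U P]) auto

text \<open>The target is the field of complex numbers: elements of the tensor products will be told
  apart by functionals.\<close>

definition balanced :: "('a \<Rightarrow> 'b \<Rightarrow> complex) \<Rightarrow> bool"
  where "balanced \<beta> \<longleftrightarrow>
    (\<forall>x\<in>carrier M. \<forall>x'\<in>carrier M. \<forall>y\<in>carrier N. \<beta> (x \<oplus>\<^bsub>M\<^esub> x') y = \<beta> x y + \<beta> x' y) \<and>
    (\<forall>x\<in>carrier M. \<forall>y\<in>carrier N. \<forall>y'\<in>carrier N. \<beta> x (y \<oplus>\<^bsub>N\<^esub> y') = \<beta> x y + \<beta> x y') \<and>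
    (\<forall>r\<in>carrier R. \<forall>x\<in>carrier M. \<forall>y\<in>carrier N. \<beta> (r \<odot>\<^bsub>M\<^esub> x) y = \<beta> x (r \<odot>\<^bsub>N\<^esub> y))"

definition lift :: "('a \<Rightarrow> 'b \<Rightarrow> complex) \<Rightarrow> ('a \<times> 'b \<Rightarrow>\<^sub>0 int) set \<Rightarrow> complex"
  where "lift \<beta> = eval (case_prod \<beta>)"

context
  fixes \<beta> assumes b: "balanced \<beta>"
begin

lemma balanced_rels: "r \<in> tensor_rels R M N \<Longrightarrow> frag_eval (case_prod \<beta>) r = 0"
  using b unfolding tensor_rels_def balanced_def
  by (elim UnE CollectE exE conjE) (auto simp: frag_eval_diff)

lemma lift_tens: "x \<in> carrier M \<Longrightarrow> y \<in> carrier N \<Longrightarrow> lift \<beta> (tens x y) = \<beta> x y"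
  unfolding lift_def tens_cls by (subst eval_cls[OF balanced_rels]) auto

lemma lift_mult: "U \<in> carrier T \<Longrightarrow> V \<in> carrier T \<Longrightarrow> lift \<beta> (U \<otimes>\<^bsub>T\<^esub> V) = lift \<beta> U + lift \<beta> V"
  unfolding lift_def T_Q by (rule eval_mult[OF balanced_rels])

lemma lift_one: "lift \<beta> \<one>\<^bsub>T\<^esub> = 0"
  unfolding lift_def T_Q by (rule eval_one[OF balanced_rels])

end

end

section \<open>Tensor products over the polynomial ring\<close>

lemma Cz_module_simps [simp]:
  "carrier (Cz_module t M) = carrier M" "(\<oplus>\<^bsub>Cz_module t M\<^esub>) = (\<oplus>\<^bsub>M\<^esub>)"
  "r \<odot>\<^bsub>Cz_module t M\<^esub> v = gwa_poly t r \<odot>\<^bsub>M\<^esub> v" "\<zero>\<^bsub>Cz_module t M\<^esub> = \<zero>\<^bsub>M\<^esub>"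
  by (simp_all add: Cz_module_def ring.defs module.defs)

lemma tensor_setup_Cz:
  assumes "gwa_module t M" "gwa_module t' M'"
  shows "tensor_setup Cz_ring (Cz_module t M) (Cz_module t' M')"
proof -
  interpret M: gwa_module t M by fact
  interpret M': gwa_module t' M' by fact
  show ?thesis by unfold_locales auto
qed

text \<open>Coefficients are extended by zero. For tensor products this brings the slices {z} x B to
  the common index set A x B.\<close>

lemma (in gwa_module) lin_reindex_superset:
  assumes "finite B" "finite A" "inj_on g B" "g ` B \<subseteq> A" "\<And>a. a \<in> A \<Longrightarrow> \<gamma> a \<in> carrier M"
  shows "lin B (\<gamma> \<circ> g) h = lin A \<gamma> (\<lambda>a. if a \<in> g ` B then h (inv_into B g a) else 0)"
proof -
  have "lin A \<gamma> (\<lambda>a. if a \<in> g ` B then h (inv_into B g a) else 0)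
      = (\<Oplus>\<^bsub>M\<^esub>a\<in>g ` B. sc (if a \<in> g ` B then h (inv_into B g a) else 0) (\<gamma> a))"
    unfolding lin_def by (rule M.add.finprod_mono_neutral_cong_right) (use assms in auto)
  also have "\<dots> = (\<Oplus>\<^bsub>M\<^esub>b\<in>B. sc (if g b \<in> g ` B then h (inv_into B g (g b)) else 0) (\<gamma> (g b)))"
    by (rule M.finsum_reindex) (use assms in auto)
  also have "\<dots> = lin B (\<gamma> \<circ> g) h"
    unfolding lin_def by (rule M.finsum_cong') (use assms in auto)
  finally show ?thesis by simp
qed

text \<open>Polynomials can be moved from one factor to the other, so only pairs of equal weight
  survive and the weight space of N at k is the tensor product of those of M and M'. Tensors of
  basis vectors span by additivity. They are independent because products of coordinate functions
  are balanced and so descend to the tensor product.\<close>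

theorem is_tensor_dimw:
  assumes "findim_mod t M" "findim_mod t' M'" "findim_mod (t * t') N" "is_tensor t t' M M' N"
  shows "gwa_module.dimw (t * t') N k = gwa_module.dimw t M k * gwa_module.dimw t' M' k"
proof -
  interpret M: findim_mod t M by fact
  interpret M': findim_mod t' M' by fact
  interpret N: findim_mod "t * t'" N by fact
  interpret T: tensor_setup Cz_ring "Cz_module t M" "Cz_module t' M'"
    by (rule tensor_setup_Cz[OF M.gwa_module_axioms M'.gwa_module_axioms])
  obtain \<phi> where \<phi>: "\<phi> \<in> iso T.T (add_monoid N)"
    and act: "\<And>r v v'. v \<in> carrier M \<Longrightarrow> v' \<in> carrier M' \<Longrightarrow>
      N.pa r (\<phi> (T.tens v v')) = \<phi> (T.tens (M.pa r v) v')"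
    using assms(4) unfolding is_tensor_def Let_def by blast
  have \<phi>c: "\<phi> U \<in> carrier N" if "U \<in> carrier T.T" for U
    using \<phi> that by (auto simp: iso_def hom_def)
  have \<phi>m: "\<phi> (U \<otimes>\<^bsub>T.T\<^esub> V) = \<phi> U \<oplus>\<^bsub>N\<^esub> \<phi> V" if "U \<in> carrier T.T" "V \<in> carrier T.T" for U V
    using \<phi> that by (auto simp: iso_def hom_def)
  have \<phi>b: "bij_betw \<phi> (carrier T.T) (carrier N)" using \<phi> by (auto simp: iso_def)
  have \<phi>1: "\<phi> \<one>\<^bsub>T.T\<^esub> = \<zero>\<^bsub>N\<^esub>"
  proof -
    have "\<phi> \<one>\<^bsub>T.T\<^esub> \<oplus>\<^bsub>N\<^esub> \<phi> \<one>\<^bsub>T.T\<^esub> = \<phi> \<one>\<^bsub>T.T\<^esub>" using \<phi>m[of "\<one>\<^bsub>T.T\<^esub>" "\<one>\<^bsub>T.T\<^esub>"] by simp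
    then show ?thesis using \<phi>c[of "\<one>\<^bsub>T.T\<^esub>"] N.M.add.l_cancel_one[of "\<phi> \<one>\<^bsub>T.T\<^esub>" "\<phi> \<one>\<^bsub>T.T\<^esub>"] by simp
  qed
  define \<tau> where "\<tau> v v' = \<phi> (T.tens v v')" for v v'
  have \<tau>c: "\<tau> v v' \<in> carrier N" if "v \<in> carrier M" "v' \<in> carrier M'" for v v'
    using that \<phi>c by (simp add: \<tau>_def)
  have \<tau>l: "\<tau> (v \<oplus>\<^bsub>M\<^esub> w) v' = \<tau> v v' \<oplus>\<^bsub>N\<^esub> \<tau> w v'"
    if "v \<in> carrier M" "w \<in> carrier M" "v' \<in> carrier M'" for v w v'
    using T.tens_add_left[of v w v'] that \<phi>m by (simp add: \<tau>_def)
  have \<tau>r: "\<tau> v (v' \<oplus>\<^bsub>M'\<^esub> w) = \<tau> v v' \<oplus>\<^bsub>N\<^esub> \<tau> v w"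
    if "v \<in> carrier M" "w \<in> carrier M'" "v' \<in> carrier M'" for v w v'
    using T.tens_add_right[of v v' w] that \<phi>m by (simp add: \<tau>_def)
  have \<tau>p: "N.pa r (\<tau> v v') = \<tau> (M.pa r v) v'" "N.pa r (\<tau> v v') = \<tau> v (M'.pa r v')"
    if "v \<in> carrier M" "v' \<in> carrier M'" for r v v'
    using act that T.tens_balanced[of r v v'] by (simp_all add: \<tau>_def)
  have \<tau>z: "\<tau> \<zero>\<^bsub>M\<^esub> v' = \<zero>\<^bsub>N\<^esub>" if "v' \<in> carrier M'" for v'
    using T.tens_idem_left[of "\<zero>\<^bsub>M\<^esub>" v'] that \<phi>1 by (simp add: \<tau>_def)
  have \<tau>z': "\<tau> v \<zero>\<^bsub>M'\<^esub> = \<zero>\<^bsub>N\<^esub>" if "v \<in> carrier M" for v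
    using T.tens_idem_right[of v "\<zero>\<^bsub>M'\<^esub>"] that \<phi>1 by (simp add: \<tau>_def)
  have \<tau>w: "\<tau> v v' \<in> N.wsp k" if "v \<in> M.wsp k" "v' \<in> carrier M'" for v v'
    using that \<tau>p(1)[of v v' "[:- of_int k, 1:]"] \<tau>z \<tau>c by (simp add: N.wsp_def M.wsp_def)
  \<comment> \<open>If q and q' certify the components in the two factors, then q q' certifies their
    tensor: q acts through the left factor and q' through the right one.\<close>
  have \<tau>prj: "N.prj k (\<tau> v v') = \<tau> (M.prj k v) (M'.prj k v')"
    if v: "v \<in> carrier M" and v': "v' \<in> carrier M'" for v v'
  proof (rule N.prj_eqI)
    show "\<tau> v v' \<in> carrier N" using v v' by (rule \<tau>c)
    define u where "u = M.prj k v"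
    define u' where "u' = M'.prj k v'"
    have uc: "u \<in> carrier M" "u' \<in> carrier M'" using v v' by (auto simp: u_def u'_def)
    obtain q where q: "poly q (of_int k) \<noteq> 0" "M.pa q (v \<ominus>\<^bsub>M\<^esub> u) = \<zero>\<^bsub>M\<^esub>"
      using M.is_prj_prj[OF v] unfolding M.is_prj_def u_def by blast
    obtain q' where q': "poly q' (of_int k) \<noteq> 0" "M'.pa q' (v' \<ominus>\<^bsub>M'\<^esub> u') = \<zero>\<^bsub>M'\<^esub>"
      using M'.is_prj_prj[OF v'] unfolding M'.is_prj_def u'_def by blast
    have "M.pa q v = M.pa q u" using q(2) v uc by (simp add: M.smult_diff M.diff_eq_zero)
    then have 1: "N.pa q (\<tau> v v') = N.pa q (\<tau> u v')" using \<tau>p(1) v v' uc by simp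
    have "M'.pa q' v' = M'.pa q' u'" using q'(2) v' uc by (simp add: M'.smult_diff M'.diff_eq_zero)
    then have 2: "N.pa q' (\<tau> u v') = N.pa q' (\<tau> u u')" using \<tau>p(2) v' uc by simp
    have "N.pa (q * q') (\<tau> v v') = N.pa q' (N.pa q (\<tau> v v'))"
      using \<tau>c v v' by (simp add: mult.commute[of q] N.pa_mult)
    also have "\<dots> = N.pa q (N.pa q' (\<tau> u v'))" unfolding 1 using \<tau>c v' uc by (intro N.pa_commute) simp
    also have "\<dots> = N.pa (q * q') (\<tau> u u')" unfolding 2 using \<tau>c uc by (simp add: N.pa_mult)
    finally have "N.pa (q * q') (\<tau> v v' \<ominus>\<^bsub>N\<^esub> \<tau> u u') = \<zero>\<^bsub>N\<^esub>"
      using \<tau>c v v' uc by (simp add: N.smult_diff N.diff_eq_zero)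
    moreover have "\<tau> u u' \<in> N.wsp k" using \<tau>w M.prj_wsp[OF v] uc by (simp add: u_def)
    ultimately show "N.is_prj k (\<tau> v v') (\<tau> (M.prj k v) (M'.prj k v'))"
      unfolding N.is_prj_def u_def[symmetric] u'_def[symmetric] using q(1) q'(1)
      by (intro conjI exI[of _ "q * q'"]) auto
  qed
  obtain A where A: "M.basis k A (\<lambda>b. b)" using M.ex_basis by blast
  obtain B where B: "M'.basis k B (\<lambda>b. b)" using M'.ex_basis by blast
  note a = M.basisD[OF A] and b = M'.basisD[OF B]
  define \<gamma> where "\<gamma> = case_prod \<tau>"
  have \<gamma>w: "\<gamma> p \<in> N.wsp k" if "p \<in> A \<times> B" for p using that a(2) b(3) \<tau>w by (auto simp: \<gamma>_def)
  note \<gamma>c = N.wsp_carrier[OF \<gamma>w]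
  have fAB: "finite (A \<times> B)" using a(1) b(1) by simp
  have "\<exists>h. \<tau> x y = N.lin (A \<times> B) \<gamma> h" if xy: "x \<in> M.wsp k" "y \<in> M'.wsp k" for x y
  proof -
    obtain h where h: "x = M.lin A (\<lambda>b. b) h" using a(4) xy by blast
    obtain h' where h': "y = M'.lin B (\<lambda>b. b) h'" using b(4) xy by blast
    have yc: "y \<in> carrier M'" using xy M'.wsp_carrier by blast
    have "\<tau> x y = N.lin A (\<lambda>z. \<tau> z y) h"
      unfolding h using M.lin_map[OF a(1) N.gwa_module_axioms, of "\<lambda>b. b" "\<lambda>z. \<tau> z y" h] a(3) yc \<tau>c \<tau>l \<tau>z \<tau>p(1)
      by (simp add: comp_def)
    also have "\<dots> = N.lin A (\<lambda>z. N.lin B (\<lambda>w. \<tau> z w) h') h"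
    proof (rule N.lin_cong)
      fix z assume z: "z \<in> A"
      show "\<tau> z y = N.lin B (\<lambda>w. \<tau> z w) h'"
        unfolding h' using M'.lin_map[OF b(1) N.gwa_module_axioms, of "\<lambda>b. b" "\<tau> z" h'] b(3) a(3)[OF z]
          \<tau>c \<tau>r \<tau>z' \<tau>p(2) by (simp add: comp_def)
      show "\<tau> z y \<in> carrier N" using \<tau>c yc a(3)[OF z] by simp
    qed auto
    also have "\<dots> = N.lin A (\<lambda>z. N.lin (A \<times> B) \<gamma>
        (\<lambda>p. if p \<in> Pair z ` B then h' (inv_into B (Pair z) p) else 0)) h"
    proof (rule N.lin_cong)
      fix z assume z: "z \<in> A"
      have "N.lin B (\<gamma> \<circ> Pair z) h' =
          N.lin (A \<times> B) \<gamma> (\<lambda>p. if p \<in> Pair z ` B then h' (inv_into B (Pair z) p) else 0)"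
        by (rule N.lin_reindex_superset) (use b(1) fAB \<gamma>c z in \<open>auto intro: inj_onI\<close>)
      moreover have "\<gamma> \<circ> Pair z = \<tau> z" by (auto simp: \<gamma>_def)
      ultimately show "N.lin B (\<lambda>w. \<tau> z w) h' =
          N.lin (A \<times> B) \<gamma> (\<lambda>p. if p \<in> Pair z ` B then h' (inv_into B (Pair z) p) else 0)" by simp
      show "N.lin B (\<lambda>w. \<tau> z w) h' \<in> carrier N" using \<tau>c a(3)[OF z] b(3) by simp
    qed auto
    also have "\<dots> = N.lin (A \<times> B) \<gamma> (\<lambda>p. \<Sum>z\<in>A. h z *
        (if p \<in> Pair z ` B then h' (inv_into B (Pair z) p) else 0))"
      by (rule N.lin_lin[OF fAB a(1)]) (rule \<gamma>c)
    finally show ?thesis by blast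
  qed
  then have pure: "\<exists>h. N.prj k (\<tau> v v') = N.lin (A \<times> B) \<gamma> h" if "v \<in> carrier M" "v' \<in> carrier M'" for v v'
    using \<tau>prj[OF that] M.prj_wsp[OF that(1)] M'.prj_wsp[OF that(2)] by simp
  have span: "\<exists>h. N.prj k (\<phi> U) = N.lin (A \<times> B) \<gamma> h" if "U \<in> carrier T.T" for U
    using that
  proof (induction U rule: T.tens_induct)
    case (tens x y)
    then show ?case using pure[of x y] by (simp add: \<tau>_def)
  next
    case one
    show ?case using N.lin_zero[of "A \<times> B" \<gamma>] \<gamma>c \<phi>1 by (intro exI[of _ "\<lambda>_. 0"]) simp
  next
    case (mult U V)
    then obtain h h' where "N.prj k (\<phi> U) = N.lin (A \<times> B) \<gamma> h" "N.prj k (\<phi> V) = N.lin (A \<times> B) \<gamma> h'" by blast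
    then have "N.prj k (\<phi> (U \<otimes>\<^bsub>T.T\<^esub> V)) = N.lin (A \<times> B) \<gamma> (\<lambda>a. h a + h' a)"
      using mult \<phi>c \<gamma>c by (simp add: \<phi>m N.prj_add N.lin_add)
    then show ?case by blast
  next
    case (inv U)
    then obtain h where h: "N.prj k (\<phi> U) = N.lin (A \<times> B) \<gamma> h" by blast
    have "\<phi> (inv\<^bsub>T.T\<^esub> U) \<oplus>\<^bsub>N\<^esub> \<phi> U = \<zero>\<^bsub>N\<^esub>" using \<phi>m[of "inv\<^bsub>T.T\<^esub> U" U] inv \<phi>1 by simp
    then have "\<phi> (inv\<^bsub>T.T\<^esub> U) = \<ominus>\<^bsub>N\<^esub> \<phi> U" using inv \<phi>c by (intro N.M.minus_equality[symmetric]) auto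
    also have "\<dots> = N.sc (-1) (\<phi> U)" using N.pa_minus[of "\<phi> U" 1] inv \<phi>c by (simp add: one_pCons)
    finally have "N.prj k (\<phi> (inv\<^bsub>T.T\<^esub> U)) = N.lin (A \<times> B) \<gamma> (\<lambda>a. (-1) * h a)"
      using inv \<phi>c \<gamma>c fAB h by (simp add: N.prj_pa N.lin_sc)
    then show ?case by blast
  qed
  \<comment> \<open>Coordinates of the component of weight k. They are defined on the whole module
    and not only on the weight space, because a functional on the tensor product has to be given on
    all pairs.\<close>
  define co where "co v = (SOME h. M.prj k v = M.lin A (\<lambda>b. b) h)" for v
  define co' where "co' v = (SOME h. M'.prj k v = M'.lin B (\<lambda>b. b) h)" for v
  have co: "M.prj k v = M.lin A (\<lambda>b. b) (co v)" if "v \<in> carrier M" for v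
    using someI_ex[OF a(4)[OF M.prj_wsp[OF that]]] by (simp add: co_def)
  have co': "M'.prj k v = M'.lin B (\<lambda>b. b) (co' v)" if "v \<in> carrier M'" for v
    using someI_ex[OF b(4)[OF M'.prj_wsp[OF that]]] by (simp add: co'_def)
  have coI: "co v x = h x" if "v \<in> carrier M" "M.prj k v = M.lin A (\<lambda>b. b) h" "x \<in> A" for v h x
    using M.basis_coeff_unique[OF A _ that(3), of "co v" h] co[OF that(1)] that(2) by simp
  have coI': "co' v x = h x" if "v \<in> carrier M'" "M'.prj k v = M'.lin B (\<lambda>b. b) h" "x \<in> B" for v h x
    using M'.basis_coeff_unique[OF B _ that(3), of "co' v" h] co'[OF that(1)] that(2) by simp
  have co_add: "co (v \<oplus>\<^bsub>M\<^esub> w) x = co v x + co w x" if "v \<in> carrier M" "w \<in> carrier M" "x \<in> A" for v w x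
    using that a(3) by (intro coI) (auto simp: M.prj_add co M.lin_add)
  have co'_add: "co' (v \<oplus>\<^bsub>M'\<^esub> w) x = co' v x + co' w x" if "v \<in> carrier M'" "w \<in> carrier M'" "x \<in> B" for v w x
    using that b(3) by (intro coI') (auto simp: M'.prj_add co' M'.lin_add)
  have co_pa: "co (M.pa r v) x = poly r (of_int k) * co v x" if v: "v \<in> carrier M" "x \<in> A" for r v x
  proof (rule coI[OF _ _ v(2)])
    have "M.prj k (M.pa r v) = M.sc (poly r (of_int k)) (M.prj k v)"
      unfolding M.prj_pa[OF v(1)] by (rule M.wsp_pa[OF M.prj_wsp[OF v(1)]])
    then show "M.prj k (M.pa r v) = M.lin A (\<lambda>b. b) (\<lambda>x. poly r (of_int k) * co v x)"
      using co[OF v(1)] a by (simp add: M.lin_sc)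
  qed (use v in simp)
  have co'_pa: "co' (M'.pa r v) x = poly r (of_int k) * co' v x" if v: "v \<in> carrier M'" "x \<in> B" for r v x
  proof (rule coI'[OF _ _ v(2)])
    have "M'.prj k (M'.pa r v) = M'.sc (poly r (of_int k)) (M'.prj k v)"
      unfolding M'.prj_pa[OF v(1)] by (rule M'.wsp_pa[OF M'.prj_wsp[OF v(1)]])
    then show "M'.prj k (M'.pa r v) = M'.lin B (\<lambda>b. b) (\<lambda>x. poly r (of_int k) * co' v x)"
      using co'[OF v(1)] b by (simp add: M'.lin_sc)
  qed (use v in simp)
  have co_delta: "co z x = (if x = z then 1 else 0)" if "z \<in> A" "x \<in> A" for z x
    using that a M.lin_delta[OF a(1) that(1), of "\<lambda>b. b" 1] by (intro coI) (auto simp: M.prj_self)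
  have co'_delta: "co' z x = (if x = z then 1 else 0)" if "z \<in> B" "x \<in> B" for z x
    using that b M'.lin_delta[OF b(1) that(1), of "\<lambda>b. b" 1] by (intro coI') (auto simp: M'.prj_self)
  have "N.basis k (A \<times> B) \<gamma>"
    unfolding N.basis_def
  proof (intro conjI ballI allI impI fAB \<gamma>w)
    show "\<exists>h. v = N.lin (A \<times> B) \<gamma> h" if v: "v \<in> N.wsp k" for v
    proof -
      have "v \<in> \<phi> ` carrier T.T" using \<phi>b N.wsp_carrier[OF v] by (simp add: bij_betw_def)
      then obtain U where "U \<in> carrier T.T" "v = \<phi> U" by blast
      then show ?thesis using span[of U] N.prj_self[OF v] by simp
    qed
    fix h p assume 0: "N.lin (A \<times> B) \<gamma> h = \<zero>\<^bsub>N\<^esub>" and p: "p \<in> A \<times> B"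
    obtain x y where xy: "p = (x, y)" "x \<in> A" "y \<in> B" using p by blast
    \<comment> \<open>Reads off the coefficient at the pair (x, y). A polynomial r acts on either
      coordinate as the scalar r(k), which makes the form balanced.\<close>
    define \<beta> where "\<beta> v v' = co v x * co' v' y" for v v'
    have bal: "T.balanced \<beta>"
      unfolding T.balanced_def \<beta>_def using xy
      by (simp add: co_add co'_add co_pa co'_pa algebra_simps)
    define \<Lambda> where "\<Lambda> n = T.lift \<beta> (inv_into (carrier T.T) \<phi> n)" for n
    have \<Lambda>\<phi>: "\<Lambda> (\<phi> U) = T.lift \<beta> U" if "U \<in> carrier T.T" for U
      using that \<phi>b by (simp add: \<Lambda>_def bij_betw_def)
    have \<Lambda>add: "\<Lambda> (n \<oplus>\<^bsub>N\<^esub> n') = \<Lambda> n + \<Lambda> n'" if n: "n \<in> carrier N" "n' \<in> carrier N" for n n'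
    proof -
      have "n \<in> \<phi> ` carrier T.T" "n' \<in> \<phi> ` carrier T.T" using \<phi>b n by (simp_all add: bij_betw_def)
      then obtain U V where UV: "U \<in> carrier T.T" "n = \<phi> U" "V \<in> carrier T.T" "n' = \<phi> V" by blast
      have "\<Lambda> (n \<oplus>\<^bsub>N\<^esub> n') = \<Lambda> (\<phi> (U \<otimes>\<^bsub>T.T\<^esub> V))" using UV \<phi>m by simp
      also have "\<dots> = T.lift \<beta> U + T.lift \<beta> V" using UV T.lift_mult[OF bal] by (simp add: \<Lambda>\<phi>)
      finally show ?thesis using UV by (simp add: \<Lambda>\<phi>)
    qed
    have \<Lambda>0: "\<Lambda> \<zero>\<^bsub>N\<^esub> = 0" using \<Lambda>\<phi>[of "\<one>\<^bsub>T.T\<^esub>"] \<phi>1 T.lift_one[OF bal] by simp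
    have \<Lambda>\<gamma>: "\<Lambda> (N.sc c (\<gamma> q)) = (if q = p then c else 0)" if q: "q \<in> A \<times> B" for c q
    proof -
      obtain x' y' where q': "q = (x', y')" "x' \<in> A" "y' \<in> B" using q by blast
      have "N.sc c (\<gamma> q) = \<phi> (T.tens (M.sc c x') y')"
        using q' a(3) b(3) \<tau>p(1)[of x' y'] by (simp add: \<gamma>_def \<tau>_def)
      then have "\<Lambda> (N.sc c (\<gamma> q)) = \<beta> (M.sc c x') y'"
        using q' a(3) b(3) T.lift_tens[OF bal] by (simp add: \<Lambda>\<phi>)
      then show ?thesis using q' xy a(3) by (simp add: \<beta>_def co_pa co_delta co'_delta)
    qed
    have "\<Lambda> (N.lin C \<gamma> h) = (\<Sum>q\<in>C. if q = p then h q else 0)" if "finite C" "C \<subseteq> A \<times> B" for C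
      using that
    proof (induction C rule: finite_induct)
      case (insert q C)
      then have "N.lin (insert q C) \<gamma> h = N.sc (h q) (\<gamma> q) \<oplus>\<^bsub>N\<^esub> N.lin C \<gamma> h"
        using \<gamma>c by (intro N.lin_insert) auto
      moreover have "N.lin C \<gamma> h \<in> carrier N" using \<gamma>c insert by (intro N.lin_closed) blast
      moreover have "\<gamma> q \<in> carrier N" using \<gamma>c insert by blast
      ultimately show ?case using insert \<Lambda>add \<Lambda>\<gamma> by auto
    qed (simp add: \<Lambda>0)
    from this[OF fAB] have "\<Lambda> (N.lin (A \<times> B) \<gamma> h) = h p" using fAB p by (simp add: sum.delta)
    then show "h p = 0" using 0 \<Lambda>0 by simp
  qed
  then have "N.dimw k = card (A \<times> B)" by (rule N.dimw_basis)
  then show ?thesis using M.dimw_basis[OF A] M'.dimw_basis[OF B] by (simp add: card_cartesian_product)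
qed

text \<open>Newton's form: the value at the new node is corrected by a multiple of the polynomial
  that vanishes at the old ones.\<close>

lemma poly_interpolation:
  assumes "finite K"
  shows "\<exists>r :: complex poly. \<forall>k\<in>K. poly r (of_int k) = g k"
  using assms
proof (induction K rule: finite_induct)
  case (insert a K)
  then obtain r where r: "\<forall>k\<in>K. poly r (of_int k) = g k" by blast
  define p where "p = (\<Prod>l\<in>K. [:- of_int l, 1:] :: complex poly)"
  have p0: "poly p (of_int l) = 0 \<longleftrightarrow> l \<in> K" for l
    using insert(1) by (auto simp: p_def poly_prod)
  define c where "c = (g a - poly r (of_int a)) / poly p (of_int a)"
  have "poly p (of_int a) \<noteq> 0" using p0[of a] insert(2) by simp
  then have "\<forall>k\<in>insert a K. poly (r + smult c p) (of_int k) = g k"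
    using p0 r by (auto simp: c_def)
  then show ?case by blast
qed simp

lemma admissible_mult: "admissible t I \<Longrightarrow> admissible t' J \<Longrightarrow> admissible (t * t') (I \<inter> J)"
  unfolding admissible_def by auto

definition one_on :: "int set \<Rightarrow> int \<Rightarrow> complex"
  where "one_on K = (\<lambda>k. if k \<in> K then 1 else 0)"

lemma one_on_fin_fun: "finite K \<Longrightarrow> K \<subseteq> I \<Longrightarrow> one_on K \<in> fin_fun I"
  by (auto simp: one_on_def fin_fun_def)

text \<open>Every element of the tensor product of two such modules is a pure tensor
  \<open>f \<otimes> 1\<^sub>K\<close>: interpolating \<^term>\<open>g\<close> by a polynomial moves it to the left factor.\<close>

theorem is_tensor_std_copy:
  fixes j :: "(int \<Rightarrow> complex) \<Rightarrow> 'u"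
  assumes adm: "admissible t I" "admissible t' J" and j: "inj j"
  shows "is_tensor t t' (std_copy j t I) (std_copy j t' J) (std_copy j (t * t') (I \<inter> J))"
proof -
  let ?M = "std_copy j t I" and ?M' = "std_copy j t' J" and ?N = "std_copy j (t * t') (I \<inter> J)"
  have adm': "admissible (t * t') (I \<inter> J)" by (rule admissible_mult[OF adm])
  note s = std_copy_iso[OF adm(1) j] and s' = std_copy_iso[OF adm(2) j] and n = std_copy_iso[OF adm' j]
  note sh = module_homD[OF s(2)] and sh' = module_homD[OF s'(2)] and nh = module_homD[OF n(2)]
  interpret M: gwa_module t ?M using s(1) by (simp add: gwa_module_def)
  interpret M': gwa_module t' ?M' using s'(1) by (simp add: gwa_module_def)
  interpret N: gwa_module "t * t'" ?N using n(1) by (simp add: gwa_module_def)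
  interpret T: tensor_setup Cz_ring "Cz_module t ?M" "Cz_module t' ?M'"
    by (rule tensor_setup_Cz[OF M.gwa_module_axioms M'.gwa_module_axioms])
  have cM: "carrier ?M = j ` fin_fun I" and cM': "carrier ?M' = j ` fin_fun J"
    and cN: "carrier ?N = j ` fin_fun (I \<inter> J)"
    using s(3) s'(3) n(3) by (auto simp: bij_betw_def)
  have jM: "j f \<in> carrier ?M" if "f \<in> fin_fun I" for f using that cM by simp
  have jM': "j f \<in> carrier ?M'" if "f \<in> fin_fun J" for f using that cM' by simp
  define te where "te f g = T.tens (j f) (j g)" for f g
  have tec: "te f g \<in> carrier T.T" if "f \<in> fin_fun I" "g \<in> fin_fun J" for f g
    using that jM jM' by (simp add: te_def)
  have te_add: "te (\<lambda>k. f k + f' k) g = te f g \<otimes>\<^bsub>T.T\<^esub> te f' g"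
    if "f \<in> fin_fun I" "f' \<in> fin_fun I" "g \<in> fin_fun J" for f f' g
    using T.tens_add_left[of "j f" "j f'" "j g"] jM jM' that sh(2)[of f f'] by (simp add: te_def)
  have te_bal: "te (\<lambda>k. poly r (of_int k) * f k) g = te f (\<lambda>k. poly r (of_int k) * g k)"
    if "f \<in> fin_fun I" "g \<in> fin_fun J" for f g r
    using T.tens_balanced[of r "j f" "j g"] jM jM' that sh(3)[of "gwa_poly t r" f]
      sh'(3)[of "gwa_poly t' r" g] by (simp add: te_def std_module_gens adm)
  have fun_prod: "(\<lambda>k. f k * g k) \<in> fin_fun (I \<inter> J)" if "f \<in> fin_fun I" "g \<in> fin_fun J" for f g
    using that unfolding fin_fun_def by (auto intro: finite_subset[of _ "{k. f k \<noteq> 0}"])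
  have sub: "f \<in> fin_fun I" if "f \<in> fin_fun (I \<inter> J)" for f using that by (auto simp: fin_fun_def)
  have key: "te f g = te (\<lambda>k. f k * g k) (one_on K)"
    if f: "f \<in> fin_fun I" and g: "g \<in> fin_fun J" and K: "finite K" "{k. g k \<noteq> 0} \<subseteq> K" "K \<subseteq> J" for f g K
  proof -
    \<comment> \<open>The nodes include the support of f, so that r f and f g agree
      everywhere.\<close>
    define F where "F = {k. f k \<noteq> 0} \<union> K"
    have F: "finite F" using f K by (simp add: F_def fin_fun_def)
    obtain r where r: "\<And>k. k \<in> F \<Longrightarrow> poly r (of_int k) = g k" using poly_interpolation[OF F, of g] by blast
    have "g = (\<lambda>k. poly r (of_int k) * one_on K k)"
      using r K(2) by (auto simp: one_on_def F_def fun_eq_iff)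
    then have "te f g = te f (\<lambda>k. poly r (of_int k) * one_on K k)" by simp
    also have "\<dots> = te (\<lambda>k. poly r (of_int k) * f k) (one_on K)"
      using te_bal[of f "one_on K" r] f one_on_fin_fun[OF K(1,3)] by simp
    also have "(\<lambda>k. poly r (of_int k) * f k) = (\<lambda>k. f k * g k)"
      using r by (auto simp: F_def fun_eq_iff)
    finally show ?thesis .
  qed
  have supp: "finite {k. g k \<noteq> 0}" "{k. g k \<noteq> 0} \<subseteq> J" if "g \<in> fin_fun J" for g
    using that by (auto simp: fin_fun_def)
  \<comment> \<open>The set K may grow once it contains the support of c. This brings two pure
    tensors to a common second factor, where they can be added.\<close>
  have enlarge: "te c (one_on K) = te c (one_on K')"
    if "c \<in> fin_fun (I \<inter> J)" "{k. c k \<noteq> 0} \<subseteq> K" "K \<subseteq> K'" "finite K'" "K' \<subseteq> J" for c K K'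
  proof -
    have "finite K" using that finite_subset by blast
    then have "te c (one_on K) = te (\<lambda>k. c k * one_on K k) (one_on K')"
      using that by (intro key sub one_on_fin_fun) (auto simp: one_on_def)
    also have "(\<lambda>k. c k * one_on K k) = c" using that by (auto simp: one_on_def fun_eq_iff)
    finally show ?thesis .
  qed
  have te0: "te (\<lambda>k. 0) g = \<one>\<^bsub>T.T\<^esub>" if "g \<in> fin_fun J" for g
    using te_add[of "\<lambda>k. 0" "\<lambda>k. 0" g] tec[of "\<lambda>k. 0" g] that fin_fun_zero
      T.T.l_cancel_one[of "te (\<lambda>k. 0) g" "te (\<lambda>k. 0) g"] by simp
  define good where "good U \<longleftrightarrow> (\<exists>c K. c \<in> fin_fun (I \<inter> J) \<and> {k. c k \<noteq> 0} \<subseteq> K \<and> finite K \<and> K \<subseteq> J \<and>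
    U = te c (one_on K))" for U
  have good: "good U" if "U \<in> carrier T.T" for U
    using that
  proof (induction U rule: T.tens_induct)
    case (tens x y)
    then obtain f g where fg: "f \<in> fin_fun I" "g \<in> fin_fun J" "x = j f" "y = j g"
      using cM cM' by auto
    have "te f g = te (\<lambda>k. f k * g k) (one_on {k. g k \<noteq> 0})" using key fg supp by blast
    then show ?case unfolding good_def fg te_def[symmetric]
      using fun_prod[OF fg(1,2)] supp[OF fg(2)]
      by (intro exI[of _ "\<lambda>k. f k * g k"] exI[of _ "{k. g k \<noteq> 0}"]) auto
  next
    case one
    show ?case unfolding good_def using te0[of "one_on {}"] one_on_fin_fun[of "{}" J] fin_fun_zero
      by (intro exI[of _ "\<lambda>k. 0"] exI[of _ "{}"]) auto
  next
    case (mult U V)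
    then obtain c K c' K' where c: "c \<in> fin_fun (I \<inter> J)" "{k. c k \<noteq> 0} \<subseteq> K" "finite K" "K \<subseteq> J"
      "U = te c (one_on K)" "c' \<in> fin_fun (I \<inter> J)" "{k. c' k \<noteq> 0} \<subseteq> K'" "finite K'" "K' \<subseteq> J"
      "V = te c' (one_on K')" unfolding good_def by blast
    have "U = te c (one_on (K \<union> K'))" unfolding c(5) using c by (intro enlarge) auto
    moreover have "V = te c' (one_on (K \<union> K'))" unfolding c(10) using c by (intro enlarge) auto
    ultimately have "U \<otimes>\<^bsub>T.T\<^esub> V = te (\<lambda>k. c k + c' k) (one_on (K \<union> K'))"
      using te_add[of c c' "one_on (K \<union> K')"] c sub one_on_fin_fun[of "K \<union> K'" J] by simp
    moreover have "{k. c k + c' k \<noteq> 0} \<subseteq> K \<union> K'"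
    proof
      fix x assume "x \<in> {k. c k + c' k \<noteq> 0}"
      then have "c x \<noteq> 0 \<or> c' x \<noteq> 0" by auto
      then show "x \<in> K \<union> K'" using c(2,7) by blast
    qed
    ultimately show ?case unfolding good_def using c fin_fun_add[OF c(1,6)]
      by (intro exI[of _ "\<lambda>k. c k + c' k"] exI[of _ "K \<union> K'"]) auto
  next
    case (inv U)
    then obtain c K where c: "c \<in> fin_fun (I \<inter> J)" "{k. c k \<noteq> 0} \<subseteq> K" "finite K" "K \<subseteq> J"
      "U = te c (one_on K)" unfolding good_def by blast
    have m: "(\<lambda>k. - c k) \<in> fin_fun (I \<inter> J)" using fin_fun_scale[OF c(1), of "\<lambda>_. -1"] by simp
    have o: "one_on K \<in> fin_fun J" using c one_on_fin_fun by blast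
    have "te (\<lambda>k. - c k) (one_on K) \<otimes>\<^bsub>T.T\<^esub> U = \<one>\<^bsub>T.T\<^esub>"
      using te_add[of "\<lambda>k. - c k" c "one_on K"] m c o sub te0 by simp
    then have "inv\<^bsub>T.T\<^esub> U = te (\<lambda>k. - c k) (one_on K)"
      using tec[of "\<lambda>k. - c k" "one_on K"] m sub o inv by (intro T.T.inv_equality) auto
    then show ?case unfolding good_def using c m
      by (intro exI[of _ "\<lambda>k. - c k"] exI[of _ K]) auto
  qed
  \<comment> \<open>One balanced form for each integer k, the value of the pointwise product at k;
    together they define the map \<phi> below.\<close>
  define \<beta> where "\<beta> k x y = inv_into UNIV j x k * inv_into UNIV j y k" for k x y
  have \<beta>j: "\<beta> k (j f) (j g) = f k * g k" for k f g using j by (simp add: \<beta>_def)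
  have bal: "T.balanced (\<beta> k)" for k
    unfolding T.balanced_def
  proof (intro conjI ballI)
    fix x x' y assume "x \<in> carrier (Cz_module t ?M)" "x' \<in> carrier (Cz_module t ?M)" "y \<in> carrier (Cz_module t' ?M')"
    then obtain f f' g where fg: "f \<in> fin_fun I" "x = j f" "f' \<in> fin_fun I" "x' = j f'" "y = j g"
      using cM cM' by auto
    then show "\<beta> k (x \<oplus>\<^bsub>Cz_module t ?M\<^esub> x') y = \<beta> k x y + \<beta> k x' y"
      using sh(2)[of f f'] by (simp add: \<beta>j distrib_right flip: sh(2))
  next
    fix x y y' assume "x \<in> carrier (Cz_module t ?M)" "y \<in> carrier (Cz_module t' ?M')" "y' \<in> carrier (Cz_module t' ?M')"
    then obtain f g g' where fg: "x = j f" "g \<in> fin_fun J" "y = j g" "g' \<in> fin_fun J" "y' = j g'"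
      using cM cM' by auto
    then show "\<beta> k x (y \<oplus>\<^bsub>Cz_module t' ?M'\<^esub> y') = \<beta> k x y + \<beta> k x y'"
      using sh'(2)[of g g'] by (simp add: \<beta>j distrib_left flip: sh'(2))
  next
    fix r x y assume "x \<in> carrier (Cz_module t ?M)" "y \<in> carrier (Cz_module t' ?M')"
    then obtain f g where fg: "f \<in> fin_fun I" "x = j f" "g \<in> fin_fun J" "y = j g"
      using cM cM' by auto
    have "gwa_poly t r \<odot>\<^bsub>?M\<^esub> x = j (\<lambda>k. poly r (of_int k) * f k)"
      using sh(3)[of "gwa_poly t r" f] fg by (simp add: std_module_gens adm)
    moreover have "gwa_poly t' r \<odot>\<^bsub>?M'\<^esub> y = j (\<lambda>k. poly r (of_int k) * g k)"
      using sh'(3)[of "gwa_poly t' r" g] fg by (simp add: std_module_gens adm)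
    ultimately show "\<beta> k (r \<odot>\<^bsub>Cz_module t ?M\<^esub> x) y = \<beta> k x (r \<odot>\<^bsub>Cz_module t' ?M'\<^esub> y)"
      using fg by (simp add: \<beta>j)
  qed
  define \<phi> where "\<phi> U = j (\<lambda>k. T.lift (\<beta> k) U)" for U
  have \<phi>te: "\<phi> (te f g) = j (\<lambda>k. f k * g k)" if "f \<in> fin_fun I" "g \<in> fin_fun J" for f g
    using T.lift_tens[OF bal] jM jM' that by (simp add: \<phi>_def te_def \<beta>j)
  have \<phi>g: "\<phi> (te c (one_on K)) = j c" if "c \<in> fin_fun (I \<inter> J)" "{k. c k \<noteq> 0} \<subseteq> K" "finite K" "K \<subseteq> J" for c K
  proof -
    have "(\<lambda>k. c k * one_on K k) = c" using that by (auto simp: one_on_def fun_eq_iff)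
    then show ?thesis using \<phi>te[of c "one_on K"] sub that one_on_fin_fun by simp
  qed
  have \<phi>car: "\<exists>c\<in>fin_fun (I \<inter> J). \<phi> U = j c" if "U \<in> carrier T.T" for U
    using good[OF that] \<phi>g unfolding good_def by blast
  have "\<phi> \<in> iso T.T (add_monoid ?N)"
  proof (rule isoI)
    show "\<phi> \<in> hom T.T (add_monoid ?N)"
    proof (rule homI)
      fix U assume U: "U \<in> carrier T.T"
      then show "\<phi> U \<in> carrier (add_monoid ?N)" using \<phi>car cN by auto
      fix V assume V: "V \<in> carrier T.T"
      obtain c c' where c: "c \<in> fin_fun (I \<inter> J)" "\<phi> U = j c" "c' \<in> fin_fun (I \<inter> J)" "\<phi> V = j c'"
        using \<phi>car U V by blast
      have "(\<lambda>k. T.lift (\<beta> k) U) = c" "(\<lambda>k. T.lift (\<beta> k) V) = c'"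
        using c injD[OF j] unfolding \<phi>_def by blast+
      then have "\<phi> (U \<otimes>\<^bsub>T.T\<^esub> V) = j (\<lambda>k. c k + c' k)"
        unfolding \<phi>_def using T.lift_mult[OF bal U V] by (auto simp: fun_eq_iff)
      then show "\<phi> (U \<otimes>\<^bsub>T.T\<^esub> V) = \<phi> U \<otimes>\<^bsub>add_monoid ?N\<^esub> \<phi> V"
        using c nh(2)[of c c'] by simp
    qed
    show "bij_betw \<phi> (carrier T.T) (carrier (add_monoid ?N))"
    proof (intro bij_betw_imageI inj_onI)
      fix U V assume UV: "U \<in> carrier T.T" "V \<in> carrier T.T" "\<phi> U = \<phi> V"
      obtain c K where c: "c \<in> fin_fun (I \<inter> J)" "{k. c k \<noteq> 0} \<subseteq> K" "finite K" "K \<subseteq> J" "U = te c (one_on K)"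
        using good[OF UV(1)] unfolding good_def by blast
      obtain c' K' where c': "c' \<in> fin_fun (I \<inter> J)" "{k. c' k \<noteq> 0} \<subseteq> K'" "finite K'" "K' \<subseteq> J" "V = te c' (one_on K')"
        using good[OF UV(2)] unfolding good_def by blast
      have "j c = j c'" using UV(3) \<phi>g[OF c(1-4)] \<phi>g[OF c'(1-4)] c(5) c'(5) by simp
      then have cc: "c = c'" using j by (auto dest: injD)
      have "U = te c (one_on (K \<union> K'))" unfolding c(5) using c c' by (intro enlarge) auto
      also have "\<dots> = V" unfolding c'(5) cc using c c' by (intro enlarge[symmetric]) auto
      finally show "U = V" .
    next
      show "\<phi> ` carrier T.T = carrier (add_monoid ?N)"
      proof (intro equalityI subsetI)
        fix y assume "y \<in> carrier (add_monoid ?N)"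
        then obtain c where c: "c \<in> fin_fun (I \<inter> J)" "y = j c" using cN by auto
        have fc: "finite {k. c k \<noteq> 0}" "{k. c k \<noteq> 0} \<subseteq> J" using c(1) by (auto simp: fin_fun_def)
        have "\<phi> (te c (one_on {k. c k \<noteq> 0})) = y" using \<phi>g[OF c(1) _ fc] c(2) by simp
        moreover have "te c (one_on {k. c k \<noteq> 0}) \<in> carrier T.T"
          using tec sub[OF c(1)] one_on_fin_fun[OF fc] by blast
        ultimately show "y \<in> \<phi> ` carrier T.T" by blast
      next
        fix y assume "y \<in> \<phi> ` carrier T.T"
        then show "y \<in> carrier (add_monoid ?N)" using \<phi>car cN by auto
      qed
    qed
  qed
  moreover have "\<forall>v\<in>carrier ?M. \<forall>v'\<in>carrier ?M'.
       (\<forall>r. gwa_poly (t * t') r \<odot>\<^bsub>?N\<^esub> \<phi> (T.tens v v') = \<phi> (T.tens (gwa_poly t r \<odot>\<^bsub>?M\<^esub> v) v')) \<and>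
       gwa_Xp (t * t') \<odot>\<^bsub>?N\<^esub> \<phi> (T.tens v v') =
         \<phi> (T.tens (gwa_Xp t \<odot>\<^bsub>?M\<^esub> v) (gwa_Xp t' \<odot>\<^bsub>?M'\<^esub> v')) \<and>
       gwa_Xm (t * t') \<odot>\<^bsub>?N\<^esub> \<phi> (T.tens v v') =
         \<phi> (T.tens (gwa_Xm t \<odot>\<^bsub>?M\<^esub> v) (gwa_Xm t' \<odot>\<^bsub>?M'\<^esub> v'))"
  proof (intro ballI)
    fix v v' assume "v \<in> carrier ?M" "v' \<in> carrier ?M'"
    then obtain f g where fg: "f \<in> fin_fun I" "v = j f" "g \<in> fin_fun J" "v' = j g"
      using cM cM' by auto
    define h where "h = (\<lambda>k. f k * g k)"
    have h: "h \<in> fin_fun (I \<inter> J)" "\<phi> (T.tens v v') = j h"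
      using fun_prod[OF fg(1,3)] \<phi>te[OF fg(1,3)] fg by (simp_all add: h_def te_def)
    have f: "a \<odot>\<^bsub>std_module t I\<^esub> f \<in> fin_fun I" "a \<odot>\<^bsub>?M\<^esub> v = j (a \<odot>\<^bsub>std_module t I\<^esub> f)"
      if "a \<in> carrier (gwa t)" for a
      using that sh(3)[of a f] fg left_module.smult_closed[OF left_module_std_module[OF adm(1)] that, of f] by auto
    have g: "a \<odot>\<^bsub>std_module t' J\<^esub> g \<in> fin_fun J" "a \<odot>\<^bsub>?M'\<^esub> v' = j (a \<odot>\<^bsub>std_module t' J\<^esub> g)"
      if "a \<in> carrier (gwa t')" for a
      using that sh'(3)[of a g] fg left_module.smult_closed[OF left_module_std_module[OF adm(2)] that, of g] by auto
    have hh: "a \<odot>\<^bsub>?N\<^esub> j h = j (a \<odot>\<^bsub>std_module (t * t') (I \<inter> J)\<^esub> h)" if "a \<in> carrier (gwa (t * t'))" for a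
      using that nh(3)[of a h] h by auto
    have te': "T.tens (j x) v' = te x g" for x by (simp add: te_def fg)
    have 1: "gwa_poly (t * t') r \<odot>\<^bsub>?N\<^esub> \<phi> (T.tens v v') = \<phi> (T.tens (gwa_poly t r \<odot>\<^bsub>?M\<^esub> v) v')" for r
      unfolding h(2) hh[OF gwa_poly_closed] f(2)[OF gwa_poly_closed] te'
        \<phi>te[OF f(1)[OF gwa_poly_closed] fg(3)]
      using fg h by (simp add: std_module_gens adm adm' h_def mult.assoc)
    have 2: "gwa_Xp (t * t') \<odot>\<^bsub>?N\<^esub> \<phi> (T.tens v v') =
         \<phi> (T.tens (gwa_Xp t \<odot>\<^bsub>?M\<^esub> v) (gwa_Xp t' \<odot>\<^bsub>?M'\<^esub> v'))"
      unfolding h(2) hh[OF gwa_Xp_closed] f(2)[OF gwa_Xp_closed] g(2)[OF gwa_Xp_closed] te_def[symmetric]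
        \<phi>te[OF f(1)[OF gwa_Xp_closed] g(1)[OF gwa_Xp_closed]]
      using fg h(1) by (intro arg_cong[of _ _ j]) (auto simp: std_module_gens adm adm' h_def fun_eq_iff)
    have 3: "gwa_Xm (t * t') \<odot>\<^bsub>?N\<^esub> \<phi> (T.tens v v') =
         \<phi> (T.tens (gwa_Xm t \<odot>\<^bsub>?M\<^esub> v) (gwa_Xm t' \<odot>\<^bsub>?M'\<^esub> v'))"
      unfolding h(2) hh[OF gwa_Xm_closed] f(2)[OF gwa_Xm_closed] g(2)[OF gwa_Xm_closed] te_def[symmetric]
        \<phi>te[OF f(1)[OF gwa_Xm_closed] g(1)[OF gwa_Xm_closed]]
      using fg h(1) by (intro arg_cong[of _ _ j]) (auto simp: std_module_gens adm adm' h_def fun_eq_iff)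
    show "(\<forall>r. gwa_poly (t * t') r \<odot>\<^bsub>?N\<^esub> \<phi> (T.tens v v') = \<phi> (T.tens (gwa_poly t r \<odot>\<^bsub>?M\<^esub> v) v')) \<and>
       gwa_Xp (t * t') \<odot>\<^bsub>?N\<^esub> \<phi> (T.tens v v') =
         \<phi> (T.tens (gwa_Xp t \<odot>\<^bsub>?M\<^esub> v) (gwa_Xp t' \<odot>\<^bsub>?M'\<^esub> v')) \<and>
       gwa_Xm (t * t') \<odot>\<^bsub>?N\<^esub> \<phi> (T.tens v v') =
         \<phi> (T.tens (gwa_Xm t \<odot>\<^bsub>?M\<^esub> v) (gwa_Xm t' \<odot>\<^bsub>?M'\<^esub> v'))"
      using 1 2 3 by blast
  qed
  ultimately show ?thesis unfolding is_tensor_def Let_def using n(1) by blast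
qed

section \<open>The Grothendieck group of one degree\<close>

lemma (in frag_quotient) cls_cmul:
  assumes "Poly_Mapping.keys x \<subseteq> S"
  shows "cls (frag_cmul n x) = cls x [^]\<^bsub>Q\<^esub> n"
proof -
  interpret h: group_hom "free_Abelian_group S" Q cls
    by unfold_locales (use cls_closed cls_add in \<open>auto simp: hom_def\<close>)
  show ?thesis using h.hom_int_pow[of x n] assms by simp
qed

lemma frag_eval_cmul: "frag_eval F (frag_cmul n x) = of_int n * frag_eval F x"
proof -
  have "Poly_Mapping.keys (frag_cmul n x) \<subseteq> Poly_Mapping.keys x" by auto
  then show ?thesis
    by (simp add: frag_eval_superset[of "Poly_Mapping.keys x"] sum_distrib_left mult.assoc)
qed

lemma keys_sum_subset: "(\<And>a. a \<in> A \<Longrightarrow> Poly_Mapping.keys (g a) \<subseteq> S) \<Longrightarrow> Poly_Mapping.keys (sum g A) \<subseteq> S"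
  using keys_sum[of g A] by blast

definition exact_rels :: "complex poly \<Rightarrow> ('u gwa_module \<Rightarrow>\<^sub>0 int) set"
  where "exact_rels t = {frag_of M'' - (frag_of M + frag_of M') | M M'' M'.
    M \<in> wmod \<O>_int t \<and> M'' \<in> wmod \<O>_int t \<and> M' \<in> wmod \<O>_int t \<and> short_exact (gwa t) M M'' M'}"

definition dimC :: "complex poly \<Rightarrow> int \<Rightarrow> 'u gwa_module \<Rightarrow> complex"
  where "dimC t k M = of_nat (gwa_module.dimw t M k)"

text \<open>A sample point of the cell with index i. Dimension functions are constant on cells and
  are recorded by their values at these points.\<close>

definition rep :: "complex poly \<Rightarrow> nat \<Rightarrow> int"
  where "rep t i = (SOME k. cidx t k = i)"

lemma cidx_rep: "i \<in> range (cidx t) \<Longrightarrow> cidx t (rep t i) = i"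
  unfolding rep_def by (rule someI_ex) auto

text \<open>The index is monotone, so between two integers of equal index it never changes, and no
  step between them crosses a root.\<close>

lemma cidx_determines:
  assumes t: "t \<in> \<Omega>_half" and f: "\<And>k. poly t (of_int k + 1/2) \<noteq> 0 \<Longrightarrow> f (k + 1) = f k"
    and kl: "cidx t k = cidx t l"
  shows "f k = f l"
proof -
  have *: "cidx t m = cidx t k \<longrightarrow> f m = f k" if "k \<le> m" for k m
    using that
  proof (induction m rule: int_ge_induct)
    case (step m)
    show ?case
    proof
      assume e: "cidx t (m + 1) = cidx t k"
      then have "cidx t m = cidx t k" using cidx_mono[OF t, of k m] cidx_mono[OF t, of m "m + 1"] step by simp
      moreover from this have "poly t (of_int m + 1/2) \<noteq> 0" using cidx_step[OF t, of m] e by (auto split: if_splits)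
      ultimately show "f (m + 1) = f k" using step f by simp
    qed
  qed simp
  show ?thesis
  proof (cases "k \<le> l")
    case True
    show ?thesis by (rule mp[OF *[OF True] kl[symmetric], symmetric])
  next
    case False
    then have "l \<le> k" by simp
    show ?thesis by (rule mp[OF *[OF \<open>l \<le> k\<close>] kl])
  qed
qed

locale degree_cat =
  fixes t :: "complex poly" and j :: "(int \<Rightarrow> complex) \<Rightarrow> 'u"
  assumes t: "t \<in> \<Omega>_half" and j: "inj j"
begin

abbreviation "obj \<equiv> (wmod \<O>_int t :: 'u gwa_module set)"
abbreviation "cells \<equiv> range (cidx t)"
definition "simp_obj i = std_copy j t (cell t i)"

lemma cells_finite: "finite cells"
  by (rule finite_range_cidx[OF t])

lemma simp_obj: "simp_obj i \<in> obj"
  unfolding simp_obj_def by (intro findim_wmod findim_std_copy admissible_cell t j)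

lemma dimw_simp_obj: "gwa_module.dimw t (simp_obj i) k = (if cidx t k = i then 1 else 0)"
  using dimw_std_copy[OF admissible_cell[OF t] j, of i k] by (auto simp: simp_obj_def cell_def)

sublocale G: frag_quotient "wmod \<O>_int t" "exact_rels t :: ('u gwa_module \<Rightarrow>\<^sub>0 int) set"
proof
  fix r :: "'u gwa_module \<Rightarrow>\<^sub>0 int" assume "r \<in> exact_rels t"
  then obtain M M'' M' where r: "r = frag_of M'' - (frag_of M + frag_of M')" "M \<in> obj" "M'' \<in> obj" "M' \<in> obj"
    unfolding exact_rels_def by blast
  have "Poly_Mapping.keys (frag_of M + frag_of M') \<subseteq> obj"
    using keys_add[of "frag_of M" "frag_of M'"] r by auto
  then show "Poly_Mapping.keys r \<subseteq> obj"
    unfolding r(1) using keys_diff[of "frag_of M''" "frag_of M + frag_of M'"] r by auto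
qed

lemma K0_sub_K: "K0_sub \<O>_int t = G.K"
  unfolding K0_sub_def G.K_def unfolding exact_rels_def ..

lemma K0_Q: "K0 \<O>_int t = G.Q"
  and K0_class_cls: "K0_class \<O>_int t M = G.cls (frag_of M)"
  by (simp_all only: K0_def K0_class_def K0_sub_K G.Q_def G.cls_def)

lemma dimC_rels:
  fixes r :: "'u gwa_module \<Rightarrow>\<^sub>0 int"
  assumes "r \<in> exact_rels t"
  shows "frag_eval (dimC t k) r = 0"
proof -
  obtain M M'' M' where r: "r = frag_of M'' - (frag_of M + frag_of M')" "M \<in> obj" "M'' \<in> obj" "M' \<in> obj"
      "short_exact (gwa t) M M'' M'"
    using assms unfolding exact_rels_def by blast
  have "gwa_module.dimw t M'' k = gwa_module.dimw t M k + gwa_module.dimw t M' k"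
    using r by (intro short_exact_dimw wmod_findim)
  then show ?thesis unfolding r(1) by (simp add: frag_eval_diff frag_eval_add dimC_def)
qed

definition comb :: "(nat \<Rightarrow> int) \<Rightarrow> ('u gwa_module \<Rightarrow>\<^sub>0 int)"
  where "comb n = (\<Sum>i\<in>cells. frag_cmul (n i) (frag_of (simp_obj i)))"

lemma comb_keys: "Poly_Mapping.keys (comb n) \<subseteq> obj"
  unfolding comb_def using simp_obj by (intro keys_sum_subset) (auto simp: keys_frag_of)

lemma comb_add: "comb (\<lambda>i. n i + m i) = comb n + comb m"
  by (simp add: comb_def frag_cmul_distrib sum.distrib)

lemma comb_zero: "comb (\<lambda>i. 0) = 0"
  by (simp add: comb_def)

lemma comb_delta: "i \<in> cells \<Longrightarrow> comb (\<lambda>l. if l = i then 1 else 0) = frag_of (simp_obj i)"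
proof -
  assume i: "i \<in> cells"
  have "comb (\<lambda>l. if l = i then 1 else 0) = (\<Sum>l\<in>cells. if l = i then frag_of (simp_obj l) else 0)"
    unfolding comb_def by (rule sum.cong) auto
  then show ?thesis using i cells_finite by simp
qed

text \<open>For a zero module the sequence with M in all three places is exact, so [M] = [M] + [M]
  in K0.\<close>

lemma zero_object:
  assumes M: "M \<in> obj" and z: "\<And>k. gwa_module.dimw t M k = 0"
  shows "frag_of M \<in> G.K"
proof -
  interpret M: findim_mod t M by (rule wmod_findim[OF M])
  have w: "M.wsp k = {\<zero>\<^bsub>M\<^esub>}" for k using z M.dimw_zero_iff by simp
  have "x = \<zero>\<^bsub>M\<^esub>" if x: "x \<in> carrier M" for x
  proof (rule M.prj_ext[OF x M.M.zero_closed])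
    show "M.prj k x = M.prj k \<zero>\<^bsub>M\<^esub>" for k using M.prj_wsp[OF x, of k] unfolding w by simp
  qed
  then have car: "carrier M = {\<zero>\<^bsub>M\<^esub>}" using M.M.zero_closed by blast
  have "(\<lambda>x. x) \<in> module_hom (gwa t) M M" by (simp add: module_hom_def)
  then have "short_exact (gwa t) M M M"
    unfolding short_exact_def by (intro bexI[of _ "\<lambda>x. x"]) (auto simp: car)
  then have "frag_of M - (frag_of M + frag_of M) \<in> exact_rels t"
    unfolding exact_rels_def using M by blast
  then have "frag_of M - (frag_of M + frag_of M) \<in> G.K" by (rule G.K_rels)
  then have "- (frag_of M - (frag_of M + frag_of M)) \<in> G.K" by (rule G.K_neg)
  then show ?thesis by simp
qed

lemma dimw_cidx:
  assumes M: "M \<in> obj" and "cidx t k = cidx t l"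
  shows "gwa_module.dimw t M k = gwa_module.dimw t M l"
proof -
  interpret M: findim_mod t M by (rule wmod_findim[OF M])
  show ?thesis using M.dimw_step assms(2) by (rule cidx_determines[OF t, of M.dimw])
qed

text \<open>Induction on the sum of the dimensions at one sample point per cell. This is a finite
  number even when the module has infinite dimension, and splitting off a cell module lowers it by
  one.\<close>

lemma object_decomposition:
  assumes "M \<in> obj"
  shows "frag_of M - comb (\<lambda>i. int (gwa_module.dimw t M (rep t i))) \<in> G.K"
  using assms
proof (induction "\<Sum>i\<in>cells. gwa_module.dimw t M (rep t i)" arbitrary: M rule: less_induct)
  case less
  let ?d = "gwa_module.dimw t"
  have rep: "?d M (rep t (cidx t k)) = ?d M k" if "M \<in> obj" for M k
    by (rule dimw_cidx[OF that]) (simp add: cidx_rep)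
  show ?case
  proof (cases "\<exists>k. ?d M k \<noteq> 0")
    case False
    then have "comb (\<lambda>i. int (?d M (rep t i))) = 0" using comb_zero by simp
    then show ?thesis using zero_object[OF less.prems] False by simp
  next
    case True
    obtain i and Q :: "'u gwa_module" where iQ: "i \<in> cells" "findim_mod t Q"
      "short_exact (gwa t) (simp_obj i) M Q"
      using peel_cell[OF t wmod_findim[OF less.prems] j True] unfolding simp_obj_def by blast
    have Q: "Q \<in> obj" by (rule findim_wmod[OF iQ(2)])
    have d: "?d M k = (if cidx t k = i then 1 else 0) + ?d Q k" for k
      using short_exact_dimw[OF wmod_findim[OF simp_obj] wmod_findim[OF less.prems] iQ(2,3)]
      by (simp add: dimw_simp_obj)
    have dr: "?d M (rep t l) = (if l = i then 1 else 0) + ?d Q (rep t l)" if "l \<in> cells" for l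
      unfolding d cidx_rep[OF that] ..
    have "(\<Sum>l\<in>cells. ?d Q (rep t l)) < (\<Sum>l\<in>cells. ?d M (rep t l))"
      by (rule sum_strict_mono_ex1[OF cells_finite]) (use iQ(1) dr in auto)
    then have IH: "frag_of Q - comb (\<lambda>i. int (?d Q (rep t i))) \<in> G.K"
      using less.hyps Q by blast
    have "comb (\<lambda>l. int (?d M (rep t l))) = comb (\<lambda>l. (if l = i then 1 else 0) + int (?d Q (rep t l)))"
      unfolding comb_def by (rule sum.cong) (auto simp: dr)
    also have "\<dots> = frag_of (simp_obj i) + comb (\<lambda>l. int (?d Q (rep t l)))"
      by (simp add: comb_add comb_delta[OF iQ(1)])
    finally have c: "comb (\<lambda>l. int (?d M (rep t l))) = frag_of (simp_obj i) + comb (\<lambda>l. int (?d Q (rep t l)))" .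
    have "frag_of M - (frag_of (simp_obj i) + frag_of Q) \<in> G.K"
      using iQ(3) Q less.prems simp_obj by (intro G.K_rels) (auto simp: exact_rels_def)
    from G.K_add[OF this IH] show ?thesis unfolding c by (simp add: algebra_simps)
  qed
qed

lemma K0_elem_comb:
  assumes "U \<in> carrier G.Q"
  shows "\<exists>n. U = G.cls (comb n)"
  using assms
proof (induction U rule: G.Q_induct)
  case (gen M)
  then have "G.cls (frag_of M) = G.cls (comb (\<lambda>i. int (gwa_module.dimw t M (rep t i))))"
    using object_decomposition[OF gen] comb_keys by (subst G.cls_eq_iff) auto
  then show ?case by blast
next
  case one
  show ?case using comb_zero by (intro exI[of _ "\<lambda>_. 0"]) (simp add: G.one_Q)
next
  case (mult U V)
  then obtain n m where "U = G.cls (comb n)" "V = G.cls (comb m)" by blast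
  then have "U \<otimes>\<^bsub>G.Q\<^esub> V = G.cls (comb (\<lambda>i. n i + m i))" using comb_keys by (simp add: comb_add G.cls_add)
  then show ?case by blast
next
  case (inv U)
  then obtain n where n: "U = G.cls (comb n)" by blast
  have "comb (\<lambda>i. - n i) + comb n = 0" using comb_add[of "\<lambda>i. - n i" n] comb_zero by simp
  then have "comb (\<lambda>i. - n i) = - comb n" by (simp add: eq_neg_iff_add_eq_0)
  then have "inv\<^bsub>G.Q\<^esub> U = G.cls (comb (\<lambda>i. - n i))" using n comb_keys G.cls_neg by simp
  then show ?case by blast
qed

section \<open>Dimension functionals and the complexified group\<close>

definition dimK :: "int \<Rightarrow> 'u K0_elem \<Rightarrow> complex"
  where "dimK k = G.eval (dimC t k)"

lemma dimK_cls: "Poly_Mapping.keys x \<subseteq> obj \<Longrightarrow> dimK k (G.cls x) = frag_eval (dimC t k) x"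
  unfolding dimK_def by (rule G.eval_cls[OF dimC_rels])

lemma dimK_mult: "U \<in> carrier G.Q \<Longrightarrow> V \<in> carrier G.Q \<Longrightarrow> dimK k (U \<otimes>\<^bsub>G.Q\<^esub> V) = dimK k U + dimK k V"
  unfolding dimK_def by (rule G.eval_mult[OF dimC_rels])

lemma dimK_pow: "U \<in> carrier G.Q \<Longrightarrow> dimK k (U [^]\<^bsub>G.Q\<^esub> (n::int)) = of_int n * dimK k U"
proof -
  assume "U \<in> carrier G.Q"
  then obtain x where x: "Poly_Mapping.keys x \<subseteq> obj" "U = G.cls x" by (auto simp: G.carrier_Q)
  have "Poly_Mapping.keys (frag_cmul n x) \<subseteq> obj" using x(1) keys_cmul[of n x] by blast
  then show ?thesis using x by (simp flip: G.cls_cmul add: dimK_cls frag_eval_cmul)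
qed

abbreviation "ZK \<equiv> Z_module_of (G.Q)"

lemma ZK_simps: "carrier ZK = carrier G.Q" "x \<oplus>\<^bsub>ZK\<^esub> y = x \<otimes>\<^bsub>G.Q\<^esub> y" "n \<odot>\<^bsub>ZK\<^esub> x = x [^]\<^bsub>G.Q\<^esub> (n::int)"
  by (simp_all add: Z_module_of_def)

lemma CZ_simps: "carrier C_as_Z_module = UNIV" "c \<oplus>\<^bsub>C_as_Z_module\<^esub> d = c + d" "n \<odot>\<^bsub>C_as_Z_module\<^esub> c = of_int n * c"
  by (simp_all add: C_as_Z_module_def ring.defs module.defs)

sublocale C: tensor_setup \<Z> C_as_Z_module ZK
  by unfold_locales (auto simp: ZK_simps CZ_simps)

lemma CK0_T: "CK0 \<O>_int t = C.T"
  and CK0_tensor_tens: "CK0_tensor \<O>_int t = C.tens"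
  by (simp_all add: CK0_def CK0_tensor_def K0_Q)

definition dimT :: "int \<Rightarrow> 'u CK0_elem \<Rightarrow> complex"
  where "dimT k = C.lift (\<lambda>c U. c * dimK k U)"

lemma dim_balanced: "C.balanced (\<lambda>c U. c * dimK k U)"
  unfolding C.balanced_def
  by (auto simp: ZK_simps CZ_simps dimK_mult dimK_pow algebra_simps)

lemma dimT_tens: "U \<in> carrier G.Q \<Longrightarrow> dimT k (C.tens c U) = c * dimK k U"
  unfolding dimT_def using C.lift_tens[OF dim_balanced] by (simp add: ZK_simps CZ_simps)

lemmas dimT_mult = C.lift_mult[OF dim_balanced, folded dimT_def]
lemmas dimT_one = C.lift_one[OF dim_balanced, folded dimT_def]
text \<open>Complex combinations of the simple classes. By \<open>CK0_elem_comp\<close> every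
  element has this form, and \<open>dimT_comp\<close> reads the coefficients back from
  dimensions.\<close>

definition comp :: "(nat \<Rightarrow> complex) \<Rightarrow> 'u CK0_elem"
  where "comp a = finprod C.T (\<lambda>i. C.tens (a i) (G.cls (frag_of (simp_obj i)))) cells"

lemma tens_simp [simp]: "C.tens c (G.cls (frag_of (simp_obj i))) \<in> carrier C.T"
  using simp_obj by (intro C.tens_closed) (simp_all add: ZK_simps CZ_simps)

lemma comp_closed [simp]: "comp a \<in> carrier C.T"
  unfolding comp_def by (rule C.T.finprod_closed) auto

lemma tens_add:
  "U \<in> carrier G.Q \<Longrightarrow> C.tens (c + d) U = C.tens c U \<otimes>\<^bsub>C.T\<^esub> C.tens d U"
  using C.tens_add_left[of c d U] by (simp add: ZK_simps CZ_simps)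

lemma comp_add: "comp (\<lambda>i. a i + b i) = comp a \<otimes>\<^bsub>C.T\<^esub> comp b"
proof -
  have "comp (\<lambda>i. a i + b i) = finprod C.T (\<lambda>i. C.tens (a i) (G.cls (frag_of (simp_obj i)))
      \<otimes>\<^bsub>C.T\<^esub> C.tens (b i) (G.cls (frag_of (simp_obj i)))) cells"
    unfolding comp_def using simp_obj by (intro C.T.finprod_cong') (auto simp: tens_add)
  also have "\<dots> = comp a \<otimes>\<^bsub>C.T\<^esub> comp b"
    unfolding comp_def by (rule C.T.finprod_multf) auto
  finally show ?thesis .
qed

lemma tens_zero: "U \<in> carrier G.Q \<Longrightarrow> C.tens 0 U = \<one>\<^bsub>C.T\<^esub>"
  using C.tens_idem_left[of 0 U] by (simp add: ZK_simps CZ_simps)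

lemma tens_one: "C.tens c \<one>\<^bsub>G.Q\<^esub> = \<one>\<^bsub>C.T\<^esub>"
  using C.tens_idem_right[of c "\<one>\<^bsub>G.Q\<^esub>"] by (simp add: ZK_simps CZ_simps)

lemma comp_zero: "comp (\<lambda>i. 0) = \<one>\<^bsub>C.T\<^esub>"
proof -
  have "comp (\<lambda>i. 0) = finprod C.T (\<lambda>i. \<one>\<^bsub>C.T\<^esub>) cells"
    unfolding comp_def using simp_obj by (intro C.T.finprod_cong') (auto simp: tens_zero)
  then show ?thesis by simp
qed

text \<open>Integer multiplicities move across the tensor sign into the complex factor.\<close>

lemma tens_comb:
  "C.tens c (G.cls (comb n)) = comp (\<lambda>i. of_int (n i) * c)"
proof -
  have "C.tens c (G.cls (\<Sum>i\<in>A. frag_cmul (n i) (frag_of (simp_obj i))))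
      = finprod C.T (\<lambda>i. C.tens (of_int (n i) * c) (G.cls (frag_of (simp_obj i)))) A" if "finite A" for A
    using that
  proof (induction A rule: finite_induct)
    case empty
    then show ?case using tens_one by (simp flip: G.one_Q)
  next
    case (insert i A)
    let ?x = "frag_cmul (n i) (frag_of (simp_obj i))" and ?y = "\<Sum>i\<in>A. frag_cmul (n i) (frag_of (simp_obj i))"
    have k: "Poly_Mapping.keys (frag_of (simp_obj i)) \<subseteq> obj" "Poly_Mapping.keys ?x \<subseteq> obj" "Poly_Mapping.keys ?y \<subseteq> obj"
      using simp_obj by (auto simp: keys_frag_of intro!: keys_sum_subset)
    have "C.tens c (G.cls (?x + ?y)) = C.tens c (G.cls ?x) \<otimes>\<^bsub>C.T\<^esub> C.tens c (G.cls ?y)"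
      using C.tens_add_right[of c "G.cls ?x" "G.cls ?y"] k by (simp add: ZK_simps CZ_simps G.cls_add)
    also have "C.tens c (G.cls ?x) = C.tens (of_int (n i) * c) (G.cls (frag_of (simp_obj i)))"
      using C.tens_balanced[of "n i" c "G.cls (frag_of (simp_obj i))"] k
      by (simp add: ZK_simps CZ_simps G.cls_cmul)
    finally show ?case using insert by simp
  qed
  from this[OF cells_finite] show ?thesis by (simp add: comb_def comp_def)
qed

lemma CK0_elem_comp:
  assumes "U \<in> carrier C.T"
  shows "\<exists>a. U = comp a"
  using assms
proof (induction U rule: C.tens_induct)
  case (tens c V)
  then obtain n where "V = G.cls (comb n)" using K0_elem_comb by (auto simp: ZK_simps)
  then show ?case using tens_comb by blast
next
  case one
  show ?case by (rule exI[of _ "\<lambda>_. 0"]) (rule comp_zero[symmetric])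
next
  case (mult U V)
  then obtain a b where "U = comp a" "V = comp b" by blast
  then have "U \<otimes>\<^bsub>C.T\<^esub> V = comp (\<lambda>i. a i + b i)" by (simp add: comp_add)
  then show ?case by blast
next
  case (inv U)
  then obtain a where a: "U = comp a" by blast
  have "comp (\<lambda>i. - a i) \<otimes>\<^bsub>C.T\<^esub> U = \<one>\<^bsub>C.T\<^esub>" using comp_add[of "\<lambda>i. - a i" a] a comp_zero by simp
  then have "inv\<^bsub>C.T\<^esub> U = comp (\<lambda>i. - a i)" using inv by (intro C.T.inv_equality) auto
  then show ?case by blast
qed

lemma dimT_comp: "dimT k (comp a) = a (cidx t k)"
proof -
  have "dimT k (finprod C.T (\<lambda>i. C.tens (a i) (G.cls (frag_of (simp_obj i)))) A)
      = (\<Sum>i\<in>A. if i = cidx t k then a i else 0)" if "finite A" for A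
    using that
  proof (induction A rule: finite_induct)
    case (insert i A)
    have "dimT k (C.tens (a i) (G.cls (frag_of (simp_obj i)))) = (if i = cidx t k then a i else 0)"
      using simp_obj[of i] by (simp add: dimT_tens dimK_cls dimC_def dimw_simp_obj)
    then show ?case using insert C.T.finprod_closed[of "\<lambda>i. C.tens (a i) (G.cls (frag_of (simp_obj i)))" A]
      by (auto simp: dimT_mult)
  qed (simp add: dimT_one)
  from this[OF cells_finite] show ?thesis using cells_finite by (simp add: comp_def sum.delta)
qed

text \<open>With \<open>dimT_step\<close> and \<open>dimT_surject\<close> this identifies the part
  of degree t with the complex functions on the integers that are constant on cells.\<close>

lemma dimT_inject:
  assumes "U \<in> carrier C.T" "V \<in> carrier C.T" "\<And>k. dimT k U = dimT k V"
  shows "U = V"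
proof -
  obtain a b where ab: "U = comp a" "V = comp b" using CK0_elem_comp assms(1,2) by blast
  then have "a i = b i" if "i \<in> cells" for i using assms(3) that by (auto simp: dimT_comp)
  then show ?thesis unfolding ab comp_def by (intro C.T.finprod_cong') auto
qed

lemma dimT_step:
  assumes "U \<in> carrier C.T" "cidx t k = cidx t l"
  shows "dimT k U = dimT l U"
  using CK0_elem_comp[OF assms(1)] assms(2) dimT_comp by auto

lemma dimT_surject:
  assumes "\<And>k l. cidx t k = cidx t l \<Longrightarrow> f k = f l"
  shows "\<exists>U\<in>carrier C.T. \<forall>k. dimT k U = f k"
proof (intro bexI[of _ "comp (\<lambda>i. f (rep t i))"] allI)
  show "dimT k (comp (\<lambda>i. f (rep t i))) = f k" for k
    unfolding dimT_comp by (rule assms) (simp add: cidx_rep)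
qed simp

text \<open>The scalar multiplication is defined as a union over all representatives of a coset.
  Scaling the complex component sends each kind of relation to one of the same kind, so all
  representatives produce one and the same coset.\<close>

lemma CK0_scale:
  assumes "U \<in> carrier C.T"
  shows "CK0_scale \<O>_int t c U \<in> carrier C.T" "dimT k (CK0_scale \<O>_int t c U) = c * dimT k U"
proof -
  let ?g = "frag_extend (\<lambda>(d, x). frag_of (c * d, x)) :: (complex \<times> 'u K0_elem \<Rightarrow>\<^sub>0 int) \<Rightarrow> _"
  let ?S = "(UNIV :: complex set) \<times> carrier G.Q"
  have S: "carrier C_as_Z_module \<times> carrier ZK = ?S" by (simp add: ZK_simps CZ_simps)
  have gk: "Poly_Mapping.keys (?g x) \<subseteq> ?S" if "Poly_Mapping.keys x \<subseteq> ?S" for x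
  proof -
    have "Poly_Mapping.keys (?g x) \<subseteq> (\<Union>y\<in>Poly_Mapping.keys x. Poly_Mapping.keys ((\<lambda>(d, x). frag_of (c * d, x)) y))"
      by (rule keys_frag_extend)
    also have "\<dots> \<subseteq> ?S" using that by (auto simp: keys_frag_of split: prod.splits)
    finally show ?thesis .
  qed
  have gadd: "?g (x + y) = ?g x + ?g y" for x y by (rule frag_extend_add)
  have gneg: "?g (- x) = - ?g x" for x by (rule frag_extend_minus)
  have grel: "?g r \<in> tensor_rels \<Z> C_as_Z_module ZK" if r: "r \<in> tensor_rels \<Z> C_as_Z_module ZK" for r
  proof -
    consider x x' y where "r = frag_of (x + x', y) - frag_of (x, y) - frag_of (x', y)" "y \<in> carrier G.Q"
      | x y y' where "r = frag_of (x, y \<otimes>\<^bsub>G.Q\<^esub> y') - frag_of (x, y) - frag_of (x, y')" "y \<in> carrier G.Q" "y' \<in> carrier G.Q"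
      | n x y where "r = frag_of (of_int n * x, y) - frag_of (x, y [^]\<^bsub>G.Q\<^esub> (n::int))" "y \<in> carrier G.Q"
      using r unfolding tensor_rels_def by (auto simp: ZK_simps CZ_simps)
    then show ?thesis
    proof cases
      case (1 x x' y)
      then have "?g r = frag_of (c * x + c * x', y) - frag_of (c * x, y) - frag_of (c * x', y)"
        by (simp add: frag_extend_diff distrib_left)
      then show ?thesis unfolding tensor_rels_def using 1(2) by (fastforce simp: ZK_simps CZ_simps)
    next
      case (2 x y y')
      then have "?g r = frag_of (c * x, y \<otimes>\<^bsub>G.Q\<^esub> y') - frag_of (c * x, y) - frag_of (c * x, y')"
        by (simp add: frag_extend_diff)
      then show ?thesis unfolding tensor_rels_def using 2(2,3) by (fastforce simp: ZK_simps CZ_simps)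
    next
      case (3 n x y)
      then have "?g r = frag_of (of_int n * (c * x), y) - frag_of (c * x, y [^]\<^bsub>G.Q\<^esub> n)"
        by (simp add: frag_extend_diff mult.left_commute)
      then show ?thesis unfolding tensor_rels_def using 3(2) by (fastforce simp: ZK_simps CZ_simps)
    qed
  qed
  have gK: "?g x \<in> C.K" if "x \<in> C.K" for x
    using that unfolding C.K_def
  proof (induction rule: generate.induct)
    case one
    then show ?case using generate.one[of "free_Abelian_group _"] by simp
  next
    case (incl h)
    show ?case by (rule generate.incl) (rule grel[OF incl])
  next
    case (inv h)
    have "- ?g h \<in> C.K" using C.K_neg[OF C.K_rels[OF grel[OF inv]]] .
    then show ?case using C.rels[OF inv] by (simp add: gneg C.K_def)
  next
    case (eng h1 h2)
    then show ?case using generate.eng[OF eng(3,4)] by (simp add: gadd)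
  qed
  have "U \<in> C.cls ` {x. Poly_Mapping.keys x \<subseteq> carrier C_as_Z_module \<times> carrier ZK}"
    using assms unfolding C.T_Q C.carrier_Q .
  then obtain x where x: "Poly_Mapping.keys x \<subseteq> ?S" "U = C.cls x" unfolding S[symmetric] by blast
  have cl: "C.cls (?g u) = C.cls (?g x)" if u: "u \<in> U" for u
  proof -
    obtain h where h: "h \<in> C.K" "u = h + x" using u x(2) by (auto simp: C.cls_def r_coset_def)
    have "Poly_Mapping.keys u \<subseteq> ?S"
      unfolding h(2) using C.K_carrier[OF h(1), unfolded S] x(1)
      by (intro order.trans[OF keys_add] Un_least)
    moreover have "?g u - ?g x = ?g h" unfolding h(2) gadd by simp
    ultimately show ?thesis using gk x(1) gK[OF h(1)] by (subst C.cls_eq_iff) (simp_all add: S)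
  qed
  have ne: "U \<noteq> {}" using x C.K_zero by (auto simp: C.cls_def r_coset_def)
  have sc: "CK0_scale \<O>_int t c U = C.cls (?g x)"
  proof -
    have "CK0_scale \<O>_int t c U = (\<Union>u\<in>U. C.cls (?g u))"
      by (simp add: CK0_scale_def Let_def K0_Q C.cls_def C.K_def tensor_sub_def)
    then show ?thesis using cl ne by auto
  qed
  show "CK0_scale \<O>_int t c U \<in> carrier C.T"
    unfolding sc C.T_Q using gk[OF x(1)] by (intro C.cls_closed) (simp add: S)
  have fe: "frag_eval F (?g x) = c * frag_eval F x"
    if "\<And>d y. F (c * d, y) = c * F (d, y)" for F x
  proof -
    have "Poly_Mapping.keys x \<subseteq> UNIV" by simp
    then show ?thesis
    proof (induction x rule: frag_induction)
      case (one a)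
      then show ?case using that by (cases a) simp
    next
      case (diff a b)
      then show ?case by (simp add: frag_extend_diff frag_eval_diff right_diff_distrib)
    qed simp
  qed
  have lift: "dimT k (C.cls y) = frag_eval (\<lambda>(c, U). c * dimK k U) y" if "Poly_Mapping.keys y \<subseteq> ?S" for y
    unfolding dimT_def C.lift_def using that S
    by (subst C.eval_cls[OF C.balanced_rels[OF dim_balanced]]) auto
  show "dimT k (CK0_scale \<O>_int t c U) = c * dimT k U"
    unfolding sc unfolding x(2) lift[OF x(1)] lift[OF gk[OF x(1)]] by (rule fe) simp
qed

end

section \<open>The presented algebra\<close>

abbreviation pt :: "half_int \<Rightarrow> complex" where "pt s \<equiv> complex_of_real (half_val s)"

lemma half_val_inj: "half_val s = half_val w \<longleftrightarrow> s = w"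
  by (rule half_val_inject)

lemma half_val_neq_int: "half_val s \<noteq> of_int k"
proof
  assume "half_val s = of_int k"
  moreover obtain l :: int where "half_val s = of_int l + 1/2" by (rule half_valE)
  ultimately have "real_of_int (2 * k) = of_int (2 * l + 1)" by simp
  then have "2 * k = 2 * l + 1" by (simp only: of_int_eq_iff)
  then show False by presburger
qed

lemma Omega_rootE:
  assumes "t \<in> \<Omega>_half" "poly t a = 0"
  obtains s where "a = pt s"
  using assms by (auto simp: \<Omega>_half_def)

lemma Omega_one: "1 \<in> \<Omega>_half"
  by (simp add: \<Omega>_half_def)

lemma Omega_mult: "t \<in> \<Omega>_half \<Longrightarrow> t' \<in> \<Omega>_half \<Longrightarrow> t * t' \<in> \<Omega>_half"
  by (auto simp: \<Omega>_half_def lead_coeff_mult)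

lemma Omega_z_minus: "z_minus s \<in> \<Omega>_half"
  by (auto simp: \<Omega>_half_def z_minus_def)

lemma Omega_power: "t \<in> \<Omega>_half \<Longrightarrow> t ^ n \<in> \<Omega>_half"
  by (induction n) (simp_all add: Omega_one Omega_mult)

lemma Omega_prod: "(\<And>x. x \<in> A \<Longrightarrow> f x \<in> \<Omega>_half) \<Longrightarrow> prod f A \<in> \<Omega>_half"
  by (induction A rule: infinite_finite_induct) (simp_all add: Omega_one Omega_mult)

text \<open>A monic complex polynomial is the product of its linear factors with multiplicities, and
  here all roots are half-integers. Degrees are therefore compared through multiplicities, which
  turn products into sums.\<close>

lemma Omega_eqI:
  assumes "t \<in> \<Omega>_half" "t' \<in> \<Omega>_half" "\<And>s. order (pt s) t = order (pt s) t'"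
  shows "t = t'"
proof -
  have nz: "t \<noteq> 0" "t' \<noteq> 0" using assms Omega_nonzero by auto
  have r: "poly p a = 0 \<longleftrightarrow> order a p \<noteq> 0" if "p \<in> {t, t'}" for p a
    using that nz order_root[of p a] by auto
  have r1: "poly t a = 0 \<and> poly t' a = 0 \<and> order a t = order a t'"
    if a: "poly t a = 0 \<or> poly t' a = 0" for a
  proof -
    have "\<exists>s. a = pt s" using a assms(1,2) by (auto simp: \<Omega>_half_def)
    then obtain s where s: "a = pt s" by blast
    show ?thesis using a r[of t a] r[of t' a] assms(3)[of s] unfolding s by auto
  qed
  have "(\<Prod>z|poly t z = 0. [:-z, 1:] ^ order z t) = (\<Prod>z|poly t' z = 0. [:-z, 1:] ^ order z t')"
  proof (rule prod.cong)
    show "{z. poly t z = 0} = {z. poly t' z = 0}" using r1 by blast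
    show "[:-z, 1:] ^ order z t = [:-z, 1:] ^ order z t'" if "z \<in> {z. poly t' z = 0}" for z
    proof -
      have "order z t = order z t'" using r1[OF disjI2, of z] that by (elim CollectE) blast
      then show ?thesis by (rule arg_cong)
    qed
  qed
  then show ?thesis
    using complex_poly_decompose[of t] complex_poly_decompose[of t'] assms by (simp add: \<Omega>_half_def)
qed

lemma order_z_minus: "order (pt s) (z_minus w) = (if s = w then 1 else 0)"
proof (cases "s = w")
  case True
  then show ?thesis using order_power_n_n[of "pt s" 1] by (simp add: z_minus_def)
next
  case False
  then have "poly (z_minus w) (pt s) \<noteq> 0" by (simp add: z_minus_def half_val_inj)
  then show ?thesis using False order_0I by auto
qed

lemma order_Omega_mult: "t \<in> \<Omega>_half \<Longrightarrow> t' \<in> \<Omega>_half \<Longrightarrow> order a (t * t') = order a t + order a t'"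
  using Omega_nonzero by (intro order_mult) auto

lemma order_Omega_power: "t \<in> \<Omega>_half \<Longrightarrow> order a (t ^ n) = n * order a t"
  by (induction n) (simp_all add: order_Omega_mult Omega_power)

lemma order_Omega_prod:
  "(\<And>x. x \<in> A \<Longrightarrow> f x \<in> \<Omega>_half) \<Longrightarrow> order a (prod f A) = (\<Sum>x\<in>A. order a (f x))"
  by (induction A rule: infinite_finite_induct) (simp_all add: order_Omega_mult Omega_prod)

lemma var_degree_Omega: "var_degree v \<in> \<Omega>_half"
  by (cases v) (simp_all add: Omega_z_minus)

lemma monom_degree_Omega: "monom_degree m \<in> \<Omega>_half"
  unfolding monom_degree_def by (intro Omega_prod Omega_power var_degree_Omega)

text \<open>Both variables attached to s have degree z - s, so the degree knows the sum of their two
  exponents but not how it is divided.\<close>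

lemma order_monom_degree:
  "order (pt s) (monom_degree m) = Poly_Mapping.lookup m (X_plus s) + Poly_Mapping.lookup m (X_minus s)"
proof -
  have "order (pt s) (monom_degree m)
      = (\<Sum>v\<in>Poly_Mapping.keys m. Poly_Mapping.lookup m v * order (pt s) (var_degree v))"
    unfolding monom_degree_def
    by (subst order_Omega_prod) (simp_all add: Omega_power var_degree_Omega order_Omega_power)
  also have "\<dots> = (\<Sum>v\<in>Poly_Mapping.keys m \<inter> {X_plus s, X_minus s}. Poly_Mapping.lookup m v)"
  proof (rule sum.mono_neutral_cong_right)
    show "\<forall>v\<in>Poly_Mapping.keys m - Poly_Mapping.keys m \<inter> {X_plus s, X_minus s}.
        Poly_Mapping.lookup m v * order (pt s) (var_degree v) = 0"
    proof
      fix v assume "v \<in> Poly_Mapping.keys m - Poly_Mapping.keys m \<inter> {X_plus s, X_minus s}"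
      then show "Poly_Mapping.lookup m v * order (pt s) (var_degree v) = 0"
        by (cases v) (auto simp: order_z_minus)
    qed
  qed (auto simp: order_z_minus)
  also have "\<dots> = (\<Sum>v\<in>{X_plus s, X_minus s}. Poly_Mapping.lookup m v)"
    by (rule sum.mono_neutral_left) (auto simp: in_keys_iff)
  finally show ?thesis by simp
qed

lemma monom_degree_add: "monom_degree (m + m') = monom_degree m * monom_degree m'"
  by (rule Omega_eqI)
     (simp_all add: monom_degree_Omega Omega_mult order_Omega_mult order_monom_degree lookup_add)

lemma monom_degree_single: "monom_degree (Poly_Mapping.single v 1) = var_degree v"
  by (simp add: monom_degree_def)

lemma monom_degree_zero: "monom_degree 0 = 1"
  by (simp add: monom_degree_def)

section \<open>The monomial ideal of relations\<close>

definition bad :: "(var \<Rightarrow>\<^sub>0 nat) \<Rightarrow> bool"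
  where "bad m \<longleftrightarrow> (\<exists>s w. half_val s \<le> half_val w \<and> X_minus s \<in> Poly_Mapping.keys m \<and> X_plus w \<in> Poly_Mapping.keys m)"

lemma keys_add_nat: "Poly_Mapping.keys (m + m') = Poly_Mapping.keys m \<union> Poly_Mapping.keys (m' :: var \<Rightarrow>\<^sub>0 nat)"
  by (auto simp: in_keys_iff lookup_add)

lemma bad_add: "bad m \<Longrightarrow> bad (m + m')"
  unfolding bad_def keys_add_nat by blast

lemma x_var_mult: "x_var v * x_var w = Poly_Mapping.single (Poly_Mapping.single v 1 + Poly_Mapping.single w 1) 1"
  by (simp add: x_var_def mult_single)

lemma cring_x: "cring x_poly_ring"
  by (rule cring_from_type_algebra)

lemma ideal_x_ideal: "ideal x_ideal x_poly_ring"
  unfolding x_ideal_def by (rule ring.genideal_ideal[OF cring.axioms(1)[OF cring_x]]) simp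

text \<open>The generators are monomials, so membership is decided monomial by monomial, and
  \<open>bad\<close> says that a monomial is divisible by some generator.\<close>

lemma x_ideal_eq: "x_ideal = {p. \<forall>m\<in>Poly_Mapping.keys p. bad m}"
proof
  interpret cring x_poly_ring by (rule cring_x)
  let ?J = "{p :: x_poly. \<forall>m\<in>Poly_Mapping.keys p. bad m}"
  have "ideal ?J x_poly_ring"
  proof (rule idealI)
    show "subgroup ?J (add_monoid x_poly_ring)"
    proof (rule add.subgroupI)
      show "?J \<noteq> {}" using keys_zero by fastforce
      show "\<ominus>\<^bsub>x_poly_ring\<^esub> a \<in> ?J" if "a \<in> ?J" for a using that by (simp add: in_keys_iff)
      show "a \<oplus>\<^bsub>x_poly_ring\<^esub> b \<in> ?J" if "a \<in> ?J" "b \<in> ?J" for a b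
        using that keys_add[of a b] by auto
    qed simp
    have *: "a * x \<in> ?J" if a: "a \<in> ?J" for a x :: x_poly
    proof -
      have "bad m" if "m \<in> Poly_Mapping.keys (a * x)" for m
      proof -
        obtain u v where "m = u + v" "u \<in> Poly_Mapping.keys a" using keys_mult[of a x] \<open>m \<in> _\<close> by blast
        then show ?thesis using a bad_add by auto
      qed
      then show ?thesis by simp
    qed
    fix a x assume "a \<in> ?J" 
    then show "a \<otimes>\<^bsub>x_poly_ring\<^esub> x \<in> ?J" "x \<otimes>\<^bsub>x_poly_ring\<^esub> a \<in> ?J"
      using *[of a x] by (simp_all only: ring_of_type_algebra_simps mult.commute[of x a])
  qed (rule ring_axioms)
  moreover have "{x_var (X_minus s) * x_var (X_plus w) | s w. half_val s \<le> half_val w} \<subseteq> ?J"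
    by (auto simp: x_var_mult bad_def keys_add_nat)
  ultimately show "x_ideal \<subseteq> ?J" unfolding x_ideal_def by (rule genideal_minimal)
  interpret I: ideal x_ideal x_poly_ring by (rule ideal_x_ideal)
  have mon: "Poly_Mapping.single m c \<in> x_ideal" if bm: "bad m" for m c
  proof -
    obtain s w where sw: "half_val s \<le> half_val w" "X_minus s \<in> Poly_Mapping.keys m" "X_plus w \<in> Poly_Mapping.keys m"
      using bm unfolding bad_def by blast
    define e where "e = Poly_Mapping.single (X_minus s) 1 + Poly_Mapping.single (X_plus w) (1::nat)"
    \<comment> \<open>Subtraction of exponents is truncated; nothing is lost since the two variables
      are distinct and both occur in m.\<close>
    have "e + (m - e) = m"
      using sw(2,3) by (intro poly_mapping_eqI)
        (auto simp: e_def lookup_add lookup_minus lookup_single when_def in_keys_iff)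
    then have "Poly_Mapping.single m c = x_var (X_minus s) * x_var (X_plus w) * Poly_Mapping.single (m - e) c"
      by (simp add: x_var_mult mult_single e_def)
    moreover have "x_var (X_minus s) * x_var (X_plus w) \<in> x_ideal"
      unfolding x_ideal_def using sw(1) by (intro subsetD[OF genideal_self]) auto
    ultimately show ?thesis
      using I.I_r_closed[of "x_var (X_minus s) * x_var (X_plus w)" "Poly_Mapping.single (m - e) c"] by simp
  qed
  show "?J \<subseteq> x_ideal"
  proof
    fix p assume "p \<in> ?J"
    then show "p \<in> x_ideal"
    proof (induction p rule: poly_mapping_single_induct)
      case zero
      show ?case using I.zero_closed by simp
    next
      case (single f a b)
      have k: "Poly_Mapping.keys (Poly_Mapping.single a b + f) = insert a (Poly_Mapping.keys f)"
        using single(1,2) by (auto simp: in_keys_iff lookup_add lookup_single when_def split: if_splits)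
      have "\<forall>m\<in>insert a (Poly_Mapping.keys f). bad m" using single.prems unfolding k[symmetric] by simp
      then have "Poly_Mapping.single a b \<in> x_ideal" "f \<in> x_ideal" using single.IH mon by auto
      then show ?case using I.a_closed[of "Poly_Mapping.single a b" f] by simp
    qed
  qed
qed

text \<open>The only monomial of degree \<^term>\<open>t\<close> whose image, a product of indicator functions of
  half-lines, does not vanish at the integer \<^term>\<open>k\<close>.\<close>

definition gmono :: "complex poly \<Rightarrow> int \<Rightarrow> (var \<Rightarrow>\<^sub>0 nat)"
  where "gmono t k = Abs_poly_mapping (\<lambda>v. case v of
      X_plus s \<Rightarrow> if half_val s < of_int k then order (pt s) t else 0
    | X_minus s \<Rightarrow> if of_int k < half_val s then order (pt s) t else 0)"

text \<open>The defining function has finite support since t has finitely many roots.\<close>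

lemma lookup_gmono:
  assumes "t \<in> \<Omega>_half"
  shows "Poly_Mapping.lookup (gmono t k) v = (case v of
      X_plus s \<Rightarrow> if half_val s < of_int k then order (pt s) t else 0
    | X_minus s \<Rightarrow> if of_int k < half_val s then order (pt s) t else 0)"
proof -
  define R where "R = {s. poly t (pt s) = 0}"
  have "inj_on pt R" by (rule inj_onI) (simp add: half_val_inj)
  moreover have "finite (pt ` R)"
    using finite_roots[OF assms, of "\<lambda>_. True"] by (rule rev_finite_subset) (auto simp: R_def)
  ultimately have "finite R" using finite_imageD by blast
  moreover have "order (pt s) t \<noteq> 0 \<Longrightarrow> s \<in> R" for s
    using order_root Omega_nonzero[OF assms] by (auto simp: R_def)
  ultimately have "finite {v. (case v of
      X_plus s \<Rightarrow> if half_val s < of_int k then order (pt s) t else 0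
    | X_minus s \<Rightarrow> if of_int k < half_val s then order (pt s) t else 0) \<noteq> 0}"
  proof (rule_tac finite_subset[of _ "X_plus ` R \<union> X_minus ` R"])
    assume R: "finite R" "\<And>s. order (pt s) t \<noteq> 0 \<Longrightarrow> s \<in> R"
    show "finite (X_plus ` R \<union> X_minus ` R)" using R by simp
    show "{v. (case v of
        X_plus s \<Rightarrow> if half_val s < of_int k then order (pt s) t else 0
      | X_minus s \<Rightarrow> if of_int k < half_val s then order (pt s) t else 0) \<noteq> 0} \<subseteq> X_plus ` R \<union> X_minus ` R"
    proof
      fix v assume "v \<in> {v. (case v of
        X_plus s \<Rightarrow> if half_val s < of_int k then order (pt s) t else 0
      | X_minus s \<Rightarrow> if of_int k < half_val s then order (pt s) t else 0) \<noteq> 0}"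
      then show "v \<in> X_plus ` R \<union> X_minus ` R"
        using R(2) by (cases v) (auto split: if_splits)
    qed
  qed
  then show ?thesis by (simp add: gmono_def)
qed

text \<open>A half-integer is never an integer, so every root of t lies on exactly one side of k and
  gives its full multiplicity to exactly one of its two variables.\<close>

lemma monom_degree_gmono:
  assumes t: "t \<in> \<Omega>_half"
  shows "monom_degree (gmono t k) = t"
proof (rule Omega_eqI[OF monom_degree_Omega t])
  fix s
  have "half_val s < of_int k \<or> of_int k < half_val s" using half_val_neq_int[of s k] by linarith
  then show "order (pt s) (monom_degree (gmono t k)) = order (pt s) t"
    by (auto simp: order_monom_degree lookup_gmono[OF t])
qed

text \<open>The plus variable at s stands for the indicator of the integers above s, the minus
  variable for that of the integers below. The predicate says that the product of indicators
  belonging to m has the value 1 at k.\<close>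

definition sep :: "int \<Rightarrow> (var \<Rightarrow>\<^sub>0 nat) \<Rightarrow> bool"
  where "sep k m \<longleftrightarrow> (\<forall>s. (X_plus s \<in> Poly_Mapping.keys m \<longrightarrow> half_val s < of_int k) \<and>
    (X_minus s \<in> Poly_Mapping.keys m \<longrightarrow> of_int k < half_val s))"

lemma sep_iff: "sep k m \<longleftrightarrow> m = gmono (monom_degree m) k"
proof
  assume s: "sep k m"
  show "m = gmono (monom_degree m) k"
  proof (rule poly_mapping_eqI)
    fix v
    have 1: "Poly_Mapping.lookup m (X_plus s) = 0" if "\<not> half_val s < of_int k" for s
      using s that by (auto simp: sep_def in_keys_iff)
    have 2: "Poly_Mapping.lookup m (X_minus s) = 0" if "\<not> of_int k < half_val s" for s
      using s that by (auto simp: sep_def in_keys_iff)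
    show "Poly_Mapping.lookup m v = Poly_Mapping.lookup (gmono (monom_degree m) k) v"
      using 1 2 by (cases v) (auto simp: lookup_gmono[OF monom_degree_Omega] order_monom_degree)
  qed
next
  assume e: "m = gmono (monom_degree m) k"
  show "sep k m"
    unfolding sep_def in_keys_iff
    by (subst (1 2) e) (auto simp: lookup_gmono[OF monom_degree_Omega] split: if_splits)
qed

lemma sep_gmono: "t \<in> \<Omega>_half \<Longrightarrow> sep k (gmono t k)"
  by (simp add: sep_iff monom_degree_gmono)

lemma sep_not_bad: "sep k m \<Longrightarrow> \<not> bad m"
  unfolding sep_def bad_def by (meson less_le_trans less_trans not_less_iff_gr_or_eq order_less_le_trans)

text \<open>Outside the ideal, every s of a plus variable in m lies strictly below every s of a
  minus variable, so an integer fits in between.\<close>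

lemma not_bad_sep:
  assumes "\<not> bad m"
  obtains k where "sep k m"
proof -
  define A where "A = {s. X_plus s \<in> Poly_Mapping.keys m}"
  define B where "B = {s. X_minus s \<in> Poly_Mapping.keys m}"
  have "finite (X_plus ` A)" "finite (X_minus ` B)"
    by (rule finite_subset[OF _ finite_keys[of m]]; auto simp: A_def B_def)+
  then have fin: "finite A" "finite B" by (auto simp: finite_image_iff inj_on_def)
  have lt: "half_val w < half_val s" if "w \<in> A" "s \<in> B" for w s
  proof (rule ccontr)
    assume "\<not> half_val w < half_val s"
    then have "half_val s \<le> half_val w" by simp
    then show False using assms that unfolding bad_def A_def B_def by blast
  qed
  show thesis
  proof (cases "A = {}")
    case True
    \<comment> \<open>Without plus variables any integer below all the minus ones will do.\<close>
    obtain k :: int where k: "\<forall>s\<in>B. of_int k < half_val s"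
    proof -
      define K where "K = Min (insert 0 ((\<lambda>s. \<lfloor>half_val s\<rfloor>) ` B)) - 1"
      have "of_int K < half_val s" if "s \<in> B" for s
      proof -
        have "Min (insert 0 ((\<lambda>s. \<lfloor>half_val s\<rfloor>) ` B)) \<le> \<lfloor>half_val s\<rfloor>" using fin that by (intro Min_le) auto
        then have "K < \<lfloor>half_val s\<rfloor>" by (simp add: K_def)
        then show ?thesis by linarith
      qed
      then show thesis by (intro that[of K]) blast
    qed
    show thesis by (rule that[of k]) (use True k in \<open>auto simp: sep_def A_def B_def\<close>)
  next
    case False
    define h where "h = Max (half_val ` A)"
    have "h \<in> half_val ` A" unfolding h_def using fin False by (intro Max_in) auto
    then obtain w where w: "w \<in> A" "h = half_val w" by blast
    \<comment> \<open>The witness is l + 1, the integer just above the largest plus position l +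
      1/2. It stays below the minus positions because these are strictly larger
      half-integers.\<close>
    obtain l :: int where l: "half_val w = of_int l + 1/2" by (rule half_valE)
    have "half_val s < of_int (l + 1)" if "s \<in> A" for s
    proof -
      have "half_val s \<le> h" unfolding h_def using fin that by (intro Max_ge) auto
      then show ?thesis using w l by simp
    qed
    moreover have "of_int (l + 1) < half_val s" if s: "s \<in> B" for s
    proof -
      obtain n :: int where n: "half_val s = of_int n + 1/2" by (rule half_valE)
      have "of_int l < real_of_int n" using lt[OF w(1) s] l n by simp
      then show ?thesis using n by simp
    qed
    ultimately show thesis by (intro that[of "l + 1"]) (auto simp: sep_def A_def B_def)
  qed
qed

text \<open>Both sides say that the same roots of t lie to the left of k and of l. The index only
  counts these roots, but this is enough because the two sets are nested.\<close>

lemma gmono_eq_iff: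
  assumes t: "t \<in> \<Omega>_half"
  shows "gmono t k = gmono t l \<longleftrightarrow> cidx t k = cidx t l"
proof -
  have main: "gmono t k = gmono t l \<longleftrightarrow> cidx t k = cidx t l" if "k \<le> l" for k l
  proof -
    have ro: "order (pt s) t = 0 \<longleftrightarrow> poly t (pt s) \<noteq> 0" for s
      using Omega_nonzero[OF t] order_root by blast
    let ?A = "\<lambda>k. {a. poly t a = 0 \<and> Re a < of_int k}"
    have sub: "?A k \<subseteq> ?A l" using that by auto
    have "cidx t k = cidx t l \<longleftrightarrow> ?A k = ?A l"
      using card_subset_eq[OF finite_roots[OF t] sub] by (auto simp: cidx_def)
    also have "\<dots> \<longleftrightarrow> (\<forall>s. poly t (pt s) = 0 \<longrightarrow> (half_val s < of_int k \<longleftrightarrow> half_val s < of_int l))"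
    proof
      assume e: "?A k = ?A l"
      show "\<forall>s. poly t (pt s) = 0 \<longrightarrow> (half_val s < of_int k \<longleftrightarrow> half_val s < of_int l)"
      proof (intro allI impI)
        fix s assume "poly t (pt s) = 0"
        then have "pt s \<in> ?A k \<longleftrightarrow> half_val s < of_int k" "pt s \<in> ?A l \<longleftrightarrow> half_val s < of_int l" by auto
        then show "half_val s < of_int k \<longleftrightarrow> half_val s < of_int l" using e by simp
      qed
    next
      assume h: "\<forall>s. poly t (pt s) = 0 \<longrightarrow> (half_val s < of_int k \<longleftrightarrow> half_val s < of_int l)"
      have "a \<in> ?A k" if a: "a \<in> ?A l" for a
      proof -
        have "poly t a = 0" using a by simp
        then obtain s where "a = pt s" by (rule Omega_rootE[OF t])
        then show ?thesis using h a by auto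
      qed
      then show "?A k = ?A l" using sub by blast
    qed
    also have "\<dots> \<longleftrightarrow> gmono t k = gmono t l"
    proof
      assume h: "\<forall>s. poly t (pt s) = 0 \<longrightarrow> (half_val s < of_int k \<longleftrightarrow> half_val s < of_int l)"
      have h': "of_int k < half_val s \<longleftrightarrow> of_int l < half_val s" if "poly t (pt s) = 0" for s
        using h that half_val_neq_int[of s k] half_val_neq_int[of s l] by (meson linorder_neqE not_less_iff_gr_or_eq)
      show "gmono t k = gmono t l"
      proof (rule poly_mapping_eqI)
        fix v show "Poly_Mapping.lookup (gmono t k) v = Poly_Mapping.lookup (gmono t l) v"
          using h h' ro by (cases v) (auto simp: lookup_gmono[OF t])
      qed
    next
      assume e: "gmono t k = gmono t l"
      show "\<forall>s. poly t (pt s) = 0 \<longrightarrow> (half_val s < of_int k \<longleftrightarrow> half_val s < of_int l)"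
      proof (intro allI impI)
        fix s assume "poly t (pt s) = 0"
        then have "order (pt s) t \<noteq> 0" using ro by simp
        moreover have "Poly_Mapping.lookup (gmono t k) (X_plus s) = Poly_Mapping.lookup (gmono t l) (X_plus s)"
          using e by simp
        ultimately show "half_val s < of_int k \<longleftrightarrow> half_val s < of_int l"
          by (auto simp: lookup_gmono[OF t] split: if_splits)
      qed
    qed
    finally show ?thesis by blast
  qed
  show ?thesis
  proof (cases "k \<le> l")
    case False
    then show ?thesis using main[of l k] by (simp add: eq_commute)
  qed (rule main)
qed

definition homogeneous :: "complex poly \<Rightarrow> x_poly \<Rightarrow> bool"
  where "homogeneous t p \<longleftrightarrow> (\<forall>m\<in>Poly_Mapping.keys p. monom_degree m = t)"

text \<open>The value at k of the function on the integers that p represents; it is additive and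
  multiplicative by \<open>ev_add\<close> and \<open>ev_mult\<close>.\<close>

definition ev :: "int \<Rightarrow> x_poly \<Rightarrow> complex"
  where "ev k p = (\<Sum>m\<in>Poly_Mapping.keys p. Poly_Mapping.lookup p m * (if sep k m then 1 else 0))"

lemma ev_superset:
  "finite S \<Longrightarrow> Poly_Mapping.keys p \<subseteq> S \<Longrightarrow>
    ev k p = (\<Sum>m\<in>S. Poly_Mapping.lookup p m * (if sep k m then 1 else 0))"
  unfolding ev_def by (rule sum.mono_neutral_left) (auto simp: in_keys_iff)

lemma ev_add: "ev k (p + q) = ev k p + ev k q"
proof -
  have "Poly_Mapping.keys (p + q) \<subseteq> Poly_Mapping.keys p \<union> Poly_Mapping.keys q" by (rule keys_add)
  then have e: "ev k r = (\<Sum>m\<in>Poly_Mapping.keys p \<union> Poly_Mapping.keys q.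
      Poly_Mapping.lookup r m * (if sep k m then 1 else 0))" if "r \<in> {p, q, p + q}" for r
    using that by (intro ev_superset) auto
  show ?thesis
    using e[of p] e[of q] e[of "p + q"] by (simp only: insert_iff simp_thms lookup_add distrib_right sum.distrib)
qed

lemma ev_single: "ev k (Poly_Mapping.single m c) = (if sep k m then c else 0)"
  using ev_superset[of "{m}" "Poly_Mapping.single m c" k] by simp

lemma sep_add: "sep k (m + m') \<longleftrightarrow> sep k m \<and> sep k m'"
  unfolding sep_def keys_add_nat by blast

lemma ev_zero [simp]: "ev k 0 = 0"
  by (simp add: ev_def)

lemma ev_mult: "ev k (p * q) = ev k p * ev k q"
proof (induction p rule: poly_mapping_single_induct)
  case (single p m c)
  have "ev k (Poly_Mapping.single m c * q) = ev k (Poly_Mapping.single m c) * ev k q"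
    by (induction q rule: poly_mapping_single_induct)
       (simp_all add: distrib_left mult_single ev_add ev_single sep_add)
  then show ?case using single by (simp add: distrib_right ev_add)
qed simp

text \<open>In degree t, \<open>gmono t k\<close> is the only monomial that does not vanish at k.
  This links evaluations, which are multiplicative, with the coordinates of
  \<open>xc_eq_iff\<close>.\<close>

lemma homogeneous_ev:
  assumes "homogeneous t p" "t \<in> \<Omega>_half"
  shows "ev k p = Poly_Mapping.lookup p (gmono t k)"
proof -
  have "ev k p = (\<Sum>m\<in>Poly_Mapping.keys p. if m = gmono t k then Poly_Mapping.lookup p m else 0)"
    unfolding ev_def
  proof (rule sum.cong[OF refl])
    fix m assume "m \<in> Poly_Mapping.keys p"
    then have "monom_degree m = t" using assms(1) by (simp add: homogeneous_def)
    then show "Poly_Mapping.lookup p m * (if sep k m then 1 else 0) = (if m = gmono t k then Poly_Mapping.lookup p m else 0)"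
      using sep_iff[of k m] by simp
  qed
  also have "\<dots> = Poly_Mapping.lookup p (gmono t k)" by (simp add: in_keys_iff)
  finally show ?thesis .
qed

lemma homogeneous_mult:
  assumes "homogeneous t p" "homogeneous t' q"
  shows "homogeneous (t * t') (p * q)"
  unfolding homogeneous_def
proof
  fix m assume "m \<in> Poly_Mapping.keys (p * q)"
  then obtain a b where "m = a + b" "a \<in> Poly_Mapping.keys p" "b \<in> Poly_Mapping.keys q"
    using keys_mult[of p q] by blast
  then show "monom_degree m = t * t'" using assms by (simp add: homogeneous_def monom_degree_add)
qed

lemma lookup_homogeneous_other:
  "homogeneous t p \<Longrightarrow> u \<in> \<Omega>_half \<Longrightarrow> u \<noteq> t \<Longrightarrow> Poly_Mapping.lookup p (gmono u k) = 0"
  by (metis homogeneous_def in_keys_iff monom_degree_gmono)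

section \<open>The quotient algebra and its grading\<close>

definition xc :: "x_poly \<Rightarrow> x_poly set"
  where "xc p = x_ideal +>\<^bsub>x_poly_ring\<^esub> p"

text \<open>The monomials outside the ideal are exactly those of the form \<open>gmono t k\<close>,
  so their coefficients are coordinates on the quotient.\<close>

lemma xc_eq_iff: "xc p = xc q \<longleftrightarrow> (\<forall>t\<in>\<Omega>_half. \<forall>k. Poly_Mapping.lookup p (gmono t k) = Poly_Mapping.lookup q (gmono t k))"
proof -
  interpret ideal x_ideal x_poly_ring by (rule ideal_x_ideal)
  have "xc p = xc q \<longleftrightarrow> p - q \<in> x_ideal"
    using quotient_eq_iff_same_a_r_cos[OF ideal_x_ideal, of p q] by (simp add: xc_def)
  also have "\<dots> \<longleftrightarrow> (\<forall>m. \<not> bad m \<longrightarrow> Poly_Mapping.lookup p m = Poly_Mapping.lookup q m)"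
    by (auto simp: x_ideal_eq in_keys_iff lookup_minus)
  also have "\<dots> \<longleftrightarrow> (\<forall>t\<in>\<Omega>_half. \<forall>k. Poly_Mapping.lookup p (gmono t k) = Poly_Mapping.lookup q (gmono t k))"
  proof
    assume "\<forall>m. \<not> bad m \<longrightarrow> Poly_Mapping.lookup p m = Poly_Mapping.lookup q m"
    then show "\<forall>t\<in>\<Omega>_half. \<forall>k. Poly_Mapping.lookup p (gmono t k) = Poly_Mapping.lookup q (gmono t k)"
      using sep_not_bad[OF sep_gmono] by blast
  next
    assume h: "\<forall>t\<in>\<Omega>_half. \<forall>k. Poly_Mapping.lookup p (gmono t k) = Poly_Mapping.lookup q (gmono t k)"
    show "\<forall>m. \<not> bad m \<longrightarrow> Poly_Mapping.lookup p m = Poly_Mapping.lookup q m"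
    proof (intro allI impI)
      fix m assume "\<not> bad m"
      then obtain k where "sep k m" by (rule not_bad_sep)
      then have "m = gmono (monom_degree m) k" by (simp add: sep_iff)
      then show "Poly_Mapping.lookup p m = Poly_Mapping.lookup q m"
        using h monom_degree_Omega[of m] by metis
    qed
  qed
  finally show ?thesis .
qed

lemma x_alg_simps:
  shows "carrier x_alg = range xc" "xc p \<oplus>\<^bsub>x_alg\<^esub> xc q = xc (p + q)" "xc p \<otimes>\<^bsub>x_alg\<^esub> xc q = xc (p * q)"
    "\<one>\<^bsub>x_alg\<^esub> = xc 1" "\<zero>\<^bsub>x_alg\<^esub> = xc 0" "c \<odot>\<^bsub>x_alg\<^esub> xc p = xc (Poly_Mapping.single 0 c * p)"
proof -
  interpret ideal x_ideal x_poly_ring by (rule ideal_x_ideal)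
  note h = rcos_ring_hom
  have x: "xc p = (+>\<^bsub>x_poly_ring\<^esub>) x_ideal p" for p by (simp add: xc_def)
  show "carrier x_alg = range xc"
    by (auto simp: x_alg_def ring.defs module.defs FactRing_def A_RCOSETS_def RCOSETS_def xc_def a_r_coset_def)
  show "xc p \<oplus>\<^bsub>x_alg\<^esub> xc q = xc (p + q)"
    using ring_hom_add[OF h, of p q] by (simp add: x_alg_def ring.defs module.defs xc_def)
  show m: "xc p \<otimes>\<^bsub>x_alg\<^esub> xc q = xc (p * q)" for p q
    using ring_hom_mult[OF h, of p q] by (simp add: x_alg_def ring.defs module.defs xc_def)
  show "\<one>\<^bsub>x_alg\<^esub> = xc 1" by (simp add: x_alg_def ring.defs module.defs xc_def FactRing_def)
  show "\<zero>\<^bsub>x_alg\<^esub> = xc 0"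
    using a_coset_add_zero[of x_ideal] a_subset by (simp add: x_alg_def ring.defs module.defs xc_def FactRing_def)
  show "c \<odot>\<^bsub>x_alg\<^esub> xc p = xc (Poly_Mapping.single 0 c * p)"
    using ring_hom_mult[OF h, of "Poly_Mapping.single 0 c" p] by (simp add: x_alg_def ring.defs module.defs xc_def)
qed

lemma x_class_xc: "x_class v = xc (x_var v)"
  by (simp add: x_class_def xc_def)

lemma x_comp_xc: "x_comp t = xc ` {p. homogeneous t p}"
  by (auto simp: x_comp_def xc_def homogeneous_def)

lemma cring_x_alg: "cring x_alg"
proof (rule cringI)
  show "abelian_group x_alg"
  proof (rule abelian_groupI)
    fix x assume "x \<in> carrier x_alg"
    then obtain p where p: "x = xc p" by (auto simp: x_alg_simps)
    have "xc (- p) \<oplus>\<^bsub>x_alg\<^esub> x = \<zero>\<^bsub>x_alg\<^esub>" unfolding p by (simp add: x_alg_simps)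
    then show "\<exists>y\<in>carrier x_alg. y \<oplus>\<^bsub>x_alg\<^esub> x = \<zero>\<^bsub>x_alg\<^esub>" by (intro bexI[of _ "xc (- p)"]) (simp_all add: x_alg_simps)
  qed (auto simp: x_alg_simps algebra_simps)
  show "comm_monoid x_alg"
    by (rule comm_monoidI) (auto simp: x_alg_simps algebra_simps)
qed (auto simp: x_alg_simps algebra_simps)

lemma cring_C_ring: "cring C_ring"
  by (rule cring_from_type_algebra)

lemma algebra_x_alg: "algebra C_ring x_alg"
proof -
  have "module C_ring x_alg"
  proof (rule moduleI)
    show "abelian_group x_alg" using cring_x_alg by (simp add: cring_def ring_def)
  qed (auto simp: x_alg_simps cring_C_ring single_add distrib_left distrib_right mult_single mult.assoc[symmetric])
  then show ?thesis
    unfolding algebra_def algebra_axioms_def using cring_x_alg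
    by (auto simp: x_alg_simps mult.assoc)
qed

lemma xc_finsum:
  assumes "finite S"
  shows "(\<Oplus>\<^bsub>x_alg\<^esub>s\<in>S. xc (g s)) = xc (\<Sum>s\<in>S. g s)"
proof -
  interpret cring x_alg by (rule cring_x_alg)
  show ?thesis using assms
  proof (induction S rule: finite_induct)
    case (insert s S)
    have "(\<lambda>s. xc (g s)) \<in> S \<rightarrow> carrier x_alg" "xc (g s) \<in> carrier x_alg" by (auto simp: x_alg_simps)
    then show ?case using insert by (simp add: x_alg_simps)
  qed (simp add: x_alg_simps)
qed

definition part :: "complex poly \<Rightarrow> x_poly \<Rightarrow> x_poly"
  where "part t p = (\<Sum>m\<in>Poly_Mapping.keys p. if monom_degree m = t then Poly_Mapping.single m (Poly_Mapping.lookup p m) else 0)"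

lemma lookup_part: "Poly_Mapping.lookup (part t p) m = (if monom_degree m = t then Poly_Mapping.lookup p m else 0)"
proof -
  have "Poly_Mapping.lookup (part t p) m = (\<Sum>n\<in>Poly_Mapping.keys p.
      if n = m then (if monom_degree m = t then Poly_Mapping.lookup p m else 0) else 0)"
    unfolding part_def lookup_sum by (rule sum.cong) (auto simp: lookup_single when_def)
  then show ?thesis by (simp add: in_keys_iff)
qed

lemma homogeneous_part: "homogeneous t (part t p)"
  by (auto simp: homogeneous_def in_keys_iff lookup_part split: if_splits)

lemma homogeneous_closed:
  "homogeneous t p \<Longrightarrow> homogeneous t q \<Longrightarrow> homogeneous t (p + q)"
  "homogeneous t p \<Longrightarrow> homogeneous t (- p)"
  "homogeneous t 0"
  "homogeneous 1 (Poly_Mapping.single 0 c)"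
  using keys_add[of p q]
  by (auto simp: homogeneous_def monom_degree_zero in_keys_iff lookup_single when_def split: if_splits)

lemma submodule_x_comp: "submodule (x_comp t) C_ring x_alg"
proof -
  interpret algebra C_ring x_alg by (rule algebra_x_alg)
  have neg: "\<ominus>\<^bsub>x_alg\<^esub> xc p = xc (- p)" for p
    by (rule M.minus_equality) (simp_all add: x_alg_simps)
  show ?thesis
  proof (rule submoduleI)
    show "x_comp t \<subseteq> carrier x_alg" by (auto simp: x_comp_xc x_alg_simps)
    show "\<zero>\<^bsub>x_alg\<^esub> \<in> x_comp t" by (auto simp: x_comp_xc x_alg_simps homogeneous_closed)
    show "\<ominus>\<^bsub>x_alg\<^esub> a \<in> x_comp t" if "a \<in> x_comp t" for a
      using that by (auto simp: x_comp_xc neg homogeneous_closed)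
    show "a \<oplus>\<^bsub>x_alg\<^esub> b \<in> x_comp t" if "a \<in> x_comp t" "b \<in> x_comp t" for a b
      using that by (auto simp: x_comp_xc x_alg_simps homogeneous_closed)
    show "a \<odot>\<^bsub>x_alg\<^esub> x \<in> x_comp t" if "a \<in> carrier C_ring" "x \<in> x_comp t" for a x
      using that homogeneous_mult[OF homogeneous_closed(4)[of a]] by (auto simp: x_comp_xc x_alg_simps)
  qed
qed

lemma xc_zero_iff: "xc p = \<zero>\<^bsub>x_alg\<^esub> \<longleftrightarrow> (\<forall>t\<in>\<Omega>_half. \<forall>k. Poly_Mapping.lookup p (gmono t k) = 0)"
  unfolding x_alg_simps xc_eq_iff by simp

text \<open>The coordinates at the monomials of degree u see only the summand of degree u, which
  makes homogeneous components unique in the quotient.\<close>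

lemma is_direct_sum_x_alg: "is_direct_sum x_alg \<Omega>_half x_comp"
  unfolding is_direct_sum_def
proof (intro conjI ballI)
  fix t show "x_comp t \<subseteq> carrier x_alg" by (auto simp: x_comp_xc x_alg_simps)
next
  fix x assume "x \<in> carrier x_alg"
  then obtain p where p: "x = xc p" by (auto simp: x_alg_simps)
  define f where "f = (\<lambda>t\<in>\<Omega>_half. xc (part t p))"
  define S where "S = {t \<in> \<Omega>_half. f t \<noteq> \<zero>\<^bsub>x_alg\<^esub>}"
  have S: "finite S"
  proof (rule finite_subset)
    show "S \<subseteq> monom_degree ` Poly_Mapping.keys p"
    proof
      fix t assume "t \<in> S"
      then have t: "t \<in> \<Omega>_half" "xc (part t p) \<noteq> \<zero>\<^bsub>x_alg\<^esub>"
        unfolding S_def f_def by (simp_all split: if_splits)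
      then obtain u k where "Poly_Mapping.lookup (part t p) (gmono u k) \<noteq> 0" by (auto simp: xc_zero_iff)
      then have "monom_degree (gmono u k) = t" "gmono u k \<in> Poly_Mapping.keys p"
        by (auto simp: lookup_part in_keys_iff split: if_splits)
      then show "t \<in> monom_degree ` Poly_Mapping.keys p" by blast
    qed
  qed simp
  have fE: "f \<in> (\<Pi>\<^sub>E t\<in>\<Omega>_half. x_comp t)" by (auto simp: f_def x_comp_xc homogeneous_part)
  have fx: "x = (\<Oplus>\<^bsub>x_alg\<^esub>t\<in>S. f t)"
  proof -
    interpret cring x_alg by (rule cring_x_alg)
    have "(\<Oplus>\<^bsub>x_alg\<^esub>t\<in>S. f t) = (\<Oplus>\<^bsub>x_alg\<^esub>t\<in>S. xc (part t p))"
      by (rule finsum_cong') (auto simp: S_def f_def x_alg_simps)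
    also have "\<dots> = xc (\<Sum>t\<in>S. part t p)" by (rule xc_finsum[OF S])
    also have "\<dots> = xc p"
      unfolding xc_eq_iff
    proof (intro ballI allI)
      fix u k assume u: "u \<in> \<Omega>_half"
      have "Poly_Mapping.lookup (\<Sum>t\<in>S. part t p) (gmono u k)
          = (\<Sum>t\<in>S. if t = u then Poly_Mapping.lookup p (gmono u k) else 0)"
        unfolding lookup_sum by (rule sum.cong) (auto simp: lookup_part monom_degree_gmono[OF u])
      also have "\<dots> = (if u \<in> S then Poly_Mapping.lookup p (gmono u k) else 0)" using S by simp
      also have "\<dots> = Poly_Mapping.lookup p (gmono u k)"
      proof (cases "u \<in> S")
        case False
        then have "xc (part u p) = \<zero>\<^bsub>x_alg\<^esub>" using u by (simp add: S_def f_def)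
        then have "Poly_Mapping.lookup (part u p) (gmono u k) = 0" using u by (simp add: xc_zero_iff)
        then show ?thesis using False by (simp add: lookup_part monom_degree_gmono[OF u])
      qed simp
      finally show "Poly_Mapping.lookup (\<Sum>t\<in>S. part t p) (gmono u k) = Poly_Mapping.lookup p (gmono u k)" .
    qed
    finally show ?thesis using p by simp
  qed
  show "\<exists>!f. f \<in> (\<Pi>\<^sub>E t\<in>\<Omega>_half. x_comp t) \<and> finite {t \<in> \<Omega>_half. f t \<noteq> \<zero>\<^bsub>x_alg\<^esub>} \<and>
     x = (\<Oplus>\<^bsub>x_alg\<^esub>t\<in>{t \<in> \<Omega>_half. f t \<noteq> \<zero>\<^bsub>x_alg\<^esub>}. f t)"
  proof (rule ex1I[of _ f])
    show "f \<in> (\<Pi>\<^sub>E t\<in>\<Omega>_half. x_comp t) \<and> finite {t \<in> \<Omega>_half. f t \<noteq> \<zero>\<^bsub>x_alg\<^esub>} \<and>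
      x = (\<Oplus>\<^bsub>x_alg\<^esub>t\<in>{t \<in> \<Omega>_half. f t \<noteq> \<zero>\<^bsub>x_alg\<^esub>}. f t)"
      using fE S fx by (simp add: S_def)
    fix g assume g: "g \<in> (\<Pi>\<^sub>E t\<in>\<Omega>_half. x_comp t) \<and> finite {t \<in> \<Omega>_half. g t \<noteq> \<zero>\<^bsub>x_alg\<^esub>} \<and>
       x = (\<Oplus>\<^bsub>x_alg\<^esub>t\<in>{t \<in> \<Omega>_half. g t \<noteq> \<zero>\<^bsub>x_alg\<^esub>}. g t)"
    define S' where "S' = {t \<in> \<Omega>_half. g t \<noteq> \<zero>\<^bsub>x_alg\<^esub>}"
    have "\<forall>t\<in>\<Omega>_half. \<exists>q. homogeneous t q \<and> g t = xc q" using g by (auto simp: PiE_iff x_comp_xc)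
    then obtain q where q: "\<And>t. t \<in> \<Omega>_half \<Longrightarrow> homogeneous t (q t)" "\<And>t. t \<in> \<Omega>_half \<Longrightarrow> g t = xc (q t)"
      using bchoice[of \<Omega>_half "\<lambda>t q. homogeneous t q \<and> g t = xc q"] by blast
    have S': "finite S'" "x = (\<Oplus>\<^bsub>x_alg\<^esub>t\<in>S'. g t)" using g by (auto simp: S'_def)
    interpret cring x_alg by (rule cring_x_alg)
    have "x = (\<Oplus>\<^bsub>x_alg\<^esub>t\<in>S'. xc (q t))"
      unfolding S'(2) by (rule finsum_cong') (auto simp: S'_def q x_alg_simps)
    also have "\<dots> = xc (\<Sum>t\<in>S'. q t)" by (rule xc_finsum[OF S'(1)])
    finally have pq: "xc p = xc (\<Sum>t\<in>S'. q t)" using p by simp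
    have l: "Poly_Mapping.lookup p (gmono u k) = Poly_Mapping.lookup (q u) (gmono u k)"
      if u: "u \<in> \<Omega>_half" for u k
    proof -
      have "Poly_Mapping.lookup p (gmono u k) = (\<Sum>t\<in>S'. Poly_Mapping.lookup (q t) (gmono u k))"
        using pq u by (simp add: xc_eq_iff lookup_sum)
      also have "\<dots> = (\<Sum>t\<in>S'. if t = u then Poly_Mapping.lookup (q u) (gmono u k) else 0)"
      proof (rule sum.cong[OF refl])
        fix t assume "t \<in> S'"
        then have "t \<in> \<Omega>_half" by (simp add: S'_def)
        then show "Poly_Mapping.lookup (q t) (gmono u k) = (if t = u then Poly_Mapping.lookup (q u) (gmono u k) else 0)"
          using lookup_homogeneous_other[OF q(1) u, of t k] by auto
      qed
      also have "\<dots> = (if u \<in> S' then Poly_Mapping.lookup (q u) (gmono u k) else 0)" using S'(1) by simp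
      also have "\<dots> = Poly_Mapping.lookup (q u) (gmono u k)"
      proof (cases "u \<in> S'")
        case False
        then have "xc (q u) = \<zero>\<^bsub>x_alg\<^esub>" using u q(2)[OF u] by (simp add: S'_def)
        then show ?thesis using u False by (simp add: xc_zero_iff)
      qed simp
      finally show ?thesis .
    qed
    show "g = f"
    proof
      fix t show "g t = f t"
      proof (cases "t \<in> \<Omega>_half")
        case t: True
        have "xc (q t) = xc (part t p)"
          unfolding xc_eq_iff
        proof (intro ballI allI)
          fix u k assume u: "u \<in> \<Omega>_half"
          show "Poly_Mapping.lookup (q t) (gmono u k) = Poly_Mapping.lookup (part t p) (gmono u k)"
            using l[OF u, of k] lookup_homogeneous_other[OF q(1)[OF t] u, of k] monom_degree_gmono[OF u, of k]
            by (cases "u = t") (simp_all add: lookup_part)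
        qed
        then show ?thesis using q(2)[OF t] t by (simp add: f_def)
      next
        case False
        then show ?thesis using g fE by (auto simp: PiE_iff extensional_def)
      qed
    qed
  qed
qed

lemma graded_algebra_x_alg: "graded_algebra \<Omega>_half x_alg x_comp"
  unfolding graded_algebra_def
proof (intro conjI ballI algebra_x_alg submodule_x_comp is_direct_sum_x_alg)
  have "homogeneous 1 1" using homogeneous_closed(4)[of 1] by simp
  then show "\<one>\<^bsub>x_alg\<^esub> \<in> x_comp 1" by (auto simp: x_alg_simps x_comp_xc)
  show "x \<otimes>\<^bsub>x_alg\<^esub> y \<in> x_comp (g * h)" if "x \<in> x_comp g" "y \<in> x_comp h" for g h x y
    using that homogeneous_mult by (auto simp: x_comp_xc x_alg_simps)
qed

text \<open>The ring, module and grading axioms of B all come along the bijection. For the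
  Grothendieck algebra this is how associativity and commutativity of the product are
  obtained.\<close>

lemma graded_algebra_transport:
  assumes A: "graded_algebra G A Ac" and bij: "bij_betw \<phi> (carrier A) (carrier B)"
    and add: "\<And>x y. x \<in> carrier A \<Longrightarrow> y \<in> carrier A \<Longrightarrow> \<phi> (x \<oplus>\<^bsub>A\<^esub> y) = \<phi> x \<oplus>\<^bsub>B\<^esub> \<phi> y"
    and mult: "\<And>x y. x \<in> carrier A \<Longrightarrow> y \<in> carrier A \<Longrightarrow> \<phi> (x \<otimes>\<^bsub>A\<^esub> y) = \<phi> x \<otimes>\<^bsub>B\<^esub> \<phi> y"
    and smult: "\<And>c x. x \<in> carrier A \<Longrightarrow> \<phi> (c \<odot>\<^bsub>A\<^esub> x) = c \<odot>\<^bsub>B\<^esub> \<phi> x"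
    and zero: "\<phi> \<zero>\<^bsub>A\<^esub> = \<zero>\<^bsub>B\<^esub>" and one: "\<phi> \<one>\<^bsub>A\<^esub> = \<one>\<^bsub>B\<^esub>"
    and comp: "\<And>g. g \<in> G \<Longrightarrow> \<phi> ` Ac g = Bc g"
    and G: "1 \<in> G" "\<And>g h. g \<in> G \<Longrightarrow> h \<in> G \<Longrightarrow> g * h \<in> G"
  shows "graded_algebra_iso G A Ac B Bc \<phi>"
proof -
  interpret A: algebra C_ring A using A by (simp add: graded_algebra_def)
  have surj: "\<phi> ` carrier A = carrier B" and inj: "inj_on \<phi> (carrier A)"
    using bij by (auto simp: bij_betw_def)
  have lA: "left_module C_ring A"
    by (intro left_module.intro left_module_axioms.intro A.R.ring_axioms A.M.abelian_group_axioms
        A.smult_closed A.smult_l_distr A.smult_r_distr A.smult_assoc1 A.smult_one)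
  note im = left_module_image[OF lA surj add zero smult]
  have lB: "left_module C_ring B" and hom: "\<phi> \<in> module_hom C_ring A B" using im by auto
  interpret B: left_module C_ring B by fact
  define \<psi> where "\<psi> = inv_into (carrier A) \<phi>"
  have \<psi>c: "\<psi> y \<in> carrier A" and \<phi>\<psi>: "\<phi> (\<psi> y) = y" if "y \<in> carrier B" for y
    using that surj unfolding \<psi>_def by (metis inv_into_into f_inv_into_f)+
  have \<psi>\<phi>: "\<psi> (\<phi> x) = x" if "x \<in> carrier A" for x using that inj unfolding \<psi>_def by simp
  have \<phi>c: "\<phi> x \<in> carrier B" if "x \<in> carrier A" for x using that surj by blast
  note hz = module_hom_zero_minus[OF A.M.abelian_group_axioms B.M.abelian_group_axioms hom]
  have \<psi>hom: "\<psi> \<in> module_hom C_ring B A" unfolding \<psi>_def by (rule module_hom_inv[OF lA hom bij])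
  note \<psi>z = module_hom_zero_minus[OF B.M.abelian_group_axioms A.M.abelian_group_axioms \<psi>hom]
  have ex: "\<exists>x'\<in>carrier A. y = \<phi> x'" if "y \<in> carrier B" for y using \<psi>c[OF that] \<phi>\<psi>[OF that] by metis
  have crB: "cring B"
  proof (rule cringI)
    show "comm_monoid B"
    proof (rule comm_monoidI)
      show "\<one>\<^bsub>B\<^esub> \<in> carrier B" using one \<phi>c[of "\<one>\<^bsub>A\<^esub>"] by simp
      show "x \<otimes>\<^bsub>B\<^esub> y \<in> carrier B" if "x \<in> carrier B" "y \<in> carrier B" for x y
        using ex[OF that(1)] ex[OF that(2)] by (auto simp flip: mult intro!: \<phi>c)
      show "\<one>\<^bsub>B\<^esub> \<otimes>\<^bsub>B\<^esub> x = x" if "x \<in> carrier B" for x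
        using ex[OF that] mult[of "\<one>\<^bsub>A\<^esub>"] by (auto simp: one)
      show "x \<otimes>\<^bsub>B\<^esub> y = y \<otimes>\<^bsub>B\<^esub> x" if "x \<in> carrier B" "y \<in> carrier B" for x y
        using ex[OF that(1)] ex[OF that(2)] by (auto simp flip: mult simp: A.m_comm)
      show "x \<otimes>\<^bsub>B\<^esub> y \<otimes>\<^bsub>B\<^esub> z = x \<otimes>\<^bsub>B\<^esub> (y \<otimes>\<^bsub>B\<^esub> z)" if "x \<in> carrier B" "y \<in> carrier B" "z \<in> carrier B" for x y z
        using ex[OF that(1)] ex[OF that(2)] ex[OF that(3)] by (auto simp flip: mult simp: A.m_assoc)
    qed
    show "(x \<oplus>\<^bsub>B\<^esub> y) \<otimes>\<^bsub>B\<^esub> z = x \<otimes>\<^bsub>B\<^esub> z \<oplus>\<^bsub>B\<^esub> y \<otimes>\<^bsub>B\<^esub> z"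
      if "x \<in> carrier B" "y \<in> carrier B" "z \<in> carrier B" for x y z
      using ex[OF that(1)] ex[OF that(2)] ex[OF that(3)]
      by (auto simp flip: mult add simp: A.l_distr)
  qed (rule B.M.abelian_group_axioms)
  have algB: "algebra C_ring B"
  proof -
    have "module C_ring B"
      by (intro module.intro module_axioms.intro cring_C_ring B.M.abelian_group_axioms
          B.smult_closed B.smult_l_distr B.smult_r_distr B.smult_assoc B.smult_one)
    moreover have "c \<odot>\<^bsub>B\<^esub> x \<otimes>\<^bsub>B\<^esub> y = c \<odot>\<^bsub>B\<^esub> (x \<otimes>\<^bsub>B\<^esub> y)" if "x \<in> carrier B" "y \<in> carrier B" for c x y
      using ex[OF that(1)] ex[OF that(2)] by (auto simp flip: mult smult simp: A.smult_assoc2)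
    ultimately show ?thesis using crB by (simp add: algebra_def algebra_axioms_def)
  qed
  have sub: "submodule (Ac g) C_ring A" if "g \<in> G" for g using A that by (simp add: graded_algebra_def)
  have AcA: "Ac g \<subseteq> carrier A" if "g \<in> G" for g
    using submodule.axioms(1)[OF sub[OF that]] subgroup.subset by fastforce
  have subB: "submodule (Bc g) C_ring B" if g: "g \<in> G" for g
  proof -
    interpret S: submodule "Ac g" C_ring A by (rule sub[OF g])
    show ?thesis unfolding comp[OF g, symmetric]
    proof (intro submodule.intro submodule_axioms.intro B.M.add.subgroupI)
      show "\<phi> ` Ac g \<subseteq> carrier B" using AcA[OF g] \<phi>c by blast
      show "\<phi> ` Ac g \<noteq> {}" using S.one_closed by blast
      show "\<ominus>\<^bsub>B\<^esub> a \<in> \<phi> ` Ac g" if a: "a \<in> \<phi> ` Ac g" for a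
      proof -
        obtain x where x: "x \<in> Ac g" "a = \<phi> x" using a by blast
        have "\<ominus>\<^bsub>A\<^esub> x \<in> Ac g" using S.m_inv_closed[OF x(1)] by (simp add: a_inv_def)
        moreover have "\<ominus>\<^bsub>B\<^esub> a = \<phi> (\<ominus>\<^bsub>A\<^esub> x)" unfolding x(2) by (rule hz(2)[symmetric]) (use x(1) AcA[OF g] in blast)
        ultimately show ?thesis by simp
      qed
      show "a \<oplus>\<^bsub>B\<^esub> b \<in> \<phi> ` Ac g" if ab: "a \<in> \<phi> ` Ac g" "b \<in> \<phi> ` Ac g" for a b
      proof -
        obtain x y where x: "x \<in> Ac g" "a = \<phi> x" "y \<in> Ac g" "b = \<phi> y" using ab by blast
        have "x \<oplus>\<^bsub>A\<^esub> y \<in> Ac g" using S.m_closed[OF x(1,3)] by simp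
        moreover have "a \<oplus>\<^bsub>B\<^esub> b = \<phi> (x \<oplus>\<^bsub>A\<^esub> y)"
          unfolding x(2,4) by (rule add[symmetric]) (use x(1,3) AcA[OF g] in blast)+
        ultimately show ?thesis by simp
      qed
      show "c \<odot>\<^bsub>B\<^esub> a \<in> \<phi> ` Ac g" if a: "a \<in> \<phi> ` Ac g" for a c
      proof -
        obtain x where x: "x \<in> Ac g" "a = \<phi> x" using a by blast
        have "c \<odot>\<^bsub>A\<^esub> x \<in> Ac g" using S.smult_closed[of c x] x by simp
        moreover have "c \<odot>\<^bsub>B\<^esub> a = \<phi> (c \<odot>\<^bsub>A\<^esub> x)"
          unfolding x(2) by (rule smult[symmetric]) (use x(1) AcA[OF g] in blast)
        ultimately show ?thesis by simp
      qed
    qed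
  qed
  have dsA: "is_direct_sum A G Ac" using A by (simp add: graded_algebra_def)
  have BcB: "Bc g \<subseteq> carrier B" if "g \<in> G" for g
    unfolding comp[OF that, symmetric] using AcA[OF that] \<phi>c by blast
  have \<psi>Bc: "\<psi> y \<in> Ac g" if "g \<in> G" "y \<in> Bc g" for g y
  proof -
    have "y \<in> \<phi> ` Ac g" unfolding comp[OF that(1)] by (rule that(2))
    then obtain x where "x \<in> Ac g" "y = \<phi> x" by blast
    then show ?thesis using \<psi>\<phi>[of x] AcA[OF that(1)] by auto
  qed
  have z: "\<phi> x = \<zero>\<^bsub>B\<^esub> \<longleftrightarrow> x = \<zero>\<^bsub>A\<^esub>" if "x \<in> carrier A" for x
    using that zero inj_onD[OF inj, of x "\<zero>\<^bsub>A\<^esub>"] by auto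
  have "is_direct_sum B G Bc"
    unfolding is_direct_sum_def
  proof (intro conjI ballI BcB)
    fix y assume y: "y \<in> carrier B"
    define P where "P f \<longleftrightarrow> f \<in> (\<Pi>\<^sub>E i\<in>G. Ac i) \<and> finite {i \<in> G. f i \<noteq> \<zero>\<^bsub>A\<^esub>} \<and>
        \<psi> y = (\<Oplus>\<^bsub>A\<^esub>i\<in>{i \<in> G. f i \<noteq> \<zero>\<^bsub>A\<^esub>}. f i)" for f
    \<comment> \<open>Existence and uniqueness in B are both read off from the decomposition in A of
      the preimage of y.\<close>
    have "\<exists>!f. P f" using dsA \<psi>c[OF y] unfolding is_direct_sum_def P_def by blast
    then obtain f where Pf: "P f" and uniq: "\<And>f'. P f' \<Longrightarrow> f' = f" by (elim ex1E) blast
    have f: "f \<in> (\<Pi>\<^sub>E i\<in>G. Ac i)" "finite {i \<in> G. f i \<noteq> \<zero>\<^bsub>A\<^esub>}"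
        "\<psi> y = (\<Oplus>\<^bsub>A\<^esub>i\<in>{i \<in> G. f i \<noteq> \<zero>\<^bsub>A\<^esub>}. f i)"
      using Pf unfolding P_def by blast+
    have fA: "f i \<in> carrier A" "f i \<in> Ac i" if "i \<in> G" for i using f(1) AcA[OF that] that by auto
    define g where "g = (\<lambda>i\<in>G. \<phi> (f i))"
    have S: "{i \<in> G. g i \<noteq> \<zero>\<^bsub>B\<^esub>} = {i \<in> G. f i \<noteq> \<zero>\<^bsub>A\<^esub>}" using z fA by (auto simp: g_def)
    have gy: "y = (\<Oplus>\<^bsub>B\<^esub>i\<in>{i \<in> G. f i \<noteq> \<zero>\<^bsub>A\<^esub>}. g i)"
    proof -
      have "y = \<phi> (\<psi> y)" using \<phi>\<psi>[OF y] by simp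
      also have "\<dots> = (\<Oplus>\<^bsub>B\<^esub>i\<in>{i \<in> G. f i \<noteq> \<zero>\<^bsub>A\<^esub>}. \<phi> (f i))"
        unfolding f(3) using fA by (intro hz(4) f(2)) auto
      also have "\<dots> = (\<Oplus>\<^bsub>B\<^esub>i\<in>{i \<in> G. f i \<noteq> \<zero>\<^bsub>A\<^esub>}. g i)"
        using fA \<phi>c by (intro B.M.finsum_cong') (auto simp: g_def)
      finally show ?thesis .
    qed
    show "\<exists>!f. f \<in> (\<Pi>\<^sub>E i\<in>G. Bc i) \<and> finite {i \<in> G. f i \<noteq> \<zero>\<^bsub>B\<^esub>} \<and>
       y = (\<Oplus>\<^bsub>B\<^esub>i\<in>{i \<in> G. f i \<noteq> \<zero>\<^bsub>B\<^esub>}. f i)"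
    proof (rule ex1I[of _ g])
      have "g \<in> (\<Pi>\<^sub>E i\<in>G. Bc i)" unfolding g_def
      proof (rule restrict_PiE_iff[THEN iffD2], rule ballI)
        show "\<phi> (f i) \<in> Bc i" if "i \<in> G" for i unfolding comp[OF that, symmetric] using fA[OF that] by blast
      qed
      then show "g \<in> (\<Pi>\<^sub>E i\<in>G. Bc i) \<and> finite {i \<in> G. g i \<noteq> \<zero>\<^bsub>B\<^esub>} \<and>
         y = (\<Oplus>\<^bsub>B\<^esub>i\<in>{i \<in> G. g i \<noteq> \<zero>\<^bsub>B\<^esub>}. g i)"
        unfolding S using f(2) gy by blast
      fix g' assume g': "g' \<in> (\<Pi>\<^sub>E i\<in>G. Bc i) \<and> finite {i \<in> G. g' i \<noteq> \<zero>\<^bsub>B\<^esub>} \<and>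
         y = (\<Oplus>\<^bsub>B\<^esub>i\<in>{i \<in> G. g' i \<noteq> \<zero>\<^bsub>B\<^esub>}. g' i)"
      have gB: "g' i \<in> carrier B" "g' i \<in> Bc i" if "i \<in> G" for i using g' BcB[OF that] that by auto
      define f' where "f' = (\<lambda>i\<in>G. \<psi> (g' i))"
      have S': "{i \<in> G. f' i \<noteq> \<zero>\<^bsub>A\<^esub>} = {i \<in> G. g' i \<noteq> \<zero>\<^bsub>B\<^esub>}"
      proof -
        have "\<psi> (g' i) = \<zero>\<^bsub>A\<^esub> \<longleftrightarrow> g' i = \<zero>\<^bsub>B\<^esub>" if "i \<in> G" for i
          using z[OF \<psi>c[OF gB(1)[OF that]]] \<phi>\<psi>[OF gB(1)[OF that]] by simp
        then show ?thesis by (auto simp: f'_def)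
      qed
      have "\<psi> y = (\<Oplus>\<^bsub>A\<^esub>i\<in>{i \<in> G. g' i \<noteq> \<zero>\<^bsub>B\<^esub>}. \<psi> (g' i))"
        using g' gB \<psi>z(4)[of "{i \<in> G. g' i \<noteq> \<zero>\<^bsub>B\<^esub>}" g'] by auto
      also have "\<dots> = (\<Oplus>\<^bsub>A\<^esub>i\<in>{i \<in> G. g' i \<noteq> \<zero>\<^bsub>B\<^esub>}. f' i)"
        using gB \<psi>c by (intro A.M.finsum_cong') (auto simp: f'_def)
      finally have "\<psi> y = (\<Oplus>\<^bsub>A\<^esub>i\<in>{i \<in> G. f' i \<noteq> \<zero>\<^bsub>A\<^esub>}. f' i)" unfolding S' .
      moreover have "f' \<in> (\<Pi>\<^sub>E i\<in>G. Ac i)" using \<psi>Bc gB by (auto simp: f'_def)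
      moreover have "finite {i \<in> G. f' i \<noteq> \<zero>\<^bsub>A\<^esub>}" using g' unfolding S' by blast
      ultimately have "P f'" unfolding P_def by blast
      then have ff: "f' = f" by (rule uniq)
      show "g' = g"
      proof
        fix i show "g' i = g i"
        proof (cases "i \<in> G")
          case True
          then have "g' i = \<phi> (f' i)" using \<phi>\<psi> gB by (simp add: f'_def)
          then show ?thesis using True by (simp add: ff g_def)
        next
          case False
          then show ?thesis using g' by (auto simp: g_def PiE_iff extensional_def)
        qed
      qed
    qed
  qed
  moreover have "\<one>\<^bsub>B\<^esub> \<in> Bc 1"
  proof -
    have "\<one>\<^bsub>A\<^esub> \<in> Ac 1" using A by (simp add: graded_algebra_def)
    then show ?thesis unfolding comp[OF G(1), symmetric] one[symmetric] by (rule imageI)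
  qed
  moreover have "x \<otimes>\<^bsub>B\<^esub> y \<in> Bc (g * h)" if gh: "g \<in> G" "h \<in> G" "x \<in> Bc g" "y \<in> Bc h" for g h x y
  proof -
    have xy: "\<psi> x \<in> Ac g" "\<psi> y \<in> Ac h" using gh \<psi>Bc by auto
    then have "\<psi> x \<otimes>\<^bsub>A\<^esub> \<psi> y \<in> Ac (g * h)" using A gh(1,2) by (simp add: graded_algebra_def)
    moreover have "x \<otimes>\<^bsub>B\<^esub> y = \<phi> (\<psi> x \<otimes>\<^bsub>A\<^esub> \<psi> y)"
    proof -
      have "x \<in> carrier B" "y \<in> carrier B" using BcB[OF gh(1)] BcB[OF gh(2)] gh(3,4) by blast+
      then show ?thesis using mult[of "\<psi> x" "\<psi> y"] by (simp add: \<phi>\<psi> \<psi>c)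
    qed
    ultimately show ?thesis unfolding comp[OF G(2)[OF gh(1,2)], symmetric] by blast
  qed
  ultimately have "graded_algebra G B Bc"
    unfolding graded_algebra_def using algB subB by blast
  moreover have "\<phi> \<in> ring_iso A B"
    unfolding ring_iso_def using bij add mult one \<phi>c by (auto intro: ring_hom_memI)
  ultimately show ?thesis
    unfolding graded_algebra_iso_def using A smult comp by blast
qed

section \<open>The isomorphism\<close>

lemma (in findim_mod) Supp_dimw: "Supp t M = {int_ideal k | k. dimw k \<noteq> 0}"
proof -
  have "weight_space t M (int_ideal k) \<noteq> {\<zero>\<^bsub>M\<^esub>} \<longleftrightarrow> dimw k \<noteq> 0" for k
    by (simp add: wsp_weight_space dimw_zero_iff)
  then have k: "int_ideal k \<in> Supp t M \<longleftrightarrow> dimw k \<noteq> 0" for k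
    using int_ideal_max[of k] by (simp only: Supp_def mem_Collect_eq simp_thms)
  have "\<exists>k. m = int_ideal k" if "m \<in> Supp t M" for m
    using that nonint_weight_space[of m] by (auto simp: Supp_def \<O>_int_def)
  then show ?thesis using k by blast
qed

lemma cidx_one: "cidx 1 k = 0"
  by (simp add: cidx_def)

lemma cidx_z_minus: "cidx (z_minus s) k = (if half_val s < of_int k then 1 else 0)"
proof -
  have "{a. poly (z_minus s) a = 0 \<and> Re a < of_int k} = (if half_val s < of_int k then {pt s} else {})"
    by (auto simp: z_minus_def)
  then show ?thesis by (simp add: cidx_def)
qed

lemma cell_z_minus:
  "cell (z_minus s) 0 = {k. of_int k < half_val s}" "cell (z_minus s) (Suc 0) = {k. half_val s < of_int k}"
proof -
  have "\<not> half_val s < of_int k \<longleftrightarrow> of_int k < half_val s" for k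
    using half_val_neq_int[of s k] by linarith
  then show "cell (z_minus s) 0 = {k. of_int k < half_val s}" "cell (z_minus s) (Suc 0) = {k. half_val s < of_int k}"
    by (auto simp: cell_def cidx_z_minus)
qed

lemma cidx_z_minus_range: "0 \<in> range (cidx (z_minus s))" "Suc 0 \<in> range (cidx (z_minus s))"
proof -
  obtain l :: int where l: "half_val s = of_int l + 1/2" by (rule half_valE)
  have "cidx (z_minus s) l = 0" "cidx (z_minus s) (l + 1) = Suc 0" by (simp_all add: cidx_z_minus l)
  then show "0 \<in> range (cidx (z_minus s))" "Suc 0 \<in> range (cidx (z_minus s))" by (metis rangeI)+
qed

text \<open>The type \<open>'u\<close> has room for all complex functions on the integers, hence for
  copies of the standard modules.\<close>

locale universe =
  fixes j :: "(int \<Rightarrow> complex) \<Rightarrow> 'u"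
  assumes j: "inj j"
begin

abbreviation CK :: "complex poly \<Rightarrow> 'u CK0_elem monoid" where "CK t \<equiv> CK0 \<O>_int t"
abbreviation dT :: "complex poly \<Rightarrow> int \<Rightarrow> 'u CK0_elem \<Rightarrow> complex" where "dT \<equiv> degree_cat.dimT"
abbreviation V :: "(complex, 'u groth_elem) module" where "V \<equiv> groth_space \<Omega>_half \<O>_int"
abbreviation gc :: "complex poly \<Rightarrow> 'u gwa_module \<Rightarrow> 'u groth_elem" where "gc \<equiv> groth_class \<Omega>_half \<O>_int"

lemma cat: "t \<in> \<Omega>_half \<Longrightarrow> degree_cat t j"
  using j by unfold_locales

context
  fixes t assumes t: "t \<in> \<Omega>_half"
begin

interpretation D: degree_cat t j by (rule cat[OF t])

lemma CK_group: "comm_group (CK t)"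
  unfolding D.CK0_T by (rule D.C.T.comm_group_axioms)

lemma dT_inject: "U \<in> carrier (CK t) \<Longrightarrow> W \<in> carrier (CK t) \<Longrightarrow> (\<And>k. dT t k U = dT t k W) \<Longrightarrow> U = W"
  unfolding D.CK0_T by (rule D.dimT_inject)

lemma dT_step: "U \<in> carrier (CK t) \<Longrightarrow> cidx t k = cidx t l \<Longrightarrow> dT t k U = dT t l U"
  unfolding D.CK0_T by (rule D.dimT_step)

lemma dT_surject: "(\<And>k l. cidx t k = cidx t l \<Longrightarrow> f k = f l) \<Longrightarrow> \<exists>U\<in>carrier (CK t). \<forall>k. dT t k U = f k"
  unfolding D.CK0_T by (rule D.dimT_surject)

lemma dT_scale: "U \<in> carrier (CK t) \<Longrightarrow> CK0_scale \<O>_int t c U \<in> carrier (CK t)"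
    "U \<in> carrier (CK t) \<Longrightarrow> dT t k (CK0_scale \<O>_int t c U) = c * dT t k U"
  unfolding D.CK0_T using D.CK0_scale by blast+

lemma dT_mult: "U \<in> carrier (CK t) \<Longrightarrow> W \<in> carrier (CK t) \<Longrightarrow> dT t k (U \<otimes>\<^bsub>CK t\<^esub> W) = dT t k U + dT t k W"
  unfolding D.CK0_T by (rule D.dimT_mult)

lemma dT_one: "dT t k \<one>\<^bsub>CK t\<^esub> = 0"
  unfolding D.CK0_T by (rule D.dimT_one)

lemma dT_class:
  assumes M: "M \<in> wmod \<O>_int t"
  shows "CK0_tensor \<O>_int t 1 (K0_class \<O>_int t M) \<in> carrier (CK t)"
    "dT t k (CK0_tensor \<O>_int t 1 (K0_class \<O>_int t M)) = of_nat (gwa_module.dimw t M k)"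
proof -
  have c: "D.G.cls (frag_of M) \<in> carrier D.G.Q" using M by simp
  then show "CK0_tensor \<O>_int t 1 (K0_class \<O>_int t M) \<in> carrier (CK t)"
    unfolding D.CK0_T D.CK0_tensor_tens D.K0_class_cls
    by (intro D.C.tens_closed) (simp_all add: D.ZK_simps D.CZ_simps)
  show "dT t k (CK0_tensor \<O>_int t 1 (K0_class \<O>_int t M)) = of_nat (gwa_module.dimw t M k)"
    unfolding D.CK0_tensor_tens D.K0_class_cls D.dimT_tens[OF c]
    using M by (simp add: D.dimK_cls dimC_def)
qed

end

section \<open>The graded space in terms of dimension functions\<close>

lemma V_carrier: "x \<in> carrier V \<longleftrightarrow> x \<in> (\<Pi>\<^sub>E t\<in>\<Omega>_half. carrier (CK t)) \<and> finite {t \<in> \<Omega>_half. x t \<noteq> \<one>\<^bsub>CK t\<^esub>}"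
proof -
  have "carrier (sum_group \<Omega>_half CK) = {x \<in> \<Pi>\<^sub>E t\<in>\<Omega>_half. carrier (CK t). finite {t \<in> \<Omega>_half. x t \<noteq> \<one>\<^bsub>CK t\<^esub>}}"
    by (rule carrier_sum_group) (use CK_group comm_group.axioms(2) in blast)
  then show ?thesis by (simp add: groth_space_def Let_def)
qed

lemma V_simps: "\<zero>\<^bsub>V\<^esub> = (\<lambda>t\<in>\<Omega>_half. \<one>\<^bsub>CK t\<^esub>)" "x \<oplus>\<^bsub>V\<^esub> y = (\<lambda>t\<in>\<Omega>_half. x t \<otimes>\<^bsub>CK t\<^esub> y t)"
    "c \<odot>\<^bsub>V\<^esub> x = (\<lambda>t\<in>\<Omega>_half. CK0_scale \<O>_int t c (x t))"
  by (simp_all add: groth_space_def Let_def)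

lemma V_component: "x \<in> carrier V \<Longrightarrow> t \<in> \<Omega>_half \<Longrightarrow> x t \<in> carrier (CK t)"
  by (auto simp: V_carrier)

lemma V_ext_gen:
  assumes "x \<in> extensional \<Omega>_half" "y \<in> extensional \<Omega>_half"
    "\<And>t. t \<in> \<Omega>_half \<Longrightarrow> x t \<in> carrier (CK t)" "\<And>t. t \<in> \<Omega>_half \<Longrightarrow> y t \<in> carrier (CK t)"
    "\<And>t k. t \<in> \<Omega>_half \<Longrightarrow> dT t k (x t) = dT t k (y t)"
  shows "x = y"
proof (rule extensionalityI[OF assms(1,2)])
  fix t assume t: "t \<in> \<Omega>_half"
  show "x t = y t" by (rule dT_inject[OF t assms(3)[OF t] assms(4)[OF t] assms(5)[OF t]])
qed

lemma V_extensional: "x \<in> carrier V \<Longrightarrow> x \<in> extensional \<Omega>_half"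
  by (simp add: V_carrier PiE_iff)

lemma V_ext:
  assumes "x \<in> carrier V" "y \<in> carrier V" "\<And>t k. t \<in> \<Omega>_half \<Longrightarrow> dT t k (x t) = dT t k (y t)"
  shows "x = y"
  using assms by (intro V_ext_gen V_extensional V_component) auto

text \<open>For fixed t the coefficients of p at \<open>gmono t k\<close> form a function of k that
  is constant on cells by \<open>gmono_eq_iff\<close>; the component of degree t is the element with
  this dimension function.\<close>

definition lam :: "x_poly \<Rightarrow> 'u groth_elem"
  where "lam p = (\<lambda>t\<in>\<Omega>_half. SOME U. U \<in> carrier (CK t) \<and> (\<forall>k. dT t k U = Poly_Mapping.lookup p (gmono t k)))"

lemma lam_component:
  assumes t: "t \<in> \<Omega>_half"
  shows "lam p t \<in> carrier (CK t)" "dT t k (lam p t) = Poly_Mapping.lookup p (gmono t k)"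
proof -
  have "\<exists>U. U \<in> carrier (CK t) \<and> (\<forall>k. dT t k U = Poly_Mapping.lookup p (gmono t k))"
    using dT_surject[OF t, of "\<lambda>k. Poly_Mapping.lookup p (gmono t k)"] gmono_eq_iff[OF t] by metis
  from someI_ex[OF this]
  show "lam p t \<in> carrier (CK t)" "dT t k (lam p t) = Poly_Mapping.lookup p (gmono t k)"
    using t by (simp_all add: lam_def)
qed

lemma lam_ext: "lam p \<in> extensional \<Omega>_half"
  by (simp add: lam_def)

lemma CK_one_closed: "t \<in> \<Omega>_half \<Longrightarrow> \<one>\<^bsub>CK t\<^esub> \<in> carrier (CK t)"
  using CK_group comm_group.axioms(2) group.is_monoid monoid.one_closed by blast

lemma lam_closed: "lam p \<in> carrier V"
proof -
  have "{t \<in> \<Omega>_half. lam p t \<noteq> \<one>\<^bsub>CK t\<^esub>} \<subseteq> monom_degree ` Poly_Mapping.keys p"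
  proof
    fix t assume "t \<in> {t \<in> \<Omega>_half. lam p t \<noteq> \<one>\<^bsub>CK t\<^esub>}"
    then have t: "t \<in> \<Omega>_half" "lam p t \<noteq> \<one>\<^bsub>CK t\<^esub>" by auto
    have "\<exists>k. Poly_Mapping.lookup p (gmono t k) \<noteq> 0"
    proof (rule ccontr)
      assume "\<not> (\<exists>k. Poly_Mapping.lookup p (gmono t k) \<noteq> 0)"
      then have "lam p t = \<one>\<^bsub>CK t\<^esub>"
        using t(1) lam_component[OF t(1)] by (intro dT_inject[OF t(1)] CK_one_closed) (auto simp: dT_one)
      then show False using t(2) by simp
    qed
    then obtain k where "gmono t k \<in> Poly_Mapping.keys p" by (auto simp: in_keys_iff)
    then show "t \<in> monom_degree ` Poly_Mapping.keys p"
      using monom_degree_gmono[OF t(1), of k] by (metis imageI)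
  qed
  then have "finite {t \<in> \<Omega>_half. lam p t \<noteq> \<one>\<^bsub>CK t\<^esub>}" by (rule finite_subset) simp
  then show ?thesis unfolding V_carrier using lam_component(1) lam_ext by (simp add: PiE_iff)
qed

lemma lam_eqI:
  assumes "x \<in> carrier V" "\<And>t k. t \<in> \<Omega>_half \<Longrightarrow> dT t k (x t) = Poly_Mapping.lookup p (gmono t k)"
  shows "lam p = x"
  by (rule V_ext[OF lam_closed assms(1)]) (simp add: lam_component assms(2))

text \<open>One direction makes the map well defined on the quotient, the other makes it
  injective.\<close>

lemma lam_eq_iff: "lam p = lam q \<longleftrightarrow> xc p = xc q"
proof
  assume "lam p = lam q"
  then show "xc p = xc q" unfolding xc_eq_iff using lam_component(2) by metis
next
  assume "xc p = xc q"
  then show "lam p = lam q" unfolding xc_eq_iff using lam_closed by (intro V_ext) (auto simp: lam_component)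
qed

lemma lam_add: "lam (p + q) = lam p \<oplus>\<^bsub>V\<^esub> lam q"
proof (rule V_ext_gen)
  fix t assume t: "t \<in> \<Omega>_half"
  interpret comm_group "CK t" by (rule CK_group[OF t])
  show "(lam p \<oplus>\<^bsub>V\<^esub> lam q) t \<in> carrier (CK t)" using t lam_component(1)[OF t] by (simp add: V_simps)
  show "dT t k (lam (p + q) t) = dT t k ((lam p \<oplus>\<^bsub>V\<^esub> lam q) t)" for k
    using t lam_component[OF t] by (simp add: V_simps dT_mult lookup_add)
qed (simp_all add: lam_ext lam_component V_simps)

lemma lookup_scale: "Poly_Mapping.lookup (Poly_Mapping.single 0 c * p) m = c * Poly_Mapping.lookup (p :: x_poly) m"
  by (induction p rule: poly_mapping_single_induct)
     (simp_all add: distrib_left mult_single lookup_add lookup_single when_def)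

lemma lam_scale: "lam (Poly_Mapping.single 0 c * p) = c \<odot>\<^bsub>V\<^esub> lam p"
proof (rule V_ext_gen)
  fix t assume t: "t \<in> \<Omega>_half"
  show "(c \<odot>\<^bsub>V\<^esub> lam p) t \<in> carrier (CK t)" using t lam_component(1)[OF t] dT_scale by (simp add: V_simps)
  show "dT t k (lam (Poly_Mapping.single 0 c * p) t) = dT t k ((c \<odot>\<^bsub>V\<^esub> lam p) t)" for k
    using t lam_component[OF t] by (simp add: V_simps dT_scale lookup_scale)
qed (simp_all add: lam_ext lam_component V_simps)

lemma lam_zero: "lam 0 = \<zero>\<^bsub>V\<^esub>"
  by (rule V_ext_gen) (simp_all add: lam_ext lam_component V_simps CK_one_closed dT_one)

text \<open>The coefficient of a monomial outside the ideal is read off from the dimension function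
  at an integer where the monomial does not vanish. Dimension functions are constant on cells, so it
  does not matter which such integer is chosen.\<close>

lemma lam_surj:
  assumes x: "x \<in> carrier V"
  obtains p where "lam p = x"
proof -
  define S where "S = {t \<in> \<Omega>_half. x t \<noteq> \<one>\<^bsub>CK t\<^esub>}"
  have S: "finite S" using x by (simp add: V_carrier S_def)
  define F where "F m = (if monom_degree m \<in> S \<and> \<not> bad m
    then dT (monom_degree m) (SOME k. sep k m) (x (monom_degree m)) else 0)" for m
  have "{m. F m \<noteq> 0} \<subseteq> (\<Union>t\<in>S. range (gmono t))"
  proof
    fix m assume "m \<in> {m. F m \<noteq> 0}"
    then have m: "monom_degree m \<in> S" "\<not> bad m" by (auto simp: F_def split: if_splits)
    obtain k where "sep k m" using not_bad_sep[OF m(2)] .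
    then have "m = gmono (monom_degree m) k" by (simp add: sep_iff)
    then show "m \<in> (\<Union>t\<in>S. range (gmono t))" using m(1) by blast
  qed
  moreover have "finite (range (gmono t))" if "t \<in> S" for t
  proof -
    have t: "t \<in> \<Omega>_half" using that by (simp add: S_def)
    \<comment> \<open>One monomial per cell, and there are finitely many cells.\<close>
    have "range (gmono t) \<subseteq> (\<lambda>i. gmono t (rep t i)) ` range (cidx t)"
    proof
      fix m assume "m \<in> range (gmono t)"
      then obtain k where "m = gmono t k" by blast
      then have "m = gmono t (rep t (cidx t k))" by (simp add: gmono_eq_iff[OF t] cidx_rep)
      then show "m \<in> (\<lambda>i. gmono t (rep t i)) ` range (cidx t)" by blast
    qed
    then show ?thesis using finite_range_cidx[OF t] by (meson finite_imageI finite_subset)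
  qed
  ultimately have fin: "finite {m. F m \<noteq> 0}" using S by (meson finite_UN_I finite_subset)
  define p where "p = Abs_poly_mapping F"
  have p: "Poly_Mapping.lookup p m = F m" for m using fin by (simp add: p_def)
  have "lam p = x"
  proof (rule lam_eqI[OF x])
    fix t k assume t: "t \<in> \<Omega>_half"
    show "dT t k (x t) = Poly_Mapping.lookup p (gmono t k)"
    proof (cases "t \<in> S")
      case True
      define l where "l = (SOME l. sep l (gmono t k))"
      have "sep l (gmono t k)" unfolding l_def using sep_gmono[OF t] by (rule someI)
      then have "gmono t k = gmono t l" by (simp add: sep_iff monom_degree_gmono[OF t])
      then have "dT t k (x t) = dT t l (x t)"
        using gmono_eq_iff[OF t] dT_step[OF t V_component[OF x t]] by blast
      moreover have "\<not> bad (gmono t k)" using sep_not_bad[OF sep_gmono[OF t]] .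
      ultimately show ?thesis using True by (simp add: p F_def monom_degree_gmono[OF t] l_def)
    next
      case False
      then have "x t = \<one>\<^bsub>CK t\<^esub>" using t by (simp add: S_def)
      then show ?thesis using False by (simp add: p F_def monom_degree_gmono[OF t] dT_one[OF t])
    qed
  qed
  then show thesis by (rule that)
qed

definition phi :: "x_poly set \<Rightarrow> 'u groth_elem"
  where "phi U = lam (SOME p. U = xc p)"

lemma phi_xc: "phi (xc p) = lam p"
proof -
  have "xc p = xc (SOME q. xc p = xc q)" by (rule someI) simp
  then show ?thesis unfolding phi_def lam_eq_iff by (rule sym)
qed

lemma phi_bij: "bij_betw phi (carrier x_alg) (carrier V)"
proof (rule bij_betw_imageI)
  show "inj_on phi (carrier x_alg)"
    by (rule inj_onI) (auto simp: x_alg_simps phi_xc lam_eq_iff)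
  show "phi ` carrier x_alg = carrier V"
  proof (intro equalityI subsetI)
    fix x assume "x \<in> phi ` carrier x_alg"
    then show "x \<in> carrier V" by (auto simp: x_alg_simps phi_xc lam_closed)
  next
    fix x assume "x \<in> carrier V"
    then obtain p where "lam p = x" by (rule lam_surj)
    then have "x = phi (xc p)" by (simp add: phi_xc)
    then show "x \<in> phi ` carrier x_alg" by (auto simp: x_alg_simps)
  qed
qed

lemma left_module_x_alg: "left_module C_ring x_alg"
proof -
  interpret algebra C_ring x_alg by (rule algebra_x_alg)
  show ?thesis
    by (intro left_module.intro left_module_axioms.intro R.ring_axioms M.abelian_group_axioms
        smult_closed smult_l_distr smult_r_distr smult_assoc1 smult_one)
qed

lemma left_module_V: "left_module C_ring V"
  by (rule left_module_image(1)[OF left_module_x_alg, of phi])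
     (use phi_bij in \<open>auto simp: bij_betw_def x_alg_simps phi_xc lam_add lam_zero lam_scale\<close>)

lemma gc_closed:
  assumes "t \<in> \<Omega>_half" "M \<in> wmod \<O>_int t"
  shows "gc t M \<in> carrier V"
proof -
  have "{u \<in> \<Omega>_half. gc t M u \<noteq> \<one>\<^bsub>CK u\<^esub>} \<subseteq> {t}" by (auto simp: groth_class_def)
  then have "finite {u \<in> \<Omega>_half. gc t M u \<noteq> \<one>\<^bsub>CK u\<^esub>}" by (rule finite_subset) simp
  then show ?thesis
    unfolding V_carrier using assms dT_class CK_one_closed by (auto simp: groth_class_def)
qed

lemma gc_dim:
  assumes "t \<in> \<Omega>_half" "M \<in> wmod \<O>_int t" "u \<in> \<Omega>_half"
  shows "dT u k (gc t M u) = (if u = t then of_nat (gwa_module.dimw t M k) else 0)"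
  using assms dT_class dT_one by (simp add: groth_class_def)

text \<open>By \<open>homogeneous_ev\<close> the evaluations carry the same information as the
  coordinates in degree t, so the class of a module is recognized by evaluating a
  polynomial.\<close>

lemma gc_lamI:
  assumes "t \<in> \<Omega>_half" "M \<in> wmod \<O>_int t" "homogeneous t p"
    "\<And>k. ev k p = of_nat (gwa_module.dimw t M k)"
  shows "lam p = gc t M"
proof (rule lam_eqI[OF gc_closed[OF assms(1,2)]])
  fix u k assume u: "u \<in> \<Omega>_half"
  show "dT u k (gc t M u) = Poly_Mapping.lookup p (gmono u k)"
    using gc_dim[OF assms(1,2) u] homogeneous_ev[OF assms(3,1), of k] assms(4)
      lookup_homogeneous_other[OF assms(3) u, of k] by simp
qed

lemma comp_image:
  assumes t: "t \<in> \<Omega>_half"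
  shows "phi ` x_comp t = groth_comp \<Omega>_half \<O>_int t"
proof (intro equalityI subsetI)
  fix x assume "x \<in> phi ` x_comp t"
  then obtain p where p: "homogeneous t p" "x = lam p" by (auto simp: x_comp_xc phi_xc)
  have "lam p u = \<one>\<^bsub>CK u\<^esub>" if u: "u \<in> \<Omega>_half" "u \<noteq> t" for u
    using lam_component[OF u(1), where p = p] lookup_homogeneous_other[OF p(1) u] CK_one_closed[OF u(1)] dT_one[OF u(1)]
    by (intro dT_inject[OF u(1)]) auto
  then show "x \<in> groth_comp \<Omega>_half \<O>_int t" using p lam_closed by (simp add: groth_comp_def)
next
  fix x :: "'u groth_elem" assume "x \<in> groth_comp \<Omega>_half \<O>_int t"
  then have x: "x \<in> carrier V" "\<And>u. u \<in> \<Omega>_half \<Longrightarrow> u \<noteq> t \<Longrightarrow> x u = \<one>\<^bsub>CK u\<^esub>" by (auto simp: groth_comp_def)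
  obtain p where p: "lam p = x" using lam_surj[OF x(1)] .
  have "lam (part t p) = x"
  proof (rule lam_eqI[OF x(1)])
    fix u k assume u: "u \<in> \<Omega>_half"
    show "dT u k (x u) = Poly_Mapping.lookup (part t p) (gmono u k)"
      using lam_component(2)[OF u, of k p] p x(2)[OF u] dT_one[OF u, of k]
      by (auto simp: lookup_part monom_degree_gmono[OF u])
  qed
  then have "x = phi (xc (part t p))" by (simp add: phi_xc)
  then show "x \<in> phi ` x_comp t" using homogeneous_part by (auto simp: x_comp_xc)
qed

text \<open>The product of the presented algebra carried over, and made \<open>undefined\<close> off
  the carrier as \<open>is_groth_mult\<close> prescribes.\<close>

definition gmult :: "'u groth_elem \<Rightarrow> 'u groth_elem \<Rightarrow> 'u groth_elem"
  where "gmult x y = (if x \<in> carrier V \<and> y \<in> carrier V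
    then phi (inv_into (carrier x_alg) phi x \<otimes>\<^bsub>x_alg\<^esub> inv_into (carrier x_alg) phi y) else undefined)"

lemma gmult_lam: "gmult (lam p) (lam q) = lam (p * q)"
proof -
  have "inv_into (carrier x_alg) phi (lam p) = xc p" for p
    using inv_into_f_f[of phi "carrier x_alg" "xc p"] phi_bij
    by (simp add: bij_betw_def phi_xc x_alg_simps)
  then show ?thesis by (simp add: gmult_def lam_closed x_alg_simps phi_xc)
qed

lemma lam_hom:
  assumes "\<And>p. \<exists>q. h (lam p) = lam q" "\<And>p q. h (lam (p + q)) = h (lam p) \<oplus>\<^bsub>V\<^esub> h (lam q)"
    "\<And>c p. h (lam (Poly_Mapping.single 0 c * p)) = c \<odot>\<^bsub>V\<^esub> h (lam p)"
  shows "h \<in> module_hom C_ring V V"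
  unfolding module_hom_def
proof (intro CollectI conjI ballI Pi_I)
  fix x assume x: "x \<in> carrier V"
  obtain p where p: "x = lam p" using lam_surj[OF x] by metis
  show "h x \<in> carrier V" using assms(1)[of p] p lam_closed by auto
  show "h (x \<oplus>\<^bsub>V\<^esub> y) = h x \<oplus>\<^bsub>V\<^esub> h y" if y: "y \<in> carrier V" for y
  proof -
    obtain q where "y = lam q" using lam_surj[OF y] by metis
    then show ?thesis using p assms(2) by (simp flip: lam_add)
  qed
  show "h (c \<odot>\<^bsub>V\<^esub> x) = c \<odot>\<^bsub>V\<^esub> h x" for c using p assms(3) by (simp flip: lam_scale)
qed

abbreviation "cellmod t k \<equiv> std_copy j t (cell t (cidx t k))"

lemma cellmod_obj: "t \<in> \<Omega>_half \<Longrightarrow> cellmod t k \<in> wmod \<O>_int t"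
  by (intro findim_wmod findim_std_copy admissible_cell j)

text \<open>The monomial takes the value 1 exactly on the cell of k, which is where the cell module
  has its weights.\<close>

lemma lam_gmono:
  assumes t: "t \<in> \<Omega>_half"
  shows "lam (Poly_Mapping.single (gmono t k) 1) = gc t (cellmod t k)"
proof (rule gc_lamI[OF t cellmod_obj[OF t]])
  show "homogeneous t (Poly_Mapping.single (gmono t k) 1)"
    using monom_degree_gmono[OF t] by (simp add: homogeneous_def)
  fix l
  have "sep l (gmono t k) \<longleftrightarrow> l \<in> cell t (cidx t k)"
    by (auto simp: sep_iff monom_degree_gmono[OF t] gmono_eq_iff[OF t] cell_def)
  then show "ev l (Poly_Mapping.single (gmono t k) 1) = of_nat (gwa_module.dimw t (cellmod t k) l)"
    by (simp add: ev_single dimw_std_copy[OF admissible_cell[OF t] j])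
qed

lemma lam_bad: "bad m \<Longrightarrow> lam (Poly_Mapping.single m c) = \<zero>\<^bsub>V\<^esub>"
proof -
  assume m: "bad m"
  have "Poly_Mapping.lookup (Poly_Mapping.single m c) (gmono t k) = 0" if "t \<in> \<Omega>_half" for t k
    using sep_not_bad[OF sep_gmono[OF that, of k]] m by (auto simp: lookup_single when_def)
  then show ?thesis using lam_eq_iff[of "Poly_Mapping.single m c" 0] by (simp add: lam_zero xc_eq_iff)
qed

text \<open>The classes of the cell modules span the graded space: a monomial goes to zero or to a
  multiple of such a class.\<close>

lemma hom_eqI:
  assumes h: "h \<in> module_hom C_ring V V" "h' \<in> module_hom C_ring V V"
    and eq: "\<And>t k. t \<in> \<Omega>_half \<Longrightarrow> h (gc t (cellmod t k)) = h' (gc t (cellmod t k))"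
    and x: "x \<in> carrier V"
  shows "h x = h' x"
proof -
  interpret left_module C_ring V by (rule left_module_V)
  note hD = module_homD[OF h(1)] and hD' = module_homD[OF h(2)]
  note z = module_hom_zero_minus(1)[OF M.abelian_group_axioms M.abelian_group_axioms h(1)]
    module_hom_zero_minus(1)[OF M.abelian_group_axioms M.abelian_group_axioms h(2)]
  have "h (lam p) = h' (lam p)" for p
  proof (induction p rule: poly_mapping_single_induct)
    case zero
    then show ?case using z by (simp add: lam_zero)
  next
    case (single p m c)
    have "h (lam (Poly_Mapping.single m c)) = h' (lam (Poly_Mapping.single m c))"
    proof (cases "bad m")
      case True
      then show ?thesis using z by (simp add: lam_bad)
    next
      case False
      then obtain k where "sep k m" by (rule not_bad_sep)
      then have m: "m = gmono (monom_degree m) k" by (simp add: sep_iff)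
      define t where "t = monom_degree m"
      have t: "t \<in> \<Omega>_half" unfolding t_def by (rule monom_degree_Omega)
      have "Poly_Mapping.single m c = Poly_Mapping.single 0 c * Poly_Mapping.single (gmono t k) 1"
        using m by (simp add: mult_single t_def)
      then have "lam (Poly_Mapping.single m c) = c \<odot>\<^bsub>V\<^esub> gc t (cellmod t k)"
        by (simp add: lam_scale lam_gmono[OF t])
      then show ?thesis
        using hD(3)[of c "gc t (cellmod t k)"] hD'(3)[of c "gc t (cellmod t k)"] eq[OF t]
          gc_closed[OF t cellmod_obj[OF t]] by simp
    qed
    then show ?case using single hD(2) hD'(2) lam_closed by (simp add: lam_add)
  qed
  moreover obtain p where "lam p = x" using lam_surj[OF x] .
  ultimately show ?thesis by metis
qed

lemma gc_homogeneous:
  assumes t: "t \<in> \<Omega>_half" and M: "M \<in> wmod \<O>_int t"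
  obtains p where "homogeneous t p" "gc t M = lam p" "\<And>k. ev k p = of_nat (gwa_module.dimw t M k)"
proof -
  have "gc t M \<in> groth_comp \<Omega>_half \<O>_int t"
    using gc_closed[OF t M] by (simp add: groth_comp_def groth_class_def)
  then have "gc t M \<in> phi ` x_comp t" unfolding comp_image[OF t] .
  then obtain p where p: "homogeneous t p" "gc t M = lam p" by (auto simp: x_comp_xc phi_xc)
  have "ev k p = of_nat (gwa_module.dimw t M k)" for k
    using gc_dim[OF t M t, of k] lam_component(2)[OF t, of k p] homogeneous_ev[OF p(1) t, of k] p(2) by simp
  then show thesis using that p by blast
qed

text \<open>Evaluation is multiplicative on polynomials and dimension is multiplicative on tensor
  products, so the product of the two polynomials has the dimension function of N.\<close>

lemma gmult_class:
  assumes t: "t \<in> \<Omega>_half" "t' \<in> \<Omega>_half" and M: "M \<in> wmod \<O>_int t" "M' \<in> wmod \<O>_int t'"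
    and N: "N \<in> wmod \<O>_int (t * t')" and T: "is_tensor t t' M M' N"
  shows "gmult (gc t M) (gc t' M') = gc (t * t') N"
proof -
  obtain p where p: "homogeneous t p" "gc t M = lam p" "\<And>k. ev k p = of_nat (gwa_module.dimw t M k)"
    using gc_homogeneous[OF t(1) M(1)] by blast
  obtain q where q: "homogeneous t' q" "gc t' M' = lam q" "\<And>k. ev k q = of_nat (gwa_module.dimw t' M' k)"
    using gc_homogeneous[OF t(2) M(2)] by blast
  have "lam (p * q) = gc (t * t') N"
  proof (rule gc_lamI[OF Omega_mult[OF t] N homogeneous_mult[OF p(1) q(1)]])
    show "ev k (p * q) = of_nat (gwa_module.dimw (t * t') N k)" for k
      using is_tensor_dimw[OF wmod_findim[OF M(1)] wmod_findim[OF M(2)] wmod_findim[OF N] T, of k]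
      by (simp add: ev_mult p(3) q(3))
  qed
  then show ?thesis by (simp add: p(2) q(2) gmult_lam)
qed

lemma is_groth_mult_gmult: "is_groth_mult \<Omega>_half \<O>_int gmult"
  unfolding is_groth_mult_def Let_def
proof (intro conjI allI impI ballI)
  show "gmult x y = undefined" if "\<not> (x \<in> carrier V \<and> y \<in> carrier V)" for x y
    using that by (auto simp: gmult_def)
  show "gmult x \<in> module_hom C_ring V V" if x: "x \<in> carrier V" for x
  proof -
    obtain p where p: "lam p = x" using lam_surj[OF x] .
    have "gmult (lam p) \<in> module_hom C_ring V V"
      by (rule lam_hom) (auto simp: gmult_lam distrib_left mult.left_commute[of p] simp flip: lam_add lam_scale)
    then show ?thesis unfolding p .
  qed
  show "(\<lambda>x. gmult x y) \<in> module_hom C_ring V V" if y: "y \<in> carrier V" for y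
  proof -
    obtain q where q: "lam q = y" using lam_surj[OF y] .
    have "(\<lambda>x. gmult x (lam q)) \<in> module_hom C_ring V V"
      by (rule lam_hom) (auto simp: gmult_lam distrib_right mult.assoc simp flip: lam_add lam_scale)
    then show ?thesis unfolding q .
  qed
qed (rule gmult_class)

text \<open>The specification constrains m through tensor products that have a copy in
  \<open>'u\<close>. For cell modules such copies exist, and bilinearity extends the agreement from
  them to all elements, one argument at a time.\<close>

lemma groth_mult_unique:
  assumes m: "is_groth_mult \<Omega>_half \<O>_int m"
  shows "m = gmult"
proof -
  have m1: "\<not> (x \<in> carrier V \<and> y \<in> carrier V) \<Longrightarrow> m x y = undefined"
    and m2: "x \<in> carrier V \<Longrightarrow> m x \<in> module_hom C_ring V V"
    and m3: "y \<in> carrier V \<Longrightarrow> (\<lambda>x. m x y) \<in> module_hom C_ring V V" for x y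
    using m unfolding is_groth_mult_def Let_def by blast+
  have m4: "m (gc t M) (gc t' M') = gc (t * t') N"
    if "t \<in> \<Omega>_half" "t' \<in> \<Omega>_half" "M \<in> wmod \<O>_int t" "M' \<in> wmod \<O>_int t'"
      "N \<in> wmod \<O>_int (t * t')" "is_tensor t t' M M' N" for t t' M M' N
    using m that unfolding is_groth_mult_def Let_def by blast
  have g: "x \<in> carrier V \<Longrightarrow> gmult x \<in> module_hom C_ring V V"
    "y \<in> carrier V \<Longrightarrow> (\<lambda>x. gmult x y) \<in> module_hom C_ring V V" for x y
    using is_groth_mult_gmult unfolding is_groth_mult_def Let_def by blast+
  have cc: "m (gc t (cellmod t k)) (gc t' (cellmod t' k')) = gmult (gc t (cellmod t k)) (gc t' (cellmod t' k'))"
    if t: "t \<in> \<Omega>_half" "t' \<in> \<Omega>_half" for t t' k k'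
  proof -
    note a = admissible_cell[OF t(1)] admissible_cell[OF t(2)]
    \<comment> \<open>The pointwise products live on the intersection of the two cells; when it is
      empty, the tensor product is the zero module.\<close>
    let ?N = "std_copy j (t * t') (cell t (cidx t k) \<inter> cell t' (cidx t' k'))"
    have N: "?N \<in> wmod \<O>_int (t * t')" by (intro findim_wmod findim_std_copy admissible_mult a j)
    have T: "is_tensor t t' (cellmod t k) (cellmod t' k') ?N" by (rule is_tensor_std_copy[OF a j])
    show ?thesis
      using m4[OF t cellmod_obj[OF t(1)] cellmod_obj[OF t(2)] N T]
        gmult_class[OF t cellmod_obj[OF t(1)] cellmod_obj[OF t(2)] N T] by simp
  qed
  have cy: "m (gc t (cellmod t k)) y = gmult (gc t (cellmod t k)) y" if t: "t \<in> \<Omega>_half" and y: "y \<in> carrier V" for t k y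
    using gc_closed[OF t cellmod_obj[OF t]] cc[OF t] by (intro hom_eqI[OF m2 g(1) _ y]) auto
  have "m x y = gmult x y" if "x \<in> carrier V" "y \<in> carrier V" for x y
    using hom_eqI[OF m3[OF that(2)] g(2)[OF that(2)] _ that(1)] cy that(2) by blast
  moreover have "gmult x y = undefined" if "\<not> (x \<in> carrier V \<and> y \<in> carrier V)" for x y
    using that by (auto simp: gmult_def)
  ultimately have "m x y = gmult x y" for x y
    using m1 by (cases "x \<in> carrier V \<and> y \<in> carrier V") auto
  then show ?thesis by (rule_tac ext, rule_tac ext)
qed

section \<open>The unit and the generators\<close>

abbreviation GA :: "(complex, 'u groth_elem) module" where "GA \<equiv> groth_alg \<Omega>_half \<O>_int"

lemma GA_simps: "carrier GA = carrier V" "x \<oplus>\<^bsub>GA\<^esub> y = x \<oplus>\<^bsub>V\<^esub> y" "\<zero>\<^bsub>GA\<^esub> = \<zero>\<^bsub>V\<^esub>" "c \<odot>\<^bsub>GA\<^esub> x = c \<odot>\<^bsub>V\<^esub> x"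
    "x \<otimes>\<^bsub>GA\<^esub> y = gmult x y" "\<one>\<^bsub>GA\<^esub> = gc 1 (SOME M. M \<in> simple_objects \<O>_int 1)"
proof -
  have "(THE m. is_groth_mult \<Omega>_half \<O>_int m) = gmult"
    using is_groth_mult_gmult groth_mult_unique by (rule the_equality)
  then show "x \<otimes>\<^bsub>GA\<^esub> y = gmult x y" by (simp add: groth_alg_def)
qed (simp_all add: groth_alg_def)

lemma simple_cell: "t \<in> \<Omega>_half \<Longrightarrow> i \<in> range (cidx t) \<Longrightarrow> std_copy j t (cell t i) \<in> simple_objects \<O>_int t"
  unfolding simple_objects_def
  by (intro CollectI conjI simple_std_copy findim_wmod findim_std_copy admissible_cell j)

text \<open>The polynomial 1 has no roots, so the integers form a single cell, and whichever simple
  object is chosen has dimension one at every integer.\<close>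

lemma lam_one: "lam 1 = \<one>\<^bsub>GA\<^esub>"
proof -
  define M :: "'u gwa_module" where "M = (SOME M. M \<in> simple_objects \<O>_int 1)"
  have "std_copy j 1 (cell 1 0) \<in> simple_objects \<O>_int 1"
    by (rule simple_cell[OF Omega_one]) (simp add: cidx_one image_iff)
  then have M: "M \<in> simple_objects \<O>_int 1" unfolding M_def by (rule someI)
  obtain i where i: "i \<in> range (cidx 1)" "\<And>k. gwa_module.dimw 1 M k = (if k \<in> cell 1 i then 1 else 0)"
    using simple_dimw[OF Omega_one M] by blast
  have d: "gwa_module.dimw 1 M k = 1" for k using i by (auto simp: cell_def cidx_one)
  have "lam (Poly_Mapping.single 0 1) = gc 1 M"
  proof (rule gc_lamI[OF Omega_one _ homogeneous_closed(4)])
    show "M \<in> wmod \<O>_int 1" using M by (simp add: simple_objects_def)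
    show "ev k (Poly_Mapping.single 0 1) = of_nat (gwa_module.dimw 1 M k)" for k
      by (simp only: ev_single d) (simp add: sep_def)
  qed
  then show ?thesis by (simp add: GA_simps M_def)
qed

text \<open>For a simple module all dimensions are 0 or 1, so they are determined by the support.
  This makes the class of an arbitrarily chosen simple object computable.\<close>

lemma some_simple_dimw:
  fixes M :: "'u gwa_module"
  assumes t: "t \<in> \<Omega>_half" and M: "M \<in> simple_objects \<O>_int t" "Supp t M = int_ideal ` I"
  shows "M \<in> wmod \<O>_int t" "gwa_module.dimw t M k = (if k \<in> I then 1 else 0)"
proof -
  show w: "M \<in> wmod \<O>_int t" using M by (simp add: simple_objects_def)
  interpret findim_mod t M by (rule wmod_findim[OF w])
  obtain i where i: "\<And>k. dimw k = (if k \<in> cell t i then 1 else 0)"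
    using simple_dimw[OF t M(1)] by blast
  have "inj int_ideal" by (auto intro: injI simp: int_ideal_inj)
  then have a: "int_ideal k \<in> Supp t M \<longleftrightarrow> k \<in> I" for k unfolding M(2) by (rule inj_image_mem_iff)
  have b: "int_ideal k \<in> Supp t M \<longleftrightarrow> dimw k \<noteq> 0" for k
    unfolding Supp_dimw by (auto simp: int_ideal_inj)
  have "dimw k \<noteq> 0 \<longleftrightarrow> k \<in> I" by (rule trans[OF sym[OF b] a])
  then show "dimw k = (if k \<in> I then 1 else 0)" using i[of k] by (simp split: if_splits)
qed

text \<open>Guarantees that the choices in \<open>M_lower\<close> and \<open>M_upper\<close> are
  made from nonempty sets.\<close>

lemma ex_simple_Supp:
  assumes t: "t \<in> \<Omega>_half" and i: "i \<in> range (cidx t)"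
  shows "\<exists>M :: 'u gwa_module. M \<in> simple_objects \<O>_int t \<and> Supp t M = int_ideal ` cell t i"
proof (intro exI conjI)
  show "std_copy j t (cell t i) \<in> simple_objects \<O>_int t" by (rule simple_cell[OF t i])
  interpret findim_mod t "std_copy j t (cell t i)" by (rule findim_std_copy[OF admissible_cell[OF t] j])
  show "Supp t (std_copy j t (cell t i)) = int_ideal ` cell t i"
    unfolding Supp_dimw by (auto simp: dimw_std_copy[OF admissible_cell[OF t] j] split: if_splits)
qed

text \<open>The polynomial z - s has two cells: index 0, with no root to the left, is the lower
  half-line, and index 1 is the upper one.\<close>

lemma lower_class: "lam (x_var (X_minus s)) = gc (z_minus s) (M_lower s)"
proof -
  have e: "{int_ideal k | k. real_of_int k < half_val s} = int_ideal ` cell (z_minus s) 0"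
    unfolding cell_z_minus by auto
  have "(M_lower s :: 'u gwa_module) \<in> simple_objects \<O>_int (z_minus s) \<and>
      Supp (z_minus s) (M_lower s :: 'u gwa_module) = int_ideal ` cell (z_minus s) 0"
    unfolding M_lower_def e by (rule someI_ex) (rule ex_simple_Supp[OF Omega_z_minus cidx_z_minus_range(1)])
  then have M: "(M_lower s :: 'u gwa_module) \<in> simple_objects \<O>_int (z_minus s)"
      "Supp (z_minus s) (M_lower s :: 'u gwa_module) = int_ideal ` cell (z_minus s) 0" by auto
  show ?thesis
  proof (rule gc_lamI[OF Omega_z_minus some_simple_dimw(1)[OF Omega_z_minus M]])
    show "homogeneous (z_minus s) (x_var (X_minus s))"
      by (simp add: homogeneous_def x_var_def monom_degree_single[simplified])
    show "ev k (x_var (X_minus s)) = of_nat (gwa_module.dimw (z_minus s) (M_lower s :: 'u gwa_module) k)" for k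
      unfolding some_simple_dimw(2)[OF Omega_z_minus M] x_var_def ev_single
      by (auto simp: sep_def cell_z_minus)
  qed
qed

lemma upper_class: "lam (x_var (X_plus s)) = gc (z_minus s) (M_upper s)"
proof -
  have e: "{int_ideal k | k. half_val s < real_of_int k} = int_ideal ` cell (z_minus s) (Suc 0)"
    unfolding cell_z_minus by auto
  have "(M_upper s :: 'u gwa_module) \<in> simple_objects \<O>_int (z_minus s) \<and>
      Supp (z_minus s) (M_upper s :: 'u gwa_module) = int_ideal ` cell (z_minus s) (Suc 0)"
    unfolding M_upper_def e by (rule someI_ex) (rule ex_simple_Supp[OF Omega_z_minus cidx_z_minus_range(2)])
  then have M: "(M_upper s :: 'u gwa_module) \<in> simple_objects \<O>_int (z_minus s)"
      "Supp (z_minus s) (M_upper s :: 'u gwa_module) = int_ideal ` cell (z_minus s) (Suc 0)" by auto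
  show ?thesis
  proof (rule gc_lamI[OF Omega_z_minus some_simple_dimw(1)[OF Omega_z_minus M]])
    show "homogeneous (z_minus s) (x_var (X_plus s))"
      by (simp add: homogeneous_def x_var_def monom_degree_single[simplified])
    show "ev k (x_var (X_plus s)) = of_nat (gwa_module.dimw (z_minus s) (M_upper s :: 'u gwa_module) k)" for k
      unfolding some_simple_dimw(2)[OF Omega_z_minus M] x_var_def ev_single
      by (auto simp: sep_def cell_z_minus)
  qed
qed

lemma graded_algebra_iso_phi: "graded_algebra_iso \<Omega>_half x_alg x_comp GA (groth_comp \<Omega>_half \<O>_int) phi"
proof (rule graded_algebra_transport[OF graded_algebra_x_alg])
  show "bij_betw phi (carrier x_alg) (carrier GA)" unfolding GA_simps by (rule phi_bij)
  show "phi \<one>\<^bsub>x_alg\<^esub> = \<one>\<^bsub>GA\<^esub>" unfolding lam_one[symmetric] by (simp add: x_alg_simps phi_xc)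
  show "phi ` x_comp g = groth_comp \<Omega>_half \<O>_int g" if "g \<in> \<Omega>_half" for g by (rule comp_image[OF that])
qed (auto simp: x_alg_simps GA_simps phi_xc lam_add lam_zero lam_scale gmult_lam Omega_one Omega_mult)

end

text \<open>Complex numbers are coded by sets of naturals, and a sequence of sets of naturals by a
  single one through a pairing of indices and elements.\<close>

lemma continuum_functions: "\<exists>f :: (int \<Rightarrow> complex) \<Rightarrow> complex. inj f"
proof -
  have "\<exists>f :: complex \<Rightarrow> nat set. inj f"
  proof -
    obtain g :: "rat \<Rightarrow> nat" where g: "inj g" using countableE[of "UNIV :: rat set"] by auto
    \<comment> \<open>Dedekind cuts, turned into sets of naturals by an injection of the rationals
      into the naturals.\<close>
    define f where "f z = g ` {q. of_rat q < Re z}" for z :: complex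
    define f' where "f' z = g ` {q. of_rat q < Im z}" for z :: complex
    have sep: "x = y" if "{q. of_rat q < (x::real)} = {q. of_rat q < y}" for x y
    proof (rule ccontr)
      assume "x \<noteq> y"
      then have "min x y < max x y" by auto
      then obtain q where "min x y < of_rat q" "of_rat q < max x y" using of_rat_dense by blast
      moreover have "of_rat q < x \<longleftrightarrow> of_rat q < y" using that by blast
      ultimately show False by (auto simp: min_def max_def not_less split: if_splits)
    qed
    \<comment> \<open>Real and imaginary part share one set of naturals, on the even and on the odd
      numbers.\<close>
    define h where "h z = (\<lambda>n. 2 * n) ` f z \<union> (\<lambda>n. 2 * n + 1) ` f' z" for z
    have "inj h"
    proof (rule injI)
      fix z w assume "h z = h w"
      then have "{n. 2 * n \<in> h z} = {n. 2 * n \<in> h w}" "{n. 2 * n + 1 \<in> h z} = {n. 2 * n + 1 \<in> h w}" by simp_all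
      moreover have "{n. 2 * n \<in> h z} = f z" "{n. 2 * n + 1 \<in> h z} = f' z" for z
        unfolding h_def by auto presburger+
      ultimately have "f z = f w" "f' z = f' w" by simp_all
      then show "z = w"
        using sep[of "Re z" "Re w"] sep[of "Im z" "Im w"] inj_image_eq_iff[OF g]
        by (simp add: f_def f'_def complex_eq_iff)
    qed
    then show ?thesis by blast
  qed
  then obtain f :: "complex \<Rightarrow> nat set" where f: "inj f" by blast
  define e :: "int \<times> nat \<Rightarrow> nat" where "e = to_nat"
  have "\<exists>g :: nat set \<Rightarrow> real. inj g"
  proof -
    have "(UNIV :: nat set set) \<lesssim> (UNIV :: real set)"
      using nat_sets_eqpoll_reals by (rule eqpoll_imp_lepoll)
    then show ?thesis by (auto simp: lepoll_def)
  qed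
  then obtain g :: "nat set \<Rightarrow> real" where g: "inj g" by blast
  \<comment> \<open>The disjoint union of the sets f(u(k)), flattened by the pairing e and then sent
    into the reals.\<close>
  define h where "h u = complex_of_real (g {e (k, n) | k n. n \<in> f (u k)})" for u :: "int \<Rightarrow> complex"
  have "inj h"
  proof (rule injI)
    fix u v assume "h u = h v"
    then have "{e (k, n) | k n. n \<in> f (u k)} = {e (k, n) | k n. n \<in> f (v k)}"
      using g by (simp add: h_def inj_eq)
    then have "e (k, n) \<in> {e (k, n) | k n. n \<in> f (u k)} \<longleftrightarrow> e (k, n) \<in> {e (k, n) | k n. n \<in> f (v k)}" for k n by simp
    then have "n \<in> f (u k) \<longleftrightarrow> n \<in> f (v k)" for k n by (auto simp: e_def)
    then have "f (u k) = f (v k)" for k by auto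
    then show "u = v" using f by (auto simp: inj_eq)
  qed
  then show ?thesis by blast
qed

theorem theorem4p6:
  assumes universe: "\<exists>f :: complex \<Rightarrow> 'u. inj f"
  shows "\<exists>\<phi> :: x_poly set \<Rightarrow> 'u groth_elem.
    graded_algebra_iso \<Omega>_half x_alg x_comp
      (groth_alg \<Omega>_half \<O>_int) (groth_comp \<Omega>_half \<O>_int) \<phi> \<and>
    (\<forall>s. \<phi> (x_class (X_minus s)) = groth_class \<Omega>_half \<O>_int (z_minus s) (M_lower s)) \<and>
    (\<forall>s. \<phi> (x_class (X_plus s)) = groth_class \<Omega>_half \<O>_int (z_minus s) (M_upper s))"
proof -
  obtain f :: "complex \<Rightarrow> 'u" and g :: "(int \<Rightarrow> complex) \<Rightarrow> complex" where "inj f" "inj g"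
    using universe continuum_functions by blast
  \<comment> \<open>The composite embeds the complex functions on the integers into
    \<open>'u\<close>, which is the injection required for the copies of modules.\<close>
  then interpret universe "f \<circ> g" by unfold_locales (rule inj_compose)
  show ?thesis
    using graded_algebra_iso_phi lower_class upper_class
    by (intro exI[of _ phi]) (simp add: x_class_xc phi_xc)
qed

end
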